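(* Let $d\ge 2$ be an integer and $c>0$ a real number, and let $Y\sim Y_d\left(n,\frac cn\right)$. Let $t_d^*$ be the unique root in $(0,1)$ of $(d+1)(1-t)+(1+dt)\ln t=0$, and let $c_d^*:=\dfrac{-\ln t_d^*}{(1-t_d^* )^d}$. (1) If $c<c_d^*$, then asymptotically almost surely $|\mathrm{SH}_{\mathbb{R}}(Y)|=\Theta(n)$. (2) If $c>c_d^*$, let $t_c$ be the smallest root in $(0,1)$ of $t=e^{-c(1-t)^d}$. Then asymptotically almost surely $$|\mathrm{SH}_{\mathbb{R}}(Y)|=\binom{n}{d+1}\left((1-t_c)^{d+1}+o(1)\right).$$
   Context: $Y_d(n,p)$ is the probability space of random $d$-dimensional simplicial complexes on $n$ vertices with full $(d-1)$-dimensional skeleton (all vertex subsets of size at most $d$ are faces), in which each of the $\binom{n}{d+1}$ possible $d$-faces (vertex sets of size $d+1$) is included independently with probability $p$. For a $d$-complex $Y$, $H_d(Y;\mathbb{R})=\ker\partial_d(Y)$, where $\partial_d(Y)$ is the real simplicial boundary operator from $d$-chains to $(d-1)$-chains. For a $d$-complex $Y$ on $n$ vertices with full $(d-1)$-skeleton, the $\mathbb{R}$-shadow of $Y$ is the set of $d$-faces (vertex sets of size $d+1$) $$\mathrm{SH}_{\mathbb{R}}(Y)=\{\sigma\notin Y: H_d(Y;\mathbb{R})\text{ is a proper subspace of }H_d(Y\cup\{\sigma\};\mathbb{R})\}.$$ Asymptotically almost surely (a.a.s.) means with probability tending to $1$ as $n\to\infty$, with $d,c$ fixed. In (1), the conclusion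 means there are constants $0<a<A$ (depending on $d,c$) such that a.a.s. $an\le|\mathrm{SH}_{\mathbb{R}}(Y)|\le An$. In (2) it means that for every $\varepsilon>0$, a.a.s. $\left||\mathrm{SH}_{\mathbb{R}}(Y)|/\binom{n}{d+1}-(1-t_c)^{d+1}\right|\le\varepsilon$. Logarithms are natural. *)

theory Defs
  imports "HOL-Probability.Probability"
begin

section \<open>Complexes on \<open>{..<n}\<close> and real cycles\<close>

text \<open>A complex is represented by its set of faces, each face being a finite set of vertices.
  A \<open>k\<close>-dimensional face has \<open>k + 1\<close> vertices.\<close>

definition all_faces :: "nat \<Rightarrow> nat \<Rightarrow> nat set set" where
  "all_faces n k = {\<sigma>. \<sigma> \<subseteq> {..<n} \<and> card \<sigma> = k + 1}"

definition full_skeleton :: "nat \<Rightarrow> nat \<Rightarrow> nat set set" where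
  "full_skeleton n d = {\<sigma>. \<sigma> \<subseteq> {..<n} \<and> card \<sigma> \<le> d}"

definition faces :: "nat set set \<Rightarrow> nat \<Rightarrow> nat set set" where
  "faces Y k = {\<sigma> \<in> Y. card \<sigma> = k + 1}"

text \<open>The coefficient of \<open>\<tau>\<close> in the boundary of the simplex \<open>\<sigma>\<close>, where simplices are oriented by the
  order of their vertices: deleting the \<open>i\<close>-th vertex (counting from 0) has sign \<open>(-1)^i\<close>.\<close>

definition incidence :: "nat set \<Rightarrow> nat set \<Rightarrow> real" where
  "incidence \<sigma> \<tau> = (\<Sum>v\<in>\<sigma>. if \<tau> = \<sigma> - {v} then (-1) ^ card {u \<in> \<sigma>. u < v} else 0)"

text \<open>Real \<open>k\<close>-chains of \<open>Y\<close> are real functions vanishing off the \<open>k\<close>-faces of \<open>Y\<close>.\<close>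

definition chains :: "nat set set \<Rightarrow> nat \<Rightarrow> (nat set \<Rightarrow> real) set" where
  "chains Y k = {f. \<forall>\<sigma>. \<sigma> \<notin> faces Y k \<longrightarrow> f \<sigma> = 0}"

definition boundary_op :: "nat set set \<Rightarrow> nat \<Rightarrow> (nat set \<Rightarrow> real) \<Rightarrow> nat set \<Rightarrow> real" where
  "boundary_op Y k f = (\<lambda>\<tau>. \<Sum>\<sigma>\<in>faces Y k. f \<sigma> * incidence \<sigma> \<tau>)"

text \<open>For a complex \<open>Y\<close> of dimension \<open>d\<close>, \<open>homology Y d\<close> is the top homology \<open>H_d(Y; \<real>)\<close>,
  that is, the kernel of the boundary operator on \<open>d\<close>-chains.\<close>

definition homology :: "nat set set \<Rightarrow> nat \<Rightarrow> (nat set \<Rightarrow> real) set" where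
  "homology Y d = {f \<in> chains Y d. boundary_op Y d f = (\<lambda>\<tau>. 0)}"

text \<open>Both sides of the strict inclusion below are linear spaces, so that it says
  ``proper subspace''.\<close>

definition shadow :: "nat \<Rightarrow> nat \<Rightarrow> nat set set \<Rightarrow> nat set set" where
  "shadow n d Y = {\<sigma> \<in> all_faces n d. \<sigma> \<notin> Y \<and> homology Y d \<subset> homology (insert \<sigma> Y) d}"

lemma homology_zero: "(\<lambda>\<sigma>. 0) \<in> homology Y d"
  by (simp add: homology_def chains_def boundary_op_def)

lemma homology_add:
  assumes "f \<in> homology Y d" "g \<in> homology Y d"
  shows "(\<lambda>\<sigma>. f \<sigma> + g \<sigma>) \<in> homology Y d"
  using assms
  by (simp add: homology_def chains_def boundary_op_def fun_eq_iff distrib_right sum.distrib)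

lemma homology_scale:
  assumes "f \<in> homology Y d"
  shows "(\<lambda>\<sigma>. a * f \<sigma>) \<in> homology Y d"
  using assms
  by (simp add: homology_def chains_def boundary_op_def fun_eq_iff mult.assoc flip: sum_distrib_left)


section \<open>The random complex\<close>

text \<open>The parameter of \<open>bernoulli_pmf\<close> is truncated to \<open>[0, 1]\<close>; for \<open>p = c / n\<close> this only matters
  for \<open>n < c\<close>.\<close>

definition random_complex :: "nat \<Rightarrow> nat \<Rightarrow> real \<Rightarrow> nat set set pmf" where
  "random_complex d n p =
     map_pmf (\<lambda>\<omega>. full_skeleton n d \<union> {\<sigma> \<in> all_faces n d. \<omega> \<sigma>})
       (Pi_pmf (all_faces n d) False (\<lambda>_. bernoulli_pmf p))"

definition aas :: "(nat \<Rightarrow> 'a pmf) \<Rightarrow> (nat \<Rightarrow> 'a \<Rightarrow> bool) \<Rightarrow> bool" where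
  "aas M P \<longleftrightarrow> (\<lambda>n. measure_pmf.prob (M n) {Y. P n Y}) \<longlonglongrightarrow> 1"


section \<open>The threshold constants\<close>

definition t_star :: "nat \<Rightarrow> real" where
  "t_star d = (THE t. 0 < t \<and> t < 1 \<and> (real d + 1) * (1 - t) + (1 + real d * t) * ln t = 0)"

definition c_star :: "nat \<Rightarrow> real" where
  "c_star d = - ln (t_star d) / (1 - t_star d) ^ d"

definition t_root :: "nat \<Rightarrow> real \<Rightarrow> real" where
  "t_root d c = (LEAST t. 0 < t \<and> t < 1 \<and> t = exp (- c * (1 - t) ^ d))"

text \<open>The two descriptions above denote: the root defining \<open>t_star\<close> is unique, and a least root
  exists above the threshold.\<close>

lemma ex1_t_star:
  assumes d: "d \<ge> 2"
  shows "\<exists>!t::real. 0 < t \<and> t < 1 \<and> (real d + 1) * (1 - t) + (1 + real d * t) * ln t = 0"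
proof -
  define h where "h t = ln t + (real d + 1) * (1 - t) / (1 + real d * t)" for t :: real
  define m where "m = 1 / (real d)\<^sup>2"
  have d2: "real d \<ge> 2" using d by simp
  have "(real d)\<^sup>2 \<ge> 2\<^sup>2" using d2 by (intro power_mono) auto
  hence dd: "(real d)\<^sup>2 \<ge> 4" by simp
  have dp: "(real d)\<^sup>2 > 0" using dd by linarith
  have less_m: "x < m \<longleftrightarrow> (real d)\<^sup>2 * x < 1" and m_less: "m < x \<longleftrightarrow> 1 < (real d)\<^sup>2 * x" for x
    unfolding m_def pos_less_divide_eq[OF dp] pos_divide_less_eq[OF dp]
    by (simp_all add: mult.commute)
  have m: "0 < m" "m < 1" using dd less_m[of 0] m_less[of 1] by simp_all
  have pos: "1 + real d * t > 0" if "t > 0" for t :: real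
    using that by (simp add: add_pos_nonneg)
  have iff: "(real d + 1) * (1 - t) + (1 + real d * t) * ln t = 0 \<longleftrightarrow> h t = 0"
    if "t > 0" for t :: real
    using pos[OF that] unfolding h_def by (simp add: field_simps)
  have der: "(h has_real_derivative ((real d)\<^sup>2 * t - 1) * (t - 1) / (t * (1 + real d * t)\<^sup>2)) (at t)"
    if "t > 0" for t :: real
  proof -
    have q: "1 + real d * t \<noteq> 0" using pos[OF that] by simp
    have "((\<lambda>t. ln t + (real d + 1) * (1 - t) / (1 + real d * t)) has_real_derivative
        1 / t + (- (real d + 1) * (1 + real d * t) - (real d + 1) * (1 - t) * real d) /
          ((1 + real d * t) * (1 + real d * t))) (at t)"
      using that q by (auto intro!: derivative_eq_intros)
    also have "1 / t + (- (real d + 1) * (1 + real d * t) - (real d + 1) * (1 - t) * real d) /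
          ((1 + real d * t) * (1 + real d * t))
        = ((real d)\<^sup>2 * t - 1) * (t - 1) / (t * (1 + real d * t)\<^sup>2)"
    proof -
      have "(1 + real d * t) * (1 + real d * t) +
              t * (- (real d + 1) * (1 + real d * t) - (real d + 1) * (1 - t) * real d)
            = ((real d)\<^sup>2 * t - 1) * (t - 1)"
        by algebra
      thus ?thesis using that q by (simp add: add_frac_eq power2_eq_square mult.commute)
    qed
    finally show ?thesis unfolding h_def .
  qed
  have h1: "h 1 = 0" by (simp add: h_def)
  have hpos: "h t > 0" if "m \<le> t" "t < 1" for t
  proof -
    have "h t > h 1"
    proof (rule DERIV_neg_imp_decreasing_open[OF \<open>t < 1\<close>])
      fix x :: real assume x: "t < x" "x < 1"
      have x0: "x > 0" using x that m by linarith
      have "x > m" using x that by linarith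
      hence "(real d)\<^sup>2 * x - 1 > 0" using m_less by simp
      hence "((real d)\<^sup>2 * x - 1) * (x - 1) / (x * (1 + real d * x)\<^sup>2) < 0"
        using x x0 pos[OF x0] by (intro divide_neg_pos mult_pos_neg mult_pos_pos) auto
      thus "\<exists>y. (h has_real_derivative y) (at x) \<and> y < 0" using der[OF x0] by blast
    next
      show "continuous_on {t..1} h"
        using that m by (intro continuous_at_imp_continuous_on ballI DERIV_isCont[OF der]) auto
    qed
    thus ?thesis using h1 by simp
  qed
  have hinc: "h s < h t" if "0 < s" "s < t" "t \<le> m" for s t
  proof (rule DERIV_pos_imp_increasing_open[OF \<open>s < t\<close>])
    fix x :: real assume x: "s < x" "x < t"
    have x0: "x > 0" using x that by linarith
    have xm: "x < m" using x that by linarith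
    hence "(real d)\<^sup>2 * x - 1 < 0" using less_m by simp
    hence "((real d)\<^sup>2 * x - 1) * (x - 1) / (x * (1 + real d * x)\<^sup>2) > 0"
      using xm m x0 pos[OF x0] by (intro divide_pos_pos mult_neg_neg mult_pos_pos) auto
    thus "\<exists>y. (h has_real_derivative y) (at x) \<and> y > 0" using der[OF x0] by blast
  next
    show "continuous_on {s..t} h"
      using that by (intro continuous_at_imp_continuous_on ballI DERIV_isCont[OF der]) auto
  qed
  define e where "e = exp (- (real d + 1))"
  have e0: "0 < e" "e < 1" by (auto simp: e_def)
  have "(real d + 1) * (1 - e) / (1 + real d * e) \<le> (real d + 1) * 1 / 1"
    using e0 by (intro frac_le mult_left_mono) auto
  hence he: "h e \<le> 0" by (simp add: h_def e_def)
  have em: "e < m" using hpos[of e] he e0 by (cases "m \<le> e") auto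
  have "\<exists>x. e \<le> x \<and> x \<le> m \<and> h x = 0"
    using he hpos[of m] m em e0
    by (intro IVT' continuous_at_imp_continuous_on ballI DERIV_isCont[OF der]) auto
  then obtain x where x: "e \<le> x" "x \<le> m" "h x = 0" by blast
  show ?thesis
  proof (rule ex1I[of _ x])
    show "0 < x \<and> x < 1 \<and> (real d + 1) * (1 - x) + (1 + real d * x) * ln x = 0"
      using x e0 m iff[of x] by auto
  next
    fix y :: real
    assume y: "0 < y \<and> y < 1 \<and> (real d + 1) * (1 - y) + (1 + real d * y) * ln y = 0"
    hence hy: "h y = 0" using iff by blast
    have "y < m" using hpos[of y] hy y by (cases "m \<le> y") auto
    thus "y = x"
      using hinc[of x y] hinc[of y x] x hy y e0 by (cases x y rule: linorder_cases) auto
  qed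
qed

lemma t_root_is_least:
  assumes d: "d \<ge> 2" and c: "c > c_star d"
  shows "0 < t_root d c" "t_root d c < 1" "t_root d c = exp (- c * (1 - t_root d c) ^ d)"
    and "\<And>t. 0 < t \<Longrightarrow> t < 1 \<Longrightarrow> t = exp (- c * (1 - t) ^ d) \<Longrightarrow> t_root d c \<le> t"
proof -
  define s where "s = t_star d"
  have s: "0 < s" "s < 1"
    using theI'[OF ex1_t_star[OF d]] unfolding s_def t_star_def by auto
  define f where "f t = t - exp (- c * (1 - t) ^ d)" for t :: real
  have cont: "continuous_on A f" for A unfolding f_def by (intro continuous_intros)
  have p: "(1 - s) ^ d > 0" using s by simp
  have "- ln s < c * (1 - s) ^ d"
    using c p unfolding c_star_def s_def[symmetric] by (simp add: field_simps)
  hence "exp (- c * (1 - s) ^ d) < exp (ln s)" by simp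
  hence fs: "f s > 0" using s by (simp add: f_def)
  have f0: "f 0 < 0" by (simp add: f_def)
  define R where "R = {t \<in> {0..s}. f t = 0}"
  have "closed {t. f t = 0}" by (intro closed_Collect_eq cont continuous_intros)
  hence "compact ({t. f t = 0} \<inter> {0..s})" by (intro closed_Int_compact) auto
  also have "{t. f t = 0} \<inter> {0..s} = R" by (auto simp: R_def)
  finally have "compact R" .
  moreover have "R \<noteq> {}"
    using IVT'[of f 0 0 s] f0 fs s cont[of "{0..s}"] by (auto simp: R_def)
  ultimately obtain r where r: "r \<in> R" "\<And>t. t \<in> R \<Longrightarrow> r \<le> t"
    using compact_attains_inf[of R] by blast
  have r0: "0 < r" "r < s" using r(1) f0 fs by (auto simp: R_def order_less_le)
  have P: "0 < r \<and> r < 1 \<and> r = exp (- c * (1 - r) ^ d)"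
    using r0 r(1) s by (auto simp: R_def f_def)
  have le: "r \<le> t" if "0 < t \<and> t < 1 \<and> t = exp (- c * (1 - t) ^ d)" for t
  proof (cases "t \<le> s")
    case True
    thus ?thesis using that by (intro r(2)) (auto simp: R_def f_def)
  qed (use r0 in auto)
  have eq: "t_root d c = r"
    unfolding t_root_def using P le by (intro Least_equality) blast+
  show "0 < t_root d c" "t_root d c < 1" "t_root d c = exp (- c * (1 - t_root d c) ^ d)"
    using P unfolding eq by auto
  show "t_root d c \<le> t" if "0 < t" "t < 1" "t = exp (- c * (1 - t) ^ d)" for t
    unfolding eq using le that by blast
qed

end

theory Submission
  imports Defs "HOL-Library.Function_Algebras" "HOL-Real_Asymp.Real_Asymp"
begin

text \<open>
  Over the full skeleton, a face \<open>\<sigma>\<close> outside \<open>S\<close> lies in the shadow exactly if its boundary is a combination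
  of boundaries of faces of \<open>S\<close>, that is, if \<open>\<sigma>\<close> is in the matroid closure of \<open>S\<close>.  Everything is
  about this closure for a random set \<open>S\<close> of density \<open>c / n\<close>, and about the nullity \<open>cyc S\<close>.

  \<^emph>\<open>The two are linked by convexity.\<close>  Adding faces one at a time raises the nullity by one for each face that
  is already in the closure.  So the expected nullity is convex in the density, with derivative the
  expected size of the closure (\<open>EE_cyc_increment\<close>).  Bounds for the closure can be integrated and bounds for
  the nullity differentiated.

  \<^emph>\<open>Local upper bounds.\<close>  Around a \<open>(d - 1)\<close>-face the random complex looks like a Poisson tree
  (\<open>local_limit\<close>).  If the tree at a facet of \<open>\<sigma>\<close> collapses to the facet, then a cochain
  that is one on this facet and orthogonal to all boundaries shows that \<open>\<sigma>\<close> is not in the closure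
  (\<open>ev_coll\<close>).  Collapsing to depth \<open>k\<close> has a probability tending to \<open>t_root d c\<close>, so the closure has density at most
  \<open>(1 - t_root d c) ^ (d + 1)\<close>.  Similarly, orthogonalising along the tree approximates the unit vector of the facet by
  boundaries up to an explicit error \<open>z\<close> (\<open>ev_z\<close>); a trace estimate turns this into a lower bound for the rank, that
  is, an upper bound for the nullity.  A Mecke formula and exchangeability bound the limiting expectation of \<open>z\<close>
  (\<open>gw_limit\<close>).  By the choice of \<open>c_star d\<close> the resulting bound is zero below the threshold.

  \<^emph>\<open>Above the threshold\<close>, the nullity is negligible at \<open>c_star d\<close> and nearly its trivial lower bound, faces minus
  facets, at very large densities.  The local upper bound on the closure, integrated between the
  two, accounts for the entire growth of the nullity.  By convexity it is therefore attained everywhere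
  (\<open>dens_limit\<close>), and as disjoint faces are asymptotically independent, a second moment bound gives concentration.

  \<^emph>\<open>Below the threshold\<close>, each face of the shadow closes a circuit.  Circuits of positive density
  do not occur: a slightly denser complex has small nullity, so that few removed faces destroy all its
  cycles, and a union bound over these faces shows that thinning it leaves no large circuit
  (\<open>no_large_cycle\<close>).  Smaller circuits are counted by exploring them facet by facet.  A positive proportion of the
  steps finds a face among few candidates, which beats the number of choices (\<open>core_weight_sum\<close>).  Circuits of bounded size have fewer vertices
  than faces unless they are boundaries of simplices (\<open>few_vertices\<close>), so that on average boundedly many of them
  are nearly present.  What remains are the boundaries of simplices that miss one face; their number is
  of order \<open>n\<close> by Chebyshev's inequality (\<open>horns_concentrated\<close>).
\<close>

section \<open>Random subsets\<close>

definition rs :: "'a set => real => 'a set pmf" where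
 "rs F p = map_pmf (\<lambda>w. {x \<in> F. w x}) (Pi_pmf F False (\<lambda>_. bernoulli_pmf p))"

abbreviation "mean \<equiv> measure_pmf.expectation"

abbreviation EE :: "'a set => real => ('a set => real) => real" where
 "EE F p f \<equiv> mean (rs F p) f"

abbreviation PR :: "'a set => real => ('a set => bool) => real" where
 "PR F p P \<equiv> measure_pmf.prob (rs F p) {S. P S}"

lemma set_pmf_rs: "set_pmf (rs F p) \<subseteq> Pow F"
 by (auto simp: rs_def)

lemma finite_set_pmf_rs: "finite F ==> finite (set_pmf (rs F p))"
 using set_pmf_rs by (rule finite_subset) auto

lemma rs_empty: "rs {} p = return_pmf {}"
 by (simp add: rs_def)

lemma rs_insert:
 assumes "finite F" "x \<notin> F"
 shows "rs (insert x F) p =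
  bernoulli_pmf p \<bind> (\<lambda>b. map_pmf (\<lambda>S. if b then insert x S else S) (rs F p))"
 unfolding rs_def Pi_pmf_insert'[OF assms] map_bind_pmf
 using assms(2)
 by (intro bind_pmf_cong refl)
 (auto simp: map_pmf_def[symmetric] map_pmf_comp intro!: map_pmf_cong split: if_splits)

lemma EE_integrable [simp]: "finite F ==> integrable (measure_pmf (rs F p)) (f :: _ => real)"
 by (intro integrable_measure_pmf_finite finite_set_pmf_rs)

lemma EE_mono:
 assumes "finite F" "\<And>S. S \<subseteq> F ==> f S \<le> g S"
 shows "EE F p f \<le> EE F p g"
 using assms set_pmf_rs[of F p] by (intro integral_mono_AE) (auto simp: AE_measure_pmf_iff)

lemma EE_cong:
 assumes "\<And>S. S \<subseteq> F ==> f S = g S"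
 shows "EE F p f = EE F p g"
 using assms set_pmf_rs[of F p] by (intro integral_cong_AE) (auto simp: AE_measure_pmf_iff)

lemma EE_const [simp]: "EE F p (\<lambda>_. c) = c"
 by simp

lemma EE_sum: "finite F ==> EE F p (\<lambda>S. \<Sum>i\<in>I. f i S) = (\<Sum>i\<in>I. EE F p (f i))"
 by simp

lemma EE_indicator: "EE F p (\<lambda>S. of_bool (P S)) = PR F p P"
proof -
 have "EE F p (\<lambda>S. of_bool (P S)) = EE F p (indicator {S. P S})"
  by (intro arg_cong[where f = "mean _"]) (auto simp: indicator_def)
 thus ?thesis by simp
qed

lemma EE_insert:
 assumes "finite F" "x \<notin> F" "0 \<le> p" "p \<le> 1"
 shows "EE (insert x F) p f = p * EE F p (\<lambda>S. f (insert x S)) + (1 - p) * EE F p f"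
proof -
 have "EE (insert x F) p f = mean (bernoulli_pmf p)
  (\<lambda>b. EE F p (\<lambda>S. f (if b then insert x S else S)))"
  unfolding rs_insert[OF assms(1,2)]
  by (subst pmf_expectation_bind[where A = UNIV])
  (auto simp: finite_set_pmf_rs[OF assms(1)] integral_measure_pmf_real[where A=UNIV] mult.commute)
 thus ?thesis using assms by simp
qed

text \<open>The union of independent random sets is a random set; this realises two densities on one space.\<close>
lemma EE_union:
 assumes "finite F" "0 \<le> p" "p \<le> 1" "0 \<le> q" "q \<le> 1"
 shows "EE F (p + q - p * q) f = EE F p (\<lambda>Y. EE F q (\<lambda>Z. f (Y \<union> Z)))"
 using assms(1)
proof (induction F arbitrary: f)
 case empty
 then show ?case by (simp add: rs_empty)
next
 case (insert x F)
 have r: "0 \<le> p + q - p * q" "p + q - p * q \<le> 1"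
 proof -
  have "(1-p)*(1-q) \<ge> 0" "(1-p)*(1-q) \<le> 1" using assms by (auto intro!: mult_le_one)
  thus "0 \<le> p + q - p * q" "p + q - p * q \<le> 1" by (auto simp: algebra_simps)
 qed
 have "EE (insert x F) p (\<lambda>Y. EE (insert x F) q (\<lambda>Z. f (Y \<union> Z))) = (p + q - p * q) * EE F p (\<lambda>Y. EE F q (\<lambda>Z. f (insert x (Y \<union> Z))))
  + (1 - (p + q - p * q)) * EE F p (\<lambda>Y. EE F q (\<lambda>Z. f (Y \<union> Z)))" using insert.hyps assms by (simp add: EE_insert algebra_simps)
 also have "... = EE (insert x F) (p + q - p * q) f"
  using insert r by (simp add: EE_insert)
 finally show ?case by simp
qed

text \<open>Intersecting with an independent random set thins the density by a factor.\<close>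
lemma EE_thin:
 assumes "finite F" "0 \<le> p" "p \<le> 1" "0 \<le> q" "q \<le> 1"
 shows "EE F (p * q) f = EE F p (\<lambda>Y. EE F q (\<lambda>Z. f (Y \<inter> Z)))"
 using assms(1)
proof (induction F arbitrary: f)
 case empty
 then show ?case by (simp add: rs_empty)
next
 case (insert x F)
 have r: "0 \<le> p * q" "p * q \<le> 1" using assms by (auto intro: mult_le_one)
 have i: "Y \<inter> insert x Z = Y \<inter> Z" "insert x Y \<inter> Z = Y \<inter> Z" if "Y \<subseteq> F" "Z \<subseteq> F" for Y Z
  using that insert.hyps by auto
 have "EE (insert x F) p (\<lambda>Y. EE (insert x F) q (\<lambda>Z. f (Y \<inter> Z))) = (p * q) * EE F p (\<lambda>Y. EE F q (\<lambda>Z. f (insert x (Y \<inter> Z))))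
  + (1 - (p * q)) * EE F p (\<lambda>Y. EE F q (\<lambda>Z. f (Y \<inter> Z)))" using insert.hyps assms by (simp add: EE_insert i algebra_simps cong: EE_cong)
 also have "... = EE (insert x F) (p * q) f"
  using insert r by (simp add: EE_insert)
 finally show ?case by simp
qed

lemma PR_present_absent:
 assumes "finite F" "0 \<le> p" "p \<le> 1" "A \<subseteq> F" "B \<subseteq> F" "A \<inter> B = {}"
 shows "PR F p (\<lambda>S. A \<subseteq> S \<and> B \<inter> S = {}) = p ^ card A * (1 - p) ^ card B"
proof -
 have "PR F p (\<lambda>S. A \<subseteq> S \<and> B \<inter> S = {}) =
  measure_pmf.prob (Pi_pmf F False (\<lambda>_. bernoulli_pmf p)) (Pi F (\<lambda>x. {b. (x \<in> A --> b) \<and> (x \<in> B --> \<not> b)}))"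
  unfolding rs_def measure_map_pmf
  by (rule arg_cong[where f = "measure_pmf.prob _"]) (use assms(4,5) in \<open>auto simp: Pi_def\<close>)
 also have "... = (\<Prod>x\<in>F. measure_pmf.prob (bernoulli_pmf p) {b. (x \<in> A --> b) \<and> (x \<in> B --> \<not> b)})"
  using assms(1) by (rule measure_Pi_pmf_Pi)
 also have "... = (\<Prod>x\<in>F. (if x \<in> A then p else 1) * (if x \<in> B then 1 - p else 1))"
 proof (rule prod.cong[OF refl])
  fix x assume "x \<in> F"
  have b: "{b. b} = {True}" "{b. \<not> b} = {False}" by auto
  show "measure_pmf.prob (bernoulli_pmf p) {b. (x \<in> A --> b) \<and> (x \<in> B --> \<not> b)} =
   (if x \<in> A then p else 1) * (if x \<in> B then 1 - p else 1)"
   using assms by (cases "x \<in> A"; cases "x \<in> B") (auto simp: b measure_pmf_single)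
 qed
 also have "... = p ^ card A * (1 - p) ^ card B"
  using assms by (simp add: prod.distrib prod.If_cases Int_absorb1)
 finally show ?thesis .
qed

lemma PR_subset:
 assumes "finite F" "0 \<le> p" "p \<le> 1" "A \<subseteq> F"
 shows "PR F p (\<lambda>S. A \<subseteq> S) = p ^ card A"
 using PR_present_absent[OF assms(1-4), of "{}"] by simp

lemma PR_mono:
 assumes "\<And>S. S \<subseteq> F ==> P S ==> Q S"
 shows "PR F p P \<le> PR F p Q"
proof -
 have "PR F p P = measure_pmf.prob (rs F p) ({S. P S} \<inter> set_pmf (rs F p))"
  by (simp add: measure_Int_set_pmf)
 also have "... \<le> PR F p Q"
  using assms set_pmf_rs[of F p] by (intro measure_pmf.finite_measure_mono) auto
 finally show ?thesis .
qed

lemma PR_markov: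
 assumes "finite F" "\<And>S. S \<subseteq> F ==> f S \<ge> 0" "a > 0"
 shows "PR F p (\<lambda>S. f S \<ge> a) \<le> EE F p f / a"
proof -
 have "PR F p (\<lambda>S. f S \<ge> a) = EE F p (\<lambda>S. of_bool (f S \<ge> a))" by (simp add: EE_indicator)
 also have "... \<le> EE F p (\<lambda>S. f S / a)"
  using assms by (intro EE_mono) (auto simp: field_simps)
 finally show ?thesis by simp
qed

lemma EE_card:
 assumes "finite F" "0 \<le> p" "p \<le> 1"
 shows "EE F p (\<lambda>S. real (card S)) = p * card F"
proof -
 have "EE F p (\<lambda>S. real (card S)) = EE F p (\<lambda>S. \<Sum>x\<in>F. of_bool (x \<in> S))"
  using assms by (intro EE_cong) (auto simp: Int_absorb1)
 also have "... = (\<Sum>x\<in>F. PR F p (\<lambda>S. {x} \<subseteq> S))"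
  using assms by (simp add: EE_indicator del: sum_of_bool_eq)
 also have "... = p * card F" using assms by (subst sum.cong[OF refl PR_subset]) auto
 finally show ?thesis .
qed

lemma random_complex_rs:
  "random_complex d n p = map_pmf (\<lambda>S. full_skeleton n d \<union> S) (rs (all_faces n d) p)"
 by (simp add: random_complex_def rs_def map_pmf_comp)

section \<open>The matroid of boundaries\<close>

abbreviation "bd \<equiv> incidence"

interpretation fv: vector_space "\<lambda>a (f :: nat set => real) x. a * f x"
 by unfold_locales (auto simp: fun_eq_iff algebra_simps)

text \<open>Faces enter the linear algebra through their boundaries, the functions \<open>incidence \<sigma>\<close>.  Thus \<open>cl\<close>, \<open>rk\<close> and \<open>cyc\<close> are the
  closure, rank and nullity of a linear matroid; \<open>cyc S\<close> is the dimension of the space of cycles on \<open>S\<close>.\<close>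
definition cl :: "nat set set => nat set set" where
 "cl S = {s. bd s \<in> fv.span (bd ` S)}"

definition rk :: "nat set set => nat" where
 "rk S = fv.dim (bd ` S)"

definition cyc :: "nat set set => nat" where
 "cyc S = card S - rk S"

lemma sum_fun_apply: "(\<Sum>i\<in>A. f i) x = (\<Sum>i\<in>A. f i x)"
  for f :: "_ => _ => real"
 by (induction A rule: infinite_finite_induct) auto

lemma rk_basis:
 assumes "finite S"
 obtains B where "fv.independent B" "finite B" "fv.span B = fv.span (bd ` S)" "rk S = card B"
proof -
 obtain B where B: "B \<subseteq> bd ` S" "fv.independent B" "bd ` S \<subseteq> fv.span B"
  using fv.maximal_independent_subset[of "bd ` S"] by blast
 have sp: "fv.span B = fv.span (bd ` S)"
  using B fv.span_mono[OF B(1)] fv.span_minimal[OF B(3) fv.subspace_span] by blast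
 show ?thesis
  using B sp assms finite_subset[OF B(1)] fv.dim_eq_card[OF sp B(2)]
  by (intro that[of B]) (auto simp: rk_def)
qed

lemma rk_insert:
 assumes "finite S"
 shows "rk (insert s S) = rk S + of_bool (s \<notin> cl S)"
proof -
 obtain B where B: "fv.independent B" "finite B" "fv.span B = fv.span (bd ` S)" "rk S = card B"
  using rk_basis[OF assms] by blast
 show ?thesis
 proof (cases "s \<in> cl S")
  case True
  thus ?thesis using B fv.dim_eq_card[of B "bd ` insert s S"] by (auto simp: cl_def fv.span_redundant rk_def)
 next
  case False
  hence n: "bd s \<notin> fv.span B" using B by (auto simp: cl_def)
  have i: "fv.independent (insert (bd s) B)" using n B by (simp add: fv.independent_insertI)
  have "fv.span (insert (bd s) B) = fv.span (bd ` insert s S)"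
   using B(3) by (simp add: fv.span_insert)
  from fv.dim_eq_card[OF this i] have "rk (insert s S) = card (insert (bd s) B)"
   by (simp add: rk_def)
  moreover have "bd s \<notin> B" using n fv.span_base by blast
  ultimately show ?thesis using False B by simp
 qed
qed

lemma rk_empty [simp]: "rk {} = 0"
 using fv.dim_eq_card[of "{}" "{}"] by (simp add: rk_def fv.independent_empty)

lemma cl_mono: "S \<subseteq> T ==> cl S \<subseteq> cl T"
 unfolding cl_def using fv.span_mono[of "bd ` S" "bd ` T"] by auto

lemma rk_le_card: "finite S ==> rk S \<le> card S"
proof (induction S rule: finite_induct)
 case (insert x S)
 then show ?case by (auto simp: rk_insert)
qed auto

lemma card_eq_cyc_rk: "finite S ==> card S = cyc S + rk S"
 using rk_le_card by (simp add: cyc_def)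

lemma cyc_insert:
 assumes "finite S" "s \<notin> S"
 shows "cyc (insert s S) = cyc S + of_bool (s \<in> cl S)"
 using assms rk_le_card[of S] by (simp add: cyc_def rk_insert)

lemma cyc_empty [simp]: "cyc {} = 0"
 by (simp add: cyc_def)

lemma Collect_insert: "{s \<in> insert x Z. P s} = (if P x then insert x {s \<in> Z. P s} else {s \<in> Z. P s})"
 by auto

text \<open>Insert the elements of \<open>Z\<close> one at a time.  Each one counts if it is in the closure of what came before, which lies
  between \<open>Y\<close> and all the rest.\<close>
lemma cyc_bounds:
 assumes "finite Y" "finite Z" "Y \<inter> Z = {}"
 shows "cyc Y + card {s \<in> Z. s \<in> cl Y} \<le> cyc (Y \<union> Z)"
  and "cyc (Y \<union> Z) \<le> cyc Y + card {s \<in> Z. s \<in> cl (Y \<union> Z - {s})}"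
proof -
 have "cyc Y + card {s \<in> Z. s \<in> cl Y} \<le> cyc (Y \<union> Z) \<and>
  cyc (Y \<union> Z) \<le> cyc Y + card {s \<in> Z. s \<in> cl (Y \<union> Z - {s})}"
  using assms(2,3)
 proof (induction Z rule: finite_induct)
  case (insert x Z)
  have c: "cyc (Y \<union> insert x Z) = cyc (Y \<union> Z) + of_bool (x \<in> cl (Y \<union> Z))"
   using insert assms by (simp add: cyc_insert)
  have 1: "card {s \<in> insert x Z. s \<in> cl Y} = card {s \<in> Z. s \<in> cl Y} + of_bool (x \<in> cl Y)"
  proof (cases "x \<in> cl Y")
   case True
   hence "{s \<in> insert x Z. s \<in> cl Y} = insert x {s \<in> Z. s \<in> cl Y}" by auto
   thus ?thesis using True insert by simp
  qed (auto intro: arg_cong[where f = card])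
  have 2: "x \<in> cl Y ==> x \<in> cl (Y \<union> Z)" using cl_mono[of Y "Y \<union> Z"] by auto
  have 3: "card {s \<in> Z. s \<in> cl (Y \<union> Z - {s})} + of_bool (x \<in> cl (Y \<union> Z))
   \<le> card {s \<in> insert x Z. s \<in> cl (Y \<union> insert x Z - {s})}"
  proof -
   have e: "Y \<union> insert x Z - {x} = Y \<union> Z" using insert by auto
   have cm: "card {s \<in> Z. s \<in> cl (Y \<union> Z - {s})} \<le> card {s \<in> Z. s \<in> cl (Y \<union> insert x Z - {s})}"
    using cl_mono[of "Y \<union> Z - {_}" "Y \<union> insert x Z - {_}"] insert.hyps by (intro card_mono) auto
   show ?thesis
   proof (cases "x \<in> cl (Y \<union> Z)")
    case True
    have "{s \<in> insert x Z. s \<in> cl (Y \<union> insert x Z - {s})} =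
     insert x {s \<in> Z. s \<in> cl (Y \<union> insert x Z - {s})}" using True by (simp only: Collect_insert e if_True)
    thus ?thesis using insert.hyps cm by simp
   next
    case False
    have "{s \<in> insert x Z. s \<in> cl (Y \<union> insert x Z - {s})} =
     {s \<in> Z. s \<in> cl (Y \<union> insert x Z - {s})}" using False by (simp only: Collect_insert e if_False)
    thus ?thesis using False cm by simp
   qed
  qed
  have IH: "cyc Y + card {s \<in> Z. s \<in> cl Y} \<le> cyc (Y \<union> Z)"
   "cyc (Y \<union> Z) \<le> cyc Y + card {s \<in> Z. s \<in> cl (Y \<union> Z - {s})}"
   using insert.IH insert.prems by auto
  have 4: "of_bool (x \<in> cl Y) \<le> (of_bool (x \<in> cl (Y \<union> Z)) :: nat)" using 2 by auto
  show ?case using IH c 1 3 4 by linarith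
 qed auto
 thus "cyc Y + card {s \<in> Z. s \<in> cl Y} \<le> cyc (Y \<union> Z)"
  and "cyc (Y \<union> Z) \<le> cyc Y + card {s \<in> Z. s \<in> cl (Y \<union> Z - {s})}" by auto
qed

text \<open>The union of the circuits of \<open>T\<close>.\<close>
definition cyclic_part :: "nat set set => nat set set" where
 "cyclic_part T = {r \<in> T. r \<in> cl (T - {r})}"

lemma cyclic_part_mono: "S \<subseteq> T ==> cyclic_part S \<subseteq> cyclic_part T"
 using cl_mono[of "S - {_}" "T - {_}"] unfolding cyclic_part_def by auto

text \<open>Removing a face of the cyclic part lowers the nullity, so at most \<open>cyc T\<close> removals of faces in \<open>R\<close> are needed
  until none of them lies on a cycle.\<close>
lemma cyclic_part_hitting:
 assumes "finite T"
 shows "\<exists>B\<subseteq>R. B \<subseteq> T \<and> card B \<le> cyc T \<and> cyclic_part (T - B) \<inter> R = {}"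
 using assms
proof (induction "cyc T" arbitrary: T rule: less_induct)
 case less
 show ?case
 proof (cases "cyclic_part T \<inter> R = {}")
  case True
  thus ?thesis by force
 next
  case False
  then obtain r where r: "r \<in> T" "r \<in> cl (T - {r})" "r \<in> R" by (auto simp: cyclic_part_def)
  have c: "cyc T = cyc (T - {r}) + 1"
   using cyc_insert[of "T - {r}" r] r less.prems by (simp add: insert_absorb)
  then obtain B where B: "B \<subseteq> R" "B \<subseteq> T - {r}" "card B \<le> cyc (T - {r})"
   "cyclic_part (T - {r} - B) \<inter> R = {}"
   using less.hyps[of "T - {r}"] less.prems by auto
  have "T - insert r B = T - {r} - B" by auto
  moreover have "card (insert r B) \<le> cyc T"
   using c B(3) card_insert_le_m1[of "cyc T" B r] by simp
  ultimately show ?thesis using B r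
   by (intro exI[of _ "insert r B"]) auto
 qed
qed

lemma mem_span_incidence:
 assumes "finite S"
 shows "v \<in> fv.span (bd ` S) \<longleftrightarrow> (\<exists>x. v = (\<lambda>t. \<Sum>g\<in>S. x g * bd g t))"
 using assms
proof (induction S arbitrary: v rule: finite_induct)
 case empty
 then show ?case by auto
next
 case (insert s S)
 have "v \<in> fv.span (bd ` insert s S) \<longleftrightarrow>
  (\<exists>k. v - (\<lambda>t. k * bd s t) \<in> fv.span (bd ` S))"
  by (simp only: image_insert fv.span_insert mem_Collect_eq)
 also have "... \<longleftrightarrow> (\<exists>k x. v - (\<lambda>t. k * bd s t) = (\<lambda>t. \<Sum>g\<in>S. x g * bd g t))"
  by (simp only: insert.IH)
 also have "... \<longleftrightarrow> (\<exists>x. v = (\<lambda>t. \<Sum>g\<in>insert s S. x g * bd g t))"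
 proof safe
  fix k x assume "v - (\<lambda>t. k * bd s t) = (\<lambda>t. \<Sum>g\<in>S. x g * bd g t)"
  hence "v t = k * bd s t + (\<Sum>g\<in>S. x g * bd g t)" for t
   by (auto simp: algebra_simps)
  moreover have "(\<Sum>g\<in>S. (x(s:=k)) g * bd g t) = (\<Sum>g\<in>S. x g * bd g t)" for t
   using insert by (intro sum.cong) auto
  ultimately show "\<exists>x. v = (\<lambda>t. \<Sum>g\<in>insert s S. x g * bd g t)"
   using insert by (intro exI[of _ "x(s:=k)"]) (auto simp: fun_eq_iff)
 next
  fix x assume "v = (\<lambda>t. \<Sum>g\<in>insert s S. x g * bd g t)"
  thus "\<exists>k x'. (\<lambda>t. \<Sum>g\<in>insert s S. x g * bd g t) - (\<lambda>t. k * bd s t) = (\<lambda>t. \<Sum>g\<in>S. x' g * bd g t)"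
   using insert by (intro exI[of _ "x s"] exI[of _ x]) (auto simp: fun_eq_iff)
 qed
 finally show ?case .
qed

lemma sum_comb: "(\<Sum>q\<in>I. w q * (\<Sum>i<r. c i * b i q)) = (\<Sum>i<r. c i * (\<Sum>q\<in>I. w q * b i q))"
  for c :: "nat => real"
proof -
 have "(\<Sum>q\<in>I. w q * (\<Sum>i<r. c i * b i q)) = (\<Sum>q\<in>I. \<Sum>i<r. c i * (w q * b i q))"
  by (simp only: sum_distrib_left mult.left_commute)
 also have "... = (\<Sum>i<r. \<Sum>q\<in>I. c i * (w q * b i q))" by (rule sum.swap)
 finally show ?thesis by (simp only: sum_distrib_left)
qed

lemma comb_linear: "(\<Sum>i<r. (\<Sum>p\<in>I. (w0 p + k * v p) * b i p) * b i q)
  = (\<Sum>i<r. (\<Sum>p\<in>I. w0 p * b i p) * b i q) + k * (\<Sum>i<r. (\<Sum>p\<in>I. v p * b i p) * b i q)"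
  for k :: real and r :: nat
proof -
 have 1: "(\<Sum>p\<in>I. (w0 p + k * v p) * b i p) = (\<Sum>p\<in>I. w0 p * b i p) + k * (\<Sum>p\<in>I. v p * b i p)" for i
  by (simp only: distrib_right sum.distrib sum_distrib_left mult.assoc)
 have 2: "(a + k * b) * c = a * c + k * (b * c)" for a b c :: real
  by (simp add: distrib_right)
 show ?thesis by (simp only: 1 2 sum.distrib sum_distrib_left[symmetric])
qed

text \<open>Gram--Schmidt for the coordinates in \<open>I\<close>, by induction on \<open>S\<close>: a new boundary is orthogonalised against the
  family so far, and discarded if nothing remains on \<open>I\<close>.\<close>
lemma orthonormal_family:
 assumes "finite S" "finite I"
 shows "\<exists>r b. r \<le> rk S \<and> (\<forall>i<r. \<forall>j<r. (\<Sum>g\<in>I. b i g * b j g) = of_bool (i = j)) \<and>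
  (\<forall>v\<in>fv.span (bd ` S). \<forall>g\<in>I. v g = (\<Sum>i<r. (\<Sum>p\<in>I. v p * b i p) * b i g))"
 using assms(1)
proof (induction S rule: finite_induct)
 case empty
 show ?case by simp
next
 case (insert s S)
 obtain r b where r: "r \<le> rk S"
  and on: "\<And>i j. i < r ==> j < r ==> (\<Sum>g\<in>I. b i g * b j g) = of_bool (i = j)"
  and rep: "\<And>v g. v \<in> fv.span (bd ` S) ==> g \<in> I ==> v g = (\<Sum>i<r. (\<Sum>p\<in>I. v p * b i p) * b i g)"
  using insert.IH by blast
 define v where "v = bd s"
 define u where "u g = v g - (\<Sum>i<r. (\<Sum>p\<in>I. v p * b i p) * b i g)" for g
 have dec: "\<exists>k w0. w0 \<in> fv.span (bd ` S) \<and> w = (\<lambda>t. w0 t + k * v t)"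
  if w: "w \<in> fv.span (bd ` insert s S)" for w
 proof -
  obtain k where k: "w - (\<lambda>t. k * v t) \<in> fv.span (bd ` S)"
   using w unfolding image_insert fv.span_insert v_def by blast
  show ?thesis by (rule exI[of _ k], rule exI[of _ "w - (\<lambda>t. k * v t)"]) (use k in \<open>auto simp: fun_eq_iff\<close>)
 qed
 have uorth: "(\<Sum>g\<in>I. u g * b j g) = 0" if "j < r" for j
 proof -
  have "(\<Sum>g\<in>I. u g * b j g) = (\<Sum>g\<in>I. v g * b j g - b j g * (\<Sum>i<r. (\<Sum>p\<in>I. v p * b i p) * b i g))"
   unfolding u_def by (intro sum.cong refl) (simp add: algebra_simps)
  also have "... = (\<Sum>g\<in>I. v g * b j g) - (\<Sum>i<r. (\<Sum>p\<in>I. v p * b i p) * (\<Sum>g\<in>I. b j g * b i g))"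
   by (simp only: sum_subtractf sum_comb)
  also have "(\<Sum>i<r. (\<Sum>p\<in>I. v p * b i p) * (\<Sum>g\<in>I. b j g * b i g)) = (\<Sum>i<r. if i = j then (\<Sum>p\<in>I. v p * b i p) else 0)"
   using on that by simp
  finally show ?thesis using that by simp
 qed
 show ?case
 proof (cases "\<forall>g\<in>I. u g = 0")
  case True
  have vrep: "v g = (\<Sum>i<r. (\<Sum>p\<in>I. v p * b i p) * b i g)" if "g \<in> I" for g
   using True that by (simp add: u_def)
  have rep': "w g = (\<Sum>i<r. (\<Sum>p\<in>I. w p * b i p) * b i g)"
   if w: "w \<in> fv.span (bd ` insert s S)" and g: "g \<in> I" for w g
  proof -
   obtain k w0 where kw: "w0 \<in> fv.span (bd ` S)" "w = (\<lambda>t. w0 t + k * v t)"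
    using dec[OF w] by blast
   show ?thesis using rep[OF kw(1) g] vrep[OF g] unfolding kw(2) by (simp only: comb_linear)
  qed
  have rr: "r \<le> rk (insert s S)" using r insert by (simp add: rk_insert)
  show ?thesis
   by (rule exI[of _ r], rule exI[of _ b], intro conjI allI impI ballI)
   (erule (1) on rep' | rule rr)+
 next
  case False
  define q where "q = (\<Sum>g\<in>I. u g * u g)"
  have q0: "q > 0"
  proof -
   obtain g where "g \<in> I" "u g \<noteq> 0" using False by auto
   thus ?thesis unfolding q_def using assms(2)
    by (intro sum_pos2[of I g]) (auto simp: zero_less_mult_iff not_less order_less_le)
  qed
  define b' where "b' i = (if i = r then (\<lambda>g. u g / sqrt q) else b i)" for i
  have on': "(\<Sum>g\<in>I. b' i g * b' j g) = of_bool (i = j)" if "i < Suc r" "j < Suc r" for i j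
  proof -
   have 1: "(\<Sum>g\<in>I. u g / sqrt q * b j g) = 0" if "j < r" for j
    using uorth[OF that] by (simp add: sum_divide_distrib[symmetric])
   have 2: "(\<Sum>g\<in>I. b j g * (u g / sqrt q)) = 0" if "j < r" for j
    using 1[OF that] by (simp add: mult.commute)
   have 3: "(\<Sum>g\<in>I. u g / sqrt q * (u g / sqrt q)) = 1"
    using q0 by (simp add: sum_divide_distrib[symmetric] q_def[symmetric])
   show ?thesis using that on 1 2 3 by (cases "i = r"; cases "j = r") (auto simp: b'_def)
  qed
  have ns: "s \<notin> cl S"
  proof
   assume "s \<in> cl S"
   hence "v \<in> fv.span (bd ` S)" by (simp add: cl_def v_def)
   from rep[OF this] False show False by (auto simp: u_def)
  qed
  have uv: "(\<Sum>p\<in>I. v p * u p) = q"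
  proof -
   have "(\<Sum>p\<in>I. v p * u p) = (\<Sum>p\<in>I. u p * u p + u p * (\<Sum>i<r. (\<Sum>p\<in>I. v p * b i p) * b i p))"
    by (intro sum.cong refl) (simp add: u_def algebra_simps)
   also have "... = q + (\<Sum>i<r. (\<Sum>p\<in>I. v p * b i p) * (\<Sum>p\<in>I. u p * b i p))"
    by (simp only: sum.distrib q_def sum_comb)
   finally show ?thesis using uorth by simp
  qed
  have wu: "(\<Sum>p\<in>I. w0 p * u p) = 0" if "w0 \<in> fv.span (bd ` S)" for w0
  proof -
   have "(\<Sum>p\<in>I. w0 p * u p) = (\<Sum>p\<in>I. u p * (\<Sum>i<r. (\<Sum>p\<in>I. w0 p * b i p) * b i p))"
    using rep[OF that] by (intro sum.cong refl) (simp add: mult.commute)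
   also have "... = (\<Sum>i<r. (\<Sum>p\<in>I. w0 p * b i p) * (\<Sum>p\<in>I. u p * b i p))"
    by (rule sum_comb)
   finally show ?thesis using uorth by simp
  qed
  have rep': "w g = (\<Sum>i<Suc r. (\<Sum>p\<in>I. w p * b' i p) * b' i g)"
   if w: "w \<in> fv.span (bd ` insert s S)" and g: "g \<in> I" for w g
  proof -
   obtain k w0 where kw: "w0 \<in> fv.span (bd ` S)" "w = (\<lambda>t. w0 t + k * v t)"
    using dec[OF w] by blast
   have "(\<Sum>p\<in>I. w p * u p) = k * q"
    unfolding kw(2) using wu[OF kw(1)] uv
    by (simp only: distrib_right sum.distrib mult.assoc sum_distrib_left[symmetric])
   hence last: "(\<Sum>p\<in>I. w p * (u p / sqrt q)) * (u g / sqrt q) = k * u g"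
    using q0 by (simp add: sum_divide_distrib[symmetric])
   have "w g = (\<Sum>i<r. (\<Sum>p\<in>I. w0 p * b i p) * b i g) + k * ((\<Sum>i<r. (\<Sum>p\<in>I. v p * b i p) * b i g) + u g)"
    unfolding kw(2) using rep[OF kw(1) g] by (simp add: u_def)
   also have "... = (\<Sum>i<r. (\<Sum>p\<in>I. w p * b i p) * b i g) + k * u g"
    unfolding kw(2) by (simp only: comb_linear distrib_left)
   also have "... = (\<Sum>i<Suc r. (\<Sum>p\<in>I. w p * b' i p) * b' i g)"
    using last by (simp add: b'_def)
   finally show ?thesis .
  qed
  have rr: "Suc r \<le> rk (insert s S)" using r insert ns by (simp add: rk_insert)
  show ?thesis
   by (rule exI[of _ "Suc r"], rule exI[of _ b'], intro conjI allI impI ballI)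
   (erule (1) on' rep' | rule rr)+
 qed
qed

text \<open>The rank is at least the trace, on the coordinates \<open>I\<close>, of the projection onto the span of the boundaries.  The projection
  minimises the distance, so that each diagonal entry is at least one minus the squared error of any approximation
  of the unit vector.\<close>
lemma rk_ge_trace:
 assumes "finite S" "finite I" "\<And>t. t \<in> I ==> y t \<in> fv.span (bd ` S)"
 shows "(\<Sum>t\<in>I. 1 - (\<Sum>q\<in>I. (of_bool (q = t) - y t q)\<^sup>2)) \<le> real (rk S)"
proof -
 obtain r b where r: "r \<le> rk S"
  and on: "\<And>i j. i < r ==> j < r ==> (\<Sum>q\<in>I. b i q * b j q) = of_bool (i = j)"
  and rep: "\<And>v q. v \<in> fv.span (bd ` S) ==> q \<in> I ==> v q = (\<Sum>i<r. (\<Sum>p\<in>I. v p * b i p) * b i q)"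
  using orthonormal_family[OF assms(1,2)] by blast
 have "1 - (\<Sum>q\<in>I. (of_bool (q = t) - y t q)\<^sup>2) \<le> (\<Sum>i<r. (b i t)\<^sup>2)" if t: "t \<in> I" for t
 proof -
  let ?B = "(\<Sum>q\<in>I. (of_bool (q = t) - y t q)\<^sup>2)"
  let ?A = "(\<Sum>q\<in>I. (y t q)\<^sup>2)"
  define a where "a i = (\<Sum>p\<in>I. y t p * b i p)" for i
  have ye: "y t q = (\<Sum>i<r. a i * b i q)" if "q \<in> I" for q
   using rep[OF assms(3)[OF t] that] by (simp add: a_def)
  have "?A = (\<Sum>q\<in>I. y t q * (\<Sum>i<r. a i * b i q))"
   using ye by (intro sum.cong) (auto simp: power2_eq_square)
  also have "... = (\<Sum>i<r. a i * (\<Sum>q\<in>I. y t q * b i q))"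
   by (rule sum_comb)
  finally have ny: "?A = (\<Sum>i<r. (a i)\<^sup>2)"
   by (simp add: a_def power2_eq_square)
  have "?B
   = (\<Sum>q\<in>I. (if q = t then 1 - 2 * y t q else 0) + (y t q)\<^sup>2)"
   by (intro sum.cong) (auto simp: power2_eq_square algebra_simps)
  also have "... = 1 - 2 * y t t + ?A"
   using t assms(2) by (simp add: sum.distrib)
  finally have "1 - ?B = 2 * (\<Sum>i<r. a i * b i t) - (\<Sum>i<r. (a i)\<^sup>2)"
   using ny ye[OF t] by simp
  also have "... = (\<Sum>i<r. 2 * (a i * b i t) - (a i)\<^sup>2)"
   by (simp add: sum_subtractf sum_distrib_left)
  also have "... \<le> (\<Sum>i<r. (b i t)\<^sup>2)"
  proof (intro sum_mono)
   fix i
   have "0 \<le> (a i - b i t)\<^sup>2" by simp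
   thus "2 * (a i * b i t) - (a i)\<^sup>2 \<le> (b i t)\<^sup>2" by (simp add: power2_eq_square algebra_simps)
  qed
  finally show ?thesis .
 qed
 hence "(\<Sum>t\<in>I. 1 - (\<Sum>q\<in>I. (of_bool (q = t) - y t q)\<^sup>2)) \<le> (\<Sum>t\<in>I. \<Sum>i<r. (b i t)\<^sup>2)"
  by (rule sum_mono)
 also have "... = real r" using on by (subst sum.swap) (simp add: power2_eq_square)
 finally show ?thesis using r by simp
qed

section \<open>Trees and their exploration in a complex\<close>

text \<open>A node stands for a \<open>(d - 1)\<close>-face.  It carries one list for each \<open>d\<close>-face through it that is new at this stage, and this list has the
  trees of the other \<open>d\<close> facets.\<close>
datatype tr = Leaf | Nd "tr list list"

fun verts :: "tr => nat" where
 "verts Leaf = 0"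
| "verts (Nd ch) = length ch + (\<Sum>l\<leftarrow>ch. \<Sum>T\<leftarrow>l. verts T)"

fun nodes :: "tr => nat" where
 "nodes Leaf = 1"
| "nodes (Nd ch) = 1 + (\<Sum>l\<leftarrow>ch. \<Sum>T\<leftarrow>l. nodes T)"

text \<open>With the Poisson weights for \<open>q\<close>, the probability of the tree.\<close>
fun wt :: "(nat => real) => tr => real" where
 "wt q Leaf = 1"
| "wt q (Nd ch) = q (length ch) * (\<Prod>l\<leftarrow>ch. \<Prod>T\<leftarrow>l. wt q T)"

fun wft :: "nat => tr => bool" where
 "wft d Leaf = True"
| "wft d (Nd ch) = (\<forall>l\<in>set ch. length l = d \<and> (\<forall>T\<in>set l. wft d T))"

fun shape :: "nat => nat => tr => bool" where
 "shape d 0 T = (T = Leaf)"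
| "shape d (Suc k) T = (\<exists>ch. T = Nd ch \<and> (\<forall>l\<in>set ch. length l = d \<and> (\<forall>T\<in>set l. shape d k T)))"

lemma shape_wft: "shape d k T ==> wft d T"
 by (induction k arbitrary: T) auto

definition child_roots :: "nat set => nat set => nat set list" where
 "child_roots t S = concat (map (\<lambda>v. map (\<lambda>a. insert v (t - {a})) (sorted_list_of_set t)) (sorted_list_of_set S))"

definition children :: "nat set => nat set => tr list list => (nat set \<times> tr) list" where
 "children t S ch = zip (child_roots t S) (concat ch)"

lemma length_concat_const: "(\<And>l. l \<in> set ls ==> length l = d) ==> length (concat ls) = length ls * d"
 by (induction ls) auto

lemma length_child_roots: "length (child_roots t S) = card S * card t"
 unfolding child_roots_def by (subst length_concat_const[of _ "card t"]) auto

lemma set_child_roots: "finite t ==> finite S ==>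
  set (child_roots t S) = {insert v (t - {a}) | v a. v \<in> S \<and> a \<in> t}"
 by (auto simp: child_roots_def)

lemma child_root_inj:
 assumes "insert v (t - {a}) = insert v' (t - {a'})" "a \<in> t" "a' \<in> t" "v \<notin> t" "v' \<notin> t"
 shows "v = v'" "a = a'"
proof -
 show "v = v'" using assms by auto
 show "a = a'" using assms by auto
qed

lemma distinct_child_roots:
 assumes "finite t" "finite S" "t \<inter> S = {}"
 shows "distinct (child_roots t S)"
proof -
 have "distinct (concat (map (\<lambda>v. map (\<lambda>a. insert v (t - {a})) (sorted_list_of_set t)) vs))"
  if "distinct vs" "set vs \<subseteq> S" for vs
  using that
 proof (induction vs)
  case (Cons v vs)
  have v: "v \<notin> t" "v \<in> S" using Cons assms by auto
  have 1: "inj_on (\<lambda>a. insert v (t - {a})) t"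
   using v by (auto simp: inj_on_def dest!: child_root_inj(2))
  have 2: "insert v (t - {a}) \<noteq> insert v' (t - {a'})" if "v' \<in> set vs" "a \<in> t" "a' \<in> t" for v' a a'
  proof
   assume "insert v (t - {a}) = insert v' (t - {a'})"
   moreover have "v' \<notin> t" using that Cons.prems assms by auto
   ultimately have "v = v'" using v by blast
   thus False using Cons.prems that by auto
  qed
  show ?case using Cons 1 2 assms by (auto simp: distinct_map)
 qed auto
 thus ?thesis using assms by (simp add: child_roots_def)
qed

lemma map_children:
 assumes "card S = length ch" "\<forall>l\<in>set ch. length l = card t"
 shows "map fst (children t S ch) = child_roots t S" "map snd (children t S ch) = concat ch"
proof -
 show "map fst (children t S ch) = child_roots t S" "map snd (children t S ch) = concat ch" using assms by (auto simp: length_child_roots length_concat_const children_def)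
qed

lemma sum_list_concat_map: "(\<Sum>x\<leftarrow>concat ls. f x) = (\<Sum>l\<leftarrow>ls. \<Sum>x\<leftarrow>l. (f x :: 'b::comm_monoid_add))"
 by (induction ls) auto

lemma prod_list_concat_map: "(\<Prod>x\<leftarrow>concat ls. f x) = (\<Prod>l\<leftarrow>ls. \<Prod>x\<leftarrow>l. (f x :: 'b::comm_monoid_mult))"
 by (induction ls) auto

lemma zip_concat:
 assumes "length xs = length ys" "\<forall>(x, y)\<in>set (zip xs ys). length x = length y"
 shows "zip (concat xs) (concat ys) = concat (map2 zip xs ys)"
 using assms by (induction xs ys rule: list_induct2) auto

text \<open>\<open>children\<close> pairs facets and subtrees by position in a list.  This lemma hides the enumeration: the facet
  \<open>insert v (t - {a})\<close> has the subtree \<open>Tm v a\<close>.\<close>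
lemma children_assign:
 assumes "finite t" "finite S" "card S = length ch" "\<forall>l\<in>set ch. length l = card t"
 obtains Tm where "\<And>v a. v \<in> S ==> a \<in> t ==> (insert v (t - {a}), Tm v a) \<in> set (children t S ch)"
  and "\<And>(F :: real => real) g. (\<Sum>v\<in>S. F (\<Sum>a\<in>t. g (Tm v a))) = (\<Sum>l\<leftarrow>ch. F (\<Sum>T\<leftarrow>l. g T))"
  and "\<And>v. v \<in> S ==> \<exists>l\<in>set ch. set l = Tm v ` t"
proof -
 define vs where "vs = sorted_list_of_set S"
 define as where "as = sorted_list_of_set t"
 have vs: "distinct vs" "set vs = S" "length vs = length ch" using assms by (auto simp: vs_def)
 have as: "distinct as" "set as = t" "length as = card t" using assms by (auto simp: as_def)
 define L where "L v = the (map_of (zip vs ch) v)" for v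
 define Tm where "Tm v a = the (map_of (zip as (L v)) a)" for v a
 have L: "L (vs ! i) = ch ! i" if "i < length ch" for i
  using map_of_zip_nth[of vs ch i] vs that by (simp add: L_def)
 have Lin: "L v \<in> set ch" if "v \<in> S" for v
 proof -
  have "v \<in> set vs" using that vs by auto
  thus ?thesis unfolding in_set_conv_nth using vs(3) L by auto
 qed
 have Tm: "Tm v (as ! j) = L v ! j" if "j < card t" "v \<in> S" for v j
  using map_of_zip_nth[of as "L v" j] as that assms(4) Lin by (simp add: Tm_def)
 have chalt: "children t S ch = concat (map2 zip (map (\<lambda>v. map (\<lambda>a. insert v (t - {a})) as) vs) ch)"
  unfolding children_def child_roots_def vs_def[symmetric] as_def[symmetric]
  using vs as assms by (intro zip_concat) (auto dest!: set_zip_rightD simp: zip_map1)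
 have idx: "(insert (vs ! i) (t - {as ! j}), ch ! i ! j) \<in> set (children t S ch)"
  if "i < length ch" "j < card t" for i j
 proof -
  have l: "length (ch ! i) = card t" using assms that by auto
  have "(map (\<lambda>a. insert (vs ! i) (t - {a})) as, ch ! i) \<in> set (zip (map (\<lambda>v. map (\<lambda>a. insert v (t - {a})) as) vs) ch)"
   unfolding in_set_zip using that vs by force
  moreover have "(insert (vs ! i) (t - {as ! j}), ch ! i ! j) \<in> set (zip (map (\<lambda>a. insert (vs ! i) (t - {a})) as) (ch ! i))"
   using that as l by (force simp: in_set_zip)
  ultimately show ?thesis unfolding chalt by force
 qed
 have 1: "(insert v (t - {a}), Tm v a) \<in> set (children t S ch)" if "v \<in> S" "a \<in> t" for v a
 proof -
  have "v \<in> set vs" "a \<in> set as" using that vs as by auto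
  then obtain i j where i: "i < length ch" "v = vs ! i" and j: "j < card t" "a = as ! j"
   unfolding in_set_conv_nth using vs(3) as(3) by auto
  show ?thesis using idx[OF i(1) j(1)] Tm[OF j(1) that(1)] L[OF i(1)] i j by simp
 qed
 have row: "(\<Sum>a\<in>t. g (Tm v a)) = (\<Sum>T\<leftarrow>L v. g T)" if "v \<in> S" for v and g :: "tr => real"
 proof -
  have "(\<Sum>a\<in>t. g (Tm v a)) = (\<Sum>a\<leftarrow>as. g (Tm v a))"
   unfolding as(2)[symmetric] by (rule sum_list_distinct_conv_sum_set[OF as(1), symmetric])
  also have "map (\<lambda>a. g (Tm v a)) as = map g (L v)"
   using as Tm that assms(4) Lin by (intro nth_equalityI) auto
  finally show ?thesis .
 qed
 have 2: "(\<Sum>v\<in>S. F (\<Sum>a\<in>t. g (Tm v a))) = (\<Sum>l\<leftarrow>ch. F (\<Sum>T\<leftarrow>l. g T))" for F :: "real => real" and g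
 proof -
  have "(\<Sum>v\<in>S. F (\<Sum>a\<in>t. g (Tm v a))) = (\<Sum>v\<leftarrow>vs. F (\<Sum>T\<leftarrow>L v. g T))"
   unfolding sum_list_distinct_conv_sum_set[OF vs(1)] vs(2) using row by simp
  also have "map (\<lambda>v. F (\<Sum>T\<leftarrow>L v. g T)) vs = map (\<lambda>l. F (\<Sum>T\<leftarrow>l. g T)) ch"
   using vs L by (intro nth_equalityI) auto
  finally show ?thesis .
 qed
 have 3: "\<exists>l\<in>set ch. set l = Tm v ` t" if "v \<in> S" for v
 proof (intro bexI[of _ "L v"])
  have "L v = map (Tm v) as" using as Tm that assms(4) Lin by (intro nth_equalityI) auto
  thus "set (L v) = Tm v ` t" using as by simp
 qed (use Lin that in auto)
 show ?thesis using that[of Tm] 1 2 3 by blast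
qed

text \<open>\<open>ev n Y W P fs\<close>: exploring \<open>Y\<close> from the facets in the queue \<open>fs\<close> finds the attached trees.
  \<open>W\<close> is the set of vertices seen so far and \<open>P\<close> the set of faces found.  A step at \<open>t\<close> looks for the faces \<open>insert v t\<close> with new
  \<open>v\<close>.  The end condition, that \<open>W\<close> spans no face other than those found, says that the neighbourhood is really a tree.\<close>
inductive ev :: "nat => nat set set => nat set => nat set set => (nat set \<times> tr) list => bool"
 for n Y where
 ev_nil: "(\<And>r. r \<in> Y ==> r \<subseteq> W ==> r \<in> P) ==> ev n Y W P []"
| ev_leaf: "ev n Y W P fs ==> ev n Y W P ((t, Leaf) # fs)"
| ev_node: "S = {v. v < n \<and> v \<notin> W \<and> insert v t \<in> Y} ==> card S = length ch ==>
   ev n Y (W \<union> S) (P \<union> (\<lambda>v. insert v t) ` S) (children t S ch @ fs) ==>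
   ev n Y W P ((t, Nd ch) # fs)"

inductive_cases ev_leafE: "ev n Y W P ((t, Leaf) # fs)"

inductive_cases ev_nodeE: "ev n Y W P ((t, Nd ch) # fs)"

lemma card_child_root:
 assumes "finite t" "card t = d" "a \<in> t" "v \<notin> t"
 shows "card (insert v (t - {a})) = d"
 using assms by (metis Diff_iff card_Suc_Diff1 card_insert_disjoint finite_Diff)

lemma finite_all_faces [simp]: "finite (all_faces n d)"
 unfolding all_faces_def by simp

definition rooted :: "nat => nat => nat set => (nat set \<times> tr) list => bool" where
 "rooted n d W fs \<longleftrightarrow> W \<subseteq> {..<n} \<and> distinct (map fst fs) \<and> (\<forall>(t, T)\<in>set fs. t \<subseteq> W \<and> card t = d \<and> wft d T)"

lemma rooted_zip:
 assumes "W \<subseteq> {..<n}" "distinct ts" "length Ts = length ts" "\<forall>t\<in>set ts. t \<subseteq> W \<and> card t = d" "\<forall>T\<in>set Ts. shape d k T"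
 shows "rooted n d W (zip ts Ts)"
 unfolding rooted_def
proof (intro conjI, goal_cases)
 case 3
 show ?case
 proof clarify
  fix t T assume "(t, T) \<in> set (zip ts Ts)"
  from set_zip_leftD[OF this] set_zip_rightD[OF this] show "t \<subseteq> W \<and> card t = d \<and> wft d T"
   using assms shape_wft by blast
 qed
qed (use assms in auto)

lemma rooted_children:
 assumes r: "rooted n d W ((t, Nd ch) # fs)" and S: "S \<subseteq> {..<n} - W" "card S = length ch"
 shows "finite t" "finite S" "t \<inter> S = {}" "W \<inter> S = {}" "W \<union> S \<subseteq> {..<n}"
  "\<forall>l\<in>set ch. length l = card t" "rooted n d (W \<union> S) (children t S ch @ fs)"
  "map fst (children t S ch) = child_roots t S" "map snd (children t S ch) = concat ch"
proof -
 let ?A = "children t S ch"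
 have t: "t \<subseteq> W" "card t = d" and wf: "wft d (Nd ch)" and W: "W \<subseteq> {..<n}"
  and fs: "\<forall>(q, T)\<in>set fs. q \<subseteq> W \<and> card q = d \<and> wft d T" and dist: "distinct (map fst fs)"
  using r by (auto simp: rooted_def)
 show fin: "finite t" using t W finite_subset finite_lessThan by metis
 show finS: "finite S" using S(1) finite_subset by blast
 show tS: "t \<inter> S = {}" and WS: "W \<inter> S = {}" using S(1) t by auto
 show n: "W \<union> S \<subseteq> {..<n}" using W S(1) by auto
 show l: "\<forall>l\<in>set ch. length l = card t" using wf t by auto
 show mc: "map fst ?A = child_roots t S" "map snd ?A = concat ch"
  by (fact map_children[OF S(2) l])+
 have A: "q \<subseteq> W \<union> S \<and> card q = d \<and> wft d T" if "(q, T) \<in> set (children t S ch @ fs)" for q T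
 proof (cases "(q, T) \<in> set fs")
  case False
  hence "q \<in> set (map fst ?A)" "T \<in> set (map snd ?A)" using that by force+
  hence r: "q \<in> set (child_roots t S)" and T: "T \<in> set (concat ch)" unfolding mc by auto
  obtain v a where va: "q = insert v (t - {a})" "v \<in> S" "a \<in> t"
   using r set_child_roots[OF fin finS] by auto
  show ?thesis using va tS card_child_root[OF fin t(2) va(3)] t(1) T wf by auto
 qed (use fs in blast)
 have B: "distinct (map fst (children t S ch @ fs))" using fs set_child_roots[OF fin finS] WS distinct_child_roots[OF fin finS tS] dist mc by fastforce
 show "rooted n d (W \<union> S) (children t S ch @ fs)"
  unfolding rooted_def by (intro conjI n B) (clarify, rule A)
qed

text \<open>The exploration is deterministic, so different trees of the same depth describe disjoint events.\<close>
lemma ev_unique: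
 assumes "ev n Y W P fs" "ev n Y W P fs'" "map fst fs = map fst fs'"
  "list_all2 (\<lambda>T T'. \<exists>k. shape d k T \<and> shape d k T') (map snd fs) (map snd fs')"
  "rooted n d W fs"
 shows "fs = fs'"
 using assms
proof (induction arbitrary: fs' rule: ev.induct)
 case (ev_leaf W P fs t)
 have r: "rooted n d W fs" using ev_leaf.prems(4) by (simp add: rooted_def)
 obtain T' fs'' where f: "fs' = (t, T') # fs''"
  using ev_leaf.prems(2) by auto
 have "\<exists>k. shape d k Leaf \<and> shape d k T'" using ev_leaf.prems f by simp
 then obtain k where k: "shape d k Leaf" "shape d k T'" by blast
 have T': "T' = Leaf" using k by (cases k) auto
 show ?case using f T' ev_leaf.IH[of fs''] ev_leaf.prems(1-3) r by (auto elim: ev_leafE)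
next
 case (ev_node S W t ch P fs)
 obtain T' fs'' where f: "fs' = (t, T') # fs''"
  using ev_node.prems(2) by auto
 obtain k where k: "shape d k (Nd ch)" "shape d k T'" using ev_node.prems f by auto
 obtain k' where k': "k = Suc k'" using k by (cases k) auto
 obtain ch' where ch': "T' = Nd ch'" using k k' by auto
 have S: "S \<subseteq> {..<n} - W" using ev_node.hyps(1) by auto
 note ns = rooted_children[OF ev_node.prems(4) S ev_node.hyps(2)]
 have e': "card S = length ch'" "ev n Y (W \<union> S) (P \<union> (\<lambda>v. insert v t) ` S) (children t S ch' @ fs'')"
  using ev_node.prems(1) ev_node.hyps(1) unfolding f ch' by (auto elim!: ev_nodeE)
 have l: "\<forall>l\<in>set ch'. length l = card t" using ev_node.prems(4) k k' ch' by (simp add: rooted_def)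
 note mc = ns(8,9) map_children[OF e'(1) l]
 have lcc: "length (concat ch) = length (concat ch')"
  using l ns(6) ev_node.hyps(2) e' by (simp add: length_concat_const)
 have "list_all2 (\<lambda>T T'. \<exists>k. shape d k T \<and> shape d k T') (concat ch) (concat ch')"
  unfolding list_all2_conv_all_nth
 proof (intro conjI allI impI)
  fix i assume i: "i < length (concat ch)"
  have "concat ch ! i \<in> set (concat ch)" "concat ch' ! i \<in> set (concat ch')"
   using i lcc nth_mem by metis+
  thus "\<exists>k. shape d k (concat ch ! i) \<and> shape d k (concat ch' ! i)"
   using k k' ch' by auto
 qed (use lcc in auto)
 hence la: "list_all2 (\<lambda>T T'. \<exists>k. shape d k T \<and> shape d k T')
  (map snd (children t S ch @ fs)) (map snd (children t S ch' @ fs''))"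
  using ev_node.prems(3) f mc by (auto intro: list_all2_appendI)
 have "children t S ch @ fs = children t S ch' @ fs''"
  using ev_node.IH[OF e'(2) _ la ns(7)] mc ev_node.prems(2) f by auto
 moreover have "length (children t S ch) = length (children t S ch')"
  using mc by (metis length_map)
 ultimately have "children t S ch = children t S ch'" "fs = fs''" by auto
 hence "concat ch = concat ch'" using mc by metis
 hence "ch = ch'"
 proof (rule concat_injective)
  show "\<forall>(x, y)\<in>set (zip ch ch'). length x = length y"
   using l ns(6) by (metis (mono_tags, lifting) case_prodI2 set_zip_leftD set_zip_rightD)
 qed (use ev_node.hyps(2) e'(1) in auto)
 thus ?case using f ch' \<open>fs = fs''\<close> by simp
qed auto

lemma wt_nonneg: "(\<And>i. q i \<ge> 0) ==> wt q T \<ge> 0"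
 by (induction T rule: nodes.induct) (auto intro!: mult_nonneg_nonneg prod_list_nonneg)

text \<open>A product bound, by induction on the number of nodes.  \<open>B\<close> is the set of faces already found absent, and \<open>U\<close> the
  set of facets already processed; these make the tests of different steps disjoint.  A step at \<open>t\<close> chooses the set \<open>S\<close> of new vertices among
  at least \<open>n - K\<close>, requires the \<open>card S\<close> faces on them and forbids at most \<open>n\<close> others.  At the end all other faces spanned by
  the at most \<open>K\<close> vertices seen are forbidden.\<close>
lemma PR_ev_ge:
 fixes p :: real and n K d :: nat
 defines "q \<equiv> (\<lambda>m. real ((n - K) choose m) * p ^ m * (1 - p) ^ n)"
 assumes p: "0 \<le> p" "p \<le> 1"
 assumes "rooted n d W fs" "P \<subseteq> all_faces n d" "\<And>w. w \<in> P ==> w \<subseteq> W"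
  "B \<subseteq> all_faces n d" "P \<inter> B = {}"
  "\<And>w. w \<in> B ==> w \<subseteq> W \<or> w \<inter> W \<in> U"
  "\<And>t. t \<in> U ==> t \<subseteq> W \<and> card t = d"
  "fst ` set fs \<inter> U = {}"
  "card W + (\<Sum>T\<leftarrow>map snd fs. verts T) \<le> K" "K \<le> n"
 shows "PR (all_faces n d) p (\<lambda>Y. P \<subseteq> Y \<and> B \<inter> Y = {} \<and> ev n Y W P fs)
  \<ge> p ^ card P * (1 - p) ^ card B * ((\<Prod>T\<leftarrow>map snd fs. wt q T) * (1 - p) ^ (2 ^ K))"
 using assms(4-)
proof (induction "\<Sum>T\<leftarrow>map snd fs. nodes T" arbitrary: W P B U fs rule: less_induct)
 case less
 note prems = less.prems
 let ?F = "all_faces n d"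
 have W: "W \<subseteq> {..<n}" using prems(1) by (simp add: rooted_def)
 hence finW: "finite W" using finite_subset by blast
 show ?case
 proof (cases fs)
  case Nil
  define C where "C = {w \<in> ?F. w \<subseteq> W} - P"
  have cC: "card C \<le> 2 ^ K"
  proof -
   have "card C \<le> card (Pow W)" using finW by (intro card_mono) (auto simp: C_def)
   also have "... \<le> 2 ^ K" using finW prems(9) by (simp add: card_Pow)
   finally show ?thesis .
  qed
  have "p ^ card P * (1 - p) ^ card B * (1 - p) ^ (2 ^ K) \<le> p ^ card P * (1 - p) ^ card (B \<union> C)"
  proof -
   have "(1 - p) ^ (card B + 2 ^ K) \<le> (1 - p) ^ card (B \<union> C)"
    using p cC card_Un_le[of B C] by (intro power_decreasing) auto
   thus ?thesis using p by (simp add: power_add mult.assoc mult_left_mono)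
  qed
  also have "... = PR ?F p (\<lambda>Y. P \<subseteq> Y \<and> (B \<union> C) \<inter> Y = {})"
   using p prems by (intro PR_present_absent[symmetric]) (auto simp: C_def)
  also have "... \<le> PR ?F p (\<lambda>Y. P \<subseteq> Y \<and> B \<inter> Y = {} \<and> ev n Y W P fs)"
   unfolding Nil by (intro PR_mono) (auto simp: C_def intro!: ev_nil)
  finally show ?thesis using Nil by simp
 next
  case (Cons f fs')
  obtain t T where f: "f = (t, T)" by (cases f)
  have t: "t \<subseteq> W" "card t = d" "t \<notin> U" "wft d T" using prems(1,8) Cons f by (auto simp: rooted_def)
  have fint: "finite t" using t(1) finW finite_subset by blast
  show ?thesis
  proof (cases T)
   case Leaf
   have "p ^ card P * (1 - p) ^ card B * ((\<Prod>T\<leftarrow>map snd fs'. wt q T) * (1 - p) ^ (2 ^ K))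
    \<le> PR ?F p (\<lambda>Y. P \<subseteq> Y \<and> B \<inter> Y = {} \<and> ev n Y W P fs')"
   proof (rule less.hyps[where U = U])
    show "rooted n d W fs'" using prems(1) by (simp add: rooted_def Cons)
    show "card W + (\<Sum>T\<leftarrow>map snd fs'. verts T) \<le> K" using prems(9) by (simp add: Cons f)
   qed (use prems(2-8,10) in \<open>simp_all add: Cons f Leaf\<close>)
   also have "... \<le> PR ?F p (\<lambda>Y. P \<subseteq> Y \<and> B \<inter> Y = {} \<and> ev n Y W P fs)"
    unfolding Cons f Leaf by (intro PR_mono) (auto intro: ev_leaf)
   finally show ?thesis using Cons f Leaf by simp
  next
   case (Nd ch)
   define m where "m = length ch"
   \<comment> \<open>\<open>A S\<close>: the exploration succeeds with \<open>S\<close> as the set of new vertices at \<open>t\<close>.\<close>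
   define Q where "Q = {S. S \<subseteq> {..<n} - W \<and> card S = m}"
   define A where "A S = {Y. P \<union> (\<lambda>v. insert v t) ` S \<subseteq> Y \<and> (B \<union> (\<lambda>v. insert v t) ` ({..<n} - W - S)) \<inter> Y = {} \<and>
    ev n Y (W \<union> S) (P \<union> (\<lambda>v. insert v t) ` S) (children t S ch @ fs')}" for S
   have finQ: "finite Q" unfolding Q_def by simp
   have AS: "S = {v. v < n \<and> v \<notin> W \<and> insert v t \<in> Y}" if "Y \<in> A S" "S \<in> Q" for Y S
   proof -
    have S: "S \<subseteq> {..<n} - W" using that(2) by (simp add: Q_def)
    have 1: "insert v t \<in> Y" if "v \<in> S" for v using that \<open>Y \<in> A S\<close> unfolding A_def by blast
    have 2: "insert v t \<notin> Y" if "v < n" "v \<notin> W" "v \<notin> S" for v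
     using that \<open>Y \<in> A S\<close> unfolding A_def by blast
    show ?thesis using S 1 2 by blast
   qed
   have disj: "disjoint_family_on A Q"
    unfolding disjoint_family_on_def
   proof (intro ballI impI)
    fix S S' assume S: "S \<in> Q" "S' \<in> Q" "S \<noteq> S'"
    have False if "Y \<in> A S" "Y \<in> A S'" for Y
     using AS[OF that(1) S(1)] AS[OF that(2) S(2)] S(3) by simp
    thus "A S \<inter> A S' = {}" by blast
   qed
   define R where "R = (\<Prod>T\<leftarrow>concat ch @ map snd fs'. wt q T) * (1 - p) ^ (2 ^ K)"
   have q0: "q i \<ge> 0" for i using p by (simp add: q_def)
   have R0: "R \<ge> 0" using wt_nonneg q0 p unfolding R_def by (auto intro!: mult_nonneg_nonneg prod_list_nonneg)
   have each: "measure_pmf.prob (rs ?F p) (A S) \<ge> p ^ card P * (1 - p) ^ card B * (p ^ m * (1 - p) ^ n * R)"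
    if S: "S \<in> Q" for S
   proof -
    let ?D = "W \<union> S"
    let ?C = "children t S ch @ fs'"
    let ?A = "map snd ?C"
    have S': "S \<subseteq> {..<n}" "S \<inter> W = {}" "card S = m" "finite S" using S unfolding Q_def
     by (auto intro: finite_subset)
    let ?P = "P \<union> (\<lambda>v. insert v t) ` S" and ?B = "B \<union> (\<lambda>v. insert v t) ` ({..<n} - W - S)"
    have ins: "insert v t \<in> ?F" if "v < n" "v \<notin> W" for v
    proof -
     have "v \<notin> t" using that t(1) by auto
     thus ?thesis using that t fint W by (auto simp: all_faces_def)
    qed
    have inj: "inj_on (\<lambda>v. insert v t) (- W)" using t(1) by (auto simp: inj_on_def)
    have notP: "insert v t \<notin> P" if "v \<notin> W" for v using prems(3)[of "insert v t"] that by auto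
    have notB: "insert v t \<notin> B" if "v \<notin> W" for v
    proof
     assume "insert v t \<in> B"
     from prems(6)[OF this] that have "insert v t \<inter> W \<in> U" by auto
     moreover have "insert v t \<inter> W = t" using t(1) that by auto
     ultimately show False using t by auto
    qed
    have finP: "finite P" "finite B" using prems(2,4) finite_subset finite_all_faces by blast+
    have cP: "card ?P = card P + m"
    proof -
     have "card ?P = card P + card ((\<lambda>v. insert v t) ` S)"
      using notP S' finP by (intro card_Un_disjoint) auto
     also have "card ((\<lambda>v. insert v t) ` S) = card S"
      by (intro card_image inj_on_subset[OF inj]) (use S' in auto)
     finally show ?thesis using S' by simp
    qed
    have cB: "card ?B \<le> card B + n"
    proof -
     have "card ?B \<le> card B + card ((\<lambda>v. insert v t) ` ({..<n} - W - S))" by (rule card_Un_le)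
     also have "card ((\<lambda>v. insert v t) ` ({..<n} - W - S)) \<le> card ({..<n} - W - S)" by (rule card_image_le) auto
     also have "... \<le> card {..<n}" by (intro card_mono) auto
     finally show ?thesis by simp
    qed
    note rc = rooted_children[OF prems(1)[unfolded Cons f Nd], of S]
    have "S \<subseteq> {..<n} - W" "card S = length ch" using S by (auto simp: Q_def m_def)
    note rc = rc[OF this] and mc = rc(8,9)[OF this]
    have sm: "(\<Sum>T\<leftarrow>?A. g T) = (\<Sum>l\<leftarrow>ch. \<Sum>T\<leftarrow>l. g T) + (\<Sum>T\<leftarrow>map snd fs'. g T)"
     for g :: "tr => nat"
     by (simp only: map_append sum_list_append mc sum_list_concat_map)
    have "p ^ card ?P * (1 - p) ^ card ?B * ((\<Prod>T\<leftarrow>?A. wt q T) * (1 - p) ^ (2 ^ K))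
     \<le> PR ?F p (\<lambda>Y. ?P \<subseteq> Y \<and> ?B \<inter> Y = {} \<and> ev n Y ?D ?P ?C)"
    proof (rule less.hyps[where U = "insert t U"])
     show "(\<Sum>T\<leftarrow>?A. nodes T) < (\<Sum>T\<leftarrow>map snd fs. nodes T)"
      unfolding sm by (simp add: Cons f Nd)
     show "rooted n d ?D ?C" by (rule rc(7))
     show "?P \<subseteq> ?F" using prems(2) ins S' by auto
     show "?B \<subseteq> ?F" using prems(4) ins by auto
     show "?P \<inter> ?B = {}"
     proof -
      have "insert v t \<noteq> insert v' t" if "v \<in> S" "v' \<in> {..<n} - W - S" for v v'
       using that S' inj_onD[OF inj, of v v'] by auto
      thus ?thesis using prems(5) notP notB S' by (auto 0 3)
     qed
     show "w \<subseteq> W \<union> S" if "w \<in> ?P" for w using that prems(3) t(1) by auto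
     show "w \<subseteq> W \<union> S \<or> w \<inter> ?D \<in> insert t U" if w: "w \<in> ?B" for w
     proof (cases "w \<in> B")
      case True
      have cw: "card w = d + 1" "finite w" using True prems(4) by (auto simp: all_faces_def intro: finite_subset)
      show ?thesis
      proof (cases "w \<subseteq> W \<union> S")
       case False
       hence "w \<inter> W \<in> U" using prems(6)[OF True] by auto
       hence c: "card (w \<inter> W) = d" using prems(7) by auto
       have "w \<inter> ?D \<subset> w" using False by auto
       hence "card (w \<inter> ?D) < d + 1" using cw psubset_card_mono by metis
       hence "w \<inter> W = w \<inter> ?D" using c cw by (intro card_seteq) auto
       thus ?thesis using \<open>w \<inter> W \<in> U\<close> by auto
      qed auto
     next
      case False
      then obtain v where "w = insert v t" "v \<in> {..<n} - W - S" using w by auto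
      thus ?thesis using t(1) by auto
     qed
     show "t' \<subseteq> W \<union> S \<and> card t' = d" if "t' \<in> insert t U" for t'
      using that prems(7) t by auto
     have "\<not> w \<subseteq> W" if "w \<in> set (child_roots t S)" for w
      using that set_child_roots[OF fint S'(4)] S' by auto
     hence "set (child_roots t S) \<inter> insert t U = {}" using prems(7) t(1) by auto
     moreover have "fst ` set ?C = set (child_roots t S) \<union> fst ` set fs'"
      unfolding mc(1)[symmetric] by (simp add: image_Un)
     ultimately show "fst ` set ?C \<inter> insert t U = {}"
      using prems(1,8) by (auto simp: Cons f rooted_def)
     show "card ?D + (\<Sum>T\<leftarrow>?A. verts T) \<le> K"
      using prems(9) S' finW unfolding sm by (subst card_Un_disjoint) (auto simp: Cons f Nd m_def)
     show "K \<le> n" by fact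
    qed
    also have "... = measure_pmf.prob (rs ?F p) (A S)" by (simp add: A_def)
    finally have 1: "p ^ card ?P * (1 - p) ^ card ?B * R \<le> measure_pmf.prob (rs ?F p) (A S)"
     by (simp only: R_def map_append mc)
    have "p ^ card P * (1 - p) ^ card B * (p ^ m * (1 - p) ^ n * R) = p ^ card ?P * (1 - p) ^ (card B + n) * R"
     by (simp add: cP power_add)
    also have "... \<le> p ^ card ?P * (1 - p) ^ card ?B * R"
     using p cB R0 by (intro mult_right_mono mult_left_mono power_decreasing) auto
    finally show ?thesis using 1 by simp
   qed
   have cS: "card Q \<ge> (n - K) choose m"
   proof -
    have "card Q = card ({..<n} - W) choose m" unfolding Q_def by (intro n_subsets) auto
    also have "card ({..<n} - W) = n - card W" using W finW by (simp add: card_Diff_subset)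
    also have "(n - K) choose m \<le> (n - card W) choose m" using prems(9) by (intro binomial_right_mono) auto
    finally show ?thesis by simp
   qed
   have "p ^ card P * (1 - p) ^ card B * ((\<Prod>T\<leftarrow>map snd fs. wt q T) * (1 - p) ^ (2 ^ K))
    = real ((n - K) choose m) * (p ^ card P * (1 - p) ^ card B * (p ^ m * (1 - p) ^ n * R))"
    by (simp add: Cons f Nd R_def q_def m_def prod_list_concat_map)
   also have "... \<le> real (card Q) * (p ^ card P * (1 - p) ^ card B * (p ^ m * (1 - p) ^ n * R))"
    using cS p R0 by (intro mult_right_mono) auto
   also have "... \<le> (\<Sum>S\<in>Q. measure_pmf.prob (rs ?F p) (A S))"
    using each sum_bounded_below[of Q "p ^ card P * (1 - p) ^ card B * (p ^ m * (1 - p) ^ n * R)"] by simp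
   also have "... = measure_pmf.prob (rs ?F p) (\<Union>S\<in>Q. A S)"
    using finQ disj by (intro measure_pmf.finite_measure_finite_Union[symmetric]) auto
   also have "... \<le> PR ?F p (\<lambda>Y. P \<subseteq> Y \<and> B \<inter> Y = {} \<and> ev n Y W P fs)"
   proof (intro measure_pmf.finite_measure_mono subsetI)
    fix Y assume "Y \<in> (\<Union>S\<in>Q. A S)"
    then obtain S where S: "S \<in> Q" "Y \<in> A S" by blast
    have "ev n Y W P ((t, Nd ch) # fs')"
     by (rule ev_node[OF AS[OF S(2,1)]]) (use S in \<open>auto simp: Q_def A_def m_def\<close>)
    thus "Y \<in> {Y. P \<subseteq> Y \<and> B \<inter> Y = {} \<and> ev n Y W P fs}"
     using S by (auto simp: Cons f Nd A_def)
   qed auto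
   finally show ?thesis .
  qed
 qed
qed

section \<open>Cochains and residuals carried by trees\<close>

lemma incidence_facet:
 assumes "finite s" "v \<in> s"
 shows "bd s (s - {v}) = (- 1) ^ card {u \<in> s. u < v}"
proof -
 have "bd s (s - {v}) = (\<Sum>w\<in>s. if w = v then (- 1) ^ card {u \<in> s. u < v} else 0)"
  unfolding incidence_def by (intro sum.cong) auto
 thus ?thesis using assms by simp
qed

lemma incidence_facet_sq:
 assumes "finite s" "v \<in> s"
 shows "bd s (s - {v}) * bd s (s - {v}) = 1"
 unfolding incidence_facet[OF assms] by simp

lemma incidence_nonzeroD:
 assumes "bd s t \<noteq> 0"
 shows "\<exists>v\<in>s. t = s - {v}"
proof (rule ccontr)
 assume "\<not> ?thesis"
 thus False using assms unfolding incidence_def by simp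
qed

lemma incidence_expand:
 assumes "finite t" "v \<notin> t"
 shows "bd (insert v t) = (\<lambda>r. bd (insert v t) t * of_bool (r = t) +
  (\<Sum>a\<in>t. bd (insert v t) (insert v (t - {a})) * of_bool (r = insert v (t - {a}))))"
proof
 fix r
 let ?s = "insert v t"
 have ea: "?s - {a} = insert v (t - {a})" if "a \<in> t" for a using assms that by auto
 have "bd ?s r = (\<Sum>w\<in>?s. bd ?s (?s - {w}) * of_bool (r = ?s - {w}))"
  unfolding incidence_def[of ?s r] using assms
  by (intro sum.cong refl) (auto simp: incidence_facet)
 also have "... = bd ?s t * of_bool (r = t) + (\<Sum>w\<in>t. bd ?s (?s - {w}) * of_bool (r = ?s - {w}))"
  using assms by simp
 also have "(\<Sum>w\<in>t. bd ?s (?s - {w}) * of_bool (r = ?s - {w})) =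
  (\<Sum>a\<in>t. bd ?s (insert v (t - {a})) * of_bool (r = insert v (t - {a})))"
  using ea by simp
 finally show "bd ?s r = bd ?s t * of_bool (r = t) +
  (\<Sum>a\<in>t. bd ?s (insert v (t - {a})) * of_bool (r = insert v (t - {a})))" .
qed

definition ip :: "nat => (nat set => real) => (nat set => real) => real" where
 "ip n x y = (\<Sum>t\<in>Pow {..<n}. x t * y t)"

lemma ip_commute: "ip n x y = ip n y x"
 by (simp add: ip_def mult.commute)

lemma ip_unit: "t \<subseteq> {..<n} ==> ip n (\<lambda>r. of_bool (r = t)) y = y t"
 unfolding ip_def by simp

lemma ip_combine: "finite X ==> ip n (\<lambda>r. A * e r - (\<Sum>x\<in>X. c x * R x r)) y = A * ip n e y - (\<Sum>x\<in>X. c x * ip n (R x) y)"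
proof -
 let ?A = "(\<Sum>t\<in>Pow {..<n}. (\<Sum>x\<in>X. c x * (R x t * y t)))"
 have "ip n (\<lambda>r. A * e r - (\<Sum>x\<in>X. c x * R x r)) y
  = (\<Sum>t\<in>Pow {..<n}. A * (e t * y t) - (\<Sum>x\<in>X. c x * (R x t * y t)))"
  unfolding ip_def by (intro sum.cong refl) (simp add: left_diff_distrib sum_distrib_right mult.assoc)
 also have "... = A * ip n e y - ?A"
  by (simp add: sum_subtractf ip_def sum_distrib_left)
 also have "?A = (\<Sum>x\<in>X. \<Sum>t\<in>Pow {..<n}. c x * (R x t * y t))"
  by (rule sum.swap)
 also have "... = (\<Sum>x\<in>X. c x * ip n (R x) y)" by (simp add: ip_def sum_distrib_left)
 finally show ?thesis .
qed

lemma ip_orth_combine: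
 fixes c :: "_ => real" and A :: real
 assumes "finite X" "\<And>x. x \<in> X ==> ip n e (R x) = 0" "ip n e e = 1"
  "\<And>x x'. x \<in> X ==> x' \<in> X ==> x \<noteq> x' ==> ip n (R x) (R x') = 0"
 defines "r \<equiv> (\<lambda>q. A * e q - (\<Sum>x\<in>X. c x * R x q))"
 shows "ip n r r = A\<^sup>2 + (\<Sum>x\<in>X. (c x)\<^sup>2 * ip n (R x) (R x))"
proof -
 have er: "ip n e r = A"
  unfolding ip_commute[of n e r] unfolding r_def ip_combine[OF assms(1)]
  using assms(2,3) by (simp add: ip_commute[of n "R _" e])
 have Rr: "ip n (R x) r = - c x * ip n (R x) (R x)" if x: "x \<in> X" for x
 proof -
  have "ip n (R x) r = A * ip n e (R x) - (\<Sum>x'\<in>X. c x' * ip n (R x') (R x))"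
   unfolding ip_commute[of n "R x" r] unfolding r_def by (rule ip_combine[OF assms(1)])
  also have "(\<Sum>x'\<in>X. c x' * ip n (R x') (R x)) = (\<Sum>x'\<in>X. if x' = x then c x * ip n (R x) (R x) else 0)"
   using assms(4) x by (intro sum.cong) auto
  finally show ?thesis using assms(1,2) x by simp
 qed
 have "ip n r r = A * ip n e r - (\<Sum>x\<in>X. c x * ip n (R x) r)"
  by (subst (1) r_def) (rule ip_combine[OF assms(1)])
 also have "(\<Sum>x\<in>X. c x * ip n (R x) r) = (\<Sum>x\<in>X. - ((c x)\<^sup>2 * ip n (R x) (R x)))"
  using Rr by (intro sum.cong) (auto simp: power2_eq_square)
 finally show ?thesis using er by (simp add: power2_eq_square sum_negf)
qed

text \<open>Written with \<open>s\<close> for the sum of the weights of the facets of one child face, \<open>1 / z = 1 + (\<Sum> 1 / s)\<close>: the rule for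
  resistances in parallel and in series.  It bounds the squared distance of the unit vector of the root from the boundaries (\<open>ev_z\<close>).\<close>
fun z :: "tr => real" where
 "z Leaf = 1"
| "z (Nd ch) = 1 / (1 + (\<Sum>l\<leftarrow>ch. 1 / (\<Sum>T\<leftarrow>l. z T)))"

text \<open>The root becomes free of \<open>d\<close>-faces by elementary collapses: each face through it can be collapsed through
  some other facet.\<close>
fun coll :: "tr => bool" where
 "coll Leaf = False"
| "coll (Nd ch) = (\<forall>l\<in>set ch. \<exists>T\<in>set l. coll T)"

lemma z_pos: "z T > 0"
proof (induction T rule: nodes.induct)
 case (2 ch)
 have "(\<Sum>l\<leftarrow>ch. 1 / (\<Sum>T\<leftarrow>l. z T)) \<ge> 0"
 proof (intro sum_list_nonneg)
  fix x assume "x \<in> set (map (\<lambda>l. 1 / (\<Sum>T\<leftarrow>l. z T)) ch)"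
  then obtain l where l: "l \<in> set ch" "x = 1 / (\<Sum>T\<leftarrow>l. z T)" by auto
  have "(\<Sum>T\<leftarrow>l. z T) \<ge> 0" using 2[OF l(1)] by (intro sum_list_nonneg) (auto intro: less_imp_le)
  thus "x \<ge> 0" using l by simp
 qed
 thus ?case by simp
qed auto

lemma z_le_1: "z T \<le> 1"
proof (cases T)
 case (Nd ch)
 have "(\<Sum>l\<leftarrow>ch. 1 / (\<Sum>T\<leftarrow>l. z T)) \<ge> 0"
 proof (intro sum_list_nonneg)
  fix x assume "x \<in> set (map (\<lambda>l. 1 / (\<Sum>T\<leftarrow>l. z T)) ch)"
  then obtain l where l: "l \<in> set ch" "x = 1 / (\<Sum>T\<leftarrow>l. z T)" by auto
  have "(\<Sum>T\<leftarrow>l. z T) \<ge> 0" using z_pos by (intro sum_list_nonneg) (auto intro: less_imp_le)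
  thus "x \<ge> 0" using l by simp
 qed
 thus ?thesis using Nd by simp
qed auto

text \<open>A boundary meets the support of \<open>y\<close> only in \<open>t\<close>.\<close>
lemma ip_local:
 assumes "r \<subseteq> {..<n}" "t \<subseteq> {..<n}" "\<And>p. p \<subseteq> r ==> p \<noteq> t ==> y p = 0"
 shows "ip n y (bd r) = y t * bd r t"
proof -
 have "ip n y (bd r) = y t * bd r t + (\<Sum>p\<in>Pow {..<n} - {t}. y p * bd r p)"
  unfolding ip_def using assms(2) by (subst sum.remove[of _ t]) auto
 also have "(\<Sum>p\<in>Pow {..<n} - {t}. y p * bd r p) = 0"
 proof (intro sum.neutral ballI)
  fix p assume "p \<in> Pow {..<n} - {t}"
  thus "y p * bd r p = 0"
   using assms(3)[of p] incidence_nonzeroD[of r p] by auto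
 qed
 finally show ?thesis by simp
qed

definition cocycle :: "nat => nat set set => nat set => nat set set => nat set => (nat set => real) => bool" where
 "cocycle n Y W P t y \<longleftrightarrow> y t = 1 \<and> (\<forall>q\<subseteq>W. q \<noteq> t --> y q = 0) \<and> (\<forall>q\<in>Y - P. ip n y (bd q) = 0)"

text \<open>At a node, every child face has a facet that collapses and hence carries a cochain by induction.  Subtracting suitable
  multiples of these from the unit cochain of the node makes it orthogonal to the boundaries of the child faces.  Child
  facets are not contained in \<open>W\<close>, which keeps the values there.\<close>
lemma ev_coll:
 assumes "ev n Y W P fs" "Y \<subseteq> all_faces n d" "rooted n d W fs"
 shows "(\<forall>q\<in>Y. q \<subseteq> W --> q \<in> P) \<and> (\<forall>(t, T)\<in>set fs. coll T --> (\<exists>y. cocycle n Y W P t y))"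
 using assms
proof (induction rule: ev.induct)
 case (ev_leaf W P fs t)
 thus ?case by (simp add: rooted_def)
next
 case (ev_node S W t ch P fs)
 have t: "t \<subseteq> W" "card t = d" and fs: "\<forall>(q, T)\<in>set fs. q \<subseteq> W" "t \<notin> fst ` set fs"
  using ev_node.prems(2) by (auto simp: rooted_def)
 have S: "S \<subseteq> {..<n} - W" using ev_node.hyps(1) by auto
 note ns = rooted_children[OF ev_node.prems(2) S ev_node.hyps(2)]
 let ?P = "P \<union> (\<lambda>v. insert v t) ` S"
 have IH: "\<And>q. q \<in> Y ==> q \<subseteq> W \<union> S ==> q \<in> ?P"
  "\<And>t' T. (t', T) \<in> set (children t S ch @ fs) ==> coll T ==> (\<exists>y. cocycle n Y (W \<union> S) ?P t' y)"
  using ev_node.IH[OF ev_node.prems(1) ns(7)] by blast+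
 have 1: "q \<in> P" if "q \<in> Y" "q \<subseteq> W" for q
  using IH(1)[of q] that ns(4) by auto
 have finY: "\<And>q. q \<in> Y ==> finite q \<and> q \<subseteq> {..<n}"
  using ev_node.prems(1) by (auto simp: all_faces_def intro: finite_subset)
 have sub: "insert v t \<subseteq> W \<union> S" if "v \<in> S" for v using that t by auto
 have 2: "\<exists>y. cocycle n Y W P t' y" if T: "(t', T) \<in> set fs" "coll T" for t' T
 proof -
  obtain y where y: "y t' = 1" "\<And>q. q \<subseteq> W \<union> S ==> q \<noteq> t' ==> y q = 0"
   "\<And>q. q \<in> Y - ?P ==> ip n y (bd q) = 0"
   using IH(2)[of t' T] T by (auto simp: cocycle_def)
  have "t' \<noteq> t" using fs(2) T(1) by force
  hence t': "t' \<subseteq> W" "t' \<noteq> t" using fs(1) T(1) by auto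
  have "ip n y (bd (insert v t)) = 0" if v: "v \<in> S" for v
  proof -
   have "ip n y (bd (insert v t)) = y t' * bd (insert v t) t'"
    using sub[OF v] ns(5) y(2) t'(1) by (intro ip_local) auto
   also have "bd (insert v t) t' = 0"
    using incidence_nonzeroD v ns(4) ns(3) t' by blast
   finally show ?thesis by simp
  qed
  thus ?thesis using y by (intro exI[of _ y]) (auto simp: cocycle_def)
 qed
 have 3: "\<exists>y. cocycle n Y W P t y" if c: "coll (Nd ch)"
 proof -
  obtain Tm where Tm: "\<And>v a. v \<in> S ==> a \<in> t ==> (insert v (t - {a}), Tm v a) \<in> set (children t S ch)"
   and Tm2: "\<And>v. v \<in> S ==> \<exists>l\<in>set ch. set l = Tm v ` t"
   using children_assign[OF ns(1,2) ev_node.hyps(2) ns(6)] by metis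
  have "\<exists>a\<in>t. coll (Tm v a)" if v: "v \<in> S" for v
   using Tm2[OF v] c by fastforce
  then obtain a where a: "\<And>v. v \<in> S ==> a v \<in> t" "\<And>v. v \<in> S ==> coll (Tm v (a v))" by metis
  define r where "r v = insert v (t - {a v})" for v
  have "\<exists>y. cocycle n Y (W \<union> S) ?P (r v) y" if "v \<in> S" for v
   using IH(2)[of "r v" "Tm v (a v)"] Tm[OF that a(1)[OF that]] a(2)[OF that] by (simp add: r_def)
  then obtain yy where "\<And>v. v \<in> S ==> cocycle n Y (W \<union> S) ?P (r v) (yy v)" by metis
  hence yy: "yy v (r v) = 1" "q \<subseteq> W \<union> S ==> q \<noteq> r v ==> yy v q = 0"
   "q \<in> Y - ?P ==> ip n (yy v) (bd q) = 0" if "v \<in> S" for v q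
   using that unfolding cocycle_def by blast+
  \<comment> \<open>Cancels the coefficient of \<open>t\<close> in the boundary of \<open>insert v t\<close>.\<close>
  define cf where "cf v = bd (insert v t) t * bd (insert v t) (r v)" for v
  define y where "y = (\<lambda>q. 1 * of_bool (q = t) - (\<Sum>v\<in>S. cf v * yy v q))"
  have tV: "t \<subseteq> {..<n}" using t ns(5) by auto
  have ipy: "ip n y (bd q) = bd q t - (\<Sum>v\<in>S. cf v * ip n (yy v) (bd q))" for q
   unfolding y_def ip_combine[OF ns(2)] using ip_unit[OF tV] by simp
  have rW: "\<not> r v \<subseteq> W" "r v \<subseteq> W \<union> S" if "v \<in> S" for v
   using that ns(4) t(1) by (auto simp: r_def)
  have yW: "y q = of_bool (q = t)" if "q \<subseteq> W" for q
  proof -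
   have "(\<Sum>v\<in>S. cf v * yy v q) = 0"
    using yy(2)[of _ q] rW(1) that by (intro sum.neutral ballI) (metis le_supI1 mult_zero_right)
   thus ?thesis by (simp add: y_def)
  qed
  have "ip n y (bd q) = 0" if q: "q \<in> Y - P" for q
  proof (cases "q \<in> (\<lambda>v. insert v t) ` S")
   case True
   then obtain v where v: "v \<in> S" "q = insert v t" by auto
   have rv: "r v = insert v t - {a v}" using v(1) ns(3) a(1)[OF v(1)] by (auto simp: r_def)
   have ipv: "ip n (yy v') (bd q) = bd q (r v')" if "v' \<in> S" for v'
   proof -
    have "ip n (yy v') (bd q) = yy v' (r v') * bd q (r v')"
     using sub[OF v(1)] v(2) ns(5) rW(2)[OF that] yy(2)[OF that] by (intro ip_local) auto
    thus ?thesis using yy(1) that by simp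
   qed
   have "bd q (r v') = 0" if "v' \<in> S" "v' \<noteq> v" for v'
   proof (rule ccontr)
    assume "bd q (r v') \<noteq> 0"
    thus False using incidence_nonzeroD that ns(3) v(2) by (auto simp: r_def)
   qed
   hence "(\<Sum>v'\<in>S. cf v' * ip n (yy v') (bd q)) = (\<Sum>v'\<in>S. if v' = v then cf v * bd q (r v) else 0)"
    using ipv by (intro sum.cong) auto
   also have "... = bd q t * (bd q (r v) * bd q (r v))"
    using v ns(2) by (simp add: cf_def)
   also have "bd q (r v) * bd q (r v) = 1"
    unfolding rv v(2) using ns(1) a v by (intro incidence_facet_sq) auto
   finally show ?thesis unfolding ipy by simp
  next
   case False
   have "bd q t = 0"
   proof (rule ccontr)
    assume "bd q t \<noteq> 0"
    then obtain w where w: "w \<in> q" "t = q - {w}" using incidence_nonzeroD by blast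
    hence r: "q = insert w t" by auto
    show False
    proof (cases "w \<in> W")
     case True thus False using 1[of q] q r t(1) by auto
    next
     case w': False
     have "w < n" using finY[of q] q w by auto
     thus False using w' r q ev_node.hyps(1) False by auto
    qed
   qed
   thus ?thesis unfolding ipy using yy(3)[of _ q] q False by simp
  qed
  thus ?thesis using yW t(1) by (intro exI[of _ y]) (auto simp: cocycle_def)
 qed
 show ?case using 1 2 3 by auto
qed auto

text \<open>\<open>R\<close> is the error in approximating the unit vector of a facet by boundaries.\<close>
definition residual :: "nat => nat set set => nat set => nat set \<times> tr => (nat set => real) => bool" where
 "residual n Y W f R \<longleftrightarrow> (\<lambda>y. of_bool (y = fst f)) - R \<in> fv.span (bd ` Y) \<and>
   (\<forall>y\<subseteq>W. y \<noteq> fst f --> R y = 0) \<and> ip n R R \<le> z (snd f)"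

definition residuals :: "nat => nat set set => nat set => (nat set \<times> tr) list => (nat set => nat set => real) => bool" where
 "residuals n Y W fs R \<longleftrightarrow> (\<forall>f\<in>set fs. residual n Y W f (R (fst f))) \<and>
   pairwise (\<lambda>w w'. ip n (R w) (R w') = 0) (fst ` set fs)"

lemma residuals_Cons:
 assumes "residuals n Y W fs R" "residual n Y W (w, T) q" "w \<notin> fst ` set fs"
  "\<And>w'. w' \<in> fst ` set fs ==> ip n q (R w') = 0"
 shows "residuals n Y W ((w, T) # fs) (R(w := q))"
proof -
 have "(R(w := q)) w' = R w'" if "w' \<in> fst ` set fs" for w' using that assms(3) by auto
 thus ?thesis
  using assms by (auto simp: residuals_def ip_commute[of n _ q] pairwise_def)
qed

text \<open>At a node \<open>w\<close>, the boundary of a child face expresses the unit vector of \<open>w\<close>, up to sign, by those of the child facets.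
  These may be replaced by their residuals.  The best convex combination of \<open>w\<close> itself and the child faces has
  weights inversely proportional to the norms, and as the residuals are orthogonal its squared norm is \<open>z\<close>.\<close>
lemma ev_z:
 assumes "ev n Y W P fs" "Y \<subseteq> all_faces n d" "rooted n d W fs" "d \<ge> 1"
 shows "\<exists>R. residuals n Y W fs R"
 using assms
proof (induction rule: ev.induct)
 case (ev_nil W P)
 show ?case by (simp add: residuals_def)
next
 case (ev_leaf W P fs w)
 have w: "w \<subseteq> W" "w \<subseteq> {..<n}" and nin: "w \<notin> fst ` set fs" and fs: "rooted n d W fs"
  using ev_leaf.prems(2) by (auto simp: rooted_def)
 obtain R where R: "residuals n Y W fs R" using ev_leaf.IH ev_leaf.prems fs by blast
 have "R w' w = 0" if w': "w' \<in> fst ` set fs" for w'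
 proof -
  obtain f where f: "f \<in> set fs" "w' = fst f" using w' by blast
  have "residual n Y W f (R (fst f))" "w \<noteq> fst f" using R nin f by (auto simp: residuals_def)
  thus ?thesis using w(1) f by (simp add: residual_def)
 qed
 moreover have "(\<lambda>y. of_bool (y = w)) - (\<lambda>y. of_bool (y = w)) = (0 :: nat set => real)" by simp
 hence "residual n Y W (w, Leaf) (\<lambda>y. of_bool (y = w))"
  using fv.span_zero ip_unit[OF w(2)] unfolding residual_def by simp
 ultimately show ?case using residuals_Cons[OF R _ nin] ip_unit[OF w(2)] by metis
next
 case (ev_node S W w ch P fs)
 have S: "S \<subseteq> {..<n} - W" using ev_node.hyps(1) by auto
 note ns = rooted_children[OF ev_node.prems(2) S ev_node.hyps(2)]
 let ?sp = "fv.span (bd ` Y)"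
 let ?u = "\<lambda>w y. of_bool (y = w) :: real"
 let ?C = "children w S ch @ fs"
 have w: "w \<subseteq> W" "card w = d" and wV: "w \<subseteq> {..<n}" and nin: "w \<notin> fst ` set fs"
  and fW: "\<And>f. f \<in> set fs ==> fst f \<subseteq> W"
  using ev_node.prems(2) by (auto simp: rooted_def case_prod_unfold)
 obtain R where R0: "residuals n Y (W \<union> S) ?C R"
  using ev_node.IH[OF ev_node.prems(1) ns(7) ev_node.prems(3)] by blast
 have R: "?u (fst f) - R (fst f) \<in> ?sp" "y \<subseteq> W \<union> S ==> y \<noteq> fst f ==> R (fst f) y = 0"
  "ip n (R (fst f)) (R (fst f)) \<le> z (snd f)" if "f \<in> set ?C" for f y
  using R0 that by (auto simp: residuals_def residual_def)
 have R4: "ip n (R w1) (R w2) = 0" if "w1 \<in> fst ` set ?C" "w2 \<in> fst ` set ?C" "w1 \<noteq> w2" for w1 w2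
  using R0 that unfolding residuals_def pairwise_def by blast
 obtain Tm where Tm: "\<And>v a. v \<in> S ==> a \<in> w ==> (insert v (w - {a}), Tm v a) \<in> set (children w S ch)"
  and Tsum: "\<And>(F :: real => real) g. (\<Sum>v\<in>S. F (\<Sum>a\<in>w. g (Tm v a))) = (\<Sum>l\<leftarrow>ch. F (\<Sum>T\<leftarrow>l. g T))"
  using children_assign[OF ns(1,2) ev_node.hyps(2) ns(6)] by metis
 define b where "b v = (\<Sum>a\<in>w. z (Tm v a))" for v
 define Z where "Z = z (Nd ch)"
 \<comment> \<open>The weight of the child face at \<open>v\<close> in the combination of minimal norm; \<open>A = Z\<close> is that of \<open>w\<close>.\<close>
 define c where "c v = Z / b v" for v
 have bpos: "b v > 0" for v unfolding b_def using w(2) ev_node.prems(3) ns(1) z_pos by (intro sum_pos) auto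
 have Zeq: "Z = 1 / (1 + (\<Sum>v\<in>S. 1 / b v))"
  using Tsum[of "\<lambda>x. 1 / x" z] by (simp add: Z_def b_def)
 have Sb: "(\<Sum>v\<in>S. 1 / b v) \<ge> 0" using bpos by (intro sum_nonneg) (auto intro: less_imp_le)
 define r where "r = (\<lambda>(v, a). insert v (w - {a}))"
 define cf where "cf = (\<lambda>(v, a). c v * (bd (insert v w) w * bd (insert v w) (insert v (w - {a}))))"
 define X where "X = S \<times> w"
 define A where "A = 1 - (\<Sum>v\<in>S. c v)"
 define q where "q = (\<lambda>y. A * ?u w y - (\<Sum>x\<in>X. cf x * R (r x) y))"
 have X: "finite X" using ns by (auto simp: X_def)
 have rch: "(r x, Tm (fst x) (snd x)) \<in> set ?C" if "x \<in> X" for x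
  using that Tm by (auto simp: X_def r_def)
 have rfst: "r x \<in> fst ` set ?C" if "x \<in> X" for x using rch[OF that] by force
 have rinj: "r x \<noteq> r x'" if "x \<in> X" "x' \<in> X" "x \<noteq> x'" for x x'
  using that child_root_inj[of "fst x" w "snd x" "fst x'" "snd x'"] ns(3)
  by (cases x; cases x') (auto simp: X_def r_def)
 have rW: "\<not> r x \<subseteq> W" if "x \<in> X" for x
  using that ns(4) by (auto simp: X_def r_def)
 have RW: "R (r x) y = 0" if "x \<in> X" "y \<subseteq> W" for x y
  using R(2)[OF rch[OF that(1)], of y] rW[OF that(1)] that(2) by auto
 have q1: "?u w - q \<in> ?sp"
 proof -
  have "?u w - q = (\<Sum>v\<in>S. (\<lambda>y. (c v * bd (insert v w) w) * bd (insert v w) y))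
   - (\<Sum>x\<in>X. (\<lambda>y. cf x * (?u (r x) - R (r x)) y))" (is "_ = ?rhs")
  proof
   fix y
   have "(\<Sum>v\<in>S. c v * bd (insert v w) w * bd (insert v w) y)
    = (\<Sum>v\<in>S. c v * ?u w y + (\<Sum>a\<in>w. cf (v, a) * ?u (r (v, a)) y))"
   proof (intro sum.cong refl)
    fix v assume v: "v \<in> S"
    hence vw: "v \<notin> w" "insert v w - {v} = w" using ns(3) by auto
    let ?i = "bd (insert v w)"
    have sq: "?i w * ?i w = 1"
     using incidence_facet_sq[of "insert v w" v] ns(1) unfolding vw by simp
    have "?i y = ?i w * ?u w y + (\<Sum>a\<in>w. ?i (insert v (w - {a})) * ?u (insert v (w - {a})) y)"
     using incidence_expand[OF ns(1) vw(1)] by (rule fun_cong)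
    hence "c v * ?i w * ?i y = c v * (?i w * ?i w) * ?u w y + (\<Sum>a\<in>w. c v * ?i w * (?i (insert v (w - {a})) * ?u (insert v (w - {a})) y))"
     by (simp only: distrib_left sum_distrib_left)
    thus "c v * ?i w * ?i y = c v * ?u w y + (\<Sum>a\<in>w. cf (v, a) * ?u (r (v, a)) y)"
     unfolding sq by (simp add: cf_def r_def mult.assoc)
   qed
   also have "... = (\<Sum>v\<in>S. c v) * ?u w y + (\<Sum>x\<in>X. cf x * ?u (r x) y)"
    unfolding X_def sum.distrib sum.cartesian_product
    by simp
   finally show "(?u w - q) y = ?rhs y"
    unfolding minus_apply sum_fun_apply q_def A_def
    by (simp only: right_diff_distrib left_diff_distrib sum_subtractf)
  qed
  moreover have "(\<lambda>y. (c v * bd (insert v w) w) * bd (insert v w) y) \<in> ?sp" if "v \<in> S" for v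
   using ev_node.hyps(1) that by (intro fv.span_scale fv.span_base) auto
  moreover have "(\<lambda>y. cf x * (?u (r x) - R (r x)) y) \<in> ?sp" if x: "x \<in> X" for x
   by (rule fv.span_scale[OF R(1)[OF rch[OF x], unfolded fst_conv]])
  ultimately show ?thesis by (simp only: fv.span_diff fv.span_sum)
 qed
 have ue: "ip n (?u w) (R (r x)) = 0" if "x \<in> X" for x
  using ip_unit[OF wV] RW[OF that w(1)] by simp
 have q3: "ip n q q \<le> Z"
 proof -
  have "ip n q q = A\<^sup>2 + (\<Sum>x\<in>X. (cf x)\<^sup>2 * ip n (R (r x)) (R (r x)))"
   unfolding q_def using X ue ip_unit[OF wV] R4 rfst rinj
   by (intro ip_orth_combine[of X n "?u w" "\<lambda>x. R (r x)"]) auto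
  also have "(\<Sum>x\<in>X. (cf x)\<^sup>2 * ip n (R (r x)) (R (r x))) \<le> (\<Sum>x\<in>X. (c (fst x))\<^sup>2 * z (Tm (fst x) (snd x)))"
  proof (intro sum_mono mult_mono)
   fix x assume x: "x \<in> X"
   obtain v a where va: "x = (v, a)" "v \<in> S" "a \<in> w" using x by (auto simp: X_def)
   have e: "insert v w - {v} = w" "insert v w - {a} = insert v (w - {a})" using ns(3) va by auto
   have "(cf x)\<^sup>2 = (c v)\<^sup>2 * ((bd (insert v w) w * bd (insert v w) w) *
    (bd (insert v w) (insert v (w - {a})) * bd (insert v w) (insert v (w - {a}))))"
    by (simp add: va cf_def power2_eq_square)
   thus "(cf x)\<^sup>2 \<le> (c (fst x))\<^sup>2"
    using incidence_facet_sq[of "insert v w" v] incidence_facet_sq[of "insert v w" a] ns(1) va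
    unfolding e by simp
   show "ip n (R (r x)) (R (r x)) \<le> z (Tm (fst x) (snd x))" using R(3)[OF rch[OF x]] by simp
  qed (auto simp: ip_def intro: sum_nonneg)
  also have "(\<Sum>x\<in>X. (c (fst x))\<^sup>2 * z (Tm (fst x) (snd x))) = (\<Sum>v\<in>S. (c v)\<^sup>2 * b v)"
   unfolding X_def b_def sum_distrib_left sum.cartesian_product by (simp add: case_prod_unfold)
  also have "... = (\<Sum>v\<in>S. Z\<^sup>2 * (1 / b v))"
   by (intro sum.cong) (auto simp: c_def power2_eq_square field_simps less_imp_neq[symmetric])
  also have "... = Z\<^sup>2 * (\<Sum>v\<in>S. 1 / b v)" by (simp add: sum_distrib_left)
  also have "A = Z"
  proof -
   have "A = 1 - Z * (\<Sum>v\<in>S. 1 / b v)" by (simp add: A_def c_def sum_distrib_left)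
   thus ?thesis unfolding Zeq using Sb by (simp add: field_simps)
  qed
  also have "Z\<^sup>2 + Z\<^sup>2 * (\<Sum>v\<in>S. 1 / b v) = Z * (Z * (1 + (\<Sum>v\<in>S. 1 / b v)))"
   by (simp add: power2_eq_square algebra_simps)
  also have "Z * (1 + (\<Sum>v\<in>S. 1 / b v)) = 1" unfolding Zeq using Sb by simp
  finally show ?thesis by simp
 qed
 have q4: "ip n q (R w') = 0" if w': "w' \<in> fst ` set fs" for w'
 proof -
  obtain f where f: "f \<in> set fs" "w' = fst f" using w' by blast
  have C: "w' \<in> fst ` set ?C" "w' \<subseteq> W" "w' \<noteq> w" using w' nin f fW by auto
  have "ip n (?u w) (R w') = 0" using ip_unit[OF wV] C w(1) R(2)[of f w] f by auto
  moreover have "ip n (R (r x)) (R w') = 0" if x: "x \<in> X" for x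
   using R4[OF rfst[OF x] C(1)] rW[OF x] C(2) by auto
  ultimately show ?thesis unfolding q_def ip_combine[OF X] by simp
 qed
 have "residual n Y W f (R (fst f))" if "f \<in> set fs" for f
  using R[of f] that by (auto simp: residual_def)
 hence "residuals n Y W fs R" using R4 by (auto simp: residuals_def pairwise_def)
 moreover have "residual n Y W (w, Nd ch) q"
  using q1 q3 RW by (simp add: residual_def Z_def q_def)
 ultimately show ?case using residuals_Cons nin q4 by blast
qed

section \<open>Poisson trees as local limits\<close>

abbreviation "PY d n c \<equiv> PR (all_faces n d) (c / real n)"

abbreviation "EY d n c \<equiv> EE (all_faces n d) (c / real n)"

primrec gw :: "nat => real => nat => tr pmf" where
 "gw d c 0 = return_pmf Leaf"
| "gw d c (Suc k) = bind_pmf (poisson_pmf c) (\<lambda>m. map_pmf Nd (replicate_pmf m (replicate_pmf d (gw d c k))))"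

lemma pmf_replicate_pmf:
  "pmf (replicate_pmf m p) xs = (if length xs = m then (\<Prod>x\<leftarrow>xs. pmf p x) else 0)"
proof (induction m arbitrary: xs)
 case 0
 then show ?case by auto
next
 case (Suc m)
 have eq: "replicate_pmf (Suc m) p = map_pmf (\<lambda>(x, xs). x # xs) (pair_pmf p (replicate_pmf m p))"
  by (simp add: pair_pmf_def bind_return_pmf map_pmf_def bind_assoc_pmf)
 show ?case
 proof (cases xs)
  case Nil
  have "[] \<notin> set_pmf (replicate_pmf (Suc m) p)" by auto
  hence "pmf (replicate_pmf (Suc m) p) [] = 0" by (simp only: pmf_eq_0_set_pmf not_False_eq_True)
  thus ?thesis using Nil by simp
 next
  case (Cons y ys)
  have "pmf (map_pmf (\<lambda>(x, xs). x # xs) (pair_pmf p (replicate_pmf m p))) ((\<lambda>(x, xs). x # xs) (y, ys))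
   = pmf (pair_pmf p (replicate_pmf m p)) (y, ys)"
   by (intro pmf_map_inj') (auto simp: inj_on_def)
  thus ?thesis unfolding eq Cons by (simp add: pmf_pair Suc.IH)
 qed
qed

lemma set_pmf_gw: "set_pmf (gw d c k) \<subseteq> {T. shape d k T}"
proof (induction k)
 case (Suc k)
 have "shape d (Suc k) T" if T: "T \<in> set_pmf (gw d c (Suc k))" for T
 proof -
  obtain m ch where ch: "T = Nd ch" "ch \<in> set_pmf (replicate_pmf m (replicate_pmf d (gw d c k)))"
   using T by auto
  show ?thesis using ch(2) ch(1) Suc.IH unfolding set_replicate_pmf by auto
 qed
 thus ?case by auto
qed auto

text \<open>So the weight of a tree in the exploration bound converges to its probability.\<close>
lemma pmf_gw:
 assumes "shape d k T"
 shows "pmf (gw d c k) T = wt (pmf (poisson_pmf c)) T"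
 using assms
proof (induction k arbitrary: T)
 case (Suc k)
 obtain ch where T: "T = Nd ch" and ch: "\<forall>l\<in>set ch. length l = d \<and> (\<forall>T\<in>set l. shape d k T)"
  using Suc.prems by auto
 have len: "pmf (map_pmf Nd (replicate_pmf m (replicate_pmf d (gw d c k)))) T =
  of_bool (m = length ch) * pmf (replicate_pmf m (replicate_pmf d (gw d c k))) ch" for m
  unfolding T by (subst pmf_map_inj') (auto simp: inj_def pmf_replicate_pmf)
 have "pmf (gw d c (Suc k)) T = mean (poisson_pmf c)
  (\<lambda>m. of_bool (m = length ch) * pmf (replicate_pmf m (replicate_pmf d (gw d c k))) ch)"
  by (simp add: pmf_bind len)
 also have "... = pmf (poisson_pmf c) (length ch) * pmf (replicate_pmf (length ch) (replicate_pmf d (gw d c k))) ch"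
  by (subst integral_measure_pmf_real[where A = "{length ch}"]) auto
 also have "pmf (replicate_pmf (length ch) (replicate_pmf d (gw d c k))) ch
  = (\<Prod>l\<leftarrow>ch. pmf (replicate_pmf d (gw d c k)) l)" by (subst pmf_replicate_pmf) simp
 also have "map (\<lambda>l. pmf (replicate_pmf d (gw d c k)) l) ch = map (\<lambda>l. \<Prod>T\<leftarrow>l. wt (pmf (poisson_pmf c)) T) ch"
 proof (rule map_cong[OF refl])
  fix l assume l: "l \<in> set ch"
  have "map (\<lambda>T. pmf (gw d c k) T) l = map (\<lambda>T. wt (pmf (poisson_pmf c)) T) l"
   using Suc.IH ch l by simp
  thus "pmf (replicate_pmf d (gw d c k)) l = (\<Prod>T\<leftarrow>l. wt (pmf (poisson_pmf c)) T)"
   using ch l by (simp only: pmf_replicate_pmf if_True refl)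
 qed
 finally show ?case by (simp add: T)
qed auto

lemma tendsto_prod_list:
 assumes "\<And>x. x \<in> set xs ==> (\<lambda>n. f n x) \<longlonglongrightarrow> (g x :: real)"
 shows "(\<lambda>n. \<Prod>x\<leftarrow>xs. f n x) \<longlonglongrightarrow> (\<Prod>x\<leftarrow>xs. g x)"
 using assms by (induction xs) (auto intro!: tendsto_mult)

lemma tendsto_wt:
 assumes "\<And>m. (\<lambda>n. q n m) \<longlonglongrightarrow> q' m"
 shows "(\<lambda>n. wt (q n) T) \<longlonglongrightarrow> wt q' T"
proof (induction T rule: nodes.induct)
 case (2 ch)
 show ?case using 2 assms by (auto intro!: tendsto_mult tendsto_prod_list)
qed auto

lemma binomial_limit:
 assumes c: "c > 0"
 shows "(\<lambda>n. real ((n - K) choose m) * (c / real n) ^ m * (1 - c / real n) ^ n) \<longlonglongrightarrow> pmf (poisson_pmf c) m"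
proof -
 have 1: "(\<lambda>n. (1 + (- c) / real n) ^ n) \<longlonglongrightarrow> exp (- c)"
  by (rule tendsto_exp_limit_sequentially)
 have f: "(\<lambda>n. (real n - real K - real i) / real n) \<longlonglongrightarrow> 1" for i by real_asymp
 have 2: "(\<lambda>n. (\<Prod>i<m. (real n - real K - real i) / real n)) \<longlonglongrightarrow> (\<Prod>i<m. 1)"
  by (intro tendsto_prod f)
 have "(\<lambda>n. c ^ m / fact m * (\<Prod>i<m. (real n - real K - real i) / real n) * (1 + (- c) / real n) ^ n)
  \<longlonglongrightarrow> c ^ m / fact m * (\<Prod>i<m. 1) * exp (- c)"
  by (intro tendsto_mult tendsto_const 1 2)
 moreover have "\<forall>\<^sub>F n in sequentially. c ^ m / fact m * (\<Prod>i<m. (real n - real K - real i) / real n) * (1 + (- c) / real n) ^ n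
  = real ((n - K) choose m) * (c / real n) ^ m * (1 - c / real n) ^ n"
  using eventually_ge_at_top[of "K + 1"]
 proof eventually_elim
  case (elim n)
  show ?case using elim by (simp add: binomial_gbinomial gbinomial_prod_rev lessThan_atLeast0 prod_dividef power_divide)
 qed
 ultimately have "(\<lambda>n. real ((n - K) choose m) * (c / real n) ^ m * (1 - c / real n) ^ n)
  \<longlonglongrightarrow> c ^ m / fact m * (\<Prod>i<m. 1) * exp (- c)"
  by (rule Lim_transform_eventually)
 thus ?thesis using c by simp
qed

lemma pmf_finite_approx:
 fixes M :: "'a pmf"
 assumes "e > (0::real)"
 obtains A where "finite A" "A \<subseteq> set_pmf M" "(\<Sum>x\<in>A. pmf M x) \<ge> 1 - e"
proof -
 define f where "f = from_nat_into (set_pmf M)"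
 have ne: "set_pmf M \<noteq> {}" by (rule set_pmf_not_empty)
 have rf: "range f = set_pmf M" unfolding f_def using range_from_nat_into[OF ne] by auto
 define B where "B n = f ` {..<n}" for n :: nat
 have "(\<lambda>n. measure_pmf.prob M (B n)) \<longlonglongrightarrow> measure_pmf.prob M (\<Union>n. B n)"
  by (intro measure_pmf.finite_Lim_measure_incseq) (auto simp: B_def incseq_def)
 also have "(\<Union>n. B n) = set_pmf M" using rf by (auto simp: B_def)
 finally have "(\<lambda>n. measure_pmf.prob M (B n)) \<longlonglongrightarrow> 1"
  using measure_Int_set_pmf[of M UNIV] by simp
 hence "\<forall>\<^sub>F n in sequentially. measure_pmf.prob M (B n) > 1 - e"
  using assms by (intro order_tendstoD) auto
 then obtain n where n: "measure_pmf.prob M (B n) > 1 - e" by force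
 show ?thesis
  by (rule that[of "B n"]) (use n rf in \<open>auto simp: B_def measure_measure_pmf_finite less_imp_le\<close>)
qed

text \<open>Only a one-sided bound is needed.  Finitely many families of trees carry almost all of the mass.
  The events that the exploration finds them are disjoint and have asymptotically at least the right probability; elsewhere \<open>X\<close> is at most one.\<close>
lemma local_limit:
 fixes P :: "tr list => real"
 assumes c: "c > 0" and P: "\<And>Ts. 0 \<le> P Ts" "\<And>Ts. P Ts \<le> 1" and a: "a > 0"
 shows "\<exists>n0. \<forall>n\<ge>n0. \<forall>W us X. W \<subseteq> {..<n} --> card W = w --> distinct us --> length us = r -->
  (\<forall>u\<in>set us. u \<subseteq> W \<and> card u = d) --> (\<forall>Y\<subseteq>all_faces n d. X Y \<le> 1) -->
  (\<forall>Y Ts. Y \<subseteq> all_faces n d --> length Ts = r --> (\<forall>T\<in>set Ts. shape d k T) --> ev n Y W {} (zip us Ts) --> X Y \<le> P Ts) -->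
  EY d n c X \<le> mean (replicate_pmf r (gw d c k)) P + a"
proof -
 define M where "M = replicate_pmf r (gw d c k)"
 obtain A where A: "finite A" "A \<subseteq> set_pmf M" "(\<Sum>x\<in>A. pmf M x) \<ge> 1 - a / 2"
  using pmf_finite_approx[of "a / 2" M] a by auto
 have sM: "length Ts = r \<and> (\<forall>T\<in>set Ts. shape d k T)" if "Ts \<in> set_pmf M" for Ts
  using that set_pmf_gw[of d c k] unfolding M_def set_replicate_pmf by auto
 define K where "K Ts = w + (\<Sum>T\<leftarrow>Ts. verts T)" for Ts
 define q where "q Ts n m = real ((n - K Ts) choose m) * (c / real n) ^ m * (1 - c / real n) ^ n" for Ts n m
 define LB where "LB Ts n = (\<Prod>T\<leftarrow>Ts. wt (q Ts n) T) * (1 - c / real n) ^ (2 ^ K Ts)" for Ts n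
 have lim: "LB Ts \<longlonglongrightarrow> pmf M Ts" if "Ts \<in> A" for Ts
 proof -
  let ?A = "(\<Prod>T\<leftarrow>Ts. wt (pmf (poisson_pmf c)) T)"
  have s: "length Ts = r" "\<forall>T\<in>set Ts. shape d k T" using sM A that by auto
  have "(\<lambda>n. (\<Prod>T\<leftarrow>Ts. wt (q Ts n) T) * (1 - c / real n) ^ (2 ^ K Ts))
   \<longlonglongrightarrow> ?A * (1 - 0) ^ (2 ^ K Ts)"
   unfolding q_def
   by (intro tendsto_intros tendsto_prod_list tendsto_wt binomial_limit[OF c] lim_const_over_n)
  moreover have "map (\<lambda>T. wt (pmf (poisson_pmf c)) T) Ts = map (\<lambda>T. pmf (gw d c k) T) Ts"
   using s pmf_gw by (intro map_cong) auto
  hence "pmf M Ts = ?A"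
   unfolding M_def using s(1) by (simp only: pmf_replicate_pmf if_True refl)
  ultimately show ?thesis by (simp add: LB_def[abs_def])
 qed
 define h where "h = a / (2 * (real (card A) + 1))"
 have h: "h > 0" "real (card A) * h \<le> a / 2" using a by (auto simp: h_def field_simps)
 have "\<forall>\<^sub>F n in sequentially. \<forall>Ts\<in>A. LB Ts n \<ge> pmf M Ts - h"
  using A(1)
 proof (intro eventually_ball_finite ballI)
  fix Ts assume "Ts \<in> A"
  have "\<forall>\<^sub>F n in sequentially. LB Ts n > pmf M Ts - h"
   using lim[OF \<open>Ts \<in> A\<close>] h(1) by (intro order_tendstoD) auto
  thus "\<forall>\<^sub>F n in sequentially. LB Ts n \<ge> pmf M Ts - h" by eventually_elim simp
 qed
 moreover have "\<forall>\<^sub>F n in sequentially. \<forall>Ts\<in>A. K Ts \<le> n"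
  using A(1) by (intro eventually_ball_finite ballI eventually_ge_at_top)
 moreover have "\<forall>\<^sub>F n in sequentially. real n \<ge> c \<and> n > 0"
  using eventually_ge_at_top[of "nat \<lceil>c\<rceil> + 1"] by eventually_elim (auto, linarith)
 ultimately have "\<forall>\<^sub>F n in sequentially. (\<forall>Ts\<in>A. LB Ts n \<ge> pmf M Ts - h) \<and> (\<forall>Ts\<in>A. K Ts \<le> n) \<and> real n \<ge> c \<and> n > 0"
  by eventually_elim blast
 then obtain n0 where n0: "\<And>n Ts. n \<ge> n0 ==> Ts \<in> A ==> LB Ts n \<ge> pmf M Ts - h"
  "\<And>n Ts. n \<ge> n0 ==> Ts \<in> A ==> K Ts \<le> n" "\<And>n. n \<ge> n0 ==> real n \<ge> c \<and> n > 0"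
  unfolding eventually_sequentially by blast
 show ?thesis
 proof (intro exI[of _ n0] allI impI)
  fix n W us X
  let ?F = "all_faces n d" and ?p = "c / real n"
  assume n: "n \<ge> n0" and W: "W \<subseteq> {..<n}" "card W = w" and us: "distinct us" "length us = r"
   "\<forall>u\<in>set us. u \<subseteq> W \<and> card u = d" and X1: "\<forall>Y\<subseteq>?F. X Y \<le> 1"
   and X: "\<forall>Y Ts. Y \<subseteq> ?F --> length Ts = r --> (\<forall>T\<in>set Ts. shape d k T) --> ev n Y W {} (zip us Ts) --> X Y \<le> P Ts"
  have p: "0 \<le> ?p" "?p \<le> 1" using n0(3)[OF n] c by (auto)
  let ?e = "\<lambda>Ts Y. ev n Y W {} (zip us Ts)"
  have pe: "PR ?F ?p (?e Ts) \<ge> pmf M Ts - h" if Ts: "Ts \<in> A" for Ts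
  proof -
   have s: "length Ts = r" "\<forall>T\<in>set Ts. shape d k T" using sM A Ts by auto
   have zs: "map fst (zip us Ts) = us" "map snd (zip us Ts) = Ts" using s us by auto
   have "?p ^ card ({} :: nat set set) * (1 - ?p) ^ card ({} :: nat set set) * ((\<Prod>T\<leftarrow>map snd (zip us Ts). wt (\<lambda>m. real ((n - K Ts) choose m) * ?p ^ m * (1 - ?p) ^ n) T) * (1 - ?p) ^ (2 ^ K Ts))
    \<le> PR ?F ?p (\<lambda>Y. {} \<subseteq> Y \<and> {} \<inter> Y = {} \<and> ev n Y W {} (zip us Ts))"
   proof (rule PR_ev_ge[OF p, where U = "{}"])
    show "rooted n d W (zip us Ts)" using s us W by (intro rooted_zip[where k = k]) auto
    show "card W + (\<Sum>T\<leftarrow>map snd (zip us Ts). verts T) \<le> K Ts" using zs W by (simp add: K_def)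
    show "K Ts \<le> n" using n0(2) n Ts by auto
   qed auto
   moreover have "LB Ts n \<ge> pmf M Ts - h" using n0(1) n Ts by auto
   ultimately show ?thesis by (simp add: LB_def zs q_def[abs_def])
  qed
  have uniq: "Ts = Ts'" if "Ts \<in> A" "Ts' \<in> A" "?e Ts Y" "?e Ts' Y" for Ts Ts' Y
  proof -
   have s: "length Ts = r" "\<forall>T\<in>set Ts. shape d k T" "length Ts' = r" "\<forall>T\<in>set Ts'. shape d k T"
    using sM A that by auto
   have "zip us Ts = zip us Ts'"
    using s us W by (intro ev_unique[OF that(3,4)] rooted_zip[where k = k])
    (auto simp: list_all2_conv_all_nth intro!: exI[of _ k])
   hence "map snd (zip us Ts) = map snd (zip us Ts')" by simp
   thus ?thesis using s us by simp
  qed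
  have "EE ?F ?p X \<le> EE ?F ?p (\<lambda>Y. 1 - (\<Sum>Ts\<in>A. (1 - P Ts) * of_bool (?e Ts Y)))"
  proof (intro EE_mono)
   fix Y assume Y: "Y \<subseteq> ?F"
   show "X Y \<le> 1 - (\<Sum>Ts\<in>A. (1 - P Ts) * of_bool (?e Ts Y))"
   proof (cases "\<exists>Ts\<in>A. ?e Ts Y")
    case True
    then obtain Ts where Ts: "Ts \<in> A" "?e Ts Y" by blast
    have "(\<Sum>Ts'\<in>A. (1 - P Ts') * of_bool (?e Ts' Y)) = (\<Sum>Ts'\<in>A. if Ts' = Ts then 1 - P Ts else 0)"
    proof (rule sum.cong[OF refl])
     fix Ts' assume t: "Ts' \<in> A"
     show "(1 - P Ts') * of_bool (?e Ts' Y) = (if Ts' = Ts then 1 - P Ts else 0)"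
     proof (cases "?e Ts' Y")
      case True
      thus ?thesis using uniq[OF t Ts(1) True Ts(2)] by simp
     next
      case False
      thus ?thesis using Ts(2) by auto
     qed
    qed
    moreover have "Ts \<in> set_pmf M" using A(2) Ts(1) by auto
    hence "X Y \<le> P Ts" using X[rule_format, OF Y _ _ Ts(2)] sM by auto
    ultimately show ?thesis using A(1) Ts by simp
   next
    case False
    thus ?thesis using X1 Y by simp
   qed
  qed simp
  also have "... = 1 - (\<Sum>Ts\<in>A. (1 - P Ts) * PR ?F ?p (?e Ts))"
   by (simp add: EE_indicator[symmetric])
  also have "... \<le> 1 - (\<Sum>Ts\<in>A. (1 - P Ts) * (pmf M Ts - h))"
   using pe P by (intro diff_left_mono sum_mono mult_left_mono) auto
  also have "... = (1 - (\<Sum>Ts\<in>A. pmf M Ts)) + (\<Sum>Ts\<in>A. P Ts * pmf M Ts) + (\<Sum>Ts\<in>A. (1 - P Ts) * h)"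
   by (simp add: algebra_simps sum_subtractf sum.distrib)
  also have "(\<Sum>Ts\<in>A. (1 - P Ts) * h) \<le> (\<Sum>Ts\<in>A. 1 * h)"
   using P h by (intro sum_mono mult_right_mono) auto
  also have "... \<le> a / 2" using h by simp
  also have "(\<Sum>Ts\<in>A. P Ts * pmf M Ts) = mean M (\<lambda>Ts. P Ts * indicator A Ts)"
   by (subst integral_measure_pmf_real[OF A(1)]) (auto simp: indicator_def mult_ac intro!: sum.cong split: if_splits)
  also have "... \<le> mean M P"
   using P by (intro integral_mono measure_pmf.integrable_const_bound[where B = 1])
   (auto simp: indicator_def)
  finally show "EE ?F ?p X \<le> mean (replicate_pmf r (gw d c k)) P + a"
   using A(3) unfolding M_def by simp
 qed
qed

section \<open>Recursions for Poisson trees\<close>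

lemma replicate_pmf_map: "replicate_pmf m (map_pmf f p) = map_pmf (map f) (replicate_pmf m p)"
 by (induction m) (simp_all add: map_bind_pmf bind_map_pmf map_pmf_def[of "map f"] bind_assoc_pmf bind_return_pmf)

definition pr :: "'a pmf => ('a => bool) => real" where
 "pr M P = measure_pmf.prob M {x. P x}"

abbreviation "nnE M f \<equiv> \<integral>\<^sup>+x. f x \<partial>measure_pmf M"

lemma nn_pr: "nnE M (\<lambda>x. of_bool (P x)) = ennreal (pr M P)"
proof -
 have "nnE M (\<lambda>x. of_bool (P x)) = nnE M (\<lambda>x. indicator {x. P x} x)"
  by (intro nn_integral_cong) (auto simp: indicator_def)
 thus ?thesis by (simp add: pr_def measure_pmf.emeasure_eq_measure)
qed

lemma pr_nonneg [simp]: "pr M P \<ge> 0" and pr_le_1 [simp]: "pr M P \<le> 1"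
 by (auto simp: pr_def)

lemma pr_eqI: "nnE M (\<lambda>x. of_bool (P x)) = ennreal r ==> r \<ge> 0 ==> pr M P = r"
 unfolding nn_pr by simp

lemma pr_mono: "(\<And>x. x \<in> set_pmf M ==> P x ==> Q x) ==> pr M P \<le> pr M Q"
 unfolding pr_def by (rule measure_pmf.finite_measure_mono_AE) (auto simp: AE_measure_pmf_iff)

lemma pr_map: "pr (map_pmf f M) P = pr M (\<lambda>x. P (f x))"
 by (simp add: pr_def)

lemma pr_compl: "pr M (\<lambda>x. \<not> P x) = 1 - pr M P"
 using measure_pmf.prob_compl[of "{x. P x}" M] by (simp add: pr_def Compl_eq_Diff_UNIV[symmetric] Collect_neg_eq)

lemma nn_replicate_all: "nnE (replicate_pmf m p) (\<lambda>xs. of_bool (\<forall>x\<in>set xs. P x)) = ennreal (pr p P ^ m)"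
proof (induction m)
 case (Suc m)
 have "nnE (replicate_pmf (Suc m) p) (\<lambda>xs. of_bool (\<forall>x\<in>set xs. P x)) = nnE p (\<lambda>x. of_bool (P x) * ennreal (pr p P ^ m))" by (simp add: of_bool_conj nn_integral_cmult Suc)
 also have "... = ennreal (pr p P) * ennreal (pr p P ^ m)"
  by (simp add: nn_integral_multc nn_pr)
 finally show ?case by (simp add: ennreal_mult)
qed auto

lemma pr_replicate_all: "pr (replicate_pmf m p) (\<lambda>xs. \<forall>x\<in>set xs. P x) = pr p P ^ m"
 by (intro pr_eqI nn_replicate_all) simp

lemma nn_poisson: "c > 0 ==> nnE (poisson_pmf c) f = (\<Sum>m. ennreal (c ^ m / fact m * exp (- c)) * f m)"
 by (simp add: nn_integral_measure_pmf nn_integral_count_space_nat)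

lemma nn_poisson_power:
 assumes "c > 0" "r \<ge> 0"
 shows "nnE (poisson_pmf c) (\<lambda>m. ennreal (r ^ m)) = ennreal (exp (- c * (1 - r)))"
proof -
 have "(\<lambda>m. (c * r) ^ m /\<^sub>R fact m) sums exp (c * r)" by (rule exp_converges)
 hence "(\<lambda>m. (c * r) ^ m /\<^sub>R fact m * exp (- c)) sums (exp (c * r) * exp (- c))" by (rule sums_mult2)
 hence "(\<lambda>m. c ^ m / fact m * exp (- c) * r ^ m) sums exp (- c * (1 - r))"
  by (simp add: field_simps exp_diff exp_minus)
 hence "(\<Sum>m. ennreal (c ^ m / fact m * exp (- c) * r ^ m)) = ennreal (exp (- c * (1 - r)))"
  using assms by (intro suminf_ennreal_eq) auto
 thus ?thesis using assms by (simp add: nn_poisson ennreal_mult''[symmetric])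
qed

text \<open>The Mecke formula for the Poisson distribution: \<open>m\<close> times the mass at \<open>m\<close> is \<open>c\<close> times the mass at \<open>m - 1\<close>.\<close>
lemma nn_poisson_mecke:
 assumes "c > 0"
 shows "nnE (poisson_pmf c) (\<lambda>m. of_nat m * f (m - 1)) = ennreal c * nnE (poisson_pmf c) f"
proof -
 define g where "g m = ennreal (c ^ m / fact m * exp (- c)) * (of_nat m * f (m - 1))" for m
 have g: "g (Suc m) = ennreal c * (ennreal (c ^ m / fact m * exp (- c)) * f m)" for m
 proof -
  have "ennreal (c ^ Suc m / fact (Suc m) * exp (- c)) * ennreal (real (Suc m)) = ennreal c * ennreal (c ^ m / fact m * exp (- c))" using assms by (simp add: ennreal_mult[symmetric] del: of_nat_Suc)
  thus ?thesis unfolding g_def by (simp add: ennreal_of_nat_eq_real_of_nat mult.assoc[symmetric])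
 qed
 have "(\<lambda>m. g (Suc m)) sums (\<Sum>m. g (Suc m))" by auto
 moreover have "g 0 = 0" by (simp add: g_def)
 ultimately have "g sums (\<Sum>m. g (Suc m))" using sums_Suc[of g] by fastforce
 hence "(\<Sum>m. g m) = (\<Sum>m. g (Suc m))" by (simp add: sums_iff)
 also have "... = ennreal c * (\<Sum>m. ennreal (c ^ m / fact m * exp (- c)) * f m)"
  unfolding g by simp
 finally show ?thesis using assms by (simp add: nn_poisson g_def)
qed

text \<open>Only the total weight \<open>w\<close> of the other entries may enter, whence the subtraction of the entry singled out.\<close>
lemma nn_replicate_single:
 fixes H :: "'a => 'm::ab_group_add => ennreal"
 shows "nnE (replicate_pmf m p) (\<lambda>xs. (\<Sum>x\<leftarrow>xs. H x ((\<Sum>y\<leftarrow>xs. w y) - w x)))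
  = of_nat m * nnE p (\<lambda>x. nnE (replicate_pmf (m - 1) p) (\<lambda>xs. H x (\<Sum>y\<leftarrow>xs. w y)))"
proof (induction m arbitrary: H)
 case (Suc m)
 let ?R = "\<lambda>m. measure_pmf (replicate_pmf m p)"
 have "(\<integral>\<^sup>+xs. (\<Sum>x\<leftarrow>xs. H x ((\<Sum>y\<leftarrow>xs. w y) - w x)) \<partial>?R (Suc m)) = nnE p (\<lambda>x. \<integral>\<^sup>+xs. H x (\<Sum>y\<leftarrow>xs. w y) \<partial>?R m) +
  nnE p (\<lambda>x. of_nat m * nnE p (\<lambda>y. \<integral>\<^sup>+xs. H y (w x + (\<Sum>y\<leftarrow>xs. w y)) \<partial>?R (m - 1)))" using Suc[of "\<lambda>y s. H y (w _ + s)"] by (simp add: add_diff_eq nn_integral_add)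
 also have "nnE p (\<lambda>x. of_nat m * nnE p (\<lambda>y. \<integral>\<^sup>+xs. H y (w x + (\<Sum>y\<leftarrow>xs. w y)) \<partial>?R (m - 1)))
  = of_nat m * nnE p (\<lambda>x. nnE p (\<lambda>y. \<integral>\<^sup>+xs. H y (w x + (\<Sum>y\<leftarrow>xs. w y)) \<partial>?R (m - 1)))"
  by (simp add: nn_integral_cmult)
 also have "nnE p (\<lambda>x. nnE p (\<lambda>y. \<integral>\<^sup>+xs. H y (w x + (\<Sum>y\<leftarrow>xs. w y)) \<partial>?R (m - 1)))
  = nnE p (\<lambda>y. nnE p (\<lambda>x. \<integral>\<^sup>+xs. H y (w x + (\<Sum>y\<leftarrow>xs. w y)) \<partial>?R (m - 1)))"
 proof -
  have "bind_pmf p (\<lambda>x. bind_pmf p (\<lambda>y. return_pmf (x, y))) = bind_pmf p (\<lambda>y. bind_pmf p (\<lambda>x. return_pmf (x, y)))"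
   by (rule bind_commute_pmf)
  from arg_cong[OF this, of "\<lambda>M. nnE M (\<lambda>z. (case z of (x, y) => \<integral>\<^sup>+xs. H y (w x + (\<Sum>y\<leftarrow>xs. w y)) \<partial>?R (m - 1)))"]
  show ?thesis by simp
 qed
 also have "of_nat m * nnE p (\<lambda>y. nnE p (\<lambda>x. \<integral>\<^sup>+xs. H y (w x + (\<Sum>y\<leftarrow>xs. w y)) \<partial>?R (m - 1)))
  = of_nat m * nnE p (\<lambda>y. \<integral>\<^sup>+xs. H y (\<Sum>y\<leftarrow>xs. w y) \<partial>?R m)"
  by (cases m) simp_all
 finally show ?case by (simp add: distrib_right)
qed auto

lemma z_nonneg: "z T \<ge> 0"
 using z_pos[of T] by simp

lemma sum_z_pos: "l \<noteq> [] ==> (\<Sum>T\<leftarrow>l. z T) > 0"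
proof (induction l)
 case (Cons T l)
 thus ?case using z_pos[of T] by force
qed auto

text \<open>Couples the trees of depths \<open>Suc k\<close> and \<open>k\<close>.\<close>
fun cut :: "nat => tr => tr" where
 "cut 0 T = Leaf"
| "cut (Suc k) Leaf = Leaf"
| "cut (Suc k) (Nd ch) = Nd (map (map (cut k)) ch)"

lemma map_cut_gw: "map_pmf (cut k) (gw d c (Suc k)) = gw d c k"
proof (induction k)
 case 0
 show ?case by auto
next
 case (Suc k)
 have "map_pmf (cut (Suc k)) (gw d c (Suc (Suc k))) =
  bind_pmf (poisson_pmf c) (\<lambda>m. map_pmf (\<lambda>ch. cut (Suc k) (Nd ch)) (replicate_pmf m (replicate_pmf d (gw d c (Suc k)))))"
  by (simp add: map_bind_pmf map_pmf_comp del: gw.simps(2) add: gw.simps(2)[of d c "Suc k"])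
 also have "... = bind_pmf (poisson_pmf c) (\<lambda>m. map_pmf Nd (replicate_pmf m (replicate_pmf d (map_pmf (cut k) (gw d c (Suc k))))))"
  by (simp add: replicate_pmf_map map_pmf_comp del: gw.simps(2))
 finally show ?case unfolding Suc by simp
qed

text \<open>\<open>z\<close> is increasing in the weights of subtrees and at most one, its value at a leaf.\<close>
lemma z_cut: "z T \<le> z (cut k T)"
proof (induction k T rule: cut.induct)
 case (1 T)
 then show ?case by (simp add: z_le_1)
next
 case (3 k ch)
 have "(\<Sum>l\<leftarrow>ch. 1 / (\<Sum>T\<leftarrow>map (cut k) l. z T)) \<le> (\<Sum>l\<leftarrow>ch. 1 / (\<Sum>T\<leftarrow>l. z T))"
 proof (intro sum_list_mono)
  fix l assume l: "l \<in> set ch"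
  show "1 / (\<Sum>T\<leftarrow>map (cut k) l. z T) \<le> 1 / (\<Sum>T\<leftarrow>l. z T)"
  proof (cases "l = []")
   case False
   have "(\<Sum>T\<leftarrow>l. z T) \<le> (\<Sum>T\<leftarrow>l. z (cut k T))" using 3[OF l] by (intro sum_list_mono) auto
   thus ?thesis using sum_z_pos[OF False] by (intro frac_le) (auto simp: o_def)
  qed auto
 qed
 moreover have "(\<Sum>l\<leftarrow>ch. 1 / (\<Sum>T\<leftarrow>map (cut k) l. z T)) \<ge> 0"
  by (intro sum_list_nonneg) (auto intro!: divide_nonneg_nonneg sum_list_nonneg simp: z_nonneg)
 ultimately show ?case by (auto intro!: frac_le simp: o_def)
qed auto

text \<open>The iteration from \<open>0\<close> for the fixed points of \<open>t = exp (- c * (1 - t) ^ d)\<close>.\<close>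
fun tk :: "nat => real => nat => real" where
 "tk d c 0 = 0"
| "tk d c (Suc k) = exp (- c * (1 - tk d c k) ^ d)"

lemma pr_coll: "c > 0 ==> pr (gw d c k) coll = tk d c k"
proof (induction k)
 case 0
 show ?case by (simp add: pr_def)
next
 case (Suc k)
 let ?r = "1 - (1 - tk d c k) ^ d"
 have 1: "pr (replicate_pmf d (gw d c k)) (\<lambda>l. \<exists>T\<in>set l. coll T) = ?r"
 proof -
  have "pr (replicate_pmf d (gw d c k)) (\<lambda>l. \<exists>T\<in>set l. coll T) = 1 - pr (replicate_pmf d (gw d c k)) (\<lambda>l. \<forall>T\<in>set l. \<not> coll T)"
   by (subst pr_compl[symmetric]) simp
  thus ?thesis using Suc by (simp add: pr_replicate_all pr_compl)
 qed
 have r0: "?r \<ge> 0" using 1 pr_nonneg by metis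
 have "nnE (gw d c (Suc k)) (\<lambda>T. of_bool (coll T))
  = nnE (poisson_pmf c) (\<lambda>m. nnE (replicate_pmf m (replicate_pmf d (gw d c k))) (\<lambda>ch. of_bool (\<forall>l\<in>set ch. \<exists>T\<in>set l. coll T)))"
  by simp
 also have "... = nnE (poisson_pmf c) (\<lambda>m. ennreal (?r ^ m))"
  unfolding nn_replicate_all 1 ..
 also have "... = ennreal (exp (- c * (1 - ?r)))" using Suc.prems r0 by (rule nn_poisson_power)
 finally show ?case by (intro pr_eqI) simp_all
qed

text \<open>\<open>nu\<close> is the law of the sum of the weights in one child face, and \<open>Lam\<close> that of the list of these sums at the root, from which
  \<open>Xf\<close> computes the weight of the root.\<close>
definition nu :: "nat => real => nat => real pmf" where
 "nu d c k = map_pmf (\<lambda>l. \<Sum>T\<leftarrow>l. z T) (replicate_pmf d (gw d c k))"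

definition Xf :: "real list => real" where
 "Xf ss = 1 / (1 + (\<Sum>s\<leftarrow>ss. 1 / s))"

definition Lam :: "nat => real => nat => real list pmf" where
 "Lam d c k = bind_pmf (poisson_pmf c) (\<lambda>m. replicate_pmf m (nu d c k))"

lemma map_z_gw: "map_pmf z (gw d c (Suc k)) = map_pmf Xf (Lam d c k)"
 by (simp add: Lam_def nu_def map_bind_pmf map_pmf_comp replicate_pmf_map Xf_def o_def)

lemma set_nu: "d \<ge> 1 ==> s \<in> set_pmf (nu d c k) ==> s > 0"
 by (auto simp: nu_def set_replicate_pmf intro!: sum_z_pos)

lemma set_Lam: "d \<ge> 1 ==> ss \<in> set_pmf (Lam d c k) ==> s \<in> set ss ==> s > 0"
 using set_nu[of d s c k] by (auto simp: Lam_def set_replicate_pmf)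

lemma mecke:
 assumes "c > 0"
 shows "nnE (Lam d c k) (\<lambda>ss. (\<Sum>s\<leftarrow>ss. G s ((\<Sum>s\<leftarrow>ss. 1 / s) - 1 / s)))
  = ennreal c * nnE (nu d c k) (\<lambda>s. nnE (Lam d c k) (\<lambda>ss. G s (\<Sum>s\<leftarrow>ss. 1 / s)))"
proof -
 let ?A = "measure_pmf (nu d c k)"
 let ?R = "\<lambda>m. measure_pmf (replicate_pmf m (nu d c k))" and ?P = "measure_pmf (poisson_pmf c)"
 have "nnE (Lam d c k) (\<lambda>ss. (\<Sum>s\<leftarrow>ss. G s ((\<Sum>s\<leftarrow>ss. 1 / s) - 1 / s)))
  = (\<integral>\<^sup>+m. of_nat m * (\<integral>\<^sup>+s. \<integral>\<^sup>+ss. G s (\<Sum>s\<leftarrow>ss. 1 / s) \<partial>?R (m - 1) \<partial>?A) \<partial>?P)"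
  by (simp add: Lam_def nn_replicate_single)
 also have "... = ennreal c * (\<integral>\<^sup>+m. (\<integral>\<^sup>+s. \<integral>\<^sup>+ss. G s (\<Sum>s\<leftarrow>ss. 1 / s) \<partial>?R m \<partial>?A) \<partial>?P)"
  using assms by (rule nn_poisson_mecke)
 also have "(\<integral>\<^sup>+m. (\<integral>\<^sup>+s. \<integral>\<^sup>+ss. G s (\<Sum>s\<leftarrow>ss. 1 / s) \<partial>?R m \<partial>?A) \<partial>?P)
  = (\<integral>\<^sup>+s. (\<integral>\<^sup>+m. \<integral>\<^sup>+ss. G s (\<Sum>s\<leftarrow>ss. 1 / s) \<partial>?R m \<partial>?P) \<partial>?A)"
 proof -
  have "bind_pmf (poisson_pmf c) (\<lambda>x. bind_pmf (nu d c k) (\<lambda>y. return_pmf (x, y)))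
   = bind_pmf (nu d c k) (\<lambda>y. bind_pmf (poisson_pmf c) (\<lambda>x. return_pmf (x, y)))"
   by (rule bind_commute_pmf)
  from arg_cong[OF this, of "\<lambda>M. nnE M (\<lambda>z. (case z of (m, s) => \<integral>\<^sup>+ss. G s (\<Sum>s\<leftarrow>ss. 1 / s) \<partial>?R m))"]
  show ?thesis by simp
 qed
 finally show ?thesis by (simp add: Lam_def)
qed

text \<open>If \<open>x\<close> is the weight of the root, and a child face with sum \<open>s\<close> is added, the weight becomes
  \<open>x * s / (x + s)\<close>.  \<open>gq\<close> is this divided by \<open>s\<close>, the share of the new face, if the weight is at least \<open>e\<close>.\<close>
definition gq :: "real => real => real => real" where
 "gq e s x = (if x * s / (x + s) \<ge> e then x / (x + s) else 0)"

text \<open>The weight \<open>X\<close> of the root and the shares \<open>X / s\<close> of its child faces add up to one, whenever \<open>X \<ge> e\<close>.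
  The Mecke formula evaluates the expected sum of the shares by adding an independent child face.\<close>
lemma nn_identity:
 assumes c: "c > 0" and d: "d \<ge> 1"
 shows "nnE (Lam d c k) (\<lambda>ss. ennreal (if Xf ss \<ge> e then Xf ss else 0)) +
  ennreal c * nnE (nu d c k) (\<lambda>s. nnE (Lam d c k) (\<lambda>ss. ennreal (gq e s (Xf ss))))
  = ennreal (pr (Lam d c k) (\<lambda>ss. Xf ss \<ge> e))"
proof -
 let ?L = "measure_pmf (Lam d c k)"
 have "ennreal c * nnE (nu d c k) (\<lambda>s. \<integral>\<^sup>+ss. ennreal (gq e s (Xf ss)) \<partial>?L)
  = (\<integral>\<^sup>+ss. (\<Sum>s\<leftarrow>ss. ennreal (gq e s (1 / (1 + ((\<Sum>s\<leftarrow>ss. 1 / s) - 1 / s))))) \<partial>?L)"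
  unfolding Xf_def by (rule mecke[OF c, where G = "\<lambda>s u. ennreal (gq e s (1 / (1 + u)))", symmetric])
 also have "... = (\<integral>\<^sup>+ss. ennreal (if Xf ss \<ge> e then Xf ss * (\<Sum>s\<leftarrow>ss. 1 / s) else 0) \<partial>?L)"
 proof (intro nn_integral_cong_AE, unfold AE_measure_pmf_iff, intro ballI)
  fix ss assume ss: "ss \<in> set_pmf (Lam d c k)"
  have pos: "s > 0" if "s \<in> set ss" for s using set_Lam[OF d ss that] .
  define U where "U = (\<Sum>s\<leftarrow>ss. 1 / s)"
  have "U \<ge> 0" unfolding U_def using pos by (intro sum_list_nonneg) (auto intro: less_imp_le)
  hence Xp: "Xf ss > 0" unfolding Xf_def U_def[symmetric] by simp
  have trm: "gq e s (1 / (1 + (U - 1 / s))) = (if Xf ss \<ge> e then Xf ss / s else 0)" if s: "s \<in> set ss" for s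
  proof -
   have s0: "s > 0" using pos s .
   have "1 / s \<le> U" using s pos unfolding U_def by (intro member_le_sum_list) (auto intro: less_imp_le)
   hence v: "1 + (U - 1 / s) > 0" by simp
   define x where "x = 1 / (1 + (U - 1 / s))"
   have x0: "x > 0" using v by (simp add: x_def)
   have "1 / x + 1 / s = 1 + U" by (simp add: x_def)
   hence xs: "(x + s) / (x * s) = 1 + U" using x0 s0 by (simp add: field_simps)
   have 1: "x * s / (x + s) = Xf ss"
    unfolding Xf_def U_def[symmetric] xs[symmetric] by simp
   have 2: "x / (x + s) = Xf ss / s"
    unfolding 1[symmetric] using s0 by simp
   show ?thesis unfolding x_def[symmetric] gq_def 1 2 by simp
  qed
  have "(\<Sum>s\<leftarrow>ss. ennreal (gq e s (1 / (1 + (U - 1 / s))))) = (\<Sum>s\<leftarrow>ss. ennreal (if Xf ss \<ge> e then Xf ss / s else 0))"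
   using trm by (intro arg_cong[where f = sum_list] map_cong) auto
  also have "... = ennreal (\<Sum>s\<leftarrow>ss. if Xf ss \<ge> e then Xf ss / s else 0)"
   using pos Xp by (intro sum_list_ennreal) (auto intro: less_imp_le)
  also have "(\<Sum>s\<leftarrow>ss. if Xf ss \<ge> e then Xf ss / s else 0) = (if Xf ss \<ge> e then Xf ss * U else 0)"
   unfolding U_def by (simp add: sum_list_const_mult[symmetric])
  finally show "(\<Sum>s\<leftarrow>ss. ennreal (gq e s (1 / (1 + ((\<Sum>s\<leftarrow>ss. 1 / s) - 1 / s))))) =
   ennreal (if Xf ss \<ge> e then Xf ss * (\<Sum>s\<leftarrow>ss. 1 / s) else 0)" unfolding U_def .
 qed
 finally have eq: "ennreal c * nnE (nu d c k) (\<lambda>s. \<integral>\<^sup>+ss. ennreal (gq e s (Xf ss)) \<partial>?L)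
  = (\<integral>\<^sup>+ss. ennreal (if Xf ss \<ge> e then Xf ss * (\<Sum>s\<leftarrow>ss. 1 / s) else 0) \<partial>?L)" .
 have "(\<integral>\<^sup>+ss. ennreal (if Xf ss \<ge> e then Xf ss else 0) \<partial>?L) + (\<integral>\<^sup>+ss. ennreal (if Xf ss \<ge> e then Xf ss * (\<Sum>s\<leftarrow>ss. 1 / s) else 0) \<partial>?L)
  = (\<integral>\<^sup>+ss. ennreal (if Xf ss \<ge> e then Xf ss else 0) + ennreal (if Xf ss \<ge> e then Xf ss * (\<Sum>s\<leftarrow>ss. 1 / s) else 0) \<partial>?L)"
  by (simp add: nn_integral_add)
 also have "... = (\<integral>\<^sup>+ss. of_bool (Xf ss \<ge> e) \<partial>?L)"
 proof (intro nn_integral_cong_AE, unfold AE_measure_pmf_iff, intro ballI)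
  fix ss assume ss: "ss \<in> set_pmf (Lam d c k)"
  have U0: "(\<Sum>s\<leftarrow>ss. 1 / s) \<ge> 0" using set_Lam[OF d ss] by (intro sum_list_nonneg) (auto intro: less_imp_le)
  have "Xf ss + Xf ss * (\<Sum>s\<leftarrow>ss. 1 / s) = 1" unfolding Xf_def using U0 by (simp add: field_simps)
  moreover have "Xf ss \<ge> 0" unfolding Xf_def using U0 by simp
  ultimately show "ennreal (if Xf ss \<ge> e then Xf ss else 0) + ennreal (if Xf ss \<ge> e then Xf ss * (\<Sum>s\<leftarrow>ss. 1 / s) else 0)
   = of_bool (Xf ss \<ge> e)"
   using U0 by (auto simp: ennreal_plus[symmetric] simp del: ennreal_plus)
 qed
 finally show ?thesis unfolding eq nn_pr .
qed

lemma nn_expectation: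
 assumes "\<And>x. 0 \<le> f x" "\<And>x. f x \<le> (B :: real)"
 shows "nnE M (\<lambda>x. ennreal (f x)) = ennreal (mean M f)"
 using assms by (intro nn_integral_eq_integral measure_pmf.integrable_const_bound[where B = B]) auto

lemma bdd_integrable:
 assumes "\<And>x. \<bar>f x\<bar> \<le> (B :: real)"
 shows "integrable (measure_pmf M) f"
 using assms by (intro measure_pmf.integrable_const_bound[where B = B]) auto

lemma sum_z_nonneg: "(\<Sum>T\<leftarrow>l. z T) \<ge> 0"
 using z_nonneg by (intro sum_list_nonneg) auto

lemma gq_bounds: "x \<ge> 0 ==> s \<ge> 0 ==> 0 \<le> gq e s x \<and> gq e s x \<le> 1"
 by (auto simp: gq_def divide_simps)

lemma real_identity:
 assumes c: "c > 0" and d: "d \<ge> 1"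
 shows "mean (gw d c (Suc k)) (\<lambda>T. if z T \<ge> e then z T else 0) +
  c * mean (pair_pmf (gw d c (Suc k)) (replicate_pmf d (gw d c k)))
  (\<lambda>(T, l). gq e (\<Sum>T\<leftarrow>l. z T) (z T))
  = pr (gw d c (Suc k)) (\<lambda>T. z T \<ge> e)"
proof -
 let ?G = "(\<lambda>(T, l). gq e (\<Sum>T\<leftarrow>l. z T) (z T))"
 let ?F = "nnE (Lam d c k) (\<lambda>ss. ennreal (if Xf ss \<ge> e then Xf ss else 0))"
 let ?E = "(gw d c (Suc k))"
 let ?D = "replicate_pmf d (gw d c k)"
 let ?C = "nnE (nu d c k) (\<lambda>s. nnE (Lam d c k) (\<lambda>ss. ennreal (gq e s (Xf ss))))"
 let ?A = "mean ?E (\<lambda>T. if z T \<ge> e then z T else 0)"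
 let ?B = "mean (pair_pmf ?E (?D)) ?G"
 have A: "?F = ennreal ?A"
 proof -
  have "?F
   = nnE (map_pmf Xf (Lam d c k)) (\<lambda>x. ennreal (if x \<ge> e then x else 0))" by simp
  also have "... = nnE ?E (\<lambda>T. ennreal (if z T \<ge> e then z T else 0))"
   unfolding map_z_gw[symmetric] by simp
  also have "... = ennreal ?A" using z_nonneg z_le_1 by (intro nn_expectation[where B = 1]) auto
  finally show ?thesis .
 qed
 have B: "?C = ennreal ?B"
 proof -
  have "?C
   = nnE (nu d c k) (\<lambda>s. nnE (map_pmf Xf (Lam d c k)) (\<lambda>x. ennreal (gq e s x)))" by simp
  also have "... = nnE (?D) (\<lambda>l. nnE ?E (\<lambda>T. ennreal (gq e (\<Sum>T\<leftarrow>l. z T) (z T))))"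
   unfolding map_z_gw[symmetric] nu_def by (simp del: gw.simps)
  also have "... = nnE ?E (\<lambda>T. nnE (?D) (\<lambda>l. ennreal (gq e (\<Sum>T\<leftarrow>l. z T) (z T))))"
  proof -
   have "bind_pmf (?D) (\<lambda>x. bind_pmf ?E (\<lambda>y. return_pmf (x, y)))
    = bind_pmf ?E (\<lambda>y. bind_pmf (?D) (\<lambda>x. return_pmf (x, y)))"
    by (rule bind_commute_pmf)
   from arg_cong[OF this, of "\<lambda>M. nnE M (\<lambda>x. (case x of (l, T) => ennreal (gq e (\<Sum>T\<leftarrow>l. z T) (z T))))"]
   show ?thesis by (simp del: gw.simps)
  qed
  also have "... = nnE (pair_pmf ?E (?D)) (\<lambda>x. ennreal (?G x))"
   by (simp add: nn_integral_pair_pmf')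
  also have "... = ennreal ?B"
   using gq_bounds[OF z_nonneg sum_z_nonneg] by (intro nn_expectation[where B = 1]) auto
  finally show ?thesis .
 qed
 have B0: "?B \<ge> 0" using gq_bounds[OF z_nonneg sum_z_nonneg] by (intro integral_nonneg_AE) auto
 have P: "pr (Lam d c k) (\<lambda>ss. Xf ss \<ge> e) = pr ?E (\<lambda>T. z T \<ge> e)"
  using pr_map[of Xf "Lam d c k" "\<lambda>x. x \<ge> e"] pr_map[of z "gw d c (Suc k)" "\<lambda>x. x \<ge> e"] by (simp only: map_z_gw)
 have "ennreal (?A + c * ?B) = ennreal (pr ?E (\<lambda>T. z T \<ge> e))" using nn_identity[OF c d, where e = e and k = k] z_nonneg B0 c unfolding A B P by (simp add: ennreal_mult)
 thus ?thesis using z_nonneg B0 c by (subst (asm) ennreal_inj) auto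
qed

section \<open>Exchangeability of weights\<close>

definition eX :: "nat => real => nat => real" where
 "eX d c k = mean (gw d c k) z"

definition uX :: "nat => real => nat => real => real" where
 "uX d c k x = pr (gw d c k) (\<lambda>T. z T < x)"

lemma z_abs: "\<bar>z T\<bar> \<le> 1"
 using z_nonneg[of T] z_le_1[of T] by simp

lemma z_integrable: "integrable (measure_pmf M) (\<lambda>x. z (f x))"
 by (rule bdd_integrable[where B = 1]) (rule z_abs)

lemma eX_cut: "eX d c k = mean (gw d c (Suc k)) (\<lambda>T. z (cut k T))"
proof -
 have "eX d c k = mean (map_pmf (cut k) (gw d c (Suc k))) z"
  unfolding map_cut_gw eX_def ..
 thus ?thesis by simp
qed

lemma eX_step: "eX d c (Suc k) \<le> eX d c k"
 unfolding eX_cut[of d c k] eX_def[of d c "Suc k"]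
 by (intro integral_mono z_integrable z_integrable[where f = "\<lambda>x. x"] z_cut)

lemma eX_nonneg: "eX d c k \<ge> 0"
 unfolding eX_def using z_nonneg by simp

lemma uX_cut: "uX d c k x = pr (gw d c (Suc k)) (\<lambda>T. z (cut k T) < x)"
 unfolding uX_def using pr_map[of "cut k" "gw d c (Suc k)" "\<lambda>T. z T < x"] by (simp only: map_cut_gw)

lemma uX_step: "uX d c k x \<le> uX d c (Suc k) x"
 unfolding uX_cut[of d c k] uX_def[of d c "Suc k"] by (rule pr_mono) (meson z_cut le_less_trans)

lemma uX_mono: "x \<le> y ==> uX d c k x \<le> uX d c k y"
 unfolding uX_def by (rule pr_mono) auto

lemma uX_bounds: "0 \<le> uX d c k x" "uX d c k x \<le> 1"
 by (auto simp: uX_def)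

lemma pr_ge: "pr (gw d c k) (\<lambda>T. z T \<ge> x) = 1 - uX d c k x"
 unfolding uX_def pr_compl[symmetric] by (simp add: not_less)

lemma sum_list_pair: "(\<Sum>x\<leftarrow>xs. (f x, g x)) = ((\<Sum>x\<leftarrow>xs. f x), (\<Sum>x\<leftarrow>xs. g x))"
 by (induction xs) (auto simp: zero_prod_def)

lemma sum_list_of_bool_zero: "(\<Sum>x\<leftarrow>xs. of_bool (Q x)) = (0 :: real) \<longleftrightarrow> (\<forall>x\<in>set xs. \<not> Q x)"
proof (induction xs)
 case (Cons x xs)
 have "(\<Sum>x\<leftarrow>xs. of_bool (Q x)) \<ge> (0 :: real)" by (intro sum_list_nonneg) auto
 thus ?case using Cons by auto
qed auto

lemma share_bounds: "0 \<le> z T / (z T + (\<Sum>T\<leftarrow>l. z T))" "z T / (z T + (\<Sum>T\<leftarrow>l. z T)) \<le> 1"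
 using z_pos[of T] sum_z_nonneg[of l] by auto

text \<open>By exchangeability, each of \<open>d + 1\<close> independent weights carries the same share of their sum.\<close>
lemma exchangeable_share:
  "mean (pair_pmf (gw d c k) (replicate_pmf d (gw d c k)))
  (\<lambda>(T, l). z T / (z T + (\<Sum>T\<leftarrow>l. z T)) * of_bool (P T \<and> (\<forall>T\<in>set l. P T)))
  = pr (gw d c k) P ^ (d + 1) / (d + 1)"
proof -
 let ?M = "gw d c k" and ?f = "\<lambda>(T, l). z T / (z T + (\<Sum>T\<leftarrow>l. z T)) * of_bool (P T \<and> (\<forall>T\<in>set l. P T))"
 define H :: "tr => real \<times> real => ennreal" where
  "H x sj = ennreal (z x / (z x + fst sj)) * of_bool (P x \<and> snd sj = 0)" for x sj
 define w :: "tr => real \<times> real" where "w x = (z x, of_bool (\<not> P x))" for x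
 have W: "(\<Sum>y\<leftarrow>xs. w y) = ((\<Sum>y\<leftarrow>xs. z y), (\<Sum>y\<leftarrow>xs. of_bool (\<not> P y)))" for xs
  by (simp add: w_def sum_list_pair)
 have Wx: "(\<Sum>y\<leftarrow>xs. w y) - w x = ((\<Sum>y\<leftarrow>xs. z y) - z x, (\<Sum>y\<leftarrow>xs. of_bool (\<not> P y)) - of_bool (\<not> P x))" for xs x
  by (simp only: W) (simp add: w_def)
 have "ennreal (pr ?M P ^ (d + 1)) = nnE (replicate_pmf (Suc d) ?M) (\<lambda>xs. of_bool (\<forall>x\<in>set xs. P x))"
  unfolding nn_replicate_all by simp
 also have "... = nnE (replicate_pmf (Suc d) ?M) (\<lambda>xs. (\<Sum>x\<leftarrow>xs. H x ((\<Sum>y\<leftarrow>xs. w y) - w x)))"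
 proof (intro nn_integral_cong_AE, unfold AE_measure_pmf_iff, intro ballI)
  fix xs assume "xs \<in> set_pmf (replicate_pmf (Suc d) ?M)"
  hence ne: "xs \<noteq> []" by auto
  define Z where "Z = (\<Sum>y\<leftarrow>xs. z y)"
  have Zp: "Z > 0" using sum_z_pos[OF ne] by (simp add: Z_def)
  show "of_bool (\<forall>x\<in>set xs. P x) = (\<Sum>x\<leftarrow>xs. H x ((\<Sum>y\<leftarrow>xs. w y) - w x))"
  proof (cases "\<forall>x\<in>set xs. P x")
   case True
   have j: "(\<Sum>y\<leftarrow>xs. of_bool (\<not> P y)) = (0 :: real)" using True by (simp add: sum_list_of_bool_zero)
   have "(\<Sum>x\<leftarrow>xs. H x ((\<Sum>y\<leftarrow>xs. w y) - w x)) = (\<Sum>x\<leftarrow>xs. ennreal (z x / Z))"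
    using True j by (intro arg_cong[where f = sum_list] map_cong) (auto simp: H_def Wx Z_def)
   also have "... = ennreal (\<Sum>x\<leftarrow>xs. z x / Z)" using Zp z_nonneg by simp
   also have "(\<Sum>x\<leftarrow>xs. z x / Z) = (\<Sum>x\<leftarrow>xs. z x * (1 / Z))" by simp
   also have "... = (\<Sum>x\<leftarrow>xs. z x) * (1 / Z)" by (rule sum_list_mult_const)
   also have "... = 1" using Zp by (simp add: Z_def[symmetric])
   finally show ?thesis using True by simp
  next
   case False
   have "(\<Sum>y\<leftarrow>xs. of_bool (\<not> P y)) \<noteq> (0 :: real)" using False by (simp add: sum_list_of_bool_zero)
   hence "(\<Sum>x\<leftarrow>xs. H x ((\<Sum>y\<leftarrow>xs. w y) - w x)) = (\<Sum>x\<leftarrow>xs. 0)"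
    by (intro arg_cong[where f = sum_list] map_cong) (auto simp: H_def Wx)
   also have "(\<Sum>x\<leftarrow>xs. 0) = (0 :: ennreal)" by simp
   finally show ?thesis using False by auto
  qed
 qed
 also have "... = of_nat (Suc d) * nnE ?M (\<lambda>x. nnE (replicate_pmf d ?M) (\<lambda>xs. H x (\<Sum>y\<leftarrow>xs. w y)))"
  unfolding nn_replicate_single by simp
 also have "nnE ?M (\<lambda>x. nnE (replicate_pmf d ?M) (\<lambda>xs. H x (\<Sum>y\<leftarrow>xs. w y)))
  = nnE (pair_pmf ?M (replicate_pmf d ?M)) (\<lambda>x. ennreal (?f x))"
  unfolding nn_integral_pair_pmf'
  by (intro nn_integral_cong) (auto simp: H_def W sum_list_of_bool_zero)
 also have "... = ennreal (mean (pair_pmf ?M (replicate_pmf d ?M)) ?f)"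
  using share_bounds by (intro nn_expectation[where B = 1]) (auto simp: of_bool_def split: prod.splits)
 finally have "ennreal (pr ?M P ^ (d + 1)) = ennreal (real (Suc d) * mean (pair_pmf ?M (replicate_pmf d ?M)) ?f)"
  by (simp add: ennreal_mult' ennreal_of_nat_eq_real_of_nat)
 moreover have "mean (pair_pmf ?M (replicate_pmf d ?M)) ?f \<ge> 0"
  using share_bounds by (intro integral_nonneg_AE) (auto intro!: AE_I2 split: prod.splits)
 ultimately have "pr ?M P ^ (d + 1) = real (Suc d) * mean (pair_pmf ?M (replicate_pmf d ?M)) ?f"
  by simp
 thus ?thesis by simp
qed

lemma pr_pair_and: "pr (pair_pmf A B) (\<lambda>(x, y). P x \<and> Q y) = pr A P * pr B Q"
proof (rule pr_eqI)
 have "nnE (pair_pmf A B) (\<lambda>x. of_bool (case x of (x, y) => P x \<and> Q y))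
  = nnE A (\<lambda>x. nnE B (\<lambda>y. of_bool (P x) * of_bool (Q y)))"
  by (simp add: nn_integral_pair_pmf' of_bool_conj)
 also have "... = ennreal (pr A P) * ennreal (pr B Q)"
  by (simp add: nn_integral_cmult nn_integral_multc nn_pr)
 finally show "nnE (pair_pmf A B) (\<lambda>x. of_bool (case x of (x, y) => P x \<and> Q y)) = ennreal (pr A P * pr B Q)"
  by (simp add: ennreal_mult)
qed simp

lemma expectation_of_bool: "mean M (\<lambda>x. of_bool (P x)) = pr M P"
proof -
 have "mean M (\<lambda>x. of_bool (P x)) = mean M (indicator {x. P x})"
  by (intro arg_cong[where f = "mean _"]) (auto simp: indicator_def)
 also have "... = pr M P" by (simp add: pr_def)
 finally show ?thesis .
qed

lemma pr_fst: "pr (pair_pmf A B) (\<lambda>(x, y). P x) = pr A P"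
 using pr_pair_and[of A B P "\<lambda>_. True"] by (auto simp: pr_def)

text \<open>Replaces the weight \<open>a\<close> of the deeper tree by the weight \<open>b\<close> of its truncation, at a cost that vanishes in the limit of
  deep trees.\<close>
lemma share_pointwise:
 fixes a b S e e' :: real
 assumes "0 < a" "a \<le> b" "0 < S" "0 < e"
 shows "gq e S a \<ge> of_bool (b \<ge> 2 * e \<and> S \<ge> 2 * e) * (b / (b + S)) - of_bool (a < 2 * e \<and> b \<ge> 2 * e) - (b - a) / (2 * e)"
proof (cases "b \<ge> 2 * e \<and> S \<ge> 2 * e")
 case False
 have "gq e S a \<ge> 0" using assms gq_bounds[of a S e] by auto
 moreover have "(b - a) / (2 * e) \<ge> 0" using assms by simp
 ultimately show ?thesis using False by auto
next
 case True
 show ?thesis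
 proof (cases "a < 2 * e")
  case a: True
  have "gq e S a \<ge> 0" using assms gq_bounds[of a S e] by auto
  moreover have "(b - a) / (2 * e) \<ge> 0" using assms by simp
  moreover have "b / (b + S) \<le> 1" using assms by simp
  ultimately show ?thesis using a by auto
 next
  case False
  have "e * (a + S) \<le> a * S"
  proof -
   have "0 \<le> (a - e) * (S - e) - e * e"
   proof -
    have "e * e \<le> (a - e) * (S - e)" using False True assms by (intro mult_mono) auto
    thus ?thesis by simp
   qed
   thus ?thesis by (simp add: algebra_simps)
  qed
  hence g: "gq e S a = a / (a + S)" using assms by (simp add: gq_def pos_le_divide_eq)
  have "b / (b + S) - a / (a + S) = (b * (a + S) - a * (b + S)) / ((b + S) * (a + S))"
   using assms by (intro diff_frac_eq) auto
  also have "b * (a + S) - a * (b + S) = (b - a) * S" by (simp add: algebra_simps)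
  also have "(b - a) * S / ((b + S) * (a + S)) = (b - a) * (S / ((a + S) * (b + S)))"
   by simp
  also have "... \<le> (b - a) * (1 / (2 * e))"
  proof (intro mult_left_mono)
   have "(2 * e) * S \<le> (a + S) * (b + S)" using assms False by (intro mult_mono) auto
   hence "S / ((a + S) * (b + S)) \<le> S / ((2 * e) * S)" using assms by (intro frac_le) auto
   thus "S / ((a + S) * (b + S)) \<le> 1 / (2 * e)" using assms by simp
  qed (use assms in auto)
  finally show ?thesis using True g by simp
 qed
qed

text \<open>Removes the cut-off for the sum \<open>S\<close>: \<open>Q\<close> says that all weights in the sum are below \<open>2 * e\<close>, and if the sum is not small
  then a weight below \<open>e'\<close> has a negligible share.\<close>
lemma share_pointwise2:
 fixes b S e e' :: real
 assumes "0 < b" "0 < S" "0 < e" "0 < e'" and all: "S < 2 * e ==> Q" and nall: "\<not> Q ==> S \<ge> 2 * e"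
 shows "of_bool (b \<ge> 2 * e \<and> S \<ge> 2 * e) * (b / (b + S)) \<ge>
  b / (b + S) - b / (b + S) * of_bool (b < 2 * e \<and> Q) - of_bool (b \<ge> 2 * e \<and> Q)
  - e' / (2 * e) - of_bool (e' \<le> b \<and> b < 2 * e)"
proof -
 have r: "0 \<le> b / (b + S)" "b / (b + S) \<le> 1" "e' / (2 * e) \<ge> 0" using assms by auto
 show ?thesis
 proof (cases "b \<ge> 2 * e")
  case True
  show ?thesis using True r all by simp
 next
  case False
  show ?thesis
  proof (cases Q)
   case True thus ?thesis using r by auto
  next
   case nA: False
   show ?thesis
   proof (cases "e' \<le> b")
    case True thus ?thesis using False r nA by auto
   next
    case b: False
    have "b / (b + S) \<le> e' / (2 * e)" using b nall[OF nA] assms by (intro frac_le) auto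
    thus ?thesis using False nA b by simp
   qed
  qed
 qed
qed

text \<open>The lower bound in \<open>share_lower\<close>: \<open>u\<close>, \<open>v\<close> are the probabilities of weights below \<open>2 * e\<close>, \<open>e'\<close>, and \<open>w\<close>, \<open>h\<close> account for the change from depth
  \<open>k\<close> to \<open>Suc k\<close>.\<close>
definition share :: "nat => real => real => real => real => real => real => real" where
 "share d e e' u v w h = (1 - u ^ (d + 1)) / (d + 1) - (1 - u) * u ^ d - e' / (2 * e) - (u - v) - (w - u) - h / (2 * e)"

text \<open>The expected share of one among \<open>d + 1\<close> weights, restricted to weights that do not degenerate.  The root has depth
  \<open>Suc k\<close> and the others \<open>k\<close>, so exchangeability applies after truncating the root.\<close>
lemma share_lower:
 fixes k :: nat
 assumes c: "c > 0" and d: "d \<ge> 1" and e: "e > 0" "e' > 0" "e' \<le> 2 * e"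
 defines "u \<equiv> uX d c k (2 * e)"
 shows "mean (pair_pmf (gw d c (Suc k)) (replicate_pmf d (gw d c k)))
  (\<lambda>(T, l). gq e (\<Sum>T\<leftarrow>l. z T) (z T))
  \<ge> share d e e' u (uX d c k e') (uX d c (Suc k) (2 * e)) (eX d c k - eX d c (Suc k))"
proof -
 let ?G = "gw d c k" and ?G' = "gw d c (Suc k)" and ?R = "replicate_pmf d (gw d c k)"
 let ?E = "mean"
 let ?S = "\<lambda>l. (\<Sum>T\<leftarrow>l. z T)"
 define all where "all l = (\<forall>T\<in>set l. z T < 2 * e)" for l
 define sh where "sh = (\<lambda>(T, l). z T / (z T + ?S l))"
 define f2 where "f2 = (\<lambda>(T, l). z T / (z T + ?S l) * of_bool (z T < 2 * e \<and> all l))"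
 define f3 where "f3 = (\<lambda>x. of_bool (case x of (T, l) => z T \<ge> 2 * e \<and> all l) :: real)"
 define f5 where "f5 = (\<lambda>x. of_bool (case x of (T, l :: tr list) => e' \<le> z T \<and> z T < 2 * e) :: real)"
 define p where "p x = sh x - f2 x - f3 x - e' / (2 * e) - f5 x" for x
 have shb: "0 \<le> sh x" "sh x \<le> 1" for x
  using z_pos[of "fst x"] sum_z_nonneg[of "snd x"] by (auto simp: sh_def split: prod.splits)
 have f2b: "\<bar>f2 x\<bar> \<le> 1" for x
 proof -
  have "f2 x = sh x \<or> f2 x = 0" by (auto simp: f2_def sh_def split: prod.splits)
  thus ?thesis using shb[of x] by auto
 qed
 have int: "integrable (measure_pmf M) sh" "integrable (measure_pmf M) f2" "integrable (measure_pmf M) f3" "integrable (measure_pmf M) f5" for M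
  using shb f2b by (auto intro!: bdd_integrable[where B = 1] simp: f3_def f5_def)
 have Ep: "?E (pair_pmf ?G ?R) p = (1 - u ^ (d + 1)) / (d + 1) - (1 - u) * u ^ d - e' / (2 * e) - (u - uX d c k e')"
 proof -
  let ?A = "pair_pmf ?G ?R"
  have 1: "?E ?A sh = 1 / (d + 1)"
   using exchangeable_share[of d c k "\<lambda>_. True"] by (simp add: sh_def pr_def)
  have 2: "?E ?A f2 = u ^ (d + 1) / (d + 1)"
   using exchangeable_share[of d c k "\<lambda>T. z T < 2 * e"] by (simp add: f2_def all_def u_def uX_def)
  have 3: "?E ?A f3 = (1 - u) * u ^ d"
   unfolding f3_def expectation_of_bool pr_pair_and pr_ge all_def pr_replicate_all u_def uX_def ..
  have 5: "?E ?A f5 = u - uX d c k e'"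
  proof -
   have "?E ?A f5 = pr ?G (\<lambda>T. e' \<le> z T \<and> z T < 2 * e)"
    unfolding f5_def expectation_of_bool by (rule pr_fst)
   also have "... = measure_pmf.prob ?G ({T. z T < 2 * e} - {T. z T < e'})"
    unfolding pr_def by (intro arg_cong[where f = "measure_pmf.prob _"]) auto
   also have "... = u - uX d c k e'"
    unfolding u_def uX_def pr_def using e by (intro measure_pmf.finite_measure_Diff) auto
   finally show ?thesis .
  qed
  have "?E ?A p = ?E ?A sh - ?E ?A f2 - ?E ?A f3 - e' / (2 * e) - ?E ?A f5"
   unfolding p_def using int by simp
  thus ?thesis unfolding 1 2 3 5 by (simp add: diff_divide_distrib)
 qed
 have cutpair: "map_pmf (apfst (cut k)) (pair_pmf ?G' ?R) = pair_pmf ?G ?R"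
  unfolding pair_map_pmf1[symmetric] map_cut_gw ..
 define g1 where "g1 = (\<lambda>x. of_bool (case x of (T, l :: tr list) => z T < 2 * e \<and> z (cut k T) \<ge> 2 * e) :: real)"
 define g2 where "g2 = (\<lambda>(T, l :: tr list). (z (cut k T) - z T) / (2 * e))"
 have Eg1: "?E (pair_pmf ?G' ?R) g1 = uX d c (Suc k) (2 * e) - u"
 proof -
  have "?E (pair_pmf ?G' ?R) g1 = pr ?G' (\<lambda>T. z T < 2 * e \<and> z (cut k T) \<ge> 2 * e)"
   unfolding g1_def expectation_of_bool by (rule pr_fst)
  also have "... = measure_pmf.prob ?G' ({T. z T < 2 * e} - {T. z (cut k T) < 2 * e})"
   unfolding pr_def by (intro arg_cong[where f = "measure_pmf.prob _"]) auto
  also have "... = uX d c (Suc k) (2 * e) - u"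
   unfolding u_def uX_cut[of d c k] uX_def[of d c "Suc k"] pr_def using z_cut
   by (intro measure_pmf.finite_measure_Diff) (auto intro: le_less_trans)
  finally show ?thesis .
 qed
 have Eg2: "?E (pair_pmf ?G' ?R) g2 = (eX d c k - eX d c (Suc k)) / (2 * e)"
 proof -
  have "?E (pair_pmf ?G' ?R) g2 = ?E (pair_pmf ?G' ?R) (\<lambda>x. (\<lambda>T. (z (cut k T) - z T) / (2 * e)) (fst x))"
   by (simp add: g2_def case_prod_unfold)
  also have "... = ?E ?G' (\<lambda>T. (z (cut k T) - z T) / (2 * e))" by (rule expectation_pair_pmf_fst)
  also have "... = (?E ?G' (\<lambda>T. z (cut k T)) - ?E ?G' z) / (2 * e)"
   using z_integrable[of ?G'] by simp
  finally show ?thesis by (simp add: eX_cut[of d c k] eX_def[of d c "Suc k"])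
 qed
 have "\<bar>p x\<bar> \<le> 4 + e' / (2 * e)" for x
 proof -
  have b: "0 \<le> f3 x" "f3 x \<le> 1" "0 \<le> f5 x" "f5 x \<le> 1" "e' / (2 * e) \<ge> 0" using e by (auto simp: f3_def f5_def)
  show ?thesis unfolding p_def using shb[of x] f2b[of x] b by linarith
 qed
 hence i1: "integrable (measure_pmf (pair_pmf ?G' ?R)) (\<lambda>x. p (apfst (cut k) x))" by (rule bdd_integrable)
 have i2: "integrable (measure_pmf (pair_pmf ?G' ?R)) g1"
  by (rule bdd_integrable[where B = 1]) (auto simp: g1_def)
 have i3: "integrable (measure_pmf (pair_pmf ?G' ?R)) g2"
 proof (rule bdd_integrable[where B = "1 / e"])
  fix x :: "tr \<times> tr list"
  show "\<bar>g2 x\<bar> \<le> 1 / e" using z_abs[of "cut k (fst x)"] z_abs[of "fst x"] e by (auto simp: g2_def field_simps split: prod.splits)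
 qed
 have "?E (pair_pmf ?G' ?R) (\<lambda>x. p (apfst (cut k) x) - g1 x - g2 x) \<le> ?E (pair_pmf ?G' ?R) (\<lambda>(T, l). gq e (?S l) (z T))"
 proof (intro integral_mono_AE)
  let ?A = "pair_pmf ?G' ?R"
  show "integrable (measure_pmf ?A) (\<lambda>x. p (apfst (cut k) x) - g1 x - g2 x)"
   using i1 i2 i3 by auto
  show "integrable (measure_pmf ?A) (\<lambda>(T, l). gq e (?S l) (z T))"
   using gq_bounds[OF z_nonneg sum_z_nonneg] by (intro bdd_integrable[where B = 1]) (auto split: prod.splits)
  show "AE x in measure_pmf ?A. p (apfst (cut k) x) - g1 x - g2 x \<le> (case x of (T, l) => gq e (?S l) (z T))"
   unfolding AE_measure_pmf_iff
  proof
   fix x assume x: "x \<in> set_pmf ?A"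
   obtain T l where Tl: "x = (T, l)" by (cases x)
   have l: "l \<noteq> []" using x d by (auto simp: Tl set_replicate_pmf)
   have S: "?S l > 0" by (rule sum_z_pos[OF l])
   have al: "all l" if "?S l < 2 * e"
    unfolding all_def
   proof
    fix T assume "T \<in> set l"
    hence "z T \<le> ?S l" using z_nonneg by (intro member_le_sum_list) auto
    thus "z T < 2 * e" using that by simp
   qed
   have nal: "?S l \<ge> 2 * e" if "\<not> all l" using al that by force
   have "gq e (?S l) (z T) \<ge> of_bool (z (cut k T) \<ge> 2 * e \<and> ?S l \<ge> 2 * e) * (z (cut k T) / (z (cut k T) + ?S l))
    - of_bool (z T < 2 * e \<and> z (cut k T) \<ge> 2 * e) - (z (cut k T) - z T) / (2 * e)"
    by (rule share_pointwise) (use z_pos z_cut S e in auto)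
   moreover have "of_bool (z (cut k T) \<ge> 2 * e \<and> ?S l \<ge> 2 * e) * (z (cut k T) / (z (cut k T) + ?S l)) \<ge> p (cut k T, l)"
    unfolding p_def sh_def f2_def f3_def f5_def prod.case
    by (rule share_pointwise2) (use z_pos S e al nal in auto)
   ultimately show "p (apfst (cut k) x) - g1 x - g2 x \<le> (case x of (T, l) => gq e (?S l) (z T))"
    by (simp add: Tl g1_def g2_def)
  qed
 qed
 moreover have "?E (pair_pmf ?G' ?R) (\<lambda>x. p (apfst (cut k) x) - g1 x - g2 x)
  = ?E (pair_pmf ?G' ?R) (\<lambda>x. p (apfst (cut k) x)) - ?E (pair_pmf ?G' ?R) g1 - ?E (pair_pmf ?G' ?R) g2"
  using i1 i2 i3 by simp
 moreover have "?E (pair_pmf ?G' ?R) (\<lambda>x. p (apfst (cut k) x)) = ?E (pair_pmf ?G ?R) p"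
  unfolding cutpair[symmetric] by (simp)
 ultimately show ?thesis unfolding Ep Eg1 Eg2 share_def by linarith
qed

lemma eX_upper:
 fixes k :: nat
 assumes c: "c > 0" and d: "d \<ge> 1" and e: "e > 0" "e' > 0" "e' \<le> 2 * e"
 defines "u \<equiv> uX d c k (2 * e)"
 shows "eX d c (Suc k) \<le> e + 1 - uX d c (Suc k) e - c * share d e e' u (uX d c k e') (uX d c (Suc k) (2 * e)) (eX d c k - eX d c (Suc k))"
proof -
 let ?G' = "gw d c (Suc k)"
 have "eX d c (Suc k) \<le> mean ?G' (\<lambda>T. e + (if z T \<ge> e then z T else 0))"
  unfolding eX_def using e(1)
  by (intro integral_mono z_integrable[where f = "\<lambda>x. x"] bdd_integrable[where B = "e + 1"])
  (use z_nonneg z_le_1 in \<open>auto intro: add_mono\<close>)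
 also have "... = e + mean ?G' (\<lambda>T. if z T \<ge> e then z T else 0)"
  using z_abs by (subst Bochner_Integration.integral_add) (auto intro!: bdd_integrable[where B = 1] simp del: gw.simps)
 finally have 1: "eX d c (Suc k) \<le> e + mean ?G' (\<lambda>T. if z T \<ge> e then z T else 0)" .
 have "c * share d e e' u (uX d c k e') (uX d c (Suc k) (2 * e)) (eX d c k - eX d c (Suc k))
  \<le> c * mean (pair_pmf ?G' (replicate_pmf d (gw d c k))) (\<lambda>(T, l). gq e (\<Sum>T\<leftarrow>l. z T) (z T))"
  unfolding u_def using c by (intro mult_left_mono share_lower[OF c d e]) auto
 thus ?thesis using 1 real_identity[OF c d, of k e] unfolding pr_ge by linarith
qed

section \<open>The limit of deep trees\<close>

lemma pr_Lam_all:
 assumes "c > 0"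
 shows "pr (Lam d c k) (\<lambda>ss. \<forall>s\<in>set ss. P s) = exp (- c * (1 - pr (nu d c k) P))"
proof (rule pr_eqI)
 have "nnE (Lam d c k) (\<lambda>ss. of_bool (\<forall>s\<in>set ss. P s)) = nnE (poisson_pmf c) (\<lambda>m. ennreal (pr (nu d c k) P ^ m))"
  unfolding Lam_def nn_integral_bind_pmf nn_replicate_all ..
 also have "... = ennreal (exp (- c * (1 - pr (nu d c k) P)))" using assms by (intro nn_poisson_power) auto
 finally show "nnE (Lam d c k) (\<lambda>ss. of_bool (\<forall>s\<in>set ss. P s)) = ennreal (exp (- c * (1 - pr (nu d c k) P)))" .
qed simp

lemma pr_Lam_length: "pr (Lam d c k) (\<lambda>ss. length ss > M) = pr (poisson_pmf c) (\<lambda>m. m > M)"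
proof (rule pr_eqI)
 let ?A = "nnE (Lam d c k) (\<lambda>ss. of_bool (length ss > M))"
 have "?A = nnE (poisson_pmf c) (\<lambda>m. of_bool (m > M))"
  unfolding Lam_def nn_integral_bind_pmf
 proof (intro nn_integral_cong)
  fix m
  have "nnE (replicate_pmf m (nu d c k)) (\<lambda>ss. of_bool (length ss > M))
   = nnE (replicate_pmf m (nu d c k)) (\<lambda>ss. of_bool (m > M))"
   by (intro nn_integral_cong_AE) (auto simp: AE_measure_pmf_iff set_replicate_pmf)
  thus "nnE (replicate_pmf m (nu d c k)) (\<lambda>ss. of_bool (length ss > M)) = of_bool (m > M)"
   by simp
 qed
 thus "?A = ennreal (pr (poisson_pmf c) (\<lambda>m. m > M))"
  by (simp add: nn_pr)
qed simp

lemma pr_gw_Lam: "pr (gw d c (Suc k)) (\<lambda>T. P (z T)) = pr (Lam d c k) (\<lambda>ss. P (Xf ss))"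
 using pr_map[of Xf "Lam d c k" P] pr_map[of z "gw d c (Suc k)" P] by (simp only: map_z_gw)

lemma pr_nu: "pr (nu d c k) P = pr (replicate_pmf d (gw d c k)) (\<lambda>l. P (\<Sum>T\<leftarrow>l. z T))"
 unfolding nu_def by (rule pr_map)

lemma sum_list_le_const:
 fixes f :: "'a => real"
 shows "(\<And>x. x \<in> set xs ==> f x \<le> (b::real)) ==> (\<Sum>x\<leftarrow>xs. f x) \<le> real (length xs) * b"
 by (induction xs) (auto simp: algebra_simps intro: add_mono)

lemma sum_list_less_const:
 fixes f :: "'a => real"
 shows "xs \<noteq> [] ==> (\<And>x. x \<in> set xs ==> f x < (b::real)) ==> (\<Sum>x\<leftarrow>xs. f x) < real (length xs) * b"
proof (induction xs)
 case (Cons x xs)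
 show ?case
  using Cons by (fastforce simp: algebra_simps)
qed auto

lemma pr_nu_lower: assumes "d \<ge> 1" shows "uX d c k (e / d) ^ d \<le> pr (nu d c k) (\<lambda>s. s < e)"
proof -
 let ?A = "(replicate_pmf d (gw d c k))"
 have "uX d c k (e / d) ^ d = pr ?A (\<lambda>l. \<forall>T\<in>set l. z T < e / d)"
  unfolding pr_replicate_all uX_def ..
 also have "... \<le> pr ?A (\<lambda>l. (\<Sum>T\<leftarrow>l. z T) < e)"
 proof (rule pr_mono)
  fix l assume l: "l \<in> set_pmf ?A" "\<forall>T\<in>set l. z T < e / d"
  have len: "length l = d" using l(1) by (auto simp: set_replicate_pmf)
  have "(\<Sum>T\<leftarrow>l. z T) < length l * (e / d)" using l(2) len assms by (intro sum_list_less_const) auto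
  thus "(\<Sum>T\<leftarrow>l. z T) < e" using len assms by simp
 qed
 finally show ?thesis unfolding pr_nu .
qed

lemma pr_nu_upper: "pr (nu d c k) (\<lambda>s. s < e) \<le> uX d c k e ^ d"
proof -
 have "pr (replicate_pmf d (gw d c k)) (\<lambda>l. (\<Sum>T\<leftarrow>l. z T) < e) \<le> pr (replicate_pmf d (gw d c k)) (\<lambda>l. \<forall>T\<in>set l. z T < e)"
 proof (rule pr_mono, intro ballI)
  fix l T assume l: "(\<Sum>T\<leftarrow>l. z T) < e" "T \<in> set l"
  have "z T \<le> (\<Sum>T\<leftarrow>l. z T)" using l(2) z_nonneg by (intro member_le_sum_list) auto
  thus "z T < e" using l(1) by simp
 qed
 thus ?thesis unfolding pr_nu pr_replicate_all uX_def .
qed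

text \<open>A weight of at least \<open>e\<close> needs sums of at least \<open>e\<close> for all child faces, and a sum of \<open>d\<close> weights below \<open>e / d\<close> is below \<open>e\<close>.\<close>
lemma fp_upper:
 assumes c: "c > 0" and d: "d \<ge> 1"
 shows "1 - uX d c (Suc k) e \<le> exp (- c * uX d c k (e / d) ^ d)"
proof -
 have "1 - uX d c (Suc k) e = pr (Lam d c k) (\<lambda>ss. Xf ss \<ge> e)"
  unfolding pr_ge[symmetric] by (rule pr_gw_Lam)
 also have "... \<le> pr (Lam d c k) (\<lambda>ss. \<forall>s\<in>set ss. s \<ge> e)"
 proof (rule pr_mono, intro ballI)
  fix ss s assume ss: "ss \<in> set_pmf (Lam d c k)" "Xf ss \<ge> e" and s: "s \<in> set ss"
  have pos: "s > 0" if "s \<in> set ss" for s using set_Lam[OF d ss(1) that] .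
  have "1 / s \<le> (\<Sum>s\<leftarrow>ss. 1 / s)" using s pos by (intro member_le_sum_list) (auto intro: less_imp_le)
  hence "Xf ss \<le> 1 / (1 / s)" unfolding Xf_def using pos[OF s] by (intro frac_le) auto
  thus "s \<ge> e" using ss(2) by simp
 qed
 also have "... \<le> exp (- c * uX d c k (e / d) ^ d)" using c pr_nu_lower[OF d, of c k e] unfolding pr_Lam_all[OF c] pr_compl[symmetric] by (simp add: not_le)
 finally show ?thesis .
qed

text \<open>Conversely, at most \<open>M\<close> child faces with sums at least \<open>e\<close> leave a weight of at least \<open>e / (1 + M)\<close>.\<close>
lemma fp_lower:
 assumes c: "c > 0" and d: "d \<ge> 1" and e: "0 < e" "e \<le> 1"
 shows "1 - uX d c (Suc k) (e / (1 + real M)) \<ge> exp (- c * uX d c k e ^ d) - pr (poisson_pmf c) (\<lambda>m. m > M)"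
proof -
 have "exp (- c * uX d c k e ^ d) \<le> pr (Lam d c k) (\<lambda>ss. \<forall>s\<in>set ss. s \<ge> e)" using c pr_nu_upper[of d c k e] unfolding pr_Lam_all[OF c] pr_compl[symmetric] by (simp add: not_le)
 also have "... \<le> pr (Lam d c k) (\<lambda>ss. Xf ss \<ge> e / (1 + real M) \<or> length ss > M)"
 proof (rule pr_mono)
  fix ss assume ss: "ss \<in> set_pmf (Lam d c k)" "\<forall>s\<in>set ss. s \<ge> e"
  show "Xf ss \<ge> e / (1 + real M) \<or> length ss > M"
  proof (cases "length ss > M")
   let ?A = "\<Sum>s\<leftarrow>ss. 1 / s"
   case False
   have "?A \<le> length ss * (1 / e)"
    using ss(2) e by (intro sum_list_le_const frac_le) auto
   also have "... \<le> real M * (1 / e)" using False e by (intro mult_right_mono) auto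
   finally have "1 + ?A \<le> 1 + real M * (1 / e)" by simp
   also have "... \<le> (1 + real M) / e" using e by (simp add: add_divide_distrib)
   finally have a: "1 + ?A \<le> (1 + real M) / e" .
   have "?A \<ge> 0" using ss(2) e by (intro sum_list_nonneg) auto
   hence "1 / ((1 + real M) / e) \<le> Xf ss" unfolding Xf_def using a e by (intro frac_le) auto
   thus ?thesis by simp
  qed auto
 qed
 also have "... \<le> pr (Lam d c k) (\<lambda>ss. Xf ss \<ge> e / (1 + real M)) + pr (Lam d c k) (\<lambda>ss. length ss > M)"
 proof -
  have "{ss. Xf ss \<ge> e / (1 + real M) \<or> length ss > M} = {ss. Xf ss \<ge> e / (1 + real M)} \<union> {ss. length ss > M}" by auto
  thus ?thesis unfolding pr_def by (simp add: measure_Un_le)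
 qed
 also have "pr (Lam d c k) (\<lambda>ss. Xf ss \<ge> e / (1 + real M)) = 1 - uX d c (Suc k) (e / (1 + real M))"
  unfolding pr_ge[symmetric] by (rule pr_gw_Lam[symmetric])
 finally show ?thesis unfolding pr_Lam_length by simp
qed

lemma poisson_tail: "(\<lambda>M. pr (poisson_pmf c) (\<lambda>m. m > M)) \<longlonglongrightarrow> 0"
proof -
 have "(\<lambda>M. measure_pmf.prob (poisson_pmf c) {..M}) \<longlonglongrightarrow> measure_pmf.prob (poisson_pmf c) (\<Union>M. {..M})"
  by (intro measure_pmf.finite_Lim_measure_incseq) (auto simp: incseq_def)
 also have "(\<Union>M. {..M}) = (UNIV :: nat set)" by auto
 finally have "(\<lambda>M. 1 - measure_pmf.prob (poisson_pmf c) {..M}) \<longlonglongrightarrow> 1 - 1" by (intro tendsto_intros) simp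
 moreover have "pr (poisson_pmf c) (\<lambda>m. m > M) = 1 - measure_pmf.prob (poisson_pmf c) {..M}" for M
  using pr_compl[of "poisson_pmf c" "\<lambda>m. m \<le> M"] by (simp add: pr_def not_le atMost_def)
 ultimately show ?thesis by simp
qed

text \<open>As the depth grows, the weights decrease.  With \<open>U\<close> the limiting distribution function, \<open>u = U(0+)\<close> is the limiting
  probability of degenerate weights, and \<open>1 - u\<close> solves the fixed point equation by the two preceding
  bounds.  The bound for the expectation follows from \<open>eX_upper\<close> in the order depth to infinity, then \<open>e\<close> to zero with \<open>e' = e\<^sup>2\<close>.\<close>
lemma gw_limit:
 assumes c: "c > 0" and d: "d \<ge> 1"
 shows "\<exists>t e. 0 \<le> t \<and> t \<le> 1 \<and> t = exp (- c * (1 - t) ^ d) \<and> (\<lambda>k. eX d c k) \<longlonglongrightarrow> e \<and>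
  e \<le> t - c * ((1 - (1 - t) ^ (d + 1)) / (d + 1) - t * (1 - t) ^ d)"
proof -
 let ?A = "poisson_pmf c"
 have "decseq (eX d c)" by (rule decseq_SucI) (rule eX_step)
 then obtain e where e: "eX d c \<longlonglongrightarrow> e" using decseq_convergent[of "eX d c" 0] eX_nonneg by metis
 have "\<exists>l. (\<lambda>k. uX d c k x) \<longlonglongrightarrow> l" for x
  using incseq_convergent[of "\<lambda>k. uX d c k x" 1] uX_step uX_bounds by (metis incseq_SucI)
 then obtain U where U: "\<And>x. (\<lambda>k. uX d c k x) \<longlonglongrightarrow> U x" by metis
 have Ub: "0 \<le> U x" "U x \<le> 1" for x
  using LIMSEQ_le_const[OF U[of x], of 0] LIMSEQ_le_const2[OF U[of x], of 1] uX_bounds by blast+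
 have Um: "U x \<le> U y" if "x \<le> y" for x y
  using LIMSEQ_le[OF U U] uX_mono[OF that] by blast
 \<comment> \<open>The limit of \<open>U\<close> at zero, as \<open>U\<close> is increasing.\<close>
 define u where "u = (INF x\<in>{0<..}. U x)"
 have bb: "bdd_below (U ` {0<..})" using Ub by force
 have u_le: "u \<le> U x" if "x > 0" for x unfolding u_def using that bb by (intro cINF_lower) auto
 have lim: "(U \<longlongrightarrow> u) (at_right 0)"
 proof (rule order_tendstoI)
  fix a assume "a < u"
  hence "\<forall>x>0. a < U x" using u_le by force
  thus "\<forall>\<^sub>F x in at_right 0. a < U x" by (auto simp: eventually_at_filter)
 next
  fix a assume "u < a"
  then obtain x0 where x0: "x0 > 0" "U x0 < a"
   unfolding u_def using bb by (subst (asm) cINF_less_iff) auto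
  have "\<forall>y>0. y < x0 --> U y < a" using x0 Um by (metis le_less_trans less_imp_le)
  thus "\<forall>\<^sub>F x in at_right 0. U x < a" using x0 eventually_at_right_field by blast
 qed
 have scal: "((\<lambda>x. U (r * x)) \<longlongrightarrow> u) (at_right 0)" if "r > 0" for r
 proof -
  have "filterlim (\<lambda>x. r * x) (at_right 0) (at_right 0)" using that by real_asymp
  from filterlim_compose[OF lim this] show ?thesis .
 qed
 have sq: "((\<lambda>x. U (x * x)) \<longlongrightarrow> u) (at_right 0)"
 proof -
  have "filterlim (\<lambda>x::real. x * x) (at_right 0) (at_right 0)" by real_asymp
  from filterlim_compose[OF lim this] show ?thesis .
 qed
 have ub: "0 \<le> u" "u \<le> 1"
 proof -
  show "u \<le> 1" using u_le[of 1] Ub(2)[of 1] by simp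
  show "0 \<le> u" unfolding u_def using Ub by (intro cINF_greatest) auto
 qed
 have S: "(\<lambda>k. f (Suc k)) \<longlonglongrightarrow> l" if "f \<longlonglongrightarrow> l" for f :: "nat => real" and l using that by (rule LIMSEQ_Suc)
 have ntr: "at_right (0::real) \<noteq> bot" by simp
 have fix1: "1 - u \<le> exp (- c * u ^ d)"
 proof -
  have k: "1 - U x \<le> exp (- c * U (x / d) ^ d)" for x
  proof (rule LIMSEQ_le)
   show "(\<lambda>k. 1 - uX d c (Suc k) x) \<longlonglongrightarrow> 1 - U x" by (intro tendsto_intros S U)
   show "(\<lambda>k. exp (- c * uX d c k (x / d) ^ d)) \<longlonglongrightarrow> exp (- c * U (x / d) ^ d)" by (intro tendsto_intros U)
  qed (use fp_upper[OF c d] in auto)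
  show ?thesis
  proof (rule tendsto_le[OF ntr])
   show "((\<lambda>x. 1 - U x) \<longlongrightarrow> 1 - u) (at_right 0)" by (intro tendsto_intros lim)
   have "((\<lambda>x. U (1 / real d * x)) \<longlongrightarrow> u) (at_right 0)" by (rule scal) (use d in simp)
   hence "((\<lambda>x. U (x / real d)) \<longlongrightarrow> u) (at_right 0)" by simp
   thus "((\<lambda>x. exp (- c * U (x / d) ^ d)) \<longlongrightarrow> exp (- c * u ^ d)) (at_right 0)" by (intro tendsto_intros)
  qed (use k in simp)
 qed
 have fix2: "1 - u \<ge> exp (- c * u ^ d)"
 proof -
  let ?C = "exp (- c * u ^ d)"
  have k: "exp (- c * U x ^ d) - pr ?A (\<lambda>m. m > M) \<le> 1 - U (x / (1 + real M))" if "0 < x" "x \<le> 1" for x M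
  proof (rule LIMSEQ_le)
   show "(\<lambda>k. 1 - uX d c (Suc k) (x / (1 + real M))) \<longlonglongrightarrow> 1 - U (x / (1 + real M))" by (intro tendsto_intros S U)
   show "(\<lambda>k. exp (- c * uX d c k x ^ d) - pr ?A (\<lambda>m. m > M)) \<longlonglongrightarrow> exp (- c * U x ^ d) - pr ?A (\<lambda>m. m > M)"
    by (intro tendsto_intros U)
  qed (use fp_lower[OF c d that] in auto)
  have M: "?C - pr ?A (\<lambda>m. m > M) \<le> 1 - u" for M
  proof (rule tendsto_le[OF ntr])
   let ?B = "pr ?A (\<lambda>m. m > M)"
   show "((\<lambda>x. exp (- c * U x ^ d) - ?B) \<longlongrightarrow> ?C - ?B) (at_right 0)"
    by (intro tendsto_intros lim)
   have "((\<lambda>x. U (1 / (1 + real M) * x)) \<longlongrightarrow> u) (at_right 0)" by (rule scal) simp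
   hence "((\<lambda>x. U (x / (1 + real M))) \<longlongrightarrow> u) (at_right 0)" by simp
   thus "((\<lambda>x. 1 - U (x / (1 + real M))) \<longlongrightarrow> 1 - u) (at_right 0)" by (intro tendsto_intros)
   show "\<forall>\<^sub>F x in at_right 0. exp (- c * U x ^ d) - ?B \<le> 1 - U (x / (1 + real M))"
    unfolding eventually_at_right_field using k by (intro exI[of _ 1]) auto
  qed
  have "(\<lambda>M. ?C - pr ?A (\<lambda>m. m > M)) \<longlonglongrightarrow> ?C - 0"
   by (intro tendsto_intros poisson_tail)
  from LIMSEQ_le_const2[OF this] M show ?thesis by auto
 qed
 have up: "e \<le> 1 - u - c * ((1 - u ^ (d + 1)) / (d + 1) - (1 - u) * u ^ d)"
 proof -
  have k: "e \<le> x + 1 - U x - c * share d x (x * x) (U (2 * x)) (U (x * x)) (U (2 * x)) (e - e)"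
   if x: "0 < x" "x \<le> 1" for x
  proof (rule LIMSEQ_le)
   show "(\<lambda>k. eX d c (Suc k)) \<longlonglongrightarrow> e" by (intro S e)
   show "(\<lambda>k. x + 1 - uX d c (Suc k) x - c * share d x (x * x) (uX d c k (2 * x)) (uX d c k (x * x))
    (uX d c (Suc k) (2 * x)) (eX d c k - eX d c (Suc k)))
    \<longlonglongrightarrow> x + 1 - U x - c * share d x (x * x) (U (2 * x)) (U (x * x)) (U (2 * x)) (e - e)"
    unfolding share_def using x by (intro tendsto_intros S[OF U] S[OF e] U e) auto
   show "\<exists>N. \<forall>k\<ge>N. eX d c (Suc k) \<le> x + 1 - uX d c (Suc k) x - c * share d x (x * x) (uX d c k (2 * x)) (uX d c k (x * x))
    (uX d c (Suc k) (2 * x)) (eX d c k - eX d c (Suc k))" using x eX_upper[OF c d x(1), of "x * x"] by auto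
  qed
  let ?f = "\<lambda>x. x + 1 - U x - c * ((1 - U (2 * x) ^ (d + 1)) / (d + 1) - (1 - U (2 * x)) * U (2 * x) ^ d - x / 2 - (U (2 * x) - U (x * x)))"
  have k': "e \<le> ?f x" if "0 < x" "x \<le> 1" for x using k[OF that] that by (simp add: share_def)
  have "(?f \<longlongrightarrow> 0 + 1 - u - c * ((1 - u ^ (d + 1)) / (d + 1) - (1 - u) * u ^ d - 0 / 2 - (u - u))) (at_right 0)"
   by (intro tendsto_intros lim scal sq) auto
  moreover have "\<forall>\<^sub>F x in at_right 0. e \<le> ?f x"
   unfolding eventually_at_right_field using k' by (intro exI[of _ 1]) auto
  ultimately show ?thesis using tendsto_le[OF ntr _ tendsto_const] by fastforce
 qed
 show ?thesis
 proof (rule exI[of _ "1 - u"], rule exI[of _ e], intro conjI)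
  show "1 - u = exp (- c * (1 - (1 - u)) ^ d)" using fix1 fix2 by simp
 qed (use ub e up in auto)
qed

section \<open>The threshold\<close>

text \<open>The density for which \<open>t\<close> is a fixed point (\<open>kap_root\<close>).\<close>
definition kap :: "nat => real => real" where
 "kap d t = - ln t / (1 - t) ^ d"

text \<open>The limiting nullity per \<open>(d - 1)\<close>-face if \<open>t\<close> is the fixed point (\<open>root_value\<close>).  It vanishes at \<open>t_star d\<close>.\<close>
definition Gd :: "nat => real => real" where
 "Gd d t = - ((real d + 1) * (1 - t) + (1 + real d * t) * ln t) / (real d + 1)"

text \<open>The common factor of the derivatives of \<open>kap\<close> and \<open>Gd\<close>.  It increases up to \<open>1 / d\<close> and is positive
  from there on, so both functions decrease and then increase.\<close>
definition slope :: "nat => real => real" where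
 "slope d t = 1 - 1 / t - real d * ln t"

lemma kap_root:
 assumes "0 < t" "t < 1"
 shows "t = exp (- c * (1 - t) ^ d) \<longleftrightarrow> c = kap d t"
proof -
 have p: "(1 - t) ^ d > 0" using assms by simp
 have "t = exp (- c * (1 - t) ^ d) \<longleftrightarrow> ln t = - c * (1 - t) ^ d"
  using assms by (metis exp_ln ln_exp)
 also have "... \<longleftrightarrow> c = kap d t"
 proof -
  have "ln t = - c * y \<longleftrightarrow> c = - ln t / y" if "y > 0" for y
   using that by auto
  from this[OF p] show ?thesis unfolding kap_def .
 qed
 finally show ?thesis .
qed

lemma root_value_aux:
 fixes D t c x :: real
 assumes "D > 0"
 shows "t - c * ((1 - (1 - t) * x) / D - t * x) = 1 - c / D + - (D * (1 - t) + (1 + (D - 1) * t) * (- c * x)) / D"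
 using assms by (simp add: field_simps)

lemma root_value:
 assumes "0 < t" "t = exp (- c * (1 - t) ^ d)"
 shows "t - c * ((1 - (1 - t) ^ (d + 1)) / real (d + 1) - t * (1 - t) ^ d) = 1 - c / real (d + 1) + Gd d t"
proof -
 show ?thesis
  using root_value_aux[of "real d + 1" t c "(1 - t) ^ d"] unfolding Gd_def arg_cong[OF assms(2), of ln]
  by (simp add: add.commute)
qed

lemma Gd_deriv:
 assumes "t > 0"
 shows "(Gd d has_real_derivative slope d t / (real d + 1)) (at t)"
proof -
 have "((\<lambda>t. - ((real d + 1) * (1 - t) + (1 + real d * t) * ln t) / (real d + 1)) has_real_derivative
  - ((real d + 1) * (- 1) + (real d * ln t + (1 + real d * t) * (1 / t))) / (real d + 1)) (at t)"
  using assms by (auto intro!: derivative_eq_intros)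
 moreover have "- ((real d + 1) * (- 1) + (real d * ln t + (1 + real d * t) * (1 / t))) = slope d t"
  using assms by (simp add: slope_def field_simps)
 ultimately show ?thesis unfolding Gd_def[abs_def] by simp
qed

lemma kap_deriv:
 assumes "0 < t" "t < 1"
 shows "(kap d has_real_derivative slope d t / (1 - t) ^ (d + 1)) (at t)"
proof (cases d)
 case 0
 have "kap d = (\<lambda>t. - ln t)" by (auto simp: kap_def 0)
 moreover have "((\<lambda>t. - ln t) has_real_derivative - (1 / t)) (at t)"
  using assms by (auto intro!: derivative_eq_intros)
 moreover have "slope d t / (1 - t) ^ (d + 1) = - (1 / t)" using assms by (simp add: slope_def 0 field_simps)
 ultimately show ?thesis by simp
next
 case (Suc e)
 define x where "x = (1 - t) ^ e"
 have x: "x > 0" using assms by (simp add: x_def)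
 have "((\<lambda>t. (1 - t) ^ d) has_real_derivative real d * ((- 1) * (1 - t) ^ (d - Suc 0))) (at t)"
  by (rule DERIV_power) (auto intro!: derivative_eq_intros)
 moreover have "((\<lambda>t. - ln t) has_real_derivative - (1 / t)) (at t)"
  using assms by (auto intro!: derivative_eq_intros)
 ultimately have "((\<lambda>t. - ln t / (1 - t) ^ d) has_real_derivative
  (- (1 / t) * (1 - t) ^ d - (- ln t) * (real d * ((- 1) * (1 - t) ^ (d - Suc 0)))) / ((1 - t) ^ d * (1 - t) ^ d)) (at t)"
  using assms by (intro DERIV_divide) auto
 moreover have "(- (1 / t) * (1 - t) ^ d - (- ln t) * (real d * ((- 1) * (1 - t) ^ (d - Suc 0)))) / ((1 - t) ^ d * (1 - t) ^ d)
  = slope d t / (1 - t) ^ (d + 1)"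
 proof -
  have n: "- (1 / t) * (1 - t) ^ d - (- ln t) * (real d * ((- 1) * (1 - t) ^ (d - Suc 0))) = x * slope d t"
   using assms by (simp add: Suc x_def[symmetric] slope_def field_simps)
  have m: "(1 - t) ^ d * (1 - t) ^ d = x * (1 - t) ^ (d + 1)"
   by (simp add: Suc x_def)
  show ?thesis unfolding n m using x by simp
 qed
 ultimately show ?thesis unfolding kap_def[abs_def] by simp
qed

lemma slope_deriv: "t > 0 ==> (slope d has_real_derivative (1 - real d * t) / t\<^sup>2) (at t)"
 unfolding slope_def[abs_def]
 by (auto intro!: derivative_eq_intros simp: field_simps power2_eq_square)

context
 fixes d :: nat
 assumes d: "d \<ge> 2"
begin

lemma slope_strict_mono: "0 < s ==> s < t ==> t \<le> 1 / d ==> slope d s < slope d t"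
proof (rule DERIV_pos_imp_increasing_open[of s t])
 fix x assume st: "0 < s" "t \<le> 1 / real d" and x: "s < x" "x < t"
 have "x < 1 / real d" using x st by simp
 hence "real d * x < 1" using d by (simp add: less_divide_eq mult.commute)
 thus "\<exists>y. DERIV (slope d) x :> y \<and> y > 0" using x st slope_deriv[of x d] by fastforce
next
 assume "0 < s"
 thus "continuous_on {s..t} (slope d)"
  by (intro continuous_at_imp_continuous_on ballI DERIV_isCont[OF slope_deriv]) auto
qed auto

lemma slope_pos: "1 / d \<le> t ==> t < 1 ==> slope d t > 0"
proof -
 assume t: "1 / d \<le> t" "t < 1"
 have "1 / real d > 0" using d by simp
 hence t0: "t > 0" using t by linarith
 have "slope d 1 < slope d t"
 proof (rule DERIV_neg_imp_decreasing_open[OF t(2)])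
  fix x assume x: "t < x" "x < 1"
  have "1 / real d < x" using x t by simp
  hence "(1 - real d * x) / x\<^sup>2 < 0" using d x t0 by (simp add: divide_less_eq mult.commute)
  thus "\<exists>y. DERIV (slope d) x :> y \<and> y < 0" using slope_deriv[of x d] x t0 by fastforce
 next
  show "continuous_on {t..1} (slope d)"
   using t0 by (intro continuous_at_imp_continuous_on ballI DERIV_isCont[OF slope_deriv]) auto
 qed
 thus ?thesis by (simp add: slope_def)
qed

lemma t_star: "0 < t_star d" "t_star d < 1" "Gd d (t_star d) = 0"
 using theI'[OF ex1_t_star[OF d]] unfolding t_star_def[symmetric] by (auto simp: Gd_def)

lemma slope_root: "\<exists>y. t_star d < y \<and> y < 1 / d \<and> y < 1 \<and> slope d y = 0"
proof -
 have "\<exists>y>t_star d. y < 1 \<and> DERIV (Gd d) y :> 0"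
 proof (rule Rolle[OF t_star(2)])
  show "Gd d (t_star d) = Gd d 1" using t_star(3) by (simp add: Gd_def)
  show "continuous_on {t_star d..1} (Gd d)"
   using t_star by (intro continuous_at_imp_continuous_on ballI DERIV_isCont[OF Gd_deriv]) auto
  show "Gd d differentiable at x" if "t_star d < x" "x < 1" for x
   using Gd_deriv[of x d] that t_star(1) real_differentiable_def by fastforce
 qed
 then obtain y where x: "y > t_star d" "y < 1" "DERIV (Gd d) y :> 0" by blast
 have s: "slope d y = 0" using DERIV_unique[OF Gd_deriv x(3)] x t_star by auto
 moreover have "y < 1 / d" using slope_pos[of y] x s by force
 ultimately show ?thesis using x by blast
qed

lemma slope_neg: "0 < t ==> t \<le> t_star d ==> slope d t < 0"
proof -
 assume t: "0 < t" "t \<le> t_star d"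
 obtain y where x: "t_star d < y" "y < 1 / d" "slope d y = 0" using slope_root by blast
 show ?thesis using slope_strict_mono[of t y] x t by simp
qed

text \<open>\<open>Gd\<close> vanishes at \<open>t_star d\<close> and at one, and decreases and then increases between them.\<close>
lemma Gd_nonpos:
 assumes "t_star d \<le> t" "t \<le> 1"
 shows "Gd d t \<le> 0"
proof -
 obtain w where x: "t_star d < w" "w < 1 / d" "w < 1" "slope d w = 0" using slope_root by blast
 show ?thesis
 proof (cases "t \<le> w")
  case True
  have "Gd d t \<le> Gd d (t_star d)"
  proof (rule DERIV_nonpos_imp_nonincreasing[OF assms(1)])
   fix y assume y: "t_star d \<le> y" "y \<le> t"
   have "slope d y \<le> 0"
    using slope_strict_mono[of y w] x y True t_star(1) by (cases "y = w") auto
   thus "\<exists>z. DERIV (Gd d) y :> z \<and> z \<le> 0"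
    using Gd_deriv[of y d] y t_star(1) by (intro exI[of _ "slope d y / (real d + 1)"]) (auto simp: divide_nonpos_pos)
  qed
  thus ?thesis using t_star by simp
 next
  case False
  have "Gd d t \<le> Gd d 1"
  proof (rule DERIV_nonneg_imp_nondecreasing[OF assms(2)])
   fix y assume y: "t \<le> y" "y \<le> 1"
   have "slope d y \<ge> 0"
   proof (cases "y = 1")
    case True thus ?thesis by (simp add: slope_def)
   next
    case y1: False
    show ?thesis
    proof (cases "1 / d \<le> y")
     case True thus ?thesis using slope_pos[of y] y y1 by simp
    next
     case yd: False
     have "slope d w < slope d y" using False y yd x t_star(1) by (intro slope_strict_mono) auto
     thus ?thesis using x by simp
    qed
   qed
   thus "\<exists>z. DERIV (Gd d) y :> z \<and> z \<ge> 0"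
    using Gd_deriv[of y d] y assms t_star(1) by auto
  qed
  thus ?thesis by (simp add: Gd_def)
 qed
qed

lemma kap_decreasing: "0 < s ==> s < t ==> t \<le> t_star d ==> kap d t < kap d s"
proof (rule DERIV_neg_imp_decreasing[of s t])
 fix x assume st: "0 < s" "t \<le> t_star d" and x: "s \<le> x" "x \<le> t"
 have x': "0 < x" "x < 1" "x \<le> t_star d" using x st t_star by auto
 have "slope d x / (1 - x) ^ (d + 1) < 0" using slope_neg x' by (intro divide_neg_pos) auto
 thus "\<exists>y. DERIV (kap d) x :> y \<and> y < 0" using kap_deriv[of x d] x' by blast
qed auto

lemma kap_t_star: "kap d (t_star d) = c_star d"
 by (simp add: kap_def c_star_def)

lemma c_star_pos: "c_star d > 0"
 unfolding c_star_def using t_star by (intro divide_pos_pos) auto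

lemma Gd_pos: "0 < t ==> t < t_star d ==> Gd d t > 0"
proof -
 assume t: "0 < t" "t < t_star d"
 have "Gd d (t_star d) < Gd d t"
 proof (rule DERIV_neg_imp_decreasing[OF t(2)])
  fix x assume x: "t \<le> x" "x \<le> t_star d"
  have "slope d x / (real d + 1) < 0" using slope_neg[of x] x t by (intro divide_neg_pos) auto
  thus "\<exists>y. DERIV (Gd d) x :> y \<and> y < 0" using Gd_deriv[of x d] x t by auto
 qed
 thus ?thesis using t_star by simp
qed

text \<open>Below the threshold every fixed point exceeds \<open>t_star d\<close>, as \<open>kap\<close> decreases up to there.\<close>
lemma eX_limit_below:
 assumes c: "0 < c" "c < c_star d"
 shows "\<exists>e. (\<lambda>k. eX d c k) \<longlonglongrightarrow> e \<and> e \<le> 1 - c / (d + 1)"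
proof -
 obtain t e where te: "0 \<le> t" "t \<le> 1" "t = exp (- c * (1 - t) ^ d)" "(\<lambda>k. eX d c k) \<longlonglongrightarrow> e"
  "e \<le> t - c * ((1 - (1 - t) ^ (d + 1)) / (d + 1) - t * (1 - t) ^ d)"
  using gw_limit[OF c(1), of d] d by auto
 have t0: "t > 0" using te(3) by (metis exp_gt_zero)
 have ts: "t_star d \<le> t"
 proof (rule ccontr)
  assume "\<not> ?thesis"
  hence t: "t < t_star d" by simp
  hence "c = kap d t" using kap_root[of t c d] te(3) t0 t_star by auto
  moreover have "kap d t > c_star d" using kap_decreasing[OF t0 t] kap_t_star by simp
  ultimately show False using c by simp
 qed
 show ?thesis using te(5) root_value[OF t0 te(3)] Gd_nonpos[OF ts te(2)] te(4) by auto
qed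

lemma t_root_kap:
 assumes "c > c_star d"
 shows "0 < t_root d c" "t_root d c < t_star d" "kap d (t_root d c) = c"
proof -
 note r = t_root_is_least[OF d assms]
 show "0 < t_root d c" by (rule r(1))
 show k: "kap d (t_root d c) = c" using kap_root[OF r(1,2), of c d] r(3) by simp
 define s where "s = exp (- c)"
 define f where "f t = t - exp (- c * (1 - t) ^ d)" for t
 have cont: "continuous_on A f" for A unfolding f_def by (intro continuous_intros)
 have f0: "f 0 < 0" by (simp add: f_def)
 have fs: "f (t_star d) > 0"
 proof -
  have p: "(1 - t_star d) ^ d > 0" using t_star by simp
  have "exp (- c * (1 - t_star d) ^ d) < exp (ln (t_star d))" using assms p unfolding c_star_def by (simp add: field_simps)
  thus ?thesis using t_star by (simp add: f_def)
 qed
 obtain x where x: "0 \<le> x" "x \<le> t_star d" "f x = 0"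
  using IVT'[of f 0 0 "t_star d"] f0 fs t_star(1) cont[of "{0..t_star d}"] by auto
 have x0: "x > 0" "x < t_star d" using x f0 fs by (auto simp: order_less_le)
 have "t_root d c \<le> x" using x0 x(3) t_star by (intro r(4)) (auto simp: f_def)
 thus "t_root d c < t_star d" using x0 by simp
qed

lemma t_root_of_kap:
 assumes "0 < t" "t < t_star d"
 shows "kap d t > c_star d" "t_root d (kap d t) = t"
proof -
 show c: "kap d t > c_star d" using kap_decreasing[OF assms] kap_t_star by simp
 note r = t_root_kap[OF c]
 show "t_root d (kap d t) = t"
 proof (rule linorder_cases[of "t_root d (kap d t)" t])
  assume "t_root d (kap d t) < t"
  thus ?thesis using kap_decreasing[of "t_root d (kap d t)" t] r assms by auto
 next
  assume "t < t_root d (kap d t)"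
  thus ?thesis using kap_decreasing[of t "t_root d (kap d t)"] r assms by auto
 qed
qed

lemma t_root_antimono:
 assumes "c_star d < c" "c < c'"
 shows "t_root d c' < t_root d c"
proof (rule ccontr)
 assume "\<not> ?thesis"
 hence le: "t_root d c \<le> t_root d c'" by simp
 have c': "c_star d < c'" using assms by simp
 note r = t_root_kap[OF assms(1)] t_root_kap[OF c']
 show False
  using kap_decreasing[of "t_root d c" "t_root d c'"] r le assms by force
qed

text \<open>The claimed densities of the closure and of the nullity, as functions of \<open>c\<close>.\<close>
definition Sd :: "real => real" where "Sd c = (1 - t_root d c) ^ (d + 1)"

definition gd :: "real => real" where "gd c = Gd d (t_root d c)"

lemma Sd_bounds: "c > c_star d ==> 0 \<le> Sd c" "c > c_star d ==> Sd c \<le> 1"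
 using t_root_kap[of c] t_star by (auto simp: Sd_def intro!: power_le_one simp del: power_Suc)

lemma Sd_mono: "c_star d < c ==> c \<le> c' ==> Sd c \<le> Sd c'"
 unfolding Sd_def using t_root_antimono[of c c'] t_root_kap[of c] t_star
 by (cases "c = c'") (auto intro!: power_mono simp del: power_Suc)

lemma gd_pos: "c > c_star d ==> gd c > 0"
 unfolding gd_def using t_root_kap[of c] by (intro Gd_pos) auto

text \<open>By the derivatives, \<open>(d + 1) * gd\<close> is a primitive of \<open>Sd\<close>.  The integral mean of \<open>Sd\<close> lies between its
  values at the end points.\<close>
lemma gd_convex:
 assumes "c_star d < c" "c < c'"
 shows "(c' - c) * Sd c \<le> (d + 1) * (gd c' - gd c)" "(d + 1) * (gd c' - gd c) \<le> (c' - c) * Sd c'"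
proof -
 have c': "c_star d < c'" using assms by simp
 define a b where "a = t_root d c" and "b = t_root d c'"
 have ab: "0 < b" "b < a" "a < t_star d" "kap d a = c" "kap d b = c'"
  using t_root_kap[OF assms(1)] t_root_kap[OF c'] t_root_antimono[OF assms] by (auto simp: a_def b_def)
 have der: "((\<lambda>t. (d + 1) * Gd d t - x * kap d t) has_real_derivative slope d t * (1 - x / (1 - t) ^ (d + 1))) (at t)"
  if "0 < t" "t < 1" for t x
 proof -
  have "((\<lambda>t. (d + 1) * Gd d t - x * kap d t) has_real_derivative
   ((d + 1) * (slope d t / (real d + 1)) - x * (slope d t / (1 - t) ^ (d + 1)))) (at t)"
   using that by (intro DERIV_diff DERIV_cmult Gd_deriv kap_deriv) auto
  moreover have "(d + 1) * (slope d t / (real d + 1)) - x * (slope d t / (1 - t) ^ (d + 1)) = slope d t * (1 - x / (1 - t) ^ (d + 1))"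
   by (auto simp: add.commute right_diff_distrib)
  ultimately show ?thesis by simp
 qed
 have pw: "0 < (1 - s) ^ (d + 1)" "(1 - s) ^ (d + 1) \<le> (1 - t) ^ (d + 1)" if "t \<le> s" "s < 1" for s t :: real
 proof -
  show "0 < (1 - s) ^ (d + 1)" using that by simp
  show "(1 - s) ^ (d + 1) \<le> (1 - t) ^ (d + 1)" using that by (intro power_mono) auto
 qed
 have "(d + 1) * Gd d a - (1 - a) ^ (d + 1) * kap d a \<le> (d + 1) * Gd d b - (1 - a) ^ (d + 1) * kap d b"
 proof (rule DERIV_nonpos_imp_nonincreasing[of b a "\<lambda>t. (d + 1) * Gd d t - (1 - a) ^ (d + 1) * kap d t"])
  fix t assume t: "b \<le> t" "t \<le> a"
  have t': "0 < t" "t < 1" "t \<le> t_star d" using t ab t_star by auto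
  have "slope d t * (1 - (1 - a) ^ (d + 1) / (1 - t) ^ (d + 1)) \<le> 0" using pw[of t a] t t' ab t_star slope_neg[OF t'(1,3)] by (intro mult_nonpos_nonneg) auto
  thus "\<exists>y. DERIV (\<lambda>t. (d + 1) * Gd d t - (1 - a) ^ (d + 1) * kap d t) t :> y \<and> y \<le> 0"
   using der[OF t'(1,2)] by blast
 qed (use ab in auto)
 thus "(c' - c) * Sd c \<le> (d + 1) * (gd c' - gd c)"
  unfolding gd_def Sd_def a_def[symmetric] b_def[symmetric] ab by (simp add: algebra_simps)
 have "(d + 1) * Gd d b - (1 - b) ^ (d + 1) * kap d b \<le> (d + 1) * Gd d a - (1 - b) ^ (d + 1) * kap d a"
 proof (rule DERIV_nonneg_imp_nondecreasing[of b a "\<lambda>t. (d + 1) * Gd d t - (1 - b) ^ (d + 1) * kap d t"])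
  fix t assume t: "b \<le> t" "t \<le> a"
  have t': "0 < t" "t < 1" "t \<le> t_star d" using t ab t_star by auto
  have "slope d t * (1 - (1 - b) ^ (d + 1) / (1 - t) ^ (d + 1)) \<ge> 0" using pw[of b t] t t' slope_neg[OF t'(1,3)] by (intro mult_nonpos_nonpos) auto
  thus "\<exists>y. DERIV (\<lambda>t. (d + 1) * Gd d t - (1 - b) ^ (d + 1) * kap d t) t :> y \<and> y \<ge> 0"
   using der[OF t'(1,2)] by blast
 qed (use ab in auto)
 thus "(d + 1) * (gd c' - gd c) \<le> (c' - c) * Sd c'"
  unfolding gd_def Sd_def a_def[symmetric] b_def[symmetric] ab by (simp add: algebra_simps)
qed

lemma Sd_left:
 assumes "c > c_star d" "e > 0"
 shows "\<exists>c'. c_star d < c' \<and> c' < c \<and> Sd c' \<ge> Sd c - e"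
proof -
 define t where "t = t_root d c"
 have t: "0 < t" "t < t_star d" "kap d t = c" using t_root_kap[OF assms(1)] by (auto simp: t_def)
 have "isCont (\<lambda>x. (1 - x) ^ (d + 1)) t" by simp
 hence "\<forall>\<^sub>F x in at t. (1 - x) ^ (d + 1) > (1 - t) ^ (d + 1) - e"
  unfolding isCont_def using assms(2) by (intro order_tendstoD(1)) auto
 hence "\<forall>\<^sub>F x in at_right t. (1 - x) ^ (d + 1) > (1 - t) ^ (d + 1) - e"
  by (rule filter_leD[OF at_le, rotated]) auto
 moreover have "\<forall>\<^sub>F x in at_right t. x \<in> {t<..<t_star d}" using t by (intro eventually_at_right_real)
 ultimately have "\<forall>\<^sub>F x in at_right t. (1 - x) ^ (d + 1) > (1 - t) ^ (d + 1) - e \<and> x \<in> {t<..<t_star d}"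
  by eventually_elim auto
 then obtain x where x: "(1 - x) ^ (d + 1) > (1 - t) ^ (d + 1) - e" "t < x" "x < t_star d"
  using eventually_happens[of _ "at_right t"] by auto
 have x0: "0 < x" using x t by simp
 note k = t_root_of_kap[OF x0 x(3)]
 show ?thesis using kap_decreasing[OF t(1) x(2)] x t k by (intro exI[of _ "kap d x"]) (auto simp: Sd_def t_def)
qed

text \<open>At large density the claimed nullity is close to its trivial lower bound, faces minus \<open>(d - 1)\<close>-faces.\<close>
lemma gd_at_infinity:
 assumes "e > 0" "c > c_star d"
 shows "\<exists>C>c. gd C \<le> C / (d + 1) - 1 + e"
proof -
 have ev1: "\<forall>\<^sub>F t in at_right 0. t - d * (t * ln t) / (real d + 1) < e" using assms(1) by real_asymp
 moreover have "\<forall>\<^sub>F t in at_right 0. t \<in> {0<..<t_root d c}" using t_root_kap[OF assms(2)] by (intro eventually_at_right_real)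
 ultimately have "\<forall>\<^sub>F t in at_right 0. t - d * (t * ln t) / (real d + 1) < e \<and> t \<in> {0<..<t_root d c}"
  by eventually_elim auto
 then obtain t where t: "t - d * (t * ln t) / (real d + 1) < e" "0 < t" "t < t_root d c"
  using eventually_happens'[OF trivial_limit_at_right_real] by auto
 have tr: "t < t_star d" using t t_root_kap[OF assms(2)] by simp
 have C: "kap d t > c" using kap_decreasing[OF t(2,3)] t_root_kap[OF assms(2)] by simp
 have k: "kap d t + ln t \<ge> 0"
 proof -
  have "(1 - t) ^ d \<le> 1" "(1 - t) ^ d > 0" using t tr t_star by (auto intro!: power_le_one)
  moreover have "- ln t \<ge> 0" using t tr t_star by simp
  ultimately have "- ln t / 1 \<le> - ln t / (1 - t) ^ d" by (intro divide_left_mono) auto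
  thus ?thesis by (simp add: kap_def)
 qed
 have "kap d t / (d + 1) - 1 - Gd d t = (kap d t + ln t) / (real d + 1) - (t - d * (t * ln t) / (real d + 1))"
  unfolding Gd_def by (simp add: field_simps)
 moreover have "(kap d t + ln t) / (real d + 1) \<ge> 0" using k by simp
 ultimately have "gd (kap d t) \<le> kap d t / (d + 1) - 1 + e"
  unfolding gd_def t_root_of_kap(2)[OF t(2) tr] using t(1) by linarith
 thus ?thesis using C by blast
qed

lemma tk_bounds: "0 \<le> tk d c k" "tk d c k \<le> 1" if "c \<ge> 0" for c k
 by (induction k) (use that in auto)

lemma tk_limit:
 assumes c: "c > c_star d"
 shows "tk d c \<longlonglongrightarrow> t_root d c"
proof -
 have c0: "c \<ge> 0" using c c_star_pos by simp
 note r = t_root_is_least[OF d c]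
 have step: "tk d c k \<le> tk d c (Suc k)" for k
 proof (induction k)
  case (Suc k)
  have "(1 - tk d c (Suc k)) ^ d \<le> (1 - tk d c k) ^ d"
   using Suc tk_bounds(2)[OF c0, of "Suc k"] by (intro power_mono) (auto simp del: tk.simps)
  thus ?case using c0 by (simp add: mult_left_mono)
 qed auto
 have up: "tk d c k \<le> t_root d c" for k
 proof (induction k)
  case (Suc k)
  have "(1 - t_root d c) ^ d \<le> (1 - tk d c k) ^ d" using Suc r by (intro power_mono) auto
  hence "tk d c (Suc k) \<le> exp (- c * (1 - t_root d c) ^ d)" using c0 by (simp add: mult_left_mono)
  thus ?case using r(3) by linarith
 qed (use r in auto)
 obtain L where L: "tk d c \<longlonglongrightarrow> L"
  using incseq_convergent[of "tk d c" "t_root d c"] step up by (metis incseq_SucI)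
 have "(\<lambda>k. tk d c (Suc k)) \<longlonglongrightarrow> exp (- c * (1 - L) ^ d)" by (simp, intro tendsto_intros L)
 moreover have "(\<lambda>k. tk d c (Suc k)) \<longlonglongrightarrow> L" using L by (rule LIMSEQ_Suc)
 ultimately have eq: "L = exp (- c * (1 - L) ^ d)" using LIMSEQ_unique by blast
 have "L \<le> t_root d c" using LIMSEQ_le_const2[OF L] up by blast
 moreover have "L > 0" using eq by (metis exp_gt_zero)
 ultimately have "L = t_root d c" using r(4)[of L] eq r(2) by simp
 thus ?thesis using L by simp
qed

end

section \<open>Closure and nullity of the random complex\<close>

lemma card_all_faces: "card (all_faces n k) = n choose (k + 1)"
 unfolding all_faces_def using n_subsets[of "{..<n}" "k + 1"] by simp

lemma all_faces_D: "s \<in> all_faces n d ==> s \<subseteq> {..<n} \<and> card s = d + 1 \<and> finite s"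
 by (auto simp: all_faces_def intro: finite_subset)

lemma finite_subset_faces: "Y \<subseteq> all_faces n d ==> finite Y"
 using finite_all_faces finite_subset by blast

text \<open>A face in \<open>Y\<close> is tested against the others, so that the event does not depend on whether the face is present.\<close>
definition closure_mass :: "nat => nat => real => real" where
 "closure_mass n d p = (\<Sum>s\<in>all_faces n d. PR (all_faces n d) p (\<lambda>Y. s \<in> cl (Y - {s})))"

text \<open>A face is new in the second round with probability \<open>p' - p\<close>, independently of the other faces.\<close>
lemma EE_two_rounds:
 fixes h :: "'a set => real"
 assumes F: "finite F" "s \<in> F" and p: "0 \<le> p" "p \<le> p'" "p' \<le> 1" "p < 1"
 defines "q \<equiv> (p' - p) / (1 - p)"
 shows "EE F p (\<lambda>Y. EE F q (\<lambda>Z. of_bool (s \<in> Z - Y) * h (Y \<union> Z - {s}))) = (p' - p) * EE F p' (\<lambda>S. h (S - {s}))"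
  and "EE F p (\<lambda>Y. EE F q (\<lambda>Z. of_bool (s \<in> Z - Y) * h (Y - {s}))) = (p' - p) * EE F p (\<lambda>S. h (S - {s}))"
proof -
 let ?A = "(\<lambda>S. h (S - {s}))"
 define F' where "F' = F - {s}"
 have F': "F = insert s F'" "s \<notin> F'" "finite F'" using F by (auto simp: F'_def)
 have q: "0 \<le> q" "q \<le> 1" using p by (auto simp: q_def)
 have qp: "(1 - p) * q = p' - p" using p by (simp add: q_def)
 hence qp2: "p + q - p * q = p'" by (simp add: algebra_simps)
 have p1: "p \<le> 1" "0 \<le> p'" using p by auto
 have d2: "Y - {s} = Y" "s \<notin> Y" if "Y \<subseteq> F'" for Y using that F' by auto
 have "EE F p (\<lambda>Y. EE F q (\<lambda>Z. of_bool (s \<in> Z - Y) * h (Y \<union> Z - {s})))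
  = (1 - p) * EE F' p (\<lambda>Y. q * EE F' q (\<lambda>Z. h (Y \<union> Z)))"
  unfolding F'(1) using F'(2,3) p(1) p1 q by (simp add: EE_insert d2 cong: EE_cong)
 also have "... = (p' - p) * EE F' p' h"
  using EE_union[OF F'(3) p(1) p1(1) q, of h] qp by (simp add: qp2)
 also have "EE F' p' h = EE F p' ?A"
  unfolding F'(1) using F'(2,3) p(3) p1 by (simp add: EE_insert d2 algebra_simps cong: EE_cong)
 finally show "EE F p (\<lambda>Y. EE F q (\<lambda>Z. of_bool (s \<in> Z - Y) * h (Y \<union> Z - {s}))) = (p' - p) * EE F p' ?A" .
 have "EE F p (\<lambda>Y. EE F q (\<lambda>Z. of_bool (s \<in> Z - Y) * h (Y - {s}))) = (p' - p) * EE F' p h" using F'(2,3) p(1) p1 q qp unfolding F'(1) by (simp add: EE_insert d2 cong: EE_cong)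
 also have "EE F' p h = EE F p ?A"
  unfolding F'(1) using F'(2,3) p p1 by (simp add: EE_insert d2 algebra_simps cong: EE_cong)
 finally show "EE F p (\<lambda>Y. EE F q (\<lambda>Z. of_bool (s \<in> Z - Y) * h (Y - {s}))) = (p' - p) * EE F p ?A" .
qed

lemma card_filter_sum: "finite A ==> real (card {x \<in> A. P x}) = (\<Sum>x\<in>A. of_bool (P x))"
 by (simp add: Int_def)

text \<open>The expected number of independent cycles is convex in the density: compare the two densities in two rounds, and apply
  \<open>cyc_bounds\<close> to the new faces.\<close>
lemma EE_cyc_increment:
 fixes n d :: nat
 defines "F \<equiv> all_faces n d"
 assumes p: "0 \<le> p" "p \<le> p'" "p' \<le> 1" "p < 1"
 shows "(p' - p) * closure_mass n d p \<le> EE F p' (\<lambda>Y. real (cyc Y)) - EE F p (\<lambda>Y. real (cyc Y))"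
  and "EE F p' (\<lambda>Y. real (cyc Y)) - EE F p (\<lambda>Y. real (cyc Y)) \<le> (p' - p) * closure_mass n d p'"
proof -
 define q where "q = (p' - p) / (1 - p)"
 have finF: "finite F" by (simp add: F_def)
 have q: "0 \<le> q" "q \<le> 1" using p by (auto simp: q_def)
 have "(1 - p) * q = p' - p" using p by (simp add: q_def)
 hence qp: "p + q - p * q = p'" by (simp add: algebra_simps)
 have p1: "p \<le> 1" using p by auto
 have D: "EE F p' (\<lambda>Y. real (cyc Y)) - EE F p (\<lambda>Y. real (cyc Y)) = EE F p (\<lambda>Y. EE F q (\<lambda>Z. real (cyc (Y \<union> Z)) - real (cyc Y)))"
  using EE_union[OF finF p(1) p1 q, of "\<lambda>Y. real (cyc Y)"] qp finF by simp
 have st: "Y \<inter> (Z - Y) = {}" "Y \<union> (Z - Y) = Y \<union> Z" for Y Z :: "nat set set" by auto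
 have b: "real (card {s \<in> Z - Y. s \<in> cl Y}) \<le> real (cyc (Y \<union> Z)) - real (cyc Y)"
  "real (cyc (Y \<union> Z)) - real (cyc Y) \<le> real (card {s \<in> Z - Y. s \<in> cl (Y \<union> Z - {s})})"
  if "Y \<subseteq> F" "Z \<subseteq> F" for Y Z
 proof -
  have "finite Y" "finite (Z - Y)" using that finF finite_subset by (blast, blast)
  from cyc_bounds[OF this st(1)] show "real (card {s \<in> Z - Y. s \<in> cl Y}) \<le> real (cyc (Y \<union> Z)) - real (cyc Y)"
   "real (cyc (Y \<union> Z)) - real (cyc Y) \<le> real (card {s \<in> Z - Y. s \<in> cl (Y \<union> Z - {s})})"
   unfolding st(2) by linarith+
 qed
 have cc: "real (card {s \<in> Z - Y. P s}) = (\<Sum>s\<in>F. of_bool (s \<in> Z - Y) * of_bool (P s))"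
  if "Z \<subseteq> F" for Y Z and P :: "nat set => bool"
 proof -
  have "{s \<in> Z - Y. P s} = {s \<in> F. s \<in> Z - Y \<and> P s}" using that by auto
  thus ?thesis using card_filter_sum[OF finF, of "\<lambda>s. s \<in> Z - Y \<and> P s"] by (simp add: of_bool_conj mult.assoc)
 qed
 have "EE F p (\<lambda>Y. EE F q (\<lambda>Z. real (cyc (Y \<union> Z)) - real (cyc Y)))
  \<le> EE F p (\<lambda>Y. EE F q (\<lambda>Z. \<Sum>s\<in>F. of_bool (s \<in> Z - Y) * of_bool (s \<in> cl (Y \<union> Z - {s}))))"
  using b(2) cc finF by (intro EE_mono) auto
 also have "... = (\<Sum>s\<in>F. EE F p (\<lambda>Y. EE F q (\<lambda>Z. of_bool (s \<in> Z - Y) * of_bool (s \<in> cl (Y \<union> Z - {s})))))"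
  using finF by (simp only: EE_sum)
 also have "... = (\<Sum>s\<in>F. (p' - p) * EE F p' (\<lambda>S. of_bool (s \<in> cl (S - {s}))))"
  unfolding q_def by (intro sum.cong refl EE_two_rounds(1)[OF finF _ p])
 also have "... = (p' - p) * closure_mass n d p'"
  unfolding closure_mass_def F_def EE_indicator sum_distrib_left ..
 finally show "EE F p' (\<lambda>Y. real (cyc Y)) - EE F p (\<lambda>Y. real (cyc Y)) \<le> (p' - p) * closure_mass n d p'"
  unfolding D .
 have clm: "of_bool (s \<in> Z - Y) * of_bool (s \<in> cl (Y - {s})) = (of_bool (s \<in> Z - Y) * of_bool (s \<in> cl Y) :: real)" for s Y Z
  by (cases "s \<in> Y") simp_all
 have "(p' - p) * closure_mass n d p = (\<Sum>s\<in>F. (p' - p) * EE F p (\<lambda>S. of_bool (s \<in> cl (S - {s}))))"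
  unfolding closure_mass_def F_def EE_indicator sum_distrib_left ..
 also have "... = (\<Sum>s\<in>F. EE F p (\<lambda>Y. EE F q (\<lambda>Z. of_bool (s \<in> Z - Y) * of_bool (s \<in> cl (Y - {s})))))"
  unfolding q_def by (intro sum.cong refl EE_two_rounds(2)[OF finF _ p, symmetric])
 also have "... = EE F p (\<lambda>Y. EE F q (\<lambda>Z. \<Sum>s\<in>F. of_bool (s \<in> Z - Y) * of_bool (s \<in> cl Y)))"
  using finF by (simp only: EE_sum clm)
 also have "... \<le> EE F p (\<lambda>Y. EE F q (\<lambda>Z. real (cyc (Y \<union> Z)) - real (cyc Y)))"
 proof (intro EE_mono[OF finF] )
  fix Y Z assume YZ: "Y \<subseteq> F" "Z \<subseteq> F"
  show "(\<Sum>s\<in>F. of_bool (s \<in> Z - Y) * of_bool (s \<in> cl Y)) \<le> real (cyc (Y \<union> Z)) - real (cyc Y)"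
   using b(1)[OF YZ] cc[OF YZ(2), of Y "\<lambda>s. s \<in> cl Y"] by simp
 qed
 finally show "(p' - p) * closure_mass n d p \<le> EE F p' (\<lambda>Y. real (cyc Y)) - EE F p (\<lambda>Y. real (cyc Y))"
  unfolding D .
qed

lemma ip_span_zero:
 assumes "\<And>r. r \<in> Y ==> ip n y (bd r) = 0" "v \<in> fv.span (bd ` Y)"
 shows "ip n y v = 0"
proof (rule fv.span_induct_alt[OF assms(2)])
 show "ip n y 0 = 0" by (simp add: ip_def)
 fix c x w assume x: "x \<in> bd ` Y" and w: "ip n y w = 0"
 have "ip n y ((\<lambda>t. c * x t) + w) = c * ip n y x + ip n y w"
  unfolding ip_def sum_distrib_left by (simp add: distrib_left sum.distrib mult_ac)
 thus "ip n y ((\<lambda>t. c * x t) + w) = 0" using x w assms(1) by auto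
qed

text \<open>The cochain pairs with the boundary of \<open>s\<close> to \<open>\<plusminus>1\<close>, but it annihilates the boundaries of all faces of \<open>Y\<close>.\<close>
lemma not_in_cl_of_coll:
 assumes Y: "Y \<subseteq> all_faces n d" and W: "W \<subseteq> {..<n}" and ev: "ev n Y W {} (zip ts Ts)"
  and ts: "distinct ts" "\<forall>t\<in>set ts. t \<subseteq> W \<and> card t = d" and Ts: "length Ts = length ts" "\<forall>T\<in>set Ts. shape d k T"
  and s: "s \<in> all_faces n d" "s \<subseteq> W" "a \<in> s" and i: "i < length ts" "ts ! i = s - {a}" "coll (Ts ! i)"
 shows "s \<notin> Y" "s \<notin> cl Y"
proof -
 note ec = ev_coll[OF ev Y rooted_zip[OF W ts(1) Ts(1) ts(2) Ts(2)], unfolded cocycle_def]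
 have nY: "r \<notin> Y" if "r \<subseteq> W" for r using ec that by blast
 thus "s \<notin> Y" using s by auto
 have "(s - {a}, Ts ! i) \<in> set (zip ts Ts)" using i Ts by (auto simp: in_set_zip intro!: exI[of _ i])
 then obtain y where y: "y (s - {a}) = 1" "\<And>r. r \<subseteq> W ==> r \<noteq> s - {a} ==> y r = 0"
  "\<And>r. r \<in> Y ==> ip n y (bd r) = 0"
  using ec i(3) by fastforce
 have fin: "finite s" using s(1) all_faces_D by auto
 have "ip n y (bd s) = y (s - {a}) * bd s (s - {a})"
  using s W y(2) by (intro ip_local) auto
 also have "... \<noteq> 0" using y(1) incidence_facet_sq[OF fin s(3)] by auto
 finally show "s \<notin> cl Y" using ip_span_zero[of Y n y "bd s"] y(3) unfolding cl_def by auto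
qed

definition local_bound :: "nat => nat => real => nat => nat => nat => (tr list => real) => real => bool" where
 "local_bound n d c k w r F B \<longleftrightarrow> (\<forall>W ts X. W \<subseteq> {..<n} --> card W = w --> distinct ts --> length ts = r -->
  (\<forall>t\<in>set ts. t \<subseteq> W \<and> card t = d) --> (\<forall>Y\<subseteq>all_faces n d. X Y \<le> 1) -->
  (\<forall>Y Ts. Y \<subseteq> all_faces n d --> length Ts = r --> (\<forall>T\<in>set Ts. shape d k T) --> ev n Y W {} (zip ts Ts) --> X Y \<le> F Ts) -->
  EY d n c X \<le> B)"

lemma local_bound_ex:
 assumes "c > 0" "\<And>Ts. 0 \<le> F Ts" "\<And>Ts. F Ts \<le> 1" "e > 0"
 shows "\<exists>n0. \<forall>n\<ge>n0. local_bound n d c k w r F (mean (replicate_pmf r (gw d c k)) F + e)"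
 unfolding local_bound_def by (rule local_limit) (fact assms)+

lemma local_boundD:
 assumes "local_bound n d c k w r F B" "W \<subseteq> {..<n}" "card W = w" "distinct ts" "length ts = r"
  "\<forall>t\<in>set ts. t \<subseteq> W \<and> card t = d" "\<forall>Y\<subseteq>all_faces n d. X Y \<le> 1"
  "\<forall>Y Ts. Y \<subseteq> all_faces n d --> length Ts = r --> (\<forall>T\<in>set Ts. shape d k T) --> ev n Y W {} (zip ts Ts) --> X Y \<le> F Ts"
 shows "EY d n c X \<le> B"
 by (rule assms(1)[unfolded local_bound_def, THEN spec, THEN spec, THEN spec, THEN mp, THEN mp, THEN mp, THEN mp, THEN mp, THEN mp, THEN mp])
 (fact assms)+

definition facets :: "nat set => nat set list" where
 "facets s = map (\<lambda>a. s - {a}) (sorted_list_of_set s)"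

lemma facets_props:
 assumes "s \<in> all_faces n d"
 shows "distinct (facets s)" "length (facets s) = d + 1" "\<forall>t\<in>set (facets s). t \<subseteq> s \<and> card t = d"
  "set (facets s) = {s - {a} | a. a \<in> s}"
 using all_faces_D[OF assms] by (auto simp: inj_on_def facets_def distinct_map)

text \<open>A face in the closure has no facet that collapses.  For disjoint faces, the trees at all their facets are asymptotically
  independent.\<close>
lemma closure_limit:
 assumes c: "c > 0" and e: "e > 0" and d1: "d \<ge> 1"
 shows "\<exists>n0. \<forall>n\<ge>n0. \<forall>gs. set gs \<subseteq> all_faces n d --> length gs = r --> distinct gs --> disjoint (set gs) -->
  PY d n c (\<lambda>Y. \<forall>g\<in>set gs. g \<in> cl (Y - {g})) \<le> (1 - tk d c k) ^ (r * (d + 1)) + e"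
proof -
 define F where "F Ts = (of_bool (\<forall>T\<in>set Ts. \<not> coll T) :: real)" for Ts
 let ?r = "r * (d + 1)"
 let ?B = "mean (replicate_pmf ?r (gw d c k)) F + e"
 obtain n0 where n0: "\<And>n. n \<ge> n0 ==> local_bound n d c k ?r ?r F ?B"
  using local_bound_ex[OF c _ _ e, of F d k ?r ?r] by (auto simp: F_def)
 have "EY d n c (\<lambda>Y. of_bool (\<forall>g\<in>set gs. g \<in> cl (Y - {g}))) \<le> ?B"
  if n: "n \<ge> n0" and gs: "set gs \<subseteq> all_faces n d" "length gs = r" "distinct gs" "disjoint (set gs)" for n gs
 proof -
  define W where "W = \<Union>(set gs)"
  define ts where "ts = concat (map facets gs)"
  note s = all_faces_D[OF subsetD[OF gs(1)]] and f = facets_props[OF subsetD[OF gs(1)]]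
  have W: "W \<subseteq> {..<n}" "card W = ?r"
   using s gs distinct_card[OF gs(3)] by (auto simp: W_def card_Union_disjoint)
  have sub: "\<forall>t\<in>set ts. t \<subseteq> W \<and> card t = d" using f(3) by (fastforce simp: ts_def W_def)
  have D: "set (facets g) \<inter> set (facets g') = {}" if "g \<in> set gs" "g' \<in> set gs" "g \<noteq> g'" for g g'
  proof (rule ccontr)
   assume "\<not> ?thesis"
   then obtain t where "t \<in> set (facets g)" "t \<in> set (facets g')" by auto
   hence "t \<subseteq> g \<inter> g'" "card t = d" using f(3) that by blast+
   moreover have "g \<inter> g' = {}" using gs(4) that by (auto simp: disjoint_def)
   ultimately show False using d1 by auto
  qed
  have "inj_on facets (set gs)"
  proof (rule inj_onI, rule ccontr)
   fix g g' assume *: "g \<in> set gs" "g' \<in> set gs" "facets g = facets g'" "g \<noteq> g'"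
   show False using D[OF *(1,2,4)] *(3) f(2)[OF *(1)] by auto
  qed
  hence dist: "distinct ts"
   unfolding ts_def using f(1) gs(3) D by (intro distinct_concat) (auto simp: distinct_map)
  have len: "length ts = ?r" using f(2) gs(2) unfolding ts_def by (induction gs arbitrary: r) auto
  show ?thesis
  proof (rule local_boundD[OF n0[OF n] W dist len sub], goal_cases)
   case 2
   show ?case
   proof (intro allI impI)
    fix Y Ts assume Y: "Y \<subseteq> all_faces n d" and Ts: "length Ts = ?r" "\<forall>T\<in>set Ts. shape d k T" and ev: "ev n Y W {} (zip ts Ts)"
    show "of_bool (\<forall>g\<in>set gs. g \<in> cl (Y - {g})) \<le> F Ts"
    proof (cases "\<exists>T\<in>set Ts. coll T")
     case True
     then obtain i where i: "i < length Ts" "coll (Ts ! i)" by (metis in_set_conv_nth)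
     have il: "i < length ts" and lT: "length Ts = length ts" using i Ts len by simp_all
     from nth_mem[OF il] obtain g where g: "g \<in> set gs" "ts ! i \<in> set (facets g)" by (auto simp: ts_def)
     then obtain a where a: "a \<in> g" "ts ! i = g - {a}" using f(4) by auto
     have "g \<notin> Y" "g \<notin> cl Y"
      using not_in_cl_of_coll[OF Y W(1) ev dist sub lT Ts(2) subsetD[OF gs(1) g(1)] _ a(1) il a(2) i(2)] g(1)
      by (auto simp: W_def)
     thus ?thesis using g(1) by (auto simp: F_def)
    qed (auto simp: F_def)
   qed
  qed auto
 qed
 moreover have "mean (replicate_pmf ?r (gw d c k)) F = (1 - tk d c k) ^ ?r"
  unfolding F_def expectation_of_bool pr_replicate_all pr_compl pr_coll[OF c] ..
 ultimately show ?thesis unfolding EE_indicator by auto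
qed

lemma closure_prob_limit:
 assumes "c > 0" "e > 0" "d \<ge> 1"
 shows "\<exists>n0. \<forall>n\<ge>n0. \<forall>g\<in>all_faces n d. PY d n c (\<lambda>Y. g \<in> cl (Y - {g})) \<le> (1 - tk d c k) ^ (d + 1) + e"
proof -
 obtain n0 where n0: "\<And>n gs. n \<ge> n0 ==> set gs \<subseteq> all_faces n d ==> length gs = 1 ==> distinct gs ==> disjoint (set gs) ==>
  PY d n c (\<lambda>Y. \<forall>g\<in>set gs. g \<in> cl (Y - {g})) \<le> (1 - tk d c k) ^ (1 * (d + 1)) + e"
  using closure_limit[OF assms, of 1 k] by blast
 show ?thesis using n0[of _ "[_]"] by auto
qed

lemma closure_pair_limit:
 assumes "c > 0" "e > 0" "d \<ge> 1"
 shows "\<exists>n0. \<forall>n\<ge>n0. \<forall>g\<in>all_faces n d. \<forall>g'\<in>all_faces n d. g \<inter> g' = {} -->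
  PY d n c (\<lambda>Y. g \<in> cl (Y - {g}) \<and> g' \<in> cl (Y - {g'})) \<le> (1 - tk d c k) ^ (2 * (d + 1)) + e"
proof -
 obtain n0 where n0: "\<And>n gs. n \<ge> n0 ==> set gs \<subseteq> all_faces n d ==> length gs = 2 ==> distinct gs ==> disjoint (set gs) ==>
  PY d n c (\<lambda>Y. \<forall>g\<in>set gs. g \<in> cl (Y - {g})) \<le> (1 - tk d c k) ^ (2 * (d + 1)) + e"
  using closure_limit[OF assms, of 2 k] by blast
 show ?thesis
 proof (intro exI[of _ n0] allI ballI impI)
  fix n g g' assume *: "n \<ge> n0" "g \<in> all_faces n d" "g' \<in> all_faces n d" "g \<inter> g' = {}"
  have "g \<noteq> g'" using * all_faces_D[of g n d] by auto
  thus "PY d n c (\<lambda>Y. g \<in> cl (Y - {g}) \<and> g' \<in> cl (Y - {g'})) \<le> (1 - tk d c k) ^ (2 * (d + 1)) + e"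
   using n0[of n "[g, g']"] * by (auto simp: disjoint_def)
 qed
qed

text \<open>The residuals in the local trees bound the rank from below by \<open>rk_ge_trace\<close>.  Where the neighbourhood is no tree, the trivial
  approximation has error one.\<close>
lemma cyc_upper_limit:
 assumes c: "c > 0" and e: "e > 0" and d1: "d \<ge> 1"
 shows "\<exists>n0. \<forall>n\<ge>n0. EY d n c (\<lambda>Y. real (cyc Y)) \<le>
  c / real n * real (n choose (d + 1)) - real (n choose d) + real (n choose d) * (eX d c k + e)"
proof -
 define P where "P Ts = z (hd Ts)" for Ts
 obtain n0 where n0: "\<And>n. n \<ge> n0 ==> local_bound n d c k (d) (1) P (mean (replicate_pmf (1) (gw d c k)) P + e)"
  using local_bound_ex[OF c _ _ e, of P d k "d" "1"] by (auto simp: P_def z_nonneg z_le_1)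
 have E: "mean (replicate_pmf 1 (gw d c k)) P = eX d c k"
  unfolding replicate_pmf_1 by (simp add: P_def eX_def)
 show ?thesis
 proof (intro exI[of _ "max n0 (nat \<lceil>c\<rceil> + 1)"] allI impI)
  fix n assume n: "n \<ge> max n0 (nat \<lceil>c\<rceil> + 1)"
  let ?F = "all_faces n d" and ?I = "all_faces n (d - 1)" and ?p = "c / real n"
  have p: "0 \<le> ?p" "?p \<le> 1" using n c by (auto simp: divide_simps) linarith
  define Tr where "Tr u Y T \<longleftrightarrow> shape d k T \<and> ev n Y u {} [(u, T)]" for u Y T
  define X where "X u Y = (if \<exists>T. Tr u Y T then z (SOME T. Tr u Y T) else 1)" for u Y
  have I: "u \<subseteq> {..<n}" "card u = d" "finite u" if "u \<in> ?I" for u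
   using all_faces_D[OF that] d1 by auto
  have EX: "EE ?F ?p (X u) \<le> eX d c k + e" if u: "u \<in> ?I" for u
   unfolding E[symmetric]
  proof (rule local_boundD[OF n0, of n u "[u]"])
   show "\<forall>Y Ts. Y \<subseteq> ?F --> length Ts = 1 --> (\<forall>T\<in>set Ts. shape d k T) --> ev n Y u {} (zip [u] Ts) --> X u Y \<le> P Ts"
   proof (intro allI impI)
    fix Y Ts assume Ts: "length Ts = 1" "\<forall>T\<in>set Ts. shape d k T" "ev n Y u {} (zip [u] Ts)"
    obtain T where T: "Ts = [T]" using Ts(1) by (cases Ts) auto
    have t: "Tr u Y T" using Ts T by (simp add: Tr_def)
    hence s: "Tr u Y (SOME T. Tr u Y T)" by (rule someI)
    have "[(u, T)] = [(u, SOME T. Tr u Y T)]"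
     using t s I[OF u] shape_wft unfolding Tr_def by (intro ev_unique[where d = d]) (auto simp: rooted_def)
    thus "X u Y \<le> P Ts" using t by (auto simp: X_def P_def T)
   qed
   show "\<forall>Y\<subseteq>?F. X u Y \<le> 1" by (auto simp: X_def z_le_1)
  qed (use n I[OF u] in auto)
  have tr: "real (card ?I) - real (rk Y) \<le> (\<Sum>u\<in>?I. X u Y)" if Y: "Y \<subseteq> ?F" for Y
  proof -
   let ?A = "fv.span (bd ` Y)"
   have "\<exists>y. y \<in> ?A \<and> (\<Sum>r\<in>?I. (of_bool (r = u) - y r)\<^sup>2) \<le> X u Y" if u: "u \<in> ?I" for u
   proof (cases "\<exists>T. Tr u Y T")
    case True
    define T where "T = (SOME T. Tr u Y T)"
    have T: "Tr u Y T" unfolding T_def using True by (rule someI_ex)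
    obtain R where R: "(\<lambda>r. of_bool (r = u)) - R u \<in> ?A" "ip n (R u) (R u) \<le> z T"
     using ev_z[of n Y u "{}" "[(u, T)]" d] T I[OF u] Y d1 shape_wft
     by (auto simp: Tr_def rooted_def residuals_def residual_def)
    have "(\<Sum>r\<in>?I. (of_bool (r = u) - ((\<lambda>r. of_bool (r = u)) - R u) r)\<^sup>2) = (\<Sum>r\<in>?I. (R u r)\<^sup>2)" by simp
    also have "... \<le> (\<Sum>r\<in>Pow {..<n}. (R u r)\<^sup>2)" by (intro sum_mono2) (auto simp: all_faces_def)
    also have "... = ip n (R u) (R u)" by (simp add: ip_def power2_eq_square)
    finally have "(\<Sum>r\<in>?I. (of_bool (r = u) - ((\<lambda>r. of_bool (r = u)) - R u) r)\<^sup>2) \<le> X u Y"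
     using R(2) True by (simp add: X_def T_def)
    thus ?thesis using R(1) by blast
   next
    case False
    have "(\<Sum>r\<in>?I. (of_bool (r = u) - (0 :: nat set => real) r)\<^sup>2) = (\<Sum>r\<in>?I. if r = u then 1 else 0)"
     by (intro sum.cong) auto
    also have "... = 1" using u by simp
    finally show ?thesis using False fv.span_zero by (intro exI[of _ 0]) (simp add: X_def)
   qed
   hence "\<forall>u\<in>?I. \<exists>y. y \<in> ?A \<and> (\<Sum>r\<in>?I. (of_bool (r = u) - y r)\<^sup>2) \<le> X u Y" by simp
   from bchoice[OF this] obtain y where y0: "\<forall>u\<in>?I. y u \<in> ?A \<and> (\<Sum>r\<in>?I. (of_bool (r = u) - y u r)\<^sup>2) \<le> X u Y" by (rule exE)
   have y: "\<And>u. u \<in> ?I ==> y u \<in> ?A"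
    "\<And>u. u \<in> ?I ==> (\<Sum>r\<in>?I. (of_bool (r = u) - y u r)\<^sup>2) \<le> X u Y"
    by (rule bspec[OF y0, THEN conjunct1], assumption) (rule bspec[OF y0, THEN conjunct2], assumption)
   have "(\<Sum>u\<in>?I. 1 - X u Y) \<le> (\<Sum>u\<in>?I. 1 - (\<Sum>r\<in>?I. (of_bool (r = u) - y u r)\<^sup>2))"
    using y(2) by (intro sum_mono) auto
   also have "... \<le> real (rk Y)" using y(1) finite_subset_faces[OF Y] by (intro rk_ge_trace) auto
   finally show ?thesis by (simp add: sum_subtractf)
  qed
  have "EE ?F ?p (\<lambda>Y. real (cyc Y)) \<le> EE ?F ?p (\<lambda>Y. real (card Y) - real (card ?I) + (\<Sum>u\<in>?I. X u Y))"
  proof (intro EE_mono)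
   fix Y assume Y: "Y \<subseteq> ?F"
   show "real (cyc Y) \<le> real (card Y) - real (card ?I) + (\<Sum>u\<in>?I. X u Y)"
    using tr[OF Y] card_eq_cyc_rk[OF finite_subset_faces[OF Y]] by simp
  qed simp
  also have "... = ?p * real (card ?F) - real (card ?I) + (\<Sum>u\<in>?I. EE ?F ?p (X u))"
   using p by (simp add: EE_card)
  also have "(\<Sum>u\<in>?I. EE ?F ?p (X u)) \<le> (\<Sum>u\<in>?I. eX d c k + e)" using EX by (intro sum_mono)
  finally show "EE ?F ?p (\<lambda>Y. real (cyc Y)) \<le> c / real n * real (n choose (d + 1)) - real (n choose d) + real (n choose d) * (eX d c k + e)"
   using d1 by (simp add: card_all_faces)
 qed
qed

text \<open>Boundaries have coordinates only at \<open>(d - 1)\<close>-faces.\<close>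
lemma rk_le:
 assumes "Y \<subseteq> all_faces n d" "d \<ge> 1"
 shows "rk Y \<le> n choose d"
proof -
 let ?I = "all_faces n (d - 1)"
 let ?u = "\<lambda>t r. of_bool (r = t) :: real"
 obtain B where B: "fv.independent B" "finite B" "fv.span B = fv.span (bd ` Y)" "rk Y = card B"
  using rk_basis[OF finite_subset_faces[OF assms(1)]] by blast
 have "bd g \<in> fv.span (?u ` ?I)" if "g \<in> Y" for g
 proof -
  have s: "g \<subseteq> {..<n}" "card g = d + 1" "finite g" using that assms(1) all_faces_D by blast+
  have "bd g = (\<Sum>a\<in>g. (\<lambda>r. (- 1) ^ card {u \<in> g. u < a} * ?u (g - {a}) r))"
  proof
   fix r
   show "bd g r = (\<Sum>a\<in>g. (\<lambda>r. (- 1) ^ card {u \<in> g. u < a} * ?u (g - {a}) r)) r"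
    unfolding sum_fun_apply incidence_def by (intro sum.cong) auto
  qed
  moreover have "g - {a} \<in> ?I" if "a \<in> g" for a using s that assms(2) by (auto simp: all_faces_def)
  ultimately show ?thesis
   by (simp only:) (intro fv.span_sum fv.span_scale fv.span_base, auto)
 qed
 hence "bd ` Y \<subseteq> fv.span (?u ` ?I)" by auto
 hence "fv.span (bd ` Y) \<subseteq> fv.span (?u ` ?I)" by (rule fv.span_minimal) (rule fv.subspace_span)
 hence "B \<subseteq> fv.span (?u ` ?I)" using B(3) fv.span_superset[of B] by auto
 from fv.independent_span_bound[OF _ B(1) this] have "card B \<le> card (?u ` ?I)" by auto
 also have "... \<le> card ?I" by (intro card_image_le) simp
 finally show ?thesis using B(4) assms(2) by (simp add: card_all_faces)
qed

section \<open>Densities above the threshold\<close>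

definition dens :: "nat => real => nat => real" where
 "dens d c n = closure_mass n d (c / real n) / real (n choose (d + 1))"

definition cycd :: "nat => real => nat => real" where
 "cycd d c n = EY d n c (\<lambda>Y. real (cyc Y)) / real (n choose d)"

definition ratio :: "nat => nat => real" where
 "ratio d n = (real n - real d) / (real n * (real d + 1))"

lemma binomial_ratio:
 assumes "n > d"
 shows "real (n choose (d + 1)) = real n * ratio d n * real (n choose d)"
proof -
 obtain m where m: "n = Suc m" using assms by (cases n) auto
 have "real (Suc d) * real (n choose Suc d) = real (n - d) * real (n choose d)" unfolding m Suc_times_binomial binomial_absorb_comp of_nat_mult[symmetric] by simp
 hence e: "(real d + 1) * real (n choose (d + 1)) = (real n - real d) * real (n choose d)"
  using assms by (simp add: add.commute)
 have "real n * ratio d n * real (n choose d) = (real n - real d) * real (n choose d) / (real d + 1)"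
  using assms by (simp add: ratio_def)
 also have "... = real (n choose (d + 1))" unfolding e[symmetric] by simp
 finally show ?thesis by simp
qed

lemma ratio_bounds: "n > d ==> 0 < ratio d n" "ratio d n \<le> 1 / (real d + 1)"
proof -
 show "n > d ==> 0 < ratio d n" by (auto simp: ratio_def)
 show "ratio d n \<le> 1 / (real d + 1)"
 proof (cases "n = 0")
  case False
  hence "(real n - real d) / real n \<le> 1" by simp
  from divide_right_mono[OF this, of "real d + 1"] show ?thesis by (simp add: ratio_def)
 qed (simp add: ratio_def)
qed

lemma ratio_limit: "ratio d \<longlonglongrightarrow> 1 / (real d + 1)"
 unfolding ratio_def[abs_def] by (real_asymp simp: inverse_eq_divide)

lemma cyc_density_increment:
 assumes "0 < a" "a \<le> b"
 shows "eventually (\<lambda>n. (b - a) * ratio d n * dens d a n \<le> cycd d b n - cycd d a n \<and>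
  cycd d b n - cycd d a n \<le> (b - a) * ratio d n * dens d b n) sequentially"
 using eventually_gt_at_top[of "max d (nat \<lceil>b\<rceil>)"]
proof eventually_elim
 case (elim n)
 hence n: "n > d" "real n > b" by (auto, linarith)
 have N: "real (n choose d) > 0" "real (n choose (d + 1)) > 0" using n by simp_all
 have p: "0 \<le> a / real n" "a / real n \<le> b / real n" "b / real n \<le> 1" "a / real n < 1"
  using assms n by (auto simp: divide_simps)
 have k: "(b / real n - a / real n) * closure_mass n d p / real (n choose d) = (b - a) * ratio d n * (closure_mass n d p / real (n choose (d + 1)))" for p
 proof -
  have "(b / real n - a / real n) * closure_mass n d p / real (n choose d)
   = (b - a) / real n * (real (n choose (d + 1)) / real (n choose d)) * (closure_mass n d p / real (n choose (d + 1)))"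
   using N by (simp add: diff_divide_distrib)
  thus ?thesis unfolding binomial_ratio[OF n(1)] N by simp
 qed
 from divide_right_mono[OF EE_cyc_increment(1)[OF p, of n d] less_imp_le[OF N(1)]]
  divide_right_mono[OF EE_cyc_increment(2)[OF p, of n d] less_imp_le[OF N(1)]]
 show ?case unfolding k diff_divide_distrib[of "EE _ _ _"] dens_def cycd_def by blast
qed

lemma dens_nonneg: "dens d c n \<ge> 0"
 unfolding dens_def closure_mass_def by (intro divide_nonneg_nonneg sum_nonneg) auto

lemma eventually_le_limit:
 fixes f :: "nat => real"
 assumes "f \<longlonglongrightarrow> l" "l < B"
 shows "eventually (\<lambda>n. f n \<le> B) sequentially"
 using order_tendstoD(2)[OF assms] by eventually_elim simp

lemma eventually_ge_limit:
 fixes f :: "nat => real"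
 assumes "f \<longlonglongrightarrow> l" "l > B"
 shows "eventually (\<lambda>n. f n \<ge> B) sequentially"
 using order_tendstoD(1)[OF assms] by eventually_elim simp

context
 fixes d :: nat
 assumes d: "d \<ge> 2"
begin

lemma tk_power_close:
 assumes "c > c_star d" "e > 0"
 shows "\<exists>k. (1 - tk d c k) ^ m \<le> (1 - t_root d c) ^ m + e"
proof -
 have "(\<lambda>k. (1 - tk d c k) ^ m) \<longlonglongrightarrow> (1 - t_root d c) ^ m"
  by (intro tendsto_intros tk_limit[OF d assms(1)])
 from eventually_le_limit[OF this, of "(1 - t_root d c) ^ m + e"] assms(2)
 show ?thesis by (auto dest: eventually_happens)
qed

lemma c_pos: "c > c_star d ==> c > 0"
 using c_star_pos[OF d] by simp

lemma dens_upper: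
 assumes c: "c > c_star d" and e: "e > 0"
 shows "eventually (\<lambda>n. dens d c n \<le> Sd d c + e) sequentially"
proof -
 obtain k where k: "(1 - tk d c k) ^ (d + 1) \<le> (1 - t_root d c) ^ (d + 1) + e / 2"
  using tk_power_close[OF c, of "e / 2" "d + 1"] e by auto
 obtain n0 where n0: "\<forall>n\<ge>n0. \<forall>s\<in>all_faces n d. PY d n c (\<lambda>Y. s \<in> cl (Y - {s})) \<le> (1 - tk d c k) ^ (d + 1) + e / 2"
  using closure_prob_limit[OF c_pos[OF c], of "e / 2" d k] e d by auto
 show ?thesis using eventually_ge_at_top[of "max n0 (d + 1)"]
 proof eventually_elim
  case (elim n)
  have "closure_mass n d (c / real n) \<le> (\<Sum>s\<in>all_faces n d. Sd d c + e)"
   unfolding closure_mass_def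
  proof (rule sum_mono)
   fix s assume "s \<in> all_faces n d"
   hence "PY d n c (\<lambda>Y. s \<in> cl (Y - {s})) \<le> (1 - tk d c k) ^ (d + 1) + e / 2" using n0 elim by auto
   thus "PY d n c (\<lambda>Y. s \<in> cl (Y - {s})) \<le> Sd d c + e"
    using k by (simp add: Sd_def[OF d])
  qed
  also have "... = real (n choose (d + 1)) * (Sd d c + e)" by (simp add: card_all_faces)
  finally show ?case using elim by (simp add: dens_def field_simps)
 qed
qed

lemma cycd_below:
 assumes c: "0 < c" "c < c_star d" and h: "h > 0"
 shows "eventually (\<lambda>n. cycd d c n \<le> h) sequentially"
proof -
 obtain e where e: "(\<lambda>k. eX d c k) \<longlonglongrightarrow> e" "e \<le> 1 - c / (d + 1)" using eX_limit_below[OF d c] by blast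
 from eventually_le_limit[OF e(1), of "e + h / 2"] h obtain k where k: "eX d c k \<le> e + h / 2"
  by force
 obtain n0 where n0: "\<forall>n\<ge>n0. EY d n c (\<lambda>Y. real (cyc Y)) \<le>
  c / real n * real (n choose (d + 1)) - real (n choose d) + real (n choose d) * (eX d c k + h / 2)"
  using cyc_upper_limit[OF c(1), of "h / 2" d k] h d by auto
 show ?thesis using eventually_ge_at_top[of "max n0 (d + 1)"]
 proof eventually_elim
  case (elim n)
  hence n: "n > d" "n > 0" by auto
  have "EY d n c (\<lambda>Y. real (cyc Y)) \<le>
   c / real n * real (n choose (d + 1)) - real (n choose d) + real (n choose d) * (eX d c k + h / 2)"
   using n0 elim by auto
  also have "... = (c * ratio d n - 1 + (eX d c k + h / 2)) * real (n choose d)"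
   unfolding binomial_ratio[OF n(1)] using n by (simp add: algebra_simps)
  finally have "cycd d c n \<le> c * ratio d n - 1 + (eX d c k + h / 2)"
   unfolding cycd_def using n by (simp add: pos_divide_le_eq)
  moreover have "c * ratio d n \<le> c * (1 / (real d + 1))" using ratio_bounds(2) c by (intro mult_left_mono) auto
  ultimately show ?case using k e(2) by (simp add: add.commute)
 qed
qed

lemma cycd_ge: "c > 0 ==> eventually (\<lambda>n. cycd d c n \<ge> c * ratio d n - 1) sequentially"
 using eventually_ge_at_top[of "max (nat \<lceil>c\<rceil>) (d + 1)"]
proof eventually_elim
 case (elim n)
 hence n: "n > d" "n > 0" by auto
 have "(c * ratio d n - 1) * real (n choose d) = c / real n * real (n choose (d + 1)) - real (n choose d)"
  unfolding binomial_ratio[OF n(1)] using n by (simp add: algebra_simps)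
 also have "... = EY d n c (\<lambda>Y. real (card Y) - real (n choose d))"
  using elim n by (simp add: EE_card card_all_faces)
 also have "... \<le> EY d n c (\<lambda>Y. real (cyc Y))"
 proof (intro EE_mono)
  fix Y assume Y: "Y \<subseteq> all_faces n d"
  show "real (card Y) - real (n choose d) \<le> real (cyc Y)"
   using card_eq_cyc_rk[OF finite_subset_faces[OF Y]] rk_le[OF Y] d by simp
 qed simp
 finally show ?case unfolding cycd_def using n by (simp add: pos_le_divide_eq)
qed

text \<open>Integrates the upper bound on the closure: on a fine partition, the upper Riemann sum of \<open>Sd\<close> exceeds the increment of \<open>gd\<close> by
  at most the mesh.\<close>
lemma cycd_increment_upper:
 assumes a: "a > c_star d" and b: "a \<le> b" and c: "c > 0"
 shows "eventually (\<lambda>n. cycd d b n - cycd d a n \<le> gd d b - gd d a + c) sequentially"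
proof (cases "a = b")
 case True
 thus ?thesis using c by simp
next
 case False
 hence ab: "a < b" using b by simp
 \<comment> \<open>The mesh \<open>h\<close> bounds the difference of upper and lower sums, as \<open>Sd\<close> is at most one.\<close>
 obtain m where m: "real m * c > 2 * (b - a)" "m > 0"
  using c ab reals_Archimedean3[OF c, rule_format, of "2 * (b - a)"] by force
 define h where "h = (b - a) / real m"
 have h: "h > 0" "h \<le> c / 2" using ab m by (auto simp: h_def divide_simps mult_ac)
 define x where "x j = a + real j * h" for j
 have x0: "x 0 = a" "x m = b" using m by (auto simp: x_def h_def)
 have xs: "x (Suc j) - x j = h" "x j > c_star d" for j
 proof -
  show "x (Suc j) - x j = h" by (simp add: x_def algebra_simps)
  have "real j * h \<ge> 0" using h by simp
  thus "x j > c_star d" using a by (simp add: x_def)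
 qed
 define e where "e = c / (2 * real m)"
 have e: "e > 0" using c m by (simp add: e_def)
 have "eventually (\<lambda>n. cycd d (x j) n - cycd d a n \<le> gd d (x j) - gd d a + h * (Sd d (x j) - Sd d a) + real j * e) sequentially" for j
 proof (induction j)
  case (Suc j)
  have s1: "x j > 0" "x j \<le> x (Suc j)" using c_pos[OF xs(2)] xs(1)[of j] h by auto
  have eh: "e / h > 0" using e h by simp
  show ?case using Suc cyc_density_increment[OF s1, of d] dens_upper[OF xs(2)[of "Suc j"] eh] eventually_gt_at_top[of d]
  proof eventually_elim
   let ?A = "Sd d (x (Suc j))"
   case (elim n)
   have "h * ratio d n * dens d (x (Suc j)) n \<le> h * (1 / (real d + 1)) * (?A + e / h)"
    using h ratio_bounds[of d n] elim dens_nonneg by (intro mult_mono) auto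
   also have "... = h * ?A / (real d + 1) + e / (real d + 1)"
    using h by (simp add: distrib_left)
   also have "e / (real d + 1) \<le> e" using e by (simp add: divide_simps)
   finally have 1: "cycd d (x (Suc j)) n - cycd d (x j) n \<le> h * ?A / (real d + 1) + e"
    using elim(2) xs(1) by simp
   have "x j < x (Suc j)" using xs(1)[of j] h by simp
   from gd_convex(1)[OF d xs(2) this] have "h * Sd d (x j) \<le> (real d + 1) * (gd d (x (Suc j)) - gd d (x j))"
    unfolding xs(1) by (simp add: add.commute)
   hence 2: "h * Sd d (x j) / (real d + 1) \<le> gd d (x (Suc j)) - gd d (x j)" by (simp add: divide_le_eq mult_ac)
   have "Sd d (x j) \<le> ?A" using s1 xs(2) by (intro Sd_mono[OF d]) auto
   hence "h * (?A - Sd d (x j)) / (real d + 1) \<le> h * (?A - Sd d (x j)) / 1"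
    using h by (intro divide_left_mono) auto
   thus ?case using elim(1) 1 2 by (simp add: diff_divide_distrib algebra_simps)
  qed
 qed (simp add: x0)
 from this[of m] show ?thesis
 proof eventually_elim
  case (elim n)
  have "Sd d b - Sd d a \<le> 1" using Sd_bounds[OF d] a ab by (smt (verit))
  hence "h * (Sd d b - Sd d a) \<le> h * 1" using h by simp
  moreover have "real m * e = c / 2" using m by (simp add: e_def)
  ultimately show ?case using elim h unfolding x0 by linarith
 qed
qed

text \<open>The increment up to a very large density is bounded above, and the nullity there is bounded below by counting.\<close>
lemma cycd_lower:
 assumes c: "c > c_star d" and e: "e > 0"
 shows "eventually (\<lambda>n. cycd d c n \<ge> gd d c - e) sequentially"
proof -
 obtain C where C: "C > c" "gd d C \<le> C / (d + 1) - 1 + e / 3"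
  using gd_at_infinity[OF d _ c, of "e / 3"] e by auto
 have C0: "C > 0" using c_pos[OF c] C by simp
 have "(\<lambda>n. C * ratio d n) \<longlonglongrightarrow> C * (1 / (real d + 1))" by (intro tendsto_intros ratio_limit)
 hence "eventually (\<lambda>n. C * ratio d n \<ge> C / (real d + 1) - e / 3) sequentially"
  using e by (intro eventually_ge_limit) auto
 moreover have "eventually (\<lambda>n. cycd d C n - cycd d c n \<le> gd d C - gd d c + e / 3) sequentially"
  using e C by (intro cycd_increment_upper c) auto
 ultimately show ?thesis using cycd_ge[OF C0]
  by eventually_elim (use C(2) in \<open>simp add: add.commute\<close>)
qed

text \<open>Just above the threshold \<open>gd\<close> is positive but the nullity increases little from just below the threshold, where it is
  negligible.\<close>
lemma cycd_upper:
 assumes c: "c > c_star d" and h: "h > 0"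
 shows "eventually (\<lambda>n. cycd d c n \<le> gd d c + h) sequentially"
proof -
 define e where "e = min (h / 8) (min (c - c_star d) (c_star d / 2))"
 define a where "a = c_star d + e"
 \<comment> \<open>Between \<open>c0\<close> and \<open>a\<close>, on both sides of the threshold, the trivial bound on the closure suffices.\<close>
 define c0 where "c0 = c_star d - e"
 have a: "a > c_star d" "a \<le> c" and c0: "0 < c0" "c0 < c_star d" "c0 \<le> a" "a - c0 \<le> h / 4" using h c c_star_pos[OF d] by (auto simp: e_def min_def a_def c0_def)
 have e4: "h / 4 > 0" using h by simp
 show ?thesis
  using cycd_below[OF c0(1,2) e4] cyc_density_increment[OF c0(1,3), of d] dens_upper[OF a(1) zero_less_one]
  cycd_increment_upper[OF a e4] eventually_gt_at_top[of d]
 proof eventually_elim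
  case (elim n)
  have R: "ratio d n \<le> 1" using ratio_bounds(2)[of d n] by (rule order_trans) simp
  have R0: "ratio d n \<ge> 0" using ratio_bounds(1) elim(5) by force
  have "(a - c0) * ratio d n * dens d a n \<le> h / 4 * 1 * 2"
   using c0 R R0 elim(3) Sd_bounds(2)[OF d a(1)] dens_nonneg h by (intro mult_mono) auto
  thus ?case using elim gd_pos[OF d a(1)] by simp
 qed
qed

text \<open>The slope of a convex function on the left is at most its derivative.  The nullity is known up to \<open>o(1)\<close>, which gives the
  difference quotients.\<close>
lemma dens_lower:
 assumes c: "c > c_star d" and h: "h > 0"
 shows "eventually (\<lambda>n. dens d c n \<ge> Sd d c - h) sequentially"
proof -
 obtain b where b: "c_star d < b" "b < c" "Sd d b \<ge> Sd d c - h / 2"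
  using Sd_left[OF d c, of "h / 2"] h by auto
 \<comment> \<open>The precision for the nullity at \<open>b\<close> and \<open>c\<close>, relative to the length of the interval.\<close>
 define e where "e = h * (c - b) / (4 * (real d + 1))"
 have e: "e > 0" using h b by (simp add: e_def)
 have bc: "0 < b" "b \<le> c" using c_pos[OF b(1)] b by auto
 show ?thesis
  using cycd_upper[OF b(1) e] cycd_lower[OF c e] cyc_density_increment[OF bc, of d] eventually_gt_at_top[of d]
 proof eventually_elim
  case (elim n)
  have "(c - b) * Sd d b \<le> (d + 1) * (gd d c - gd d b)" using gd_convex(1)[OF d b(1,2)] .
  also have "... \<le> (real d + 1) * ((c - b) * ratio d n * dens d c n + 2 * e)"
   unfolding of_nat_add using elim by simp
  also have "... = (c - b) * ((real d + 1) * ratio d n * dens d c n) + (real d + 1) * 2 * e" by (simp add: algebra_simps)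
  also have "(real d + 1) * 2 * e = (c - b) * (h / 2)" by (simp add: e_def field_simps)
  also have "(real d + 1) * ratio d n * dens d c n \<le> 1 * dens d c n"
   using ratio_bounds(2)[of d n] dens_nonneg by (intro mult_right_mono) (auto simp: le_divide_eq mult_ac)
  finally have "(c - b) * Sd d b \<le> (c - b) * (dens d c n + h / 2)"
   using b by (simp add: distrib_left)
  thus ?case using b by simp
 qed
qed

lemma dens_limit:
 assumes "c > c_star d"
 shows "dens d c \<longlonglongrightarrow> (1 - t_root d c) ^ (d + 1)"
proof (rule order_tendstoI)
 fix a assume a: "a < (1 - t_root d c) ^ (d + 1)"
 define L where "L = (1 - t_root d c) ^ (d + 1)"
 have "(L - a) / 2 > 0" using a by (simp only: L_def) simp
 from dens_lower[OF assms this]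
 show "eventually (\<lambda>n. a < dens d c n) sequentially"
  using a unfolding Sd_def[OF d] L_def[symmetric] by (elim eventually_mono) argo
next
 fix a assume a: "a > (1 - t_root d c) ^ (d + 1)"
 define L where "L = (1 - t_root d c) ^ (d + 1)"
 have "(a - L) / 2 > 0" using a by (simp only: L_def) simp
 from dens_upper[OF assms this]
 show "eventually (\<lambda>n. a > dens d c n) sequentially"
  using a unfolding Sd_def[OF d] L_def[symmetric] by (elim eventually_mono) argo
qed

text \<open>Pairs of faces that share a vertex are negligible; for the others the closure events are bounded jointly.\<close>
lemma closure_second_moment:
 assumes c: "c > c_star d" and e: "e > 0"
 shows "eventually (\<lambda>n. EY d n c (\<lambda>Y. (real (card {g \<in> all_faces n d. g \<in> cl (Y - {g})}))\<^sup>2)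
  \<le> (real (n choose (d + 1)))\<^sup>2 * ((1 - t_root d c) ^ (2 * (d + 1)) + e)) sequentially"
proof -
 obtain k where k: "(1 - tk d c k) ^ (2 * (d + 1)) \<le> (1 - t_root d c) ^ (2 * (d + 1)) + e / 3"
  using tk_power_close[OF c, of "e / 3" "2 * (d + 1)"] e by auto
 obtain n0 where n0: "\<forall>n\<ge>n0. \<forall>g\<in>all_faces n d. \<forall>g'\<in>all_faces n d. g \<inter> g' = {} -->
  PY d n c (\<lambda>Y. g \<in> cl (Y - {g}) \<and> g' \<in> cl (Y - {g'})) \<le> (1 - tk d c k) ^ (2 * (d + 1)) + e / 3"
  using closure_pair_limit[OF c_pos[OF c], of "e / 3" d k] e d by auto
 have "eventually (\<lambda>n. (real d + 1)\<^sup>2 / real n \<le> e / 3) sequentially" using e by real_asymp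
 thus ?thesis using eventually_ge_at_top[of "max n0 (d + 1)"]
 proof eventually_elim
  case (elim n)
  let ?F = "all_faces n d" and ?B = "real (n choose (d + 1))"
  let ?I = "\<lambda>g Y. of_bool (g \<in> cl (Y - {g})) :: real"
  define M where "M = (1 - t_root d c) ^ (2 * (d + 1)) + 2 * e / 3"
  have M: "M \<ge> 0" unfolding M_def using e t_root_is_least(2)[OF d c] by simp
  have n: "n > d" using elim by auto
  have sq: "(real (card {g \<in> ?F. g \<in> cl (Y - {g})}))\<^sup>2 = (\<Sum>g\<in>?F. \<Sum>g'\<in>?F. of_bool (g \<in> cl (Y - {g}) \<and> g' \<in> cl (Y - {g'})))" for Y
   unfolding card_filter_sum[OF finite_all_faces] power2_eq_square sum_product by (simp only: of_bool_conj)
  have pr: "PR ?F (c / real n) (\<lambda>Y. g \<in> cl (Y - {g}) \<and> g' \<in> cl (Y - {g'})) \<le> M + of_bool (g \<inter> g' \<noteq> {})"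
   if "g \<in> ?F" "g' \<in> ?F" for g g'
  proof (cases "g \<inter> g' = {}")
   case True
   hence "PR ?F (c / real n) (\<lambda>Y. g \<in> cl (Y - {g}) \<and> g' \<in> cl (Y - {g'})) \<le> (1 - tk d c k) ^ (2 * (d + 1)) + e / 3"
    using n0 elim that by auto
   thus ?thesis using k by (simp add: M_def)
  next
   case False
   have "PR ?F (c / real n) (\<lambda>Y. g \<in> cl (Y - {g}) \<and> g' \<in> cl (Y - {g'})) \<le> 1" by simp
   also have "1 \<le> M + of_bool (g \<inter> g' \<noteq> {})" using M False by simp
   finally show ?thesis .
  qed
  have meet: "(\<Sum>g'\<in>?F. of_bool (g \<inter> g' \<noteq> {})) \<le> ?B * ((real d + 1)\<^sup>2 / real n)" if "g \<in> ?F" for g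
  proof -
   note s = all_faces_D[OF that]
   have one: "real (card {g'\<in>?F. v \<in> g'}) \<le> ?B * ((real d + 1) / real n)" if v: "v < n" for v
   proof -
    have "{g'\<in>?F. v \<in> g'} \<subseteq> insert v ` {A. A \<subseteq> {..<n} - {v} \<and> card A = d}"
    proof
     fix A assume "A \<in> {g'\<in>?F. v \<in> g'}"
     hence A: "A \<in> ?F" "v \<in> A" by auto
     show "A \<in> insert v ` {A. A \<subseteq> {..<n} - {v} \<and> card A = d}"
      using A all_faces_D[OF A(1)] by (intro image_eqI[of _ _ "A - {v}"]) auto
    qed
    moreover have fA: "finite {A. A \<subseteq> {..<n} - {v} \<and> card A = d}"
     by simp
    ultimately have "card {g'\<in>?F. v \<in> g'} \<le> card (insert v ` {A. A \<subseteq> {..<n} - {v} \<and> card A = d})"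
     by (intro card_mono finite_imageI)
    also have "... \<le> card {A. A \<subseteq> {..<n} - {v} \<and> card A = d}" by (rule card_image_le[OF fA])
    also have "... = (n - 1) choose d" using n_subsets[of "{..<n} - {v}" d] v by simp
    finally have 1: "card {g'\<in>?F. v \<in> g'} \<le> (n - 1) choose d" .
    obtain m where m: "n = Suc m" using v by (cases n) auto
    have "Suc d * (n choose Suc d) = n * (n - 1 choose d)" unfolding m Suc_times_binomial by simp
    hence "(real d + 1) * ?B = real n * real (n - 1 choose d)" by (metis Suc_eq_plus1 of_nat_1 of_nat_add of_nat_mult)
    thus ?thesis using v 1 by (simp add: field_simps)
   qed
   have "(\<Sum>g'\<in>?F. of_bool (g \<inter> g' \<noteq> {}) :: real) \<le> (\<Sum>g'\<in>?F. \<Sum>v\<in>g. of_bool (v \<in> g'))"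
   proof (rule sum_mono)
    fix g'
    show "(of_bool (g \<inter> g' \<noteq> {}) :: real) \<le> (\<Sum>v\<in>g. of_bool (v \<in> g'))"
    proof (cases "g \<inter> g' = {}")
     case False
     then obtain v where "v \<in> g" "v \<in> g'" by auto
     thus ?thesis using member_le_sum[of v g "\<lambda>v. of_bool (v \<in> g') :: real"] s by simp
    qed (simp add: sum_nonneg)
   qed
   also have "... = (\<Sum>v\<in>g. real (card {g'\<in>?F. v \<in> g'}))"
    unfolding card_filter_sum[OF finite_all_faces] by (rule sum.swap)
   also have "... \<le> (\<Sum>v\<in>g. ?B * ((real d + 1) / real n))" using s by (intro sum_mono one) auto
   also have "... = ?B * ((real d + 1)\<^sup>2 / real n)" using s by (simp add: power2_eq_square)
   finally show ?thesis .
  qed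
  have "EE ?F (c / real n) (\<lambda>Y. (real (card {g \<in> ?F. g \<in> cl (Y - {g})}))\<^sup>2)
   = (\<Sum>g\<in>?F. \<Sum>g'\<in>?F. PR ?F (c / real n) (\<lambda>Y. g \<in> cl (Y - {g}) \<and> g' \<in> cl (Y - {g'})))"
   unfolding sq by (simp only: EE_sum[OF finite_all_faces] EE_indicator)
  also have "... \<le> (\<Sum>g\<in>?F. \<Sum>g'\<in>?F. M + of_bool (g \<inter> g' \<noteq> {}))" using pr by (intro sum_mono)
  also have "... = (\<Sum>g\<in>?F. ?B * M + (\<Sum>g'\<in>?F. of_bool (g \<inter> g' \<noteq> {})))"
   by (simp only: sum.distrib sum_constant card_all_faces)
  also have "... \<le> (\<Sum>g\<in>?F. ?B * M + ?B * ((real d + 1)\<^sup>2 / real n))"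
   using meet by (intro sum_mono add_left_mono)
  also have "... = ?B\<^sup>2 * (M + (real d + 1)\<^sup>2 / real n)"
   by (simp only: sum_constant card_all_faces) (simp add: power2_eq_square distrib_left)
  also have "... \<le> ?B\<^sup>2 * ((1 - t_root d c) ^ (2 * (d + 1)) + e)"
  proof (rule mult_left_mono)
   show "M + (real d + 1)\<^sup>2 / real n \<le> (1 - t_root d c) ^ (2 * (d + 1)) + e"
    using elim(1) unfolding M_def by linarith
  qed simp
  finally show ?case .
 qed
qed

end

text \<open>A cycle that uses the new face expresses its boundary by those of the other faces, and conversely.\<close>
lemma shadow_eq:
 assumes S: "S \<subseteq> all_faces n d"
 shows "shadow n d (full_skeleton n d \<union> S) = {g \<in> all_faces n d. g \<notin> S \<and> g \<in> cl S}"
proof -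
 let ?Y = "full_skeleton n d \<union> S"
 have fS: "finite S" by (rule finite_subset_faces[OF S])
 have f1: "faces ?Y d = S" using S by (auto simp: faces_def full_skeleton_def all_faces_def)
 have "homology ?Y d \<subset> homology (insert g ?Y) d \<longleftrightarrow> g \<in> cl S" if s: "g \<in> all_faces n d" "g \<notin> S" for g
 proof -
  have f2: "faces (insert g ?Y) d = insert g S" using S s by (auto simp: faces_def full_skeleton_def all_faces_def)
  have b1: "boundary_op ?Y d f = (\<lambda>t. \<Sum>r\<in>S. f r * bd r t)" for f by (simp add: boundary_op_def f1)
  have b2: "boundary_op (insert g ?Y) d f = (\<lambda>t. f g * bd g t + (\<Sum>r\<in>S. f r * bd r t))" for f
   using fS s by (simp add: boundary_op_def f2)
  have h1: "f \<in> homology ?Y d \<longleftrightarrow> (\<forall>r. r \<notin> S --> f r = 0) \<and> (\<forall>t. (\<Sum>r\<in>S. f r * bd r t) = 0)" for f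
   by (simp add: homology_def chains_def f1 b1 fun_eq_iff)
  have h2: "f \<in> homology (insert g ?Y) d \<longleftrightarrow> (\<forall>r. r \<notin> insert g S --> f r = 0) \<and> (\<forall>t. f g * bd g t + (\<Sum>r\<in>S. f r * bd r t) = 0)" for f
   by (simp add: homology_def chains_def f2 b2 fun_eq_iff)
  have sub: "homology ?Y d \<subseteq> homology (insert g ?Y) d" using s by (auto simp: h1 h2)
  have m: "g \<in> cl S \<longleftrightarrow> (\<exists>x. bd g = (\<lambda>t. \<Sum>r\<in>S. x r * bd r t))"
   unfolding cl_def using mem_span_incidence[OF fS] by simp
  show ?thesis
  proof
   assume "homology ?Y d \<subset> homology (insert g ?Y) d"
   then obtain f where f: "f \<in> homology (insert g ?Y) d" "f \<notin> homology ?Y d" by auto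
   have fs: "f g \<noteq> 0"
    using f(1) f(2) by (auto simp: h1 h2)
   have e: "\<And>t. f g * bd g t + (\<Sum>r\<in>S. f r * bd r t) = 0" using f(1) by (simp add: h2)
   have "bd g t = (\<Sum>r\<in>S. (- f r / f g) * bd r t)" for t
   proof -
    have "(\<Sum>r\<in>S. (- f r / f g) * bd r t) = - (\<Sum>r\<in>S. f r * bd r t) / f g"
     by (simp add: sum_negf sum_divide_distrib)
    also have "... = bd g t" using e[of t] fs by (simp add: field_simps)
    finally show ?thesis by simp
   qed
   thus "g \<in> cl S" unfolding m by fastforce
  next
   assume "g \<in> cl S"
   then obtain x where x: "bd g = (\<lambda>t. \<Sum>r\<in>S. x r * bd r t)" unfolding m by (rule exE)
   define f where "f r = (if r = g then 1 else if r \<in> S then - x r else 0)" for r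
   have "(\<Sum>r\<in>S. f r * bd r t) = - bd g t" for t
   proof -
    have "(\<Sum>r\<in>S. f r * bd r t) = (\<Sum>r\<in>S. - (x r * bd r t))"
     using s by (intro sum.cong) (auto simp: f_def)
    also have "... = - (\<Sum>r\<in>S. x r * bd r t)" by (rule sum_negf)
    also have "... = - bd g t" by (simp only: fun_cong[OF x, of t])
    finally show ?thesis .
   qed
   hence "f \<in> homology (insert g ?Y) d" unfolding h2 by (simp add: f_def)
   moreover have "f \<notin> homology ?Y d"
   proof
    assume "f \<in> homology ?Y d"
    hence "f g = 0" using s(2) unfolding h1 by blast
    thus False by (simp add: f_def)
   qed
   ultimately show "homology ?Y d \<subset> homology (insert g ?Y) d" using sub by blast
  qed
 qed
 moreover have "g \<notin> ?Y \<longleftrightarrow> g \<notin> S" if "g \<in> all_faces n d" for g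
  using that by (auto simp: full_skeleton_def all_faces_def)
 ultimately show ?thesis unfolding shadow_def by blast
qed

lemma aas_shadowI:
 assumes "(\<lambda>n. PY d n c (\<lambda>S. \<not> P n (card {s \<in> all_faces n d. s \<notin> S \<and> s \<in> cl S}))) \<longlonglongrightarrow> 0"
 shows "aas (\<lambda>n. random_complex d n (c / real n)) (\<lambda>n Y. P n (card (shadow n d Y)))"
proof -
 have "measure_pmf.prob (random_complex d n (c / real n)) {Y. P n (card (shadow n d Y))}
  = 1 - PY d n c (\<lambda>S. \<not> P n (card {s \<in> all_faces n d. s \<notin> S \<and> s \<in> cl S}))" (is "?l = 1 - ?r") for n
 proof -
  have "?l = PY d n c (\<lambda>S. P n (card (shadow n d (full_skeleton n d \<union> S))))"
   unfolding random_complex_rs by simp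
  also have "... = PY d n c (\<lambda>S. P n (card {s \<in> all_faces n d. s \<notin> S \<and> s \<in> cl S}))"
   by (intro antisym PR_mono) (simp_all only: shadow_eq)
  also have "... = 1 - ?r"
   using measure_pmf.prob_compl[of "{S. P n (card {s \<in> all_faces n d. s \<notin> S \<and> s \<in> cl S})}" "rs (all_faces n d) (c / real n)"]
   by (simp add: Compl_eq_Diff_UNIV[symmetric] Collect_neg_eq)
  finally show ?thesis .
 qed
 moreover have "(\<lambda>n. 1 - PY d n c (\<lambda>S. \<not> P n (card {s \<in> all_faces n d. s \<notin> S \<and> s \<in> cl S}))) \<longlonglongrightarrow> 1 - 0"
  by (intro tendsto_intros assms)
 ultimately show ?thesis unfolding aas_def by simp
qed

text \<open>By Chebyshev's inequality.  The count over all faces of those in the closure of the others differs from the shadow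
  only in the faces present, which are a fraction of about \<open>c / n\<close>.\<close>
lemma shadow_above:
 assumes d: "d \<ge> 2" and c: "c > c_star d" and e: "e > 0"
 shows "aas (\<lambda>n. random_complex d n (c / real n))
  (\<lambda>n Y. \<bar>real (card (shadow n d Y)) / real (n choose (d + 1)) - (1 - t_root d c) ^ (d + 1)\<bar> \<le> e)"
proof (rule aas_shadowI, rule tendsto_sandwich[OF _ _ tendsto_const])
 define s where "s = (1 - t_root d c) ^ (d + 1)"
 let ?P = "\<lambda>n. PY d n c (\<lambda>S. \<not> \<bar>real (card {g \<in> all_faces n d. g \<notin> S \<and> g \<in> cl S}) / real (n choose (d + 1)) - s\<bar> \<le> e)"
 have s: "0 \<le> s" "s \<le> 1" using t_root_is_least(1,2)[OF d c] by (auto simp: s_def intro!: power_le_one simp del: power_Suc)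
 let ?X = "\<lambda>n Y. real (card {g \<in> all_faces n d. g \<in> cl (Y - {g})}) / real (n choose (d + 1))"
 define u where "u n = EY d n c (\<lambda>Y. (?X n Y - s)\<^sup>2)" for n
 have u0: "u n \<ge> 0" for n unfolding u_def by simp
 have u: "u \<longlonglongrightarrow> 0"
 proof (rule order_tendstoI)
  fix a :: real assume "a > 0"
  have s2: "(1 - t_root d c) ^ (2 * (d + 1)) = s\<^sup>2" unfolding s_def power_mult[symmetric] by (simp only: mult.commute)
  have "eventually (\<lambda>n. dens d c n \<ge> s - a / 4) sequentially"
   using \<open>a > 0\<close> unfolding s_def by (intro eventually_ge_limit[OF dens_limit[OF d c]]) auto
  moreover have "eventually (\<lambda>n. EY d n c (\<lambda>Y. (real (card {g \<in> all_faces n d. g \<in> cl (Y - {g})}))\<^sup>2)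
   \<le> (real (n choose (d + 1)))\<^sup>2 * (s\<^sup>2 + a / 4)) sequentially"
   using closure_second_moment[OF d c, of "a / 4"] \<open>a > 0\<close> unfolding s2 by simp
  ultimately show "eventually (\<lambda>n. u n < a) sequentially" using eventually_gt_at_top[of d]
  proof eventually_elim
   case (elim n)
   let ?B = "real (n choose (d + 1))"
   have e1: "EY d n c (\<lambda>Y. ?X n Y) = dens d c n"
   proof -
    have "EY d n c (\<lambda>Y. ?X n Y) = EY d n c (\<lambda>Y. \<Sum>g\<in>all_faces n d. of_bool (g \<in> cl (Y - {g}))) / ?B"
     unfolding card_filter_sum[OF finite_all_faces] by simp
    also have "... = dens d c n"
     unfolding dens_def closure_mass_def by (simp only: EE_sum[OF finite_all_faces] EE_indicator)
    finally show ?thesis .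
   qed
   have e2: "EY d n c (\<lambda>Y. (?X n Y)\<^sup>2) \<le> s\<^sup>2 + a / 4"
    using elim by (simp add: power_divide pos_divide_le_eq mult.commute)
   have "u n = EY d n c (\<lambda>Y. (?X n Y)\<^sup>2 - 2 * s * ?X n Y + s\<^sup>2)"
    unfolding u_def by (intro EE_cong) (simp only: power2_diff, simp)
   also have "... = EY d n c (\<lambda>Y. (?X n Y)\<^sup>2) - 2 * s * EY d n c (\<lambda>Y. ?X n Y) + s\<^sup>2"
    by simp
   also have "... \<le> s\<^sup>2 + a / 4 - 2 * s * (s - a / 4) + s\<^sup>2"
    unfolding e1 using e2 elim(1) s by (intro add_right_mono diff_mono mult_left_mono) auto
   also have "... \<le> a / 4 + a / 2 * 1" using s \<open>a > 0\<close> by (simp add: power2_eq_square algebra_simps)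
   also have "... < a" using \<open>a > 0\<close> by simp
   finally show ?case .
  qed
 next
  fix a :: real assume "a < 0"
  thus "eventually (\<lambda>n. a < u n) sequentially" using u0 by (intro always_eventually allI) (rule less_le_trans)
 qed
 show "(\<lambda>n. u n / (e / 2)\<^sup>2 + (c / real n) / (e / 2)) \<longlonglongrightarrow> 0"
  using tendsto_add[OF tendsto_divide[OF u tendsto_const] tendsto_divide[OF lim_const_over_n tendsto_const], of "(e / 2)\<^sup>2" "e / 2" c] e by simp
 show "eventually (\<lambda>n. 0 \<le> ?P n) sequentially" by simp
 show "eventually (\<lambda>n. ?P n \<le> u n / (e / 2)\<^sup>2 + (c / real n) / (e / 2)) sequentially"
  using eventually_gt_at_top[of "max d (nat \<lceil>c\<rceil>)"]
 proof eventually_elim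
  case (elim n)
  let ?F = "all_faces n d" and ?B = "real (n choose (d + 1))"
  have "real n > c" using elim by linarith
  moreover have "c > 0" using c_pos[OF d c] .
  ultimately have p: "0 \<le> c / real n" "c / real n \<le> 1" by (auto)
  have "?P n \<le> PR ?F (c / real n) (\<lambda>Y. (?X n Y - s)\<^sup>2 \<ge> (e / 2)\<^sup>2 \<or> real (card Y) / ?B \<ge> e / 2)"
  proof (rule PR_mono)
   fix S assume S: "S \<subseteq> ?F" and ns: "\<not> \<bar>real (card {g \<in> ?F. g \<notin> S \<and> g \<in> cl S}) / ?B - s\<bar> \<le> e"
   have fS: "finite S" by (rule finite_subset_faces[OF S])
   let ?A = "{g \<in> ?F. g \<notin> S \<and> g \<in> cl S}" and ?C = "{g \<in> ?F. g \<in> cl (S - {g})}"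
   have 1: "card ?A \<le> card ?C" by (intro card_mono) auto
   have "?C \<subseteq> ?A \<union> S" by auto
   from card_mono[OF _ this] fS have "card ?C \<le> card (?A \<union> S)" by auto
   also have "... \<le> card ?A + card S" by (rule card_Un_le)
   finally have 2: "card ?C \<le> card ?A + card S" .
   have 1: "real (card ?A) / ?B \<le> ?X n S" using 1 by (intro divide_right_mono) auto
   have 2: "?X n S \<le> real (card ?A) / ?B + real (card S) / ?B"
    unfolding add_divide_distrib[symmetric] using 2 by (intro divide_right_mono) auto
   show "(?X n S - s)\<^sup>2 \<ge> (e / 2)\<^sup>2 \<or> real (card S) / ?B \<ge> e / 2"
   proof (rule disjCI)
    assume "\<not> real (card S) / ?B \<ge> e / 2"
    hence "\<bar>?X n S - s\<bar> \<ge> e / 2" using 1 2 ns by linarith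
    from power_mono[OF this, of 2] e show "(?X n S - s)\<^sup>2 \<ge> (e / 2)\<^sup>2" by simp
   qed
  qed
  also have "... \<le> PR ?F (c / real n) (\<lambda>Y. (?X n Y - s)\<^sup>2 \<ge> (e / 2)\<^sup>2) + PR ?F (c / real n) (\<lambda>Y. real (card Y) / ?B \<ge> e / 2)"
   unfolding Collect_disj_eq by (rule measure_Un_le) auto
  also have "... \<le> u n / (e / 2)\<^sup>2 + EE ?F (c / real n) (\<lambda>Y. real (card Y) / ?B) / (e / 2)"
   unfolding u_def using e by (intro add_mono PR_markov) auto
  also have "EE ?F (c / real n) (\<lambda>Y. real (card Y) / ?B) = c / real n"
   using p elim by (simp add: EE_card card_all_faces)
  finally show ?case .
 qed
qed

section \<open>Exploring circuits\<close>

text \<open>The \<open>(d - 1)\<close>-faces of \<open>K\<close>.\<close>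
definition facs :: "nat set set => nat set set" where
 "facs K = {r - {a} | r a. r \<in> K \<and> a \<in> r}"

lemma facs_mono: "A \<subseteq> K ==> facs A \<subseteq> facs K"
 by (auto simp: facs_def)

lemma facs_single: "facs {s} = (\<lambda>a. s - {a}) ` s"
 by (auto simp: facs_def)

lemma facs_UN: "facs K = (\<Union>s\<in>K. facs {s})"
 by (auto simp: facs_def)

lemma card_facs_single: "finite s ==> card (facs {s}) = card s"
 unfolding facs_single by (intro card_image) (auto simp: inj_on_def)

lemma finite_facs: "finite K ==> (\<And>s. s \<in> K ==> finite s) ==> finite (facs K)"
 unfolding facs_UN[of K] facs_single by auto

lemma facs_memD: "t \<in> facs {r} ==> r \<in> K ==> t \<in> facs K"
 by (auto simp: facs_def)

text \<open>Each facet lies on a second face.  As the lightest facets of different faces outside \<open>S\<close> are different, apart from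
  the facets \<open>par q\<close>, such a facet is shared with a face of \<open>S\<close> or with one that has lighter facets.  So each of the \<open>d + 1\<close>
  classes adds at most \<open>d + 1\<close> times the number of faces counted before.\<close>
lemma seed_proportion:
 fixes cls :: "nat set => nat"
 assumes K: "finite K" "\<And>q. q \<in> K ==> finite q \<and> card q = d + 1" and d: "d \<ge> 2"
  and S: "S \<subseteq> K" and cls: "\<And>u. cls u \<le> d"
  and codeg: "\<And>q u. q \<in> K ==> u \<in> facs {q} ==> \<exists>q'\<in>K. q' \<noteq> q \<and> u \<in> facs {q'}"
  and par: "\<And>q. q \<in> K - S ==> par q \<in> facs {q}"
  and par0: "\<And>q u. q \<in> K - S ==> cls (par q) = 0 ==> u \<in> facs {q} ==> cls u = 0"
  and par1: "\<And>q. q \<in> K - S ==> cls (par q) > 0 ==> \<exists>u\<in>facs {q}. cls u < cls (par q)"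
  and Lm: "\<And>q. Lm q = {u \<in> facs {q}. \<forall>u'\<in>facs {q}. cls u \<le> cls u'}"
  and dis: "\<And>q q'. q \<in> K - S ==> q' \<in> K - S ==> q \<noteq> q' ==> (Lm q - {par q}) \<inter> (Lm q' - {par q'}) = {}"
 shows "card K \<le> (d + 2) ^ (d + 1) * card S"
proof -
 define mc where "mc q = Min (cls ` facs {q})" for q
 define N where "N q = Lm q - {par q}" for q
 define X where "X j = {q \<in> K - S. mc q = j}" for j
 have finf: "finite (facs {q})" "facs {q} \<noteq> {}" "card (facs {q}) = d + 1" if "q \<in> K" for q
  using K(2)[OF that] card_facs_single[of q] unfolding facs_single by auto
 have mcle: "mc q \<le> cls u" if "q \<in> K" "u \<in> facs {q}" for q u
  unfolding mc_def using finf[OF that(1)] that(2) by (intro Min_le) auto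
 have mcex: "\<exists>u\<in>facs {q}. cls u = mc q" if "q \<in> K" for q
 proof -
  have "mc q \<in> cls ` facs {q}" unfolding mc_def using finf[OF that] by (intro Min_in) auto
  thus ?thesis by auto
 qed
 have Lm_iff: "u \<in> Lm q \<longleftrightarrow> u \<in> facs {q} \<and> cls u = mc q" if rK: "q \<in> K" for q u
 proof
  assume t: "u \<in> Lm q"
  obtain u' where t': "u' \<in> facs {q}" "cls u' = mc q" using mcex[OF rK] by blast
  show "u \<in> facs {q} \<and> cls u = mc q" using t t' mcle[OF rK, of u] by (auto simp: Lm)
 qed (use mcle[OF rK] in \<open>auto simp: Lm\<close>)
 have par_notin: "par q \<notin> Lm q" if "q \<in> K - S" "cls (par q) > 0" for q
  using par1[OF that] by (auto simp: Lm not_le)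
 have other: "g \<in> S \<or> (u = par g \<and> mc g = 0 \<and> cls (par g) = 0) \<or> mc g < cls u"
  if r: "q \<in> K - S" "u \<in> N q" and g: "g \<in> K" "g \<noteq> q" "u \<in> facs {g}" for q u g
 proof (rule ccontr)
  assume n: "\<not> ?thesis"
  hence gK: "g \<in> K - S" using g by auto
  have "mc g = cls u" using mcle[OF g(1,3)] n by simp
  hence "u \<in> Lm g" using Lm_iff[OF g(1)] g by simp
  hence "u = par g" using dis[OF r(1) gK] g(2) r(2) unfolding N_def by blast
  moreover have "cls (par g) = 0" using par_notin[OF gK] \<open>u \<in> Lm g\<close> calculation by (cases "cls (par g)") auto
  ultimately show False using n \<open>mc g = cls u\<close> by simp
 qed
 have finS: "finite S" "finite (K - S)" using S K finite_subset by auto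
 have Nfin: "finite (N q)" if "q \<in> K" for q using finf[OF that] unfolding N_def Lm by auto
 have Nne: "\<exists>u. u \<in> N q \<and> cls u = mc q" if r: "q \<in> K - S" "cls (par q) > 0" for q
 proof -
  have rK: "q \<in> K" using r by auto
  obtain u where "u \<in> facs {q}" "cls u = mc q" using mcex[OF rK] by blast
  moreover have "u \<in> Lm q" using Lm_iff[OF rK] calculation by simp
  ultimately show ?thesis using par_notin[OF r] unfolding N_def by blast
 qed
 \<comment> \<open>In class \<open>0\<close> the facet \<open>par q\<close> may itself be a lightest one and shared; the remaining \<open>d \<ge> 2\<close> lightest facets compensate for this.\<close>
 have X0: "card (X 0) \<le> (d + 1) * card S"
 proof -
  define A where "A = {q \<in> X 0. cls (par q) = 0}"
  define B where "B = {q \<in> X 0. cls (par q) > 0}"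
  have fin: "finite A" "finite B" "finite (X 0)" using finS by (auto simp: A_def B_def X_def)
  have XAB: "X 0 = A \<union> B" "A \<inter> B = {}" by (auto simp: A_def B_def)
  have sub: "q \<in> K - S" "q \<in> K" if "q \<in> X 0" for q using that by (auto simp: X_def)
  have cA: "card (N q) = d" if "q \<in> A" for q
  proof -
   have r: "q \<in> X 0" "cls (par q) = 0" using that by (auto simp: A_def)
   note s = sub[OF r(1)]
   have "Lm q = facs {q}" using par0[OF s(1) r(2)] by (auto simp: Lm)
   thus ?thesis unfolding N_def using finf[OF s(2)] par[OF s(1)] by simp
  qed
  have cB: "card (N q) \<ge> 1" if "q \<in> B" for q
  proof -
   have r: "q \<in> X 0" "cls (par q) > 0" using that by (auto simp: B_def)
   show ?thesis using Nne[OF sub(1)[OF r(1)] r(2)] Nfin[OF sub(2)[OF r(1)]] by (auto simp: Suc_le_eq card_gt_0_iff)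
  qed
  have "d * card A + card B \<le> (\<Sum>q\<in>X 0. card (N q))" using sum_mono[of B "\<lambda>_. 1" "\<lambda>q. card (N q)"] cB fin XAB(2) unfolding XAB(1) by (auto simp: cA sum.union_disjoint)
  also have "... = card (\<Union>q\<in>X 0. N q)"
  proof (rule card_UN_disjoint[symmetric])
   show "\<forall>i\<in>X 0. \<forall>j\<in>X 0. i \<noteq> j --> N i \<inter> N j = {}" using dis sub(1) unfolding N_def by blast
  qed (use fin Nfin sub in auto)
  also have "... \<le> card ((\<Union>g\<in>S. facs {g}) \<union> par ` A)"
  proof (rule card_mono)
   show "finite ((\<Union>g\<in>S. facs {g}) \<union> par ` A)" using finS finf S fin by auto
   show "(\<Union>q\<in>X 0. N q) \<subseteq> (\<Union>g\<in>S. facs {g}) \<union> par ` A"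
   proof
    fix u assume "u \<in> (\<Union>q\<in>X 0. N q)"
    then obtain q where r: "q \<in> X 0" "u \<in> N q" by auto
    have tf: "u \<in> facs {q}" "cls u = 0" using r Lm_iff[OF sub(2)[OF r(1)]] by (auto simp: N_def X_def)
    obtain g where g: "g \<in> K" "g \<noteq> q" "u \<in> facs {g}" using codeg[OF sub(2)[OF r(1)] tf(1)] by blast
    from other[OF sub(1)[OF r(1)] r(2) g] tf(2)
    show "u \<in> (\<Union>g\<in>S. facs {g}) \<union> par ` A" using g by (auto simp: A_def X_def)
   qed
  qed
  also have "... \<le> card (\<Union>g\<in>S. facs {g}) + card (par ` A)" by (rule card_Un_le)
  also have "... \<le> (\<Sum>g\<in>S. card (facs {g})) + card A" by (intro add_mono card_UN_le card_image_le finS fin)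
  also have "(\<Sum>g\<in>S. card (facs {g})) = (d + 1) * card S" using finf(3) S by (simp add: subset_iff)
  finally have "d * card A + card B \<le> (d + 1) * card S + card A" .
  moreover have "2 * card A \<le> d * card A" using d by simp
  moreover have "card (X 0) = card A + card B" unfolding XAB(1) using fin XAB(2) by (simp add: card_Un_disjoint)
  ultimately show ?thesis by linarith
 qed
 have Xj: "card (X j) \<le> (d + 1) * (card S + (\<Sum>i<j. card (X i)))" if j: "j > 0" for j
 proof -
  let ?B = "\<Union>i<j. X i"
  let ?A = "(S \<union> ?B)"
  have "\<exists>g u. g \<in> S \<union> ?B \<and> u \<in> facs {g} \<and> u \<in> N q" if r: "q \<in> X j" for q
  proof -
   have rK: "q \<in> K - S" "q \<in> K" "mc q = j" using r by (auto simp: X_def)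
   have "cls (par q) > 0" using mcle[OF rK(2) par[OF rK(1)]] rK(3) j by simp
   then obtain u where t: "u \<in> N q" "cls u = j" using Nne[OF rK(1)] rK(3) by blast
   have "u \<in> facs {q}" using t by (auto simp: N_def Lm)
   then obtain g where g: "g \<in> K" "g \<noteq> q" "u \<in> facs {g}" using codeg[OF rK(2)] by blast
   from other[OF rK(1) t(1) g] t(2) j have "g \<in> S \<or> mc g < j" by auto
   thus ?thesis using g t by (auto simp: X_def)
  qed
  then obtain g u where gt: "\<And>q. q \<in> X j ==> g q \<in> S \<union> ?B \<and> u q \<in> facs {g q} \<and> u q \<in> N q" by metis
  let ?T = "SIGMA h:?A. facs {h}"
  have hK: "S \<union> ?B \<subseteq> K" using S by (auto simp: X_def)
  hence finh: "finite ?A" using K(1) finite_subset by blast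
  have finT: "finite ?T" using finh hK finf by blast
  have inj: "inj_on (\<lambda>q. (g q, u q)) (X j)"
  proof (rule inj_onI)
   fix q q' assume a: "q \<in> X j" "q' \<in> X j" "(g q, u q) = (g q', u q')"
   have "u q \<in> N q" "u q \<in> N q'" using gt[OF a(1)] gt[OF a(2)] a(3) by auto
   thus "q = q'" using dis[of q q'] a unfolding N_def X_def by blast
  qed
  have "card (X j) \<le> card ?T"
   by (rule card_inj_on_le[OF inj _ finT]) (use gt in auto)
  also have "... = (\<Sum>h\<in>S \<union> ?B. card (facs {h}))" using finh hK finf by (intro card_SigmaI) auto
  also have "... = (\<Sum>h\<in>S \<union> ?B. d + 1)" using hK by (intro sum.cong refl finf(3)) auto
  also have "... = (d + 1) * card ?A" by simp
  finally have 1: "card (X j) \<le> (d + 1) * card ?A" .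
  have "card ?A \<le> card S + (\<Sum>i<j. card (X i))"
   by (rule order_trans[OF card_Un_le]) (intro add_left_mono card_UN_le, simp)
  from order_trans[OF 1 mult_le_mono2[OF this]] show ?thesis .
 qed
 have acc: "card S + (\<Sum>i<j. card (X i)) \<le> (d + 2) ^ j * card S" for j
 proof (induction j)
  case (Suc j)
  have "card (X j) \<le> (d + 1) * (card S + (\<Sum>i<j. card (X i)))" using X0 Xj[of j] by (cases "j = 0") auto
  hence "card (X j) \<le> (d + 1) * ((d + 2) ^ j * card S)" by (rule order_trans) (intro mult_left_mono Suc, simp)
  hence "card S + (\<Sum>i<Suc j. card (X i)) \<le> (d + 2) ^ j * card S + (d + 1) * ((d + 2) ^ j * card S)" using Suc by simp
  also have "... = (d + 2) ^ Suc j * card S" by (simp add: algebra_simps)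
  finally show ?case .
 qed simp
 have "K \<subseteq> S \<union> (\<Union>i<d + 1. X i)"
 proof
  fix q assume r: "q \<in> K"
  obtain u where "u \<in> facs {q}" "cls u = mc q" using mcex[OF r] by blast
  hence "mc q < d + 1" using cls[of u] by simp
  thus "q \<in> S \<union> (\<Union>i<d + 1. X i)" using r by (auto simp: X_def)
 qed
 hence "card K \<le> card (S \<union> (\<Union>i<d + 1. X i))" using finS by (intro card_mono) (auto simp: X_def)
 also have "... \<le> card S + (\<Sum>i<d + 1. card (X i))"
  by (rule order_trans[OF card_Un_le]) (intro add_left_mono card_UN_le, simp)
 also have "... \<le> (d + 2) ^ (d + 1) * card S" by (rule acc)
 finally show ?thesis .
qed

text \<open>\<open>H k\<close> is the set of heavy sets of size \<open>k\<close>.\<close>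
definition tlight :: "nat => (nat => nat set set) => nat set => bool" where
 "tlight d H e \<longleftrightarrow> (\<forall>r\<subseteq>e. card r < d --> r \<notin> H (card r))"

text \<open>The codimension of a largest totally light subset.\<close>
definition cls :: "nat => (nat => nat set set) => nat set => nat" where
 "cls d H t = d - Max (card ` {e \<in> Pow t. tlight d H e})"

text \<open>The exploration always continues at a lightest open facet.\<close>
definition pick :: "nat => (nat => nat set set) => nat set set => nat set set => nat set" where
 "pick d H A E = arg_min (cls d H) (\<lambda>t. t \<in> facs A - E)"

text \<open>If a light set \<open>r\<close> in \<open>t\<close> extends by \<open>v\<close> to a heavy one then there are few choices of \<open>v\<close>, since otherwise \<open>r\<close> would be heavy itself.
  The facets found so far play the part of heavy sets of size \<open>d\<close>.\<close>
definition cand :: "nat => (nat => nat set set) => nat set set => nat set => nat set" where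
 "cand d H A t = {v. \<exists>r\<subseteq>t. card r < d \<and> v \<notin> r \<and> r \<notin> H (card r) \<and>
   insert v r \<in> (if card r + 1 = d then facs A else H (card r + 1))}"

text \<open>Explores \<open>K\<close> from the faces \<open>A\<close>, where \<open>E\<close> is the set of finished facets.  A run consists of \<open>L\<close> steps: \<open>s\<close> of them pick
  the new vertex among the candidates, \<open>r\<close> pick an arbitrary new vertex, and the others close a facet.\<close>
inductive expl :: "nat => nat => nat => (nat => nat set set) => nat set set => nat set set => nat set set => nat => nat => nat => bool"
 for d n Q H K where
 finish: "facs K \<subseteq> E ==> expl d n Q H K K E 0 0 0"
| closed: "expl d n Q H K A (insert (pick d H A E) E) L s r ==> expl d n Q H K A E (Suc L) s r"
| saving: "finite (cand d H A (pick d H A E)) ==> card (cand d H A (pick d H A E)) \<le> Q ==> v \<in> cand d H A (pick d H A E) ==>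
  expl d n Q H K (insert (insert v (pick d H A E)) A) E L s r ==> expl d n Q H K A E (Suc L) (Suc s) r"
| free: "v < n ==> expl d n Q H K (insert (insert v (pick d H A E)) A) E L s r ==> expl d n Q H K A E (Suc L) s (Suc r)"

text \<open>Each step has three kinds, and a saving step at most \<open>Q\<close> and a free step at most \<open>n\<close> continuations.\<close>
lemma card_expl: "finite {K. expl d n Q H K A E L s r} \<and> card {K. expl d n Q H K A E L s r} \<le> 3 ^ L * Q ^ s * n ^ r"
proof (induction L arbitrary: A E s r)
 case 0
 have "{K. expl d n Q H K A E 0 s r} \<subseteq> (if s = 0 \<and> r = 0 then {A} else {})"
  by (auto elim: expl.cases)
 from finite_subset[OF this] card_mono[OF _ this] show ?case by (cases "s = 0 \<and> r = 0") auto
next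
 case (Suc L)
 let ?t = "pick d H A E"
 let ?C = "cand d H A ?t"
 define X1 where "X1 = {K. expl d n Q H K A (insert ?t E) L s r}"
 define X2 where "X2 = (if finite ?C \<and> card ?C \<le> Q \<and> s > 0 then \<Union>v\<in>?C. {K. expl d n Q H K (insert (insert v ?t) A) E L (s - 1) r} else {})"
 define X3 where "X3 = (if r > 0 then \<Union>v<n. {K. expl d n Q H K (insert (insert v ?t) A) E L s (r - 1)} else {})"
 let ?B = "3 ^ L * Q ^ s * n ^ r"
 have sub: "{K. expl d n Q H K A E (Suc L) s r} \<subseteq> X1 \<union> X2 \<union> X3"
 proof
  fix K assume "K \<in> {K. expl d n Q H K A E (Suc L) s r}"
  hence "expl d n Q H K A E (Suc L) s r" by simp
  thus "K \<in> X1 \<union> X2 \<union> X3"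
   by cases (auto simp: X1_def X2_def X3_def)
 qed
 have 1: "finite X1" "card X1 \<le> ?B" using Suc.IH by (auto simp: X1_def)
 have 2: "finite X2 \<and> card X2 \<le> ?B"
 proof (cases "finite ?C \<and> card ?C \<le> Q \<and> s > 0")
  case True
  then obtain s' where s': "s = Suc s'" by (cases s) auto
  have eq: "X2 = (\<Union>v\<in>?C. {K. expl d n Q H K (insert (insert v ?t) A) E L s' r})" using True s' by (simp add: X2_def)
  have "card X2 \<le> (\<Sum>v\<in>?C. card {K. expl d n Q H K (insert (insert v ?t) A) E L s' r})"
   unfolding eq using True by (intro card_UN_le) auto
  also have "... \<le> (\<Sum>v\<in>?C. 3 ^ L * Q ^ s' * n ^ r)" using Suc.IH by (intro sum_mono) auto
  also have "... \<le> Q * (3 ^ L * Q ^ s' * n ^ r)" unfolding sum_constant of_nat_id using True by (intro mult_right_mono) auto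
  finally show ?thesis using Suc.IH True unfolding eq by (simp add: s' mult_ac)
 qed (auto simp: X2_def)
 have 3: "finite X3 \<and> card X3 \<le> ?B"
 proof (cases r)
  case (Suc r')
  have eq: "X3 = (\<Union>v<n. {K. expl d n Q H K (insert (insert v ?t) A) E L s r'})" using Suc by (simp add: X3_def)
  have "card X3 \<le> (\<Sum>v<n. card {K. expl d n Q H K (insert (insert v ?t) A) E L s r'})"
   unfolding eq by (intro card_UN_le) auto
  also have "... \<le> (\<Sum>v<n. 3 ^ L * Q ^ s * n ^ r')" using Suc.IH by (intro sum_mono) auto
  finally show ?thesis using Suc.IH unfolding eq by (simp add: Suc mult_ac)
 qed (auto simp: X3_def)
 have fin: "finite (X1 \<union> X2 \<union> X3)" using 1 2 3 by auto
 have "card (X1 \<union> X2 \<union> X3) \<le> card X1 + card X2 + card X3"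
  using card_Un_le[of "X1 \<union> X2" X3] card_Un_le[of X1 X2] by linarith
 also have "... \<le> 3 * ?B" using 1 2 3 by linarith
 finally have "card (X1 \<union> X2 \<union> X3) \<le> 3 ^ Suc L * Q ^ s * n ^ r" by (simp add: mult_ac)
 thus ?case using card_mono[OF fin sub] finite_subset[OF sub fin] by linarith
qed

text \<open>What is used of a circuit \<open>K\<close> through \<open>s\<close>: no facet lies on a single face, and all faces are reached from \<open>s\<close>
  through common facets.\<close>
definition core :: "nat => nat => nat set => nat set set => bool" where
 "core d n s K \<longleftrightarrow> s \<in> K \<and> K \<subseteq> all_faces n d \<and>
  (\<forall>r\<in>K. \<forall>t\<in>facs {r}. \<exists>r'\<in>K. r' \<noteq> r \<and> t \<in> facs {r'}) \<and>
  (\<forall>A. s \<in> A \<and> A \<subseteq> K \<and> facs A \<inter> facs (K - A) = {} --> A = K)"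

lemma max_tlight:
 assumes "finite t" "{} \<notin> H 0" "d > 0"
 obtains h where "h \<subseteq> t" "tlight d H h" "cls d H t = d - card h" "\<And>h'. h' \<subseteq> t ==> tlight d H h' ==> card h' \<le> card h"
proof -
 let ?M = "card ` {h \<in> Pow t. tlight d H h}"
 have fin: "finite ?M" using assms(1) by auto
 have "?M \<noteq> {}" using assms(2) by (auto simp: tlight_def)
 from Max_in[OF fin this] obtain h where e: "h \<subseteq> t" "tlight d H h" "Max ?M = card h" by auto
 have "card h' \<le> card h" if "h' \<subseteq> t" "tlight d H h'" for h'
  unfolding e(3)[symmetric] using fin that by simp
 thus thesis using e by (intro that[of h]) (auto simp: cls_def)
qed

lemma cls_le_card:
 assumes "finite t" "e \<subseteq> t" "tlight d H e"
 shows "cls d H t \<le> d - card e"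
 unfolding cls_def using assms by (intro diff_le_mono2 Max_ge) auto

lemma tlight_extend:
 assumes "e \<subseteq> t" "tlight d H e" "card e < d" "v \<notin> t" "v \<notin> cand d H A t" "finite t"
 shows "tlight d H (insert v e)"
 unfolding tlight_def
proof (intro allI impI)
 fix q assume r: "q \<subseteq> insert v e" "card q < d"
 show "q \<notin> H (card q)"
 proof (cases "v \<in> q")
  case False
  thus ?thesis using r assms(2) by (auto simp: tlight_def)
 next
  case True
  define q' where "q' = q - {v}"
  have r': "q = insert v q'" "v \<notin> q'" "q' \<subseteq> e" using True r by (auto simp: q'_def)
  have fin: "finite q'" by (rule finite_subset[OF order_trans[OF r'(3) assms(1)] assms(6)])
  have "q' \<notin> H (card q')" using assms(2) fin r' r(2) by (simp add: tlight_def)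
  moreover have "v \<notin> q'" "card q' < d" "q' \<subseteq> t" using r' fin r' r assms(1) by auto
  ultimately have "insert v q' \<notin> (if card q' + 1 = d then facs A else H (card q' + 1))"
   using assms(5) unfolding cand_def by blast
  thus ?thesis using fin r' r r' by auto
 qed
qed

text \<open>If \<open>v\<close> is not a candidate, then it extends a largest totally light subset of \<open>t\<close> to a totally light set.  Some facet of the new
  face contains this and is lighter.  If \<open>t\<close> is totally light itself then so are all new facets, and they
  are unseen.\<close>
lemma cls_step:
 assumes t: "finite t" "card t = d" "d \<ge> 2" "v \<notin> t" and H: "{} \<notin> H 0" and v: "v \<notin> cand d H A t"
 shows "cls d H t > 0 ==> \<exists>t'\<in>facs {insert v t}. cls d H t' < cls d H t"
  and "cls d H t = 0 ==> \<forall>t'\<in>facs {insert v t}. cls d H t' = 0 \<and> (t' \<noteq> t --> t' \<notin> facs A)"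
proof -
 obtain h where e: "h \<subseteq> t" "tlight d H h" "cls d H t = d - card h"
  using max_tlight[of t H d] t(1,3) H by (metis gr0I not_numeral_le_zero)
 {
  assume "cls d H t > 0"
  hence c: "card h < d" using e(3) by simp
  hence "h \<noteq> t" using t(2) by auto
  then obtain u where u: "u \<in> t" "u \<notin> h" using e(1) by blast
  have "cls d H (insert v t - {u}) \<le> d - card (insert v h)" using tlight_extend[OF e(1,2) c t(4) v t(1)] t e(1) u by (intro cls_le_card) auto
  also have "... < cls d H t" using c e t(1) finite_subset t(4) by (subst card_insert_disjoint) auto
  finally have "cls d H (insert v t - {u}) < cls d H t" .
  moreover have "insert v t - {u} \<in> facs {insert v t}" using u by (auto simp: facs_def)
  ultimately show "\<exists>t'\<in>facs {insert v t}. cls d H t' < cls d H t" by blast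
 }
 {
  assume "cls d H t = 0"
  hence "card h \<ge> d" using e(3) by simp
  hence tl: "tlight d H t" using t e by (metis card_subset_eq card_mono le_antisym)
  show "\<forall>t'\<in>facs {insert v t}. cls d H t' = 0 \<and> (t' \<noteq> t --> t' \<notin> facs A)"
  proof
   fix t' assume "t' \<in> facs {insert v t}"
   then obtain u where u: "u \<in> insert v t" "t' = insert v t - {u}" by (auto simp: facs_def)
   show "cls d H t' = 0 \<and> (t' \<noteq> t --> t' \<notin> facs A)"
   proof (cases "u = v")
    case True
    thus ?thesis using u t(4) \<open>cls d H t = 0\<close> by simp
   next
    case False
    hence ut: "u \<in> t" "t' = insert v (t - {u})" using u by auto
    have l: "tlight d H (t - {u})" using tl unfolding tlight_def by blast
    have c: "card (t - {u}) + 1 = d" using t ut by simp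
    have "cls d H t' \<le> d - card t'" using tlight_extend[OF _ l _ t(4) v t(1)] c t ut by (intro cls_le_card) auto
    moreover have "card t' = d" unfolding ut(2) using t c by simp
    moreover have "t' \<notin> facs A"
    proof
     assume "t' \<in> facs A"
     hence "insert v (t - {u}) \<in> (if card (t - {u}) + 1 = d then facs A else H (card (t - {u}) + 1))"
      using c ut by simp
     moreover have "t - {u} \<notin> H (card (t - {u}))" using l c unfolding tlight_def by auto
     moreover have "card (t - {u}) < d" "t - {u} \<subseteq> t" "v \<notin> t - {u}" using c t(4) by auto
     ultimately have "v \<in> cand d H A t" unfolding cand_def by blast
     thus False using v by simp
    qed
    ultimately show ?thesis by simp
   qed
  qed
 }
qed

definition lightest :: "nat => (nat => nat set set) => nat set => nat set set" where
 "lightest d H r = {t \<in> facs {r}. \<forall>t'\<in>facs {r}. cls d H t \<le> cls d H t'}"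

text \<open>The invariant of the exploration needed for \<open>seed_proportion\<close>, with \<open>S\<close> the first face and those found by saving steps.\<close>
definition forest :: "nat => (nat => nat set set) => nat set set => nat set set => (nat set => nat set) => bool" where
 "forest d H A S par \<longleftrightarrow> S \<subseteq> A \<and> (\<forall>r\<in>A - S. par r \<in> facs {r} \<and>
   (cls d H (par r) = 0 --> (\<forall>t\<in>facs {r}. cls d H t = 0)) \<and>
   (cls d H (par r) > 0 --> (\<exists>t\<in>facs {r}. cls d H t < cls d H (par r)))) \<and>
  (\<forall>r\<in>A - S. \<forall>r'\<in>A - S. r \<noteq> r' --> (lightest d H r - {par r}) \<inter> (lightest d H r' - {par r'}) = {})"

lemma forest_insert:
 assumes f: "forest d H A S par" and s: "s \<notin> A" and p: "t \<in> facs {s}"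
  "cls d H t = 0 --> (\<forall>t'\<in>facs {s}. cls d H t' = 0)"
  "cls d H t > 0 --> (\<exists>t'\<in>facs {s}. cls d H t' < cls d H t)"
  and new: "(lightest d H s - {t}) \<inter> facs A = {}"
 shows "forest d H (insert s A) S (par(s := t))"
proof -
 have S: "S \<subseteq> A" using f by (simp add: forest_def)
 have e: "insert s A - S = insert s (A - S)" using S s by auto
 have sub: "lightest d H q - X \<subseteq> facs A" if "q \<in> A - S" for q X
  using that unfolding lightest_def facs_def by blast
 have d1: "(lightest d H s - {t}) \<inter> (lightest d H q - {par q}) = {}" if "q \<in> A - S" for q
  using new sub[OF that] by blast
 show ?thesis
  unfolding forest_def e
 proof (intro conjI ballI)
  show "S \<subseteq> insert s A" using S by auto
 next
  fix q assume r: "q \<in> insert s (A - S)"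
  have "par' q \<in> facs {q} \<and>
   (cls d H (par' q) = 0 --> (\<forall>t\<in>facs {q}. cls d H t = 0)) \<and>
   (cls d H (par' q) > 0 --> (\<exists>t\<in>facs {q}. cls d H t < cls d H (par' q)))" if par': "par' = par(s := t)" for par'
  proof (cases "q = s")
   case True
   thus ?thesis using p by (simp add: par')
  next
   case False
   show ?thesis using False f r unfolding forest_def by (simp add: par')
  qed
  from this[OF refl] show "(par(s := t)) q \<in> facs {q}"
   "cls d H ((par(s := t)) q) = 0 --> (\<forall>t\<in>facs {q}. cls d H t = 0)"
   "cls d H ((par(s := t)) q) > 0 --> (\<exists>t'\<in>facs {q}. cls d H t' < cls d H ((par(s := t)) q))" by blast+
 next
  fix q q' assume r: "q \<in> insert s (A - S)" "q' \<in> insert s (A - S)"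
  show "q \<noteq> q' --> (lightest d H q - {(par(s := t)) q}) \<inter> (lightest d H q' - {(par(s := t)) q'}) = {}"
  proof (cases "q = s"; cases "q' = s")
   assume "q \<noteq> s" "q' \<noteq> s"
   thus ?thesis using f r unfolding forest_def by simp
  next
   assume "q = s" "q' \<noteq> s"
   thus ?thesis using d1[of q'] r by simp
  next
   assume "q \<noteq> s" "q' = s"
   thus ?thesis using d1[of q] r by (simp add: Int_commute)
  qed simp
 qed
qed

lemma forest_insert_seed:
 assumes f: "forest d H A S par" and s: "s \<notin> A"
 shows "forest d H (insert s A) (insert s S) par"
proof -
 show ?thesis using s f unfolding forest_def by auto
qed

lemma facs_new:
 assumes "t \<in> facs K" "K \<subseteq> all_faces n d"
 shows "finite t" "card t = d" "t \<subseteq> {..<n}"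
proof -
 obtain q a where r: "q \<in> K" "a \<in> q" "t = q - {a}" using assms(1) by (auto simp: facs_def)
 have "q \<in> all_faces n d" using r assms(2) by auto
 from all_faces_D[OF this] r show "finite t" "card t = d" "t \<subseteq> {..<n}" by auto
qed

text \<open>Every core is found by some exploration.  A vertex that is not a candidate leads to lighter facets by \<open>cls_step\<close>.  As the facet
  explored is a lightest open one, these have not been seen before, so the lightest facets
  of the faces found by free steps are disjoint.\<close>
lemma exploration_exists:
 assumes core: "core d n s0 K" and d: "d \<ge> 2" and H: "{} \<notin> H 0"
  and Q: "\<And>A u. A \<subseteq> K ==> u \<in> facs K ==> finite (cand d H A u) \<and> card (cand d H A u) \<le> Q"
 shows "A \<subseteq> K ==> s0 \<in> A ==> E \<subseteq> facs K ==> (\<forall>u\<in>E. \<forall>q\<in>K. u \<in> facs {q} --> q \<in> A) ==> forest d H A S par ==>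
  \<exists>L s r S' par'. expl d n Q H K A E L s r \<and> forest d H K S' par' \<and> card S' = card S + s \<and>
  s + r = card (K - A) \<and> L \<le> card (K - A) + card (facs K - E)"
proof (induction "card (K - A) + card (facs K - E)" arbitrary: A E S par rule: less_induct)
 case less
 have KF: "K \<subseteq> all_faces n d" using core by (simp add: core_def)
 have finK: "finite K" by (rule finite_subset_faces[OF KF])
 have finf: "finite (facs K)" using finK KF all_faces_D by (intro finite_facs) auto
 have finS: "finite S" using less.prems finK finite_subset unfolding forest_def by metis
 show ?case
 proof (cases "facs A \<subseteq> E")
  case True
  have "facs A \<inter> facs (K - A) = {}"
   using True less.prems(4) by (auto simp: facs_def)
  moreover have "\<forall>A. s0 \<in> A \<and> A \<subseteq> K \<and> facs A \<inter> facs (K - A) = {} --> A = K" using core unfolding core_def by simp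
  ultimately have AK: "A = K" using less.prems(1,2) by blast
  have "expl d n Q H K A E 0 0 0" unfolding AK using True AK by (intro expl.finish) simp
  thus ?thesis using less.prems(5) AK by force
 next
  case False
  define u where "u = pick d H A E"
  obtain u0 where t0: "u0 \<in> facs A - E" using False by blast
  have u: "u \<in> facs A" "u \<notin> E" unfolding u_def pick_def using arg_min_natI[of "\<lambda>u. u \<in> facs A - E", OF t0, of "cls d H"] by auto
  have umin: "cls d H u \<le> cls d H u'" if "u' \<in> facs A - E" for u'
   unfolding u_def pick_def using arg_min_nat_le[of "\<lambda>u. u \<in> facs A - E", OF that, of "cls d H"] .
  have uK: "u \<in> facs K" using u(1) facs_mono[OF less.prems(1)] by auto
  note t = facs_new[OF uK KF]
  show ?thesis
  proof (cases "\<exists>q\<in>K - A. u \<in> facs {q}")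
   case False
   have lt: "card (facs K - insert u E) < card (facs K - E)"
    using u uK finf by (intro psubset_card_mono) auto
   have "\<exists>L s r S' par'. expl d n Q H K A (insert u E) L s r \<and> forest d H K S' par' \<and> card S' = card S + s \<and>
    s + r = card (K - A) \<and> L \<le> card (K - A) + card (facs K - insert u E)"
   proof (rule less.hyps)
    show "\<forall>u\<in>insert u E. \<forall>q\<in>K. u \<in> facs {q} --> q \<in> A" using less.prems(4) False by auto
   qed (use lt less.prems uK in auto)
   then obtain L s r S' par' where e: "expl d n Q H K A (insert u E) L s r" "forest d H K S' par'"
    "card S' = card S + s" "s + r = card (K - A)" "L \<le> card (K - A) + card (facs K - insert u E)" by auto
   have "expl d n Q H K A E (Suc L) s r" using e(1) unfolding u_def by (rule expl.closed)
   thus ?thesis using e lt by force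
  next
   case True
   then obtain q where r: "q \<in> K" "q \<notin> A" "u \<in> facs {q}" by auto
   obtain v where v: "v \<in> q" "u = q - {v}" using r(3) by (auto simp: facs_def)
   have q: "q = insert v u" "v \<notin> u" using v by auto
   have vn: "v < n" using r(1) KF v(1) all_faces_D[of q n d] by auto
   have lt: "card (K - insert q A) < card (K - A)" using r finK by (intro psubset_card_mono) auto
   have c1: "card (K - A) = Suc (card (K - insert q A))"
   proof -
    have "K - A = insert q (K - insert q A)" using r by auto
    thus ?thesis using finK by (metis Diff_iff card_insert_disjoint finite_Diff insertI1)
   qed
   have step: "\<exists>L s r' S' par'. expl d n Q H K (insert q A) E L s r' \<and> forest d H K S' par' \<and> card S' = card S1 + s \<and>
    s + r' = card (K - insert q A) \<and> L \<le> card (K - insert q A) + card (facs K - E)"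
    if "forest d H (insert q A) S1 par1" for S1 par1
    by (rule less.hyps[OF _ _ _ _ _ that]) (use less.prems r lt in auto)
   show ?thesis
   proof (cases "v \<in> cand d H A u")
    case True
    from step[OF forest_insert_seed[OF less.prems(5) r(2)]] obtain L s r' S' par' where e:
     "expl d n Q H K (insert q A) E L s r'" "forest d H K S' par'" "card S' = card (insert q S) + s"
     "s + r' = card (K - insert q A)" "L \<le> card (K - insert q A) + card (facs K - E)" by auto
    have "q \<notin> S" using less.prems(5) r by (auto simp: forest_def)
    hence cS: "card S' = card S + Suc s" using e(3) finS by simp
    have "expl d n Q H K A E (Suc L) (Suc s) r'"
     by (rule expl.saving[of _ _ _ _ _ v]) (use Q[OF less.prems(1) uK] True e(1) q in \<open>simp_all add: u_def[symmetric]\<close>)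
    thus ?thesis using e(2) cS e(4,5) c1 by force
   next
    case False
    note cs = cls_step[OF t(1,2) d q(2) H False, folded q(1)]
    have "(lightest d H q - {u}) \<inter> facs A = {}"
    proof (rule ccontr)
     assume "\<not> ?thesis"
     then obtain u' where t': "u' \<in> lightest d H q" "u' \<noteq> u" "u' \<in> facs A" by blast
     have tr: "u' \<in> facs {q}" using t' by (simp add: lightest_def)
     show False
     proof (cases "cls d H u = 0")
      case True
      thus False using cs(2) tr t' by blast
     next
      case False
      then obtain u2 where t2: "u2 \<in> facs {q}" "cls d H u2 < cls d H u" using cs(1) by auto
      have "cls d H u' \<le> cls d H u2" using t'(1) t2(1) by (simp add: lightest_def)
      thus False using t2(2) umin[of u'] t'(3) less.prems(4) r tr by auto
     qed
    qed
    moreover have "cls d H u = 0 --> (\<forall>u'\<in>facs {q}. cls d H u' = 0)" using cs(2) by simp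
    moreover have "cls d H u > 0 --> (\<exists>u'\<in>facs {q}. cls d H u' < cls d H u)" using cs(1) by simp
    ultimately have "forest d H (insert q A) S (par(q := u))" by (intro forest_insert[OF less.prems(5) r(2,3)])
    from step[OF this] obtain L s r' S' par' where e:
     "expl d n Q H K (insert q A) E L s r'" "forest d H K S' par'" "card S' = card S + s"
     "s + r' = card (K - insert q A)" "L \<le> card (K - insert q A) + card (facs K - E)" by auto
    have "expl d n Q H K A E (Suc L) s (Suc r')"
     by (rule expl.free[of v]) (use vn e(1) q in \<open>simp_all add: u_def[symmetric]\<close>)
    thus ?thesis using e(2-5) c1 by force
   qed
  qed
 qed
qed

section \<open>Heavy sets\<close>

text \<open>Heavy sets are defined downwards from the facets: a set is heavy if it has more than \<open>q\<close> heavy extensions by one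
  element.  The index is the codimension.\<close>
primrec hv :: "nat => nat set set => nat => nat set set" where
 "hv q K 0 = facs K"
| "hv q K (Suc j) = {r. q < card {v. v \<notin> r \<and> insert v r \<in> hv q K j}}"

definition Hd :: "nat => nat => nat set set => nat => nat set set" where
 "Hd q d K k = (if 1 \<le> k \<and> k < d then hv q K (d - k) else {})"

lemma hv_props:
 assumes K: "K \<subseteq> all_faces n d"
 shows "j \<le> d ==> r \<in> hv q K j ==> r \<subseteq> {..<n} \<and> card r = d - j"
proof (induction j arbitrary: r)
 case 0
 thus ?case using facs_new[OF _ K] by simp
next
 case (Suc j)
 have "0 < card {v. v \<notin> r \<and> insert v r \<in> hv q K j}" using Suc.prems(2) by simp
 then obtain v where v: "v \<notin> r" "insert v r \<in> hv q K j" unfolding card_gt_0_iff by blast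
 from Suc.IH[OF _ v(2)] Suc.prems(1) have i: "insert v r \<subseteq> {..<n}" "card (insert v r) = d - j" by auto
 have "finite r" using i(1) by (meson finite_insert finite_lessThan finite_subset)
 thus ?case using i v(1) by auto
qed

lemma finite_hv:
 assumes "K \<subseteq> all_faces n d" "j \<le> d"
 shows "finite (hv q K j)"
 by (rule finite_subset[of _ "Pow {..<n}"]) (use hv_props[OF assms] in auto)

lemma card_facs_le:
 assumes "K \<subseteq> all_faces n d"
 shows "card (facs K) \<le> (d + 1) * card K"
proof -
 have fK: "finite K" by (rule finite_subset_faces[OF assms])
 have "card (facs K) \<le> (\<Sum>s\<in>K. card (facs {s}))" unfolding facs_UN[of K] by (rule card_UN_le[OF fK])
 also have "... = (\<Sum>s\<in>K. d + 1)"
  using all_faces_D assms by (intro sum.cong) (auto simp: card_facs_single)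
 finally show ?thesis by (simp add: mult.commute)
qed

text \<open>Double counting of pairs of a heavy set and a heavy extension.\<close>
lemma card_hv_Suc:
 assumes K: "K \<subseteq> all_faces n d" and j: "Suc j \<le> d"
 shows "(q + 1) * card (hv q K (Suc j)) \<le> d * card (hv q K j)"
proof -
 let ?A = "hv q K (Suc j)"
 let ?V = "\<lambda>r. {v. v \<notin> r \<and> insert v r \<in> hv q K j}"
 have fin: "finite (?A)" "finite (hv q K j)" using finite_hv[OF K] j by (auto simp del: hv.simps)
 have pj: "r \<subseteq> {..<n} \<and> card r = d - j" if "r \<in> hv q K j" for r
  using hv_props[OF K _ that] j by simp
 have finV: "finite (?V r)" for r by (rule finite_subset[of _ "{..<n}"]) (use pj in auto)
 have "(q + 1) * card (?A) = (\<Sum>r\<in>?A. q + 1)" by simp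
 also have "... \<le> (\<Sum>r\<in>?A. card (?V r))" by (rule sum_mono) simp
 also have "... = card (SIGMA r:?A. ?V r)" using fin finV by simp
 also have "... \<le> card (SIGMA r:hv q K j. r)"
 proof (rule card_inj_on_le)
  show "inj_on (\<lambda>(r, v). (insert v r, v)) (SIGMA r:?A. ?V r)"
   by (rule inj_on_inverseI[of _ "\<lambda>(r, v). (r - {v}, v)"]) auto
  show "(\<lambda>(r, v). (insert v r, v)) ` (SIGMA r:?A. ?V r) \<subseteq> (SIGMA r:hv q K j. r)" by auto
  show "finite (SIGMA r:hv q K j. r)" using fin pj by (intro finite_SigmaI) (auto intro: finite_subset)
 qed
 also have "... = (\<Sum>r\<in>hv q K j. card r)" using fin pj by (intro card_SigmaI) (auto intro: finite_subset)
 also have "... \<le> d * card (hv q K j)" using pj by simp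
 finally show ?thesis .
qed

lemma card_hv:
 assumes K: "K \<subseteq> all_faces n d"
 shows "j \<le> d ==> (q + 1) ^ j * card (hv q K j) \<le> d ^ j * ((d + 1) * card K)"
proof (induction j)
 case 0
 thus ?case using card_facs_le[OF K] by simp
next
 case (Suc j)
 have "(q + 1) ^ Suc j * card (hv q K (Suc j)) = (q + 1) ^ j * ((q + 1) * card (hv q K (Suc j)))" by (simp only: power_Suc mult_ac)
 also have "... \<le> (q + 1) ^ j * (d * card (hv q K j))"
  by (intro mult_left_mono card_hv_Suc[OF K Suc.prems]) simp
 also have "... \<le> d * (d ^ j * ((d + 1) * card K))" using Suc by simp
 finally show ?case by simp
qed

lemma cand_bound:
 assumes K: "K \<subseteq> all_faces n d" and d: "d \<ge> 2" and e: "{} \<notin> hv h K d" and A: "A \<subseteq> K" and u: "u \<in> facs K"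
 shows "finite (cand d (Hd h d K) A u) \<and> card (cand d (Hd h d K) A u) \<le> 2 ^ d * h"
proof -
 note t = facs_new[OF u K]
 let ?R = "{q \<in> Pow u. card q < d \<and> q \<notin> Hd h d K (card q)}"
 let ?V = "\<lambda>q. {v. v \<notin> q \<and> insert v q \<in> hv h K (d - card q - 1)}"
 have finV: "finite (?V q)" for q
 proof (rule finite_subset[of _ "{..<n}"])
  show "?V q \<subseteq> {..<n}"
  proof
   fix v assume "v \<in> ?V q"
   hence "insert v q \<in> hv h K (d - card q - 1)" by blast
   from hv_props[OF K _ this] have "insert v q \<subseteq> {..<n}" by simp
   thus "v \<in> {..<n}" by blast
  qed
 qed simp
 have "cand d (Hd h d K) A u \<subseteq> (\<Union>q\<in>?R. ?V q)"
 proof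
  fix v assume "v \<in> cand d (Hd h d K) A u"
  then obtain q where r: "q \<subseteq> u" "card q < d" "v \<notin> q" "q \<notin> Hd h d K (card q)"
   "insert v q \<in> (if card q + 1 = d then facs A else Hd h d K (card q + 1))" unfolding cand_def by blast
  have "insert v q \<in> hv h K (d - card q - 1)"
  proof (cases "card q + 1 = d")
   case True
   hence "insert v q \<in> facs K" using r(5) facs_mono[OF A] by auto
   moreover have "d - card q - 1 = 0" using True by simp
   ultimately show ?thesis by simp
  next
   case False
   thus ?thesis using r(2,5) by (simp add: Hd_def)
  qed
  thus "v \<in> (\<Union>q\<in>?R. ?V q)" using r by auto
 qed
 moreover have cV: "card (?V q) \<le> h" if "q \<in> ?R" for q
 proof -
  have r: "q \<subseteq> u" "card q < d" "q \<notin> Hd h d K (card q)" using that by auto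
  have "q \<notin> hv h K (Suc (d - card q - 1))"
  proof (cases "card q = 0")
   case True
   thus ?thesis using finite_subset[OF r(1) t(1)] e d by simp
  next
   case False
   thus ?thesis using r by (simp add: Hd_def Suc_diff_Suc)
  qed
  thus ?thesis by simp
 qed
 moreover have fR: "finite ?R" using t(1) by auto
 ultimately have sub: "cand d (Hd h d K) A u \<subseteq> (\<Union>q\<in>?R. ?V q)" and fin: "finite (\<Union>q\<in>?R. ?V q)" using finV by auto
 have "card (cand d (Hd h d K) A u) \<le> card (\<Union>q\<in>?R. ?V q)" by (rule card_mono[OF fin sub])
 also have "... \<le> (\<Sum>q\<in>?R. card (?V q))" by (rule card_UN_le[OF fR])
 also have "... \<le> (\<Sum>q\<in>?R. h)" by (rule sum_mono[OF cV])
 also have "... = card ?R * h" by simp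
 also have "... \<le> card (Pow u) * h" using t(1) by (intro mult_right_mono card_mono) auto
 finally show ?thesis using finite_subset[OF sub fin] t by (simp add: card_Pow)
qed

text \<open>Sum \<open>card_expl\<close> over the parameters.  By \<open>seed_proportion\<close> at least \<open>s0\<close> steps save, each replacing a factor \<open>n\<close> by
  \<open>2 ^ d * h\<close>.\<close>
lemma card_cores_prescribed:
 assumes d: "d \<ge> 2" and C: "C = (d + 2) ^ (d + 1)" and s0: "C * s0 < m" and h: "2 ^ d * h \<le> n"
 shows "card {K. core d n g K \<and> card K = m \<and> Hd h d K = H \<and> {} \<notin> hv h K d}
  \<le> ((d + 2) * m + 1) * m * (3 ^ ((d + 2) * m) * ((2 ^ d * h) ^ s0 * n ^ (m - 1 - s0)))"
proof (cases "H 0 = {}")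
 case False
 hence e: "{K. core d n g K \<and> card K = m \<and> Hd h d K = H \<and> {} \<notin> hv h K d} = {}" by (auto simp: Hd_def)
 show ?thesis unfolding e by simp
next
 case True
 define Q where "Q = 2 ^ d * h"
 let ?I = "{..(d + 2) * m} \<times> {s. s < m \<and> s0 \<le> s}"
 have "{K. core d n g K \<and> card K = m \<and> Hd h d K = H \<and> {} \<notin> hv h K d} \<subseteq> (\<Union>(L, s)\<in>?I. {K. expl d n Q H K {g} {} L s (m - 1 - s)})"
 proof
  fix K assume "K \<in> {K. core d n g K \<and> card K = m \<and> Hd h d K = H \<and> {} \<notin> hv h K d}"
  hence K: "core d n g K" "card K = m" "Hd h d K = H" "{} \<notin> hv h K d" by auto
  have KF: "K \<subseteq> all_faces n d" and s: "g \<in> K" using K(1) by (auto simp: core_def)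
  have finK: "finite K" by (rule finite_subset_faces[OF KF])
  have Q: "finite (cand d H A t) \<and> card (cand d H A t) \<le> Q" if "A \<subseteq> K" "t \<in> facs K" for A t
   using cand_bound[OF KF d K(4) that] unfolding K(3) Q_def .
  have "\<exists>L s r S' par'. expl d n Q H K {g} {} L s r \<and> forest d H K S' par' \<and> card S' = card {g} + s \<and>
   s + r = card (K - {g}) \<and> L \<le> card (K - {g}) + card (facs K - {})"
   by (rule exploration_exists[OF K(1) d _ Q, where S = "{g}" and par = undefined]) (use s True in \<open>auto simp: forest_def\<close>)
  then obtain L s r S' par' where e: "expl d n Q H K {g} {} L s r" "forest d H K S' par'" "card S' = card {g} + s"
   "s + r = card (K - {g})" "L \<le> card (K - {g}) + card (facs K - {})" by auto
  have m1: "m \<ge> 1" using K(2) s finK by (metis One_nat_def Suc_leI card_gt_0_iff empty_iff)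
  have "card K \<le> (d + 2) ^ (d + 1) * card S'"
  proof (rule seed_proportion[where cls = "cls d H" and par = par' and Lm = "lightest d H"])
   show "finite K" by (rule finK)
   show "\<And>q. q \<in> K ==> finite q \<and> card q = d + 1" using KF all_faces_D by auto
   show "S' \<subseteq> K" using e(2) by (simp add: forest_def)
   show "\<And>q t. q \<in> K ==> t \<in> facs {q} ==> \<exists>q'\<in>K. q' \<noteq> q \<and> t \<in> facs {q'}" using K(1) unfolding core_def by blast
   show "\<And>q. q \<in> K - S' ==> par' q \<in> facs {q}" using e(2) unfolding forest_def by blast
   show "\<And>q t. q \<in> K - S' ==> cls d H (par' q) = 0 ==> t \<in> facs {q} ==> cls d H t = 0" using e(2) unfolding forest_def by blast
   show "\<And>q. q \<in> K - S' ==> cls d H (par' q) > 0 ==> \<exists>t\<in>facs {q}. cls d H t < cls d H (par' q)" using e(2) unfolding forest_def by blast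
   show "\<And>q q'. q \<in> K - S' ==> q' \<in> K - S' ==> q \<noteq> q' ==> (lightest d H q - {par' q}) \<inter> (lightest d H q' - {par' q'}) = {}"
    using e(2) unfolding forest_def by blast
  qed (use d in \<open>auto simp: cls_def lightest_def\<close>)
  hence "C * s0 < C * (1 + s)" using s0 K(2) e(3) C by simp
  hence "s0 \<le> s" unfolding mult_less_cancel1 by simp
  moreover have "s < m" "r = m - 1 - s" using e(4) K(2) s m1 by auto
  ultimately show "K \<in> (\<Union>(L, s)\<in>?I. {K. expl d n Q H K {g} {} L s (m - 1 - s)})" using e(5) card_facs_le[OF KF] K(2) s e(1) by auto
 qed
 moreover have "finite (\<Union>(L, s)\<in>?I. {K. expl d n Q H K {g} {} L s (m - 1 - s)})"
  using card_expl by auto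
 ultimately have "card {K. core d n g K \<and> card K = m \<and> Hd h d K = H \<and> {} \<notin> hv h K d}
  \<le> card (\<Union>(L, s)\<in>?I. {K. expl d n Q H K {g} {} L s (m - 1 - s)})" by (intro card_mono)
 also have "... \<le> (\<Sum>x\<in>?I. card (case x of (L, s) => {K. expl d n Q H K {g} {} L s (m - 1 - s)}))"
  by (rule card_UN_le) simp
 also have "... \<le> (\<Sum>x\<in>?I. 3 ^ ((d + 2) * m) * (Q ^ s0 * n ^ (m - 1 - s0)))"
 proof (rule sum_mono)
  fix x assume "x \<in> ?I"
  then obtain L s where x: "x = (L, s)" and L: "L \<le> (d + 2) * m" "s < m" "s0 \<le> s" by auto
  have "card {K. expl d n Q H K {g} {} L s (m - 1 - s)} \<le> 3 ^ L * Q ^ s * n ^ (m - 1 - s)" using card_expl by blast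
  also have "... = 3 ^ L * (Q ^ s0 * (Q ^ (s - s0) * n ^ (m - 1 - s)))" using L by (simp add: power_add[symmetric])
  also have "... \<le> 3 ^ ((d + 2) * m) * (Q ^ s0 * (n ^ (s - s0) * n ^ (m - 1 - s)))"
   using L h unfolding Q_def[symmetric] by (intro mult_mono power_increasing power_mono) auto
  also have "n ^ (s - s0) * n ^ (m - 1 - s) = n ^ (m - 1 - s0)" using L by (simp add: power_add[symmetric])
  finally show "card (case x of (L, s) => {K. expl d n Q H K {g} {} L s (m - 1 - s)}) \<le> 3 ^ ((d + 2) * m) * (Q ^ s0 * n ^ (m - 1 - s0))"
   by (simp add: x)
 qed
 also have "... = card ?I * (3 ^ ((d + 2) * m) * (Q ^ s0 * n ^ (m - 1 - s0)))" by simp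
 also have "card ?I \<le> ((d + 2) * m + 1) * m"
 proof -
  have "card {s. s < m \<and> s0 \<le> s} \<le> card {..<m}" by (intro card_mono) auto
  hence "card {s. s < m \<and> s0 \<le> s} \<le> m" by simp
  from mult_le_mono2[OF this] show ?thesis by (simp only: card_cartesian_product card_atMost Suc_eq_plus1)
 qed
 finally show ?thesis unfolding Q_def by simp
qed

section \<open>The expected number of circuits\<close>

definition cores :: "nat => nat => nat => (nat set \<times> nat set set) set" where
 "cores d n m = {(s, K). core d n s K \<and> card K = m}"

text \<open>The expected number of cores of size \<open>m\<close> that are present up to the marked face.\<close>
definition core_weight :: "nat => real => nat => nat => real" where
 "core_weight d c n m = real (card (cores d n m)) * (c / real n) ^ (m - 1)"

lemma coreD: "core d n s K ==> s \<in> K" "core d n s K ==> K \<subseteq> all_faces n d"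
 by (simp_all add: core_def)

lemma finite_cores: "finite (cores d n m)"
proof (rule finite_subset)
 show "cores d n m \<subseteq> all_faces n d \<times> Pow (all_faces n d)"
  by (auto simp: cores_def dest: coreD(1) coreD(2)[THEN subsetD])
qed simp

lemma choose_le_power: "n choose k \<le> n ^ k"
 by (cases "k \<le> n") (auto simp: binomial_le_pow binomial_eq_0)

lemma card_cores_le:
 assumes d: "d \<ge> 2" and C: "C = (d + 2) ^ (d + 1)" and s0: "C * s0 < m" and q: "2 ^ d * q \<le> n"
  and G: "finite G" "\<And>g K. core d n g K ==> card K = m ==> Hd q d K \<in> G \<and> {} \<notin> hv q K d"
 shows "card (cores d n m) \<le> n ^ (d + 1) * (card G * (((d + 2) * m + 1) * m * (3 ^ ((d + 2) * m) * ((2 ^ d * q) ^ s0 * n ^ (m - 1 - s0)))))"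
proof -
 let ?B = "((d + 2) * m + 1) * m * (3 ^ ((d + 2) * m) * ((2 ^ d * q) ^ s0 * n ^ (m - 1 - s0)))"
 let ?S = "\<lambda>g H. {K. core d n g K \<and> card K = m \<and> Hd q d K = H \<and> {} \<notin> hv q K d}"
 have finS: "finite (?S g H)" for g H
  by (rule finite_subset[of _ "Pow (all_faces n d)"]) (auto dest: coreD(2)[THEN subsetD])
 have "cores d n m \<subseteq> (SIGMA g:all_faces n d. \<Union>H\<in>G. ?S g H)"
 proof
  fix x assume "x \<in> cores d n m"
  then obtain g K where x: "x = (g, K)" and c: "core d n g K" "card K = m" by (auto simp: cores_def)
  show "x \<in> (SIGMA g:all_faces n d. \<Union>H\<in>G. ?S g H)" using G(2)[OF c] c coreD[OF c(1)] unfolding x by auto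
 qed
 hence "card (cores d n m) \<le> card (SIGMA g:all_faces n d. \<Union>H\<in>G. ?S g H)"
  using finS G(1) by (intro card_mono finite_SigmaI finite_UN_I) auto
 also have "... = (\<Sum>g\<in>all_faces n d. card (\<Union>H\<in>G. ?S g H))"
  using finS G(1) by simp
 also have "... \<le> (\<Sum>g\<in>all_faces n d. card G * ?B)"
 proof (rule sum_mono)
  fix g
  have "card (\<Union>H\<in>G. ?S g H) \<le> (\<Sum>H\<in>G. card (?S g H))" by (rule card_UN_le[OF G(1)])
  also have "... \<le> (\<Sum>H\<in>G. ?B)" by (intro sum_mono card_cores_prescribed[OF d C s0 q])
  finally show "card (\<Union>H\<in>G. ?S g H) \<le> card G * ?B" by simp
 qed
 also have "... = (n choose (d + 1)) * (card G * ?B)" by (simp only: sum_constant of_nat_id card_all_faces)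
 also have "... \<le> n ^ (d + 1) * (card G * ?B)" by (intro mult_right_mono choose_le_power) simp
 finally show ?thesis .
qed

text \<open>The factor \<open>n ^ (m - 1)\<close> of the free choices cancels against the density.  Each of the \<open>s0\<close> savings contributes
  \<open>2 ^ d * q / n\<close>, and the exponential terms in \<open>m\<close> are absorbed into \<open>E\<close> as \<open>m\<close> is at most
  about \<open>C * s0\<close>.\<close>
lemma core_weight_le:
 assumes d: "d \<ge> 2" and C: "C = (d + 2) ^ (d + 1)" and m: "m \<ge> 1" and n: "n > 0" and q: "2 ^ d * q \<le> n" and c: "c > 0"
  and H: "finite H" "\<And>s K. core d n s K ==> card K = m ==> Hd q d K \<in> H \<and> {} \<notin> hv q K d"
  and E: "E = (2 * 6 ^ (d + 2) * max 1 c) ^ C" and s0: "s0 = (m - 1) div C"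
 shows "core_weight d c n m \<le> real n ^ (d + 1) * real (card H) * (E * (E * (2 ^ d * real q) / real n) ^ s0)"
proof -
 let ?A = "real (((d + 2) * m + 1) * m * 3 ^ ((d + 2) * m))"
 have C0: "C > 0" using C by simp
 have le: "C * s0 \<le> m - 1" using s0 by simp
 have ml: "m \<le> C * (s0 + 1)"
 proof -
  have "m - 1 < C * ((m - 1) div C) + C" using C0 by (metis add.commute dividend_less_times_div mult.commute add_less_cancel_left mod_less_divisor mult_div_mod_eq)
  thus ?thesis using m s0 by simp
 qed
 have s0m: "s0 \<le> m - 1" using le C0 by (metis le_trans mult_le_mono1 nat_mult_1 Suc_leI One_nat_def)
 let ?D = "2 * 6 ^ (d + 2) * max 1 c"
 have D1: "?D \<ge> 1"
 proof -
  have "(1::real) \<le> 6 ^ (d + 2)" by (rule one_le_power) simp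
  hence "(1::real) * 1 \<le> (2 * 6 ^ (d + 2)) * max 1 c" by (intro mult_mono) linarith+
  thus ?thesis by simp
 qed
 have poly: "?A * c ^ (m - 1) \<le> ?D ^ m"
 proof -
  have 1: "(d + 2) * m + 1 \<le> 2 ^ ((d + 2) * m)" using Suc_leI[OF less_exp[of "(d + 2) * m"]] unfolding Suc_eq_plus1 .
  have 2: "m \<le> 2 ^ m" by simp
  have "((d + 2) * m + 1) * m * 3 ^ ((d + 2) * m) \<le> 2 ^ ((d + 2) * m) * 2 ^ m * 3 ^ ((d + 2) * m)"
   by (intro mult_mono 1 2) auto
  also have "... = 2 ^ m * (2 * 3) ^ ((d + 2) * m)" by (simp only: power_mult_distrib mult_ac)
  also have "... = 2 ^ m * 6 ^ ((d + 2) * m)" by simp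
  also have "... = (2 * 6 ^ (d + 2)) ^ m" by (simp only: power_mult power_mult_distrib)
  finally have "?A \<le> real ((2 * 6 ^ (d + 2)) ^ m)" by (simp only:)
  also have "... = (2 * 6 ^ (d + 2)) ^ m" by simp
  finally have a: "?A \<le> (2 * 6 ^ (d + 2)) ^ m" .
  have "c ^ (m - 1) \<le> max 1 c ^ (m - 1)" using c by (intro power_mono) auto
  also have "... \<le> max 1 c ^ m" by (intro power_increasing) auto
  finally have b: "c ^ (m - 1) \<le> max 1 c ^ m" .
  show ?thesis unfolding power_mult_distrib[of "2 * 6 ^ (d + 2)" "max 1 c"] by (rule mult_mono[OF a b]) (use c in auto)
 qed
 have np: "real n ^ (m - 1 - s0) / real n ^ (m - 1) = 1 / real n ^ s0"
 proof -
  have "real n ^ (m - 1) = real n ^ (m - 1 - s0) * real n ^ s0" using s0m by (simp only: power_add[symmetric] le_add_diff_inverse2)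
  thus ?thesis using n by simp
 qed
 have "core_weight d c n m \<le> real (n ^ (d + 1) * (card H * (((d + 2) * m + 1) * m * (3 ^ ((d + 2) * m) * ((2 ^ d * q) ^ s0 * n ^ (m - 1 - s0)))))) * (c / real n) ^ (m - 1)"
  unfolding core_weight_def using c le m by (intro mult_right_mono of_nat_mono card_cores_le[OF d C _ q H]) auto
 also have "... = real n ^ (d + 1) * real (card H) * ((?A * c ^ (m - 1)) * ((2 ^ d * real q) ^ s0 * (real n ^ (m - 1 - s0) / real n ^ (m - 1))))"
  unfolding power_divide by simp
 also have "... \<le> real n ^ (d + 1) * real (card H) * (?D ^ m * ((2 ^ d * real q) ^ s0 * (real n ^ (m - 1 - s0) / real n ^ (m - 1))))"
  by (intro mult_left_mono mult_right_mono poly) auto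
 also have "... = real n ^ (d + 1) * real (card H) * (?D ^ m * (2 ^ d * real q / real n) ^ s0)"
  unfolding np by (simp add: power_divide)
 also have "... \<le> real n ^ (d + 1) * real (card H) * (?D ^ (C * (s0 + 1)) * (2 ^ d * real q / real n) ^ s0)"
  using D1 ml by (intro mult_left_mono mult_right_mono power_increasing) auto
 also have "?D ^ (C * (s0 + 1)) = E * E ^ s0" unfolding E power_mult by simp
 also have "E * E ^ s0 * (2 ^ d * real q / real n) ^ s0 = E * (E * (2 ^ d * real q) / real n) ^ s0"
  by (simp add: power_mult_distrib power_divide)
 finally show ?thesis .
qed

lemma no_heavy:
 assumes K: "K \<subseteq> all_faces n d" and q: "(d + 1) * card K \<le> q"
 shows "hv q K (Suc j) = {}"
proof (induction j)
 case 0
 have "card {v. v \<notin> r \<and> insert v r \<in> facs K} \<le> q" for r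
 proof -
  have f: "finite (facs K)" using finite_hv[OF K, of 0] by simp
  have "card {v. v \<notin> r \<and> insert v r \<in> facs K} \<le> card (facs K)"
   by (rule card_inj_on_le[of "\<lambda>v. insert v r", OF _ _ f]) (auto intro!: inj_onI)
  thus ?thesis using card_facs_le[OF K] q by simp
 qed
 thus ?case by (auto simp: not_less)
qed auto

text \<open>With a threshold above the number of facets nothing is heavy.\<close>
lemma core_weight_light:
 assumes d: "d \<ge> 2" and C: "C = (d + 2) ^ (d + 1)" and m: "m \<ge> 1" and n: "n > 0" and l: "2 ^ d * ((d + 1) * m) \<le> n" and c: "c > 0"
  and E: "E = (2 * 6 ^ (d + 2) * max 1 c) ^ C"
 shows "core_weight d c n m \<le> real n ^ (d + 1) * (E * (E * (2 ^ d * real ((d + 1) * m)) / real n) ^ ((m - 1) div C))"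
proof -
 have "core_weight d c n m \<le> real n ^ (d + 1) * real (card {\<lambda>k :: nat. {} :: nat set set}) * (E * (E * (2 ^ d * real ((d + 1) * m)) / real n) ^ ((m - 1) div C))"
 proof (rule core_weight_le[OF d C m n l c _ _ E refl])
  fix s K assume "core d n s K" "card K = m"
  hence K: "K \<subseteq> all_faces n d" "(d + 1) * card K \<le> (d + 1) * m" using coreD(2)[of d n s K] by auto
  have e: "hv ((d + 1) * m) K j = {}" if "j > 0" for j using no_heavy[OF K, of "j - 1"] that by simp
  have "Hd ((d + 1) * m) d K = (\<lambda>k. {})" unfolding Hd_def using e by (intro ext) auto
  thus "Hd ((d + 1) * m) d K \<in> {\<lambda>k. {}} \<and> {} \<notin> hv ((d + 1) * m) K d" using e[of d] d by auto
 qed simp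
 moreover have "card {\<lambda>k :: nat. {} :: nat set set} = 1" by simp
 ultimately show ?thesis by simp
qed

text \<open>Count functions from \<open>h\<close> places to \<open>M\<close> with one default value.\<close>
lemma card_small_subsets:
 assumes "finite M"
 shows "finite {X. X \<subseteq> M \<and> card X \<le> h} \<and> card {X. X \<subseteq> M \<and> card X \<le> h} \<le> (card M + 1) ^ h"
proof
 show fin: "finite {X. X \<subseteq> M \<and> card X \<le> h}" using assms by simp
 have "{X. X \<subseteq> M \<and> card X \<le> h} = (\<Union>j\<le>h. {X. X \<subseteq> M \<and> card X = j})" by auto
 hence "card {X. X \<subseteq> M \<and> card X \<le> h} \<le> (\<Sum>j\<le>h. card {X. X \<subseteq> M \<and> card X = j})"
  using card_UN_le[of "{..h}"] by simp
 also have "... = (\<Sum>j\<le>h. card M choose j)" using n_subsets[OF assms] by simp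
 also have "... \<le> (\<Sum>j\<le>h. (h choose j) * card M ^ j * 1 ^ (h - j))"
 proof (rule sum_mono)
  fix j assume "j \<in> {..h}"
  hence "1 \<le> h choose j" by (simp add: Suc_le_eq)
  from mult_mono[OF this choose_le_power[of "card M" j]] show "card M choose j \<le> (h choose j) * card M ^ j * 1 ^ (h - j)" by simp
 qed
 also have "... = (card M + 1) ^ h" using binomial[of "card M" 1 h] by simp
 finally show "card {X. X \<subseteq> M \<and> card X \<le> h} \<le> (card M + 1) ^ h" .
qed

lemma card_hv_le:
 assumes K: "K \<subseteq> all_faces n d" and j: "1 \<le> j" "j \<le> d" and q: "d \<le> q + 1"
 shows "card (hv q K j) \<le> d * ((d + 1) * card K) div (q + 1)"
proof -
 obtain i where i: "j = Suc i" using j by (cases j) auto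
 have "(q + 1) ^ i * ((q + 1) * card (hv q K j)) = (q + 1) ^ j * card (hv q K j)" unfolding i by (simp only: power_Suc mult_ac)
 also have "... \<le> d ^ j * ((d + 1) * card K)" by (rule card_hv[OF K j(2)])
 also have "... = d ^ i * (d * ((d + 1) * card K))" unfolding i by simp
 also have "... \<le> (q + 1) ^ i * (d * ((d + 1) * card K))" using q by (intro mult_right_mono power_mono) auto
 finally have "(q + 1) * card (hv q K j) \<le> d * ((d + 1) * card K)" by simp
 thus ?thesis by (subst less_eq_div_iff_mult_less_eq) (simp_all add: mult.commute)
qed

text \<open>The possible systems of heavy sets.\<close>
definition heavy_data :: "nat => nat => nat => (nat => nat set set) set" where
 "heavy_data d n h = {H. \<forall>k. if 1 \<le> k \<and> k < d then H k \<subseteq> {r. r \<subseteq> {..<n} \<and> card r = k} \<and> card (H k) \<le> h else H k = {}}"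

lemma card_heavy_data: "finite (heavy_data d n h) \<and> card (heavy_data d n h) \<le> (n + 1) ^ (d * d * h)"
proof -
 let ?M = "\<lambda>k. {r. r \<subseteq> {..<n} \<and> card r = k}"
 let ?T = "PiE {1..<d} (\<lambda>k. {X. X \<subseteq> ?M k \<and> card X \<le> h})"
 have finM: "finite (?M k)" for k by simp
 have cM: "card (?M k) = n choose k" for k using n_subsets[of "{..<n}" k] by simp
 note s = card_small_subsets[OF finM]
 have finT: "finite ?T" by (intro finite_PiE) auto
 have inj: "inj_on (\<lambda>H. restrict H {1..<d}) (heavy_data d n h)"
 proof (rule inj_onI)
  fix H H' assume H: "H \<in> heavy_data d n h" "H' \<in> heavy_data d n h" "restrict H {1..<d} = restrict H' {1..<d}"
  show "H = H'"
  proof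
   fix k
   show "H k = H' k"
   proof (cases "1 \<le> k \<and> k < d")
    case True
    thus ?thesis using fun_cong[OF H(3), of k] by simp
   next
    case False
    thus ?thesis using H(1,2) unfolding heavy_data_def by simp
   qed
  qed
 qed
 have im: "(\<lambda>H. restrict H {1..<d}) ` heavy_data d n h \<subseteq> ?T"
 proof (rule image_subsetI, rule PiE_I)
  fix H k assume H: "H \<in> heavy_data d n h" and k: "k \<in> {1..<d}"
  show "restrict H {1..<d} k \<in> {X. X \<subseteq> ?M k \<and> card X \<le> h}" using H k unfolding heavy_data_def by simp
 qed auto
 have "card (heavy_data d n h) \<le> card ?T" by (rule card_inj_on_le[OF inj im finT])
 also have "... = (\<Prod>k\<in>{1..<d}. card {X. X \<subseteq> ?M k \<and> card X \<le> h})" by (simp add: card_PiE)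
 also have "... \<le> (\<Prod>k\<in>{1..<d}. (n + 1) ^ (d * h))"
 proof (rule prod_mono, rule conjI)
  fix k assume k: "k \<in> {1..<d}"
  have "card {X. X \<subseteq> ?M k \<and> card X \<le> h} \<le> (card (?M k) + 1) ^ h" using s by blast
  also have "... \<le> ((n + 1) ^ d) ^ h"
  proof (rule power_mono)
   have "card (?M k) + 1 \<le> n ^ k + 1" using choose_le_power[of n k] unfolding cM by simp
   also have "... \<le> (n + 1) ^ k"
   proof -
    have "n ^ k < (n + 1) ^ k" using k by (intro power_strict_mono) auto
    thus ?thesis by simp
   qed
   also have "... \<le> (n + 1) ^ d" using k by (intro power_increasing) auto
   finally show "card (?M k) + 1 \<le> (n + 1) ^ d" .
  qed simp
  finally show "card {X. X \<subseteq> ?M k \<and> card X \<le> h} \<le> (n + 1) ^ (d * h)" by (simp only: power_mult)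
 qed simp
 also have "... = (n + 1) ^ (d * h * (d - 1))" by (simp add: power_mult)
 also have "... \<le> (n + 1) ^ (d * d * h)" by (intro power_increasing) (auto simp: mult_le_mono)
 finally show ?thesis using inj_on_finite[OF inj im finT] by simp
qed

lemma Hd_heavy_data:
 assumes K: "K \<subseteq> all_faces n d" and q: "d \<le> q + 1" and h: "h = d * ((d + 1) * card K) div (q + 1)"
 shows "Hd q d K \<in> heavy_data d n h"
 unfolding heavy_data_def mem_Collect_eq
proof
 fix k
 show "if 1 \<le> k \<and> k < d then Hd q d K k \<subseteq> {r. r \<subseteq> {..<n} \<and> card r = k} \<and> card (Hd q d K k) \<le> h else Hd q d K k = {}"
 proof (cases "1 \<le> k \<and> k < d")
  case True
  have "card (hv q K (d - k)) \<le> h" unfolding h using True by (intro card_hv_le[OF K _ _ q]) auto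
  moreover have "hv q K (d - k) \<subseteq> {r. r \<subseteq> {..<n} \<and> card r = k}"
  proof
   fix r assume "r \<in> hv q K (d - k)"
   from hv_props[OF K _ this] show "r \<in> {r. r \<subseteq> {..<n} \<and> card r = k}" using True by simp
  qed
  ultimately show ?thesis by (simp add: Hd_def)
 qed (auto simp: Hd_def)
qed

lemma empty_light:
 assumes K: "K \<subseteq> all_faces n d" and d: "d \<ge> 2" and q: "d ^ (d - 1) * ((d + 1) * card K) \<le> (q + 1) ^ (d - 1) * q"
 shows "{} \<notin> hv q K d"
proof -
 obtain j where j: "d = Suc j" using d by (cases d) auto
 have fin: "finite (hv q K j)" using finite_hv[OF K] j by simp
 have "(q + 1) ^ j * card (hv q K j) \<le> d ^ j * ((d + 1) * card K)" using card_hv[OF K, of j] j by simp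
 also have "... \<le> (q + 1) ^ j * q" using q j by simp
 finally have "card (hv q K j) \<le> q" by simp
 moreover have "card {v. v \<notin> {} \<and> insert v {} \<in> hv q K j} \<le> card (hv q K j)"
  by (rule card_inj_on_le[of "\<lambda>v. insert v {}", OF _ _ fin]) (auto intro!: inj_onI)
 ultimately show ?thesis unfolding j by simp
qed

text \<open>With a threshold proportional to \<open>n\<close> there are few heavy sets, so that their choice costs only a factor \<open>2 ^ m\<close>.\<close>
lemma core_weight_heavy:
 assumes d: "d \<ge> 2" and C: "C = (d + 2) ^ (d + 1)" and m: "m \<ge> 1" and n: "n > 0" and c: "c > 0"
  and E: "E = (2 * 6 ^ (d + 2) * max 1 c) ^ C" and q: "d \<le> q + 1" "2 ^ d * q \<le> n"
  and l: "d ^ (d - 1) * ((d + 1) * m) \<le> (q + 1) ^ (d - 1) * q"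
  and ent: "(n + 1) ^ (d * d * (d * ((d + 1) * m) div (q + 1))) \<le> 2 ^ m"
 shows "core_weight d c n m \<le> real n ^ (d + 1) * 2 ^ m * (E * (E * (2 ^ d * real q) / real n) ^ ((m - 1) div C))"
proof -
 let ?A = "(E * (E * (2 ^ d * real q) / real n) ^ ((m - 1) div C))"
 let ?h = "d * ((d + 1) * m) div (q + 1)"
 have E0: "E > 0" unfolding E by simp
 have "core_weight d c n m \<le> real n ^ (d + 1) * real (card (heavy_data d n ?h)) * ?A"
 proof (rule core_weight_le[OF d C m n q(2) c _ _ E refl])
  show "finite (heavy_data d n ?h)" using card_heavy_data by blast
  fix s K assume K: "core d n s K" "card K = m"
  show "Hd q d K \<in> heavy_data d n ?h \<and> {} \<notin> hv q K d"
   using Hd_heavy_data[OF coreD(2)[OF K(1)] q(1)] empty_light[OF coreD(2)[OF K(1)] d] l K(2) by blast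
 qed
 also have "... \<le> real n ^ (d + 1) * 2 ^ m * ?A"
 proof (intro mult_right_mono mult_left_mono)
  have "card (heavy_data d n ?h) \<le> 2 ^ m" using card_heavy_data ent order_trans by blast
  thus "real (card (heavy_data d n ?h)) \<le> 2 ^ m" by simp
 qed (use E0 in auto)
 finally show ?thesis .
qed

text \<open>For \<open>m \<le> \<surd>n\<close> nothing is declared heavy, and each saving step gains a factor of about \<open>m / n \<le> 1 / \<surd>n\<close>;
  enough of them outweigh the \<open>n ^ (d + 1)\<close> choices of the first face.  For larger \<open>m\<close> the threshold is \<open>i * n\<close> with a small constant \<open>i\<close>,
  and the bound decays exponentially in \<open>m\<close>.  The empty set is light as long as \<open>m \<le> w * n ^ d\<close> for a suitable \<open>w\<close>.\<close>
lemma core_weight_sum: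
 assumes d: "d \<ge> 2" and c: "c > 0"
 shows "\<exists>w>0. \<exists>m0\<ge>1. (\<lambda>n. \<Sum>m | m0 \<le> m \<and> real m \<le> w * real (n choose d). core_weight d c n m) \<longlonglongrightarrow> 0"
proof -
 let ?A = "(real d * real d * real d * (real d + 1))"
 define C :: nat where "C = (d + 2) ^ (d + 1)"
 define E :: real where "E = (2 * 6 ^ (d + 2) * max 1 c) ^ C"
 have C0: "C > 0" by (simp add: C_def)
 have E1: "E \<ge> 1"
 proof -
  have "(1::real) \<le> 6 ^ (d + 2)" by (rule one_le_power) simp
  hence "(1::real) * 1 \<le> (2 * 6 ^ (d + 2)) * max 1 c" by (intro mult_mono) linarith+
  thus ?thesis unfolding E_def by simp
 qed
 \<comment> \<open>Each saving gains \<open>1 / sqrt n\<close>, so \<open>s1\<close> of them leave a factor \<open>1 / n\<^sup>2\<close> after the choice of the first face.\<close>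
 define s1 where "s1 = 2 * (d + 3)"
 define m0 where "m0 = C * s1 + 1"
 define A where "A = E * (2 ^ d * (real d + 1))"
 define F where "F = 2 ^ C * E"
 \<comment> \<open>Chosen so that each saving gains a factor \<open>1 / 2\<close>, including the choice of the heavy sets.\<close>
 define i where "i = 1 / (2 * (F * 2 ^ d))"
 define w where "w = i ^ d / (2 * (real d ^ (d - 1) * (real d + 1)))"
 define b where "b = ln 2 / real C"
 have A1: "A \<ge> 2 ^ d * (real d + 1)" unfolding A_def using mult_right_mono[OF E1, of "2 ^ d * (real d + 1)"] by simp
 hence A0: "A > 0" by (rule less_le_trans[rotated]) (intro mult_pos_pos, auto)
 have F1: "F \<ge> 1" unfolding F_def using mult_mono[of 1 "2 ^ C" 1 E] E1 by simp
 have F2: "F * 2 ^ d \<ge> 1" using mult_mono[of 1 F 1 "2 ^ d"] F1 by simp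
 have i0: "i > 0" using F2 by (simp add: i_def)
 have i1: "2 ^ d * i \<le> 1" unfolding i_def using F1 by simp
 have w0: "w > 0" using i0 d by (simp add: w_def)
 have w1: "w \<le> 1"
 proof -
  have "i \<le> 1" using F2 by (simp add: i_def)
  hence a: "i ^ d \<le> 1" using i0 by (intro power_le_one) auto
  have "(1::real) * 1 \<le> real d ^ (d - 1) * (real d + 1)" using d by (intro mult_mono) auto
  thus ?thesis unfolding w_def using a by simp
 qed
 have b0: "b > 0" using C0 by (simp add: b_def)
 have mC: "m \<le> C * ((m - 1) div C + 1)" if "m \<ge> 1" for m
 proof -
  have "m - 1 < C * ((m - 1) div C) + C" using C0 by (metis add.commute dividend_less_times_div mult.commute add_less_cancel_left mod_less_divisor mult_div_mod_eq)
  thus ?thesis by simp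
 qed
 define light where "light n = E * A ^ s1 / (real n)\<^sup>2" for n :: nat
 define heavy where "heavy n = real n ^ (d + 1) * (2 * F * exp (- b * sqrt (real n)))" for n :: nat
 have light0: "light n \<ge> 0" and heavy0: "heavy n \<ge> 0" for n using E1 A0 F1 by (auto simp: light_def heavy_def)
 have L: "core_weight d c n m \<le> light n" if n: "n > 0" "A \<le> sqrt (real n)" and m: "m0 \<le> m" "m * m \<le> n" for n m
 proof -
  let ?A = "(2 ^ d * real ((d + 1) * m))"
  let ?r = "sqrt (real n)"
  have mr: "real m \<le> ?r"
   using m(2) by (metis of_nat_le_iff of_nat_mult real_le_rsqrt power2_eq_square)
  have m1: "m \<ge> 1" using m(1) by (simp add: m0_def)
  have "2 ^ d * (real d + 1) * real m \<le> ?r * ?r" using A1 n(2) mr by (intro mult_mono) auto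
  hence "real (2 ^ d * ((d + 1) * m)) \<le> real n" by (simp add: algebra_simps)
  hence l: "2 ^ d * ((d + 1) * m) \<le> n" by (simp only:)
  have s: "s1 \<le> (m - 1) div C"
  proof -
   have "C * s1 \<le> m - 1" using m(1) by (simp add: m0_def)
   thus ?thesis using C0 by (subst less_eq_div_iff_mult_less_eq) (auto simp: mult.commute)
  qed
  have "E * ?A / real n = A * real m / (?r * ?r)" by (simp add: A_def algebra_simps)
  also have "... = A / ?r * (real m / ?r)" by simp
  also have "... \<le> A / ?r * 1" using A0 n mr by (intro mult_left_mono) auto
  finally have x: "E * ?A / real n \<le> A / ?r" by simp
  have "core_weight d c n m \<le> real n ^ (d + 1) * (E * (E * ?A / real n) ^ ((m - 1) div C))"
   by (rule core_weight_light[OF d C_def m1 n(1) l c E_def])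
  also have "... \<le> real n ^ (d + 1) * (E * (A / ?r) ^ ((m - 1) div C))"
   using x E1 by (intro mult_left_mono power_mono) auto
  also have "... \<le> real n ^ (d + 1) * (E * (A / ?r) ^ s1)"
   using s E1 A0 n n by (intro mult_left_mono power_decreasing) auto
  also have "(A / ?r) ^ s1 = A ^ s1 / real n ^ (d + 3)"
   unfolding s1_def power_divide power_mult[of ?r] by simp
  also have "real n ^ (d + 3) = real n ^ (d + 1) * (real n)\<^sup>2" unfolding power_add[symmetric] by (rule arg_cong[where f = "\<lambda>k. real n ^ k"]) simp
  also have "real n ^ (d + 1) * (E * (A ^ s1 / (real n ^ (d + 1) * (real n)\<^sup>2))) = light n"
   by (simp add: light_def)
  finally show ?thesis .
 qed
 have Hv: "core_weight d c n m \<le> heavy n"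
  if n: "n > 0" "i * real n \<ge> real d" "i * real n \<ge> 2" "ln (real n + 1) / real n \<le> ln 2 * i / ?A"
  and m: "m \<ge> 1" "real m \<le> w * real (n choose d)" "m * m > n" for n m
 proof -
  let ?D = "(real d * real d * real d * (real d + 1) / i)"
  let ?C = "exp (- b * sqrt (real n))"
  let ?B = "real (d * ((d + 1) * m))"
  define q where "q = nat \<lfloor>i * real n\<rfloor>"
  have q: "real q \<le> i * real n" "real q + 1 \<ge> i * real n" "real q \<ge> i * real n / 2"
   using n by (auto simp: q_def) linarith+
  have t1: "d \<le> q + 1" using q(2) n(2) by linarith
  have "2 ^ d * real q \<le> 2 ^ d * (i * real n)" using q(1) by simp
  also have "... \<le> 1 * real n" unfolding mult.assoc[symmetric] using i1 by (intro mult_right_mono) auto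
  finally have "real (2 ^ d * q) \<le> real n" by simp
  hence t2: "2 ^ d * q \<le> n" by (simp only:)
  have l: "d ^ (d - 1) * ((d + 1) * m) \<le> (q + 1) ^ (d - 1) * q"
  proof -
   have dd: "real d ^ (d - 1) * (real d + 1) > 0" using d by simp
   have "real m \<le> w * real n ^ d"
   proof -
    have "w * real (n choose d) \<le> w * real n ^ d" using choose_le_power[of n d] w0 by simp
    thus ?thesis using m(2) by simp
   qed
   hence "real d ^ (d - 1) * (real d + 1) * real m \<le> real d ^ (d - 1) * (real d + 1) * (w * real n ^ d)"
    by (intro mult_left_mono) auto
   also have "... = i ^ d * real n ^ d / 2"       proof -
    have "x * (i ^ d / (2 * x) * real n ^ d) = i ^ d * real n ^ d / 2" if "x > 0" for x :: real using that by simp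
    from this[OF dd] show ?thesis unfolding w_def .
   qed
   also have "... = (i * real n) ^ (d - 1) * (i * real n / 2)"
    using d by (cases d) (auto simp: power_mult_distrib)
   also have "... \<le> (real q + 1) ^ (d - 1) * real q"
    using q i0 by (intro mult_mono power_mono) auto
   finally have "real (d ^ (d - 1) * ((d + 1) * m)) \<le> real ((q + 1) ^ (d - 1) * q)" by (simp only: of_nat_mult of_nat_power of_nat_add of_nat_1)
   thus ?thesis by (simp only:)
  qed
  have ent: "(n + 1) ^ (d * d * (d * ((d + 1) * m) div (q + 1))) \<le> 2 ^ m"
  proof -
   let ?h = "d * ((d + 1) * m) div (q + 1)"
   have "real ?h \<le> ?B / real (q + 1)" by (rule of_nat_div_le_of_nat)
   also have "... \<le> ?B / (i * real n)" using q(2) i0 n(1) by (intro divide_left_mono) auto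
   finally have h: "real ?h \<le> ?B / (i * real n)" .
   have "real (d * d * ?h) * ln (real n + 1) \<le> real (d * d) * (?B / (i * real n)) * ln (real n + 1)"
    unfolding of_nat_mult[of "d * d" ?h] using h by (intro mult_right_mono mult_left_mono) auto
   also have "... = real m * ?D * (ln (real n + 1) / real n)"
    by (simp add: field_simps)
   also have "... \<le> real m * ?D * (ln 2 * i / ?A)"
    using n(4) i0 by (intro mult_left_mono) auto
   also have "... = real m * ln 2" using i0 d by simp
   finally have "exp (real (d * d * ?h) * ln (real n + 1)) \<le> exp (real m * ln 2)" by simp
   hence "(real n + 1) ^ (d * d * ?h) \<le> 2 ^ m" by (simp add: exp_of_nat_mult del: of_nat_mult)
   hence "real ((n + 1) ^ (d * d * ?h)) \<le> real (2 ^ m)" by (simp add: add.commute)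
   thus ?thesis by (simp only:)
  qed
  let ?s = "(m - 1) div C"
  have "core_weight d c n m \<le> real n ^ (d + 1) * 2 ^ m * (E * (E * (2 ^ d * real q) / real n) ^ ?s)"
   by (rule core_weight_heavy[OF d C_def m(1) n(1) c E_def t1 t2 l ent])
  also have "... \<le> real n ^ (d + 1) * 2 ^ (C * (?s + 1)) * (E * (E * (2 ^ d * real q) / real n) ^ ?s)"
   using mC[OF m(1)] E1 by (intro mult_right_mono mult_left_mono power_increasing) auto
  also have "... = real n ^ (d + 1) * (F * (F * 2 ^ d * real q / real n) ^ ?s)"
   by (simp add: F_def power_mult_distrib power_divide) (simp add: power_mult[symmetric] power_add)
  also have "... \<le> real n ^ (d + 1) * (F * (1 / 2) ^ ?s)"
  proof (intro mult_left_mono power_mono)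
   have "F * 2 ^ d * real q / real n \<le> F * 2 ^ d * (i * real n) / real n"
    using q(1) F2 by (intro divide_right_mono mult_left_mono) auto
   also have "... = 1 / 2" using n F1 by (simp add: i_def)
   finally show "F * 2 ^ d * real q / real n \<le> 1 / 2" .
  qed (use F1 in auto)
  also have "(1 / 2 :: real) ^ ?s \<le> 2 * ?C"
  proof -
   have "real n \<le> real m * real m" using m(3) by (simp only: of_nat_mult[symmetric])
   hence "sqrt (real n) \<le> real m" by (simp add: real_le_lsqrt power2_eq_square)
   also have "... \<le> real (C * (?s + 1))" using mC[OF m(1)] by (simp only:)
   also have "... = real C * (real ?s + 1)" by (simp add: distrib_left)
   finally have "b * sqrt (real n) \<le> b * (real C * (real ?s + 1))" using b0 by simp
   also have "... = ln 2 * (real ?s + 1)" using C0 by (simp add: b_def)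
   finally have "exp (- (ln 2 * real ?s)) \<le> exp (ln 2 + - b * sqrt (real n))" by (simp add: algebra_simps)
   also have "... = 2 * ?C" by (simp only: exp_add) simp
   also have "exp (- (ln 2 * real ?s)) = (1 / 2 :: real) ^ ?s"
    by (simp add: exp_minus exp_of_nat2_mult power_one_over inverse_eq_divide)
   finally show ?thesis .
  qed
  also have "real n ^ (d + 1) * (F * (2 * ?C)) = heavy n"
   by (simp add: heavy_def)
  finally show ?thesis using F1 by (simp add: mult_left_mono)
 qed
 define g where "g n = (real n + 1) * light n + (real n ^ d + 1) * heavy n" for n
 have "(\<lambda>n. \<Sum>m | m0 \<le> m \<and> real m \<le> w * real (n choose d). core_weight d c n m) \<longlonglongrightarrow> 0"
 proof (rule tendsto_sandwich[OF _ _ tendsto_const])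
  show "eventually (\<lambda>n. 0 \<le> (\<Sum>m | m0 \<le> m \<and> real m \<le> w * real (n choose d). core_weight d c n m)) sequentially"
   using c by (intro always_eventually allI sum_nonneg) (auto simp: core_weight_def)
  have e1: "eventually (\<lambda>n. i * real n \<ge> max 2 (real d)) sequentially" using i0 by real_asymp
  have e2: "eventually (\<lambda>n. sqrt (real n) \<ge> A) sequentially" by real_asymp
  have e3: "eventually (\<lambda>n. ln (real n + 1) / real n \<le> ln 2 * i / ?A) sequentially" using i0 d by real_asymp
  show "eventually (\<lambda>n. (\<Sum>m | m0 \<le> m \<and> real m \<le> w * real (n choose d). core_weight d c n m) \<le> g n) sequentially"
   using e1 e2 e3 eventually_gt_at_top[of 0]
  proof eventually_elim
   case (elim n)
   let ?M = "{m. m0 \<le> m \<and> real m \<le> w * real (n choose d)}"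
   have sub: "?M \<subseteq> {..n ^ d}"
   proof
    fix m assume "m \<in> ?M"
    hence "real m \<le> w * real (n choose d)" by simp
    also have "... \<le> 1 * real (n ^ d)" using w1 w0 choose_le_power[of n d] by (intro mult_mono) (auto simp del: of_nat_power)
    finally show "m \<in> {..n ^ d}" by simp
   qed
   hence finM: "finite ?M" using finite_subset by blast
   have "(\<Sum>m\<in>?M. core_weight d c n m) \<le> (\<Sum>m\<in>?M. of_bool (m \<le> n) * light n + heavy n)"
   proof (rule sum_mono)
    fix m assume m: "m \<in> ?M"
    show "core_weight d c n m \<le> of_bool (m \<le> n) * light n + heavy n"
    proof (cases "m * m \<le> n")
     case True
     hence "m \<le> n" by (meson le_square order_trans)
     thus ?thesis using L[of n m] True m elim heavy0[of n] by simp
    next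
     case False
     have "m \<ge> 1" using m by (simp add: m0_def)
     moreover have "i * real n \<ge> real d" "i * real n \<ge> 2" using elim(1) by auto
     ultimately have "core_weight d c n m \<le> heavy n" using Hv[of n m] False m elim by auto
     thus ?thesis using light0[of n] by (simp)
    qed
   qed
   also have "... = (\<Sum>m\<in>?M. of_bool (m \<le> n)) * light n + real (card ?M) * heavy n"
    by (simp add: sum.distrib sum_distrib_right)
   also have "... \<le> (real n + 1) * light n + (real n ^ d + 1) * heavy n"
   proof (intro add_mono mult_right_mono)
    have "(\<Sum>m\<in>?M. of_bool (m \<le> n) :: real) = real (card {m\<in>?M. m \<le> n})" using finM by (simp add: Int_def)
    also have "... \<le> real (card {..n})" by (intro of_nat_mono card_mono) auto
    finally show "(\<Sum>m\<in>?M. of_bool (m \<le> n) :: real) \<le> real n + 1" by simp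
    have "real (card ?M) \<le> real (card {..n ^ d})" using sub by (intro of_nat_mono card_mono) auto
    thus "real (card ?M) \<le> real n ^ d + 1" by simp
   qed (use light0 heavy0 in auto)
   finally show ?case unfolding g_def .
  qed
  show "g \<longlonglongrightarrow> 0" using b0 unfolding g_def light_def heavy_def by real_asymp
 qed
 thus ?thesis using w0 by (intro exI[of _ w] conjI exI[of _ m0]) (auto simp: m0_def)
qed

section \<open>Circuits and their vertices\<close>

text \<open>The boundary of a boundary vanishes, as the two ways of deleting two vertices cancel.\<close>
lemma boundary_boundary:
 assumes B: "finite B"
 shows "(\<Sum>b\<in>B. (-1) ^ card {u \<in> B. u < b} * bd (B - {b}) t) = 0"
proof -
 let ?A = "(\<Sum>b\<in>B. (-1) ^ card {u \<in> B. u < b} * bd (B - {b}) t)"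
 define s where "s b a = (-1 :: real) ^ card {u \<in> B. u < b} * (if t = B - {b} - {a} then (-1) ^ card {u \<in> B - {b}. u < a} else 0)" for b a
 have sw: "s b a = - s a b" if ab: "a \<in> B" "b \<in> B" "a < b" for a b
 proof -
  have 1: "{u \<in> B - {b}. u < a} = {u \<in> B. u < a}" using ab by auto
  have 2: "{u \<in> B. u < b} = insert a {u \<in> B - {a}. u < b}" using ab by auto
  have "card {u \<in> B. u < b} = Suc (card {u \<in> B - {a}. u < b})" unfolding 2 by simp
  moreover have "B - {b} - {a} = B - {a} - {b}" by auto
  ultimately show ?thesis unfolding s_def 1 by simp
 qed
 have sw': "- s b a = s a b" if ab: "a \<in> B" "b \<in> B" "a \<noteq> b" for a b
  using sw[of a b] sw[of b a] ab by force
 let ?P = "SIGMA b:B. B - {b}"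
 have "?A = (\<Sum>b\<in>B. \<Sum>a\<in>B - {b}. s b a)"
  unfolding incidence_def sum_distrib_left s_def ..
 also have "... = (\<Sum>(b, a)\<in>?P. s b a)" using B by (intro sum.Sigma) auto
 finally have e: "?A = (\<Sum>(b, a)\<in>?P. s b a)" .
 have "(\<Sum>(b, a)\<in>?P. s b a) = (\<Sum>(b, a)\<in>?P. - s b a)"
  by (rule sum.reindex_bij_witness[of _ prod.swap prod.swap]) (auto, metis sw')
 also have "... = - (\<Sum>(b, a)\<in>?P. s b a)" by (simp add: sum_negf case_prod_unfold)
 finally show ?thesis unfolding e by simp
qed

lemma facet_in_cl:
 assumes B: "finite B" and s: "s \<in> facs {B}"
 shows "s \<in> cl (facs {B} - {s})"
proof -
 obtain b where b: "b \<in> B" "s = B - {b}" using s by (auto simp: facs_def)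
 define w where "w x = (-1 :: real) ^ card {u \<in> B. u < x}" for x
 have wb: "w b * w b = 1" by (simp add: w_def power_mult_distrib[symmetric])
 have "bd s = (\<Sum>x\<in>B - {b}. (\<lambda>t. (- w b * w x) * bd (B - {x}) t))"
 proof
  fix t
  have "w b * bd s t + (\<Sum>x\<in>B - {b}. w x * bd (B - {x}) t) = 0"
   using boundary_boundary[OF B, of t] sum.remove[OF B b(1), of "\<lambda>x. w x * bd (B - {x}) t"]
   unfolding w_def[symmetric] b(2) by simp
  hence "w b * (w b * bd s t) = - w b * (\<Sum>x\<in>B - {b}. w x * bd (B - {x}) t)"
  proof -
   assume a: "w b * bd s t + (\<Sum>x\<in>B - {b}. w x * bd (B - {x}) t) = 0"
   hence "w b * bd s t = - (\<Sum>x\<in>B - {b}. w x * bd (B - {x}) t)" by linarith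
   thus ?thesis by simp
  qed
  thus "bd s t = (\<Sum>x\<in>B - {b}. (\<lambda>t. (- w b * w x) * bd (B - {x}) t)) t" using wb unfolding sum_fun_apply sum_distrib_left by (simp add: mult.assoc[symmetric])
 qed
 moreover have "bd (B - {x}) \<in> bd ` (facs {B} - {s})" if "x \<in> B - {b}" for x
 proof -
  have "B - {x} \<in> facs {B}" using that by (auto simp: facs_def)
  moreover have "B - {x} \<noteq> s" using that b by auto
  ultimately show ?thesis by auto
 qed
 ultimately have "bd s \<in> fv.span (bd ` (facs {B} - {s}))"
  by (simp only:) (intro fv.span_sum fv.span_scale fv.span_base, auto)
 thus ?thesis by (simp add: cl_def)
qed

lemma cl_absorb:
 assumes "r \<in> cl (X - {r})"
 shows "cl X \<subseteq> cl (X - {r})"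
proof -
 have "bd ` X \<subseteq> fv.span (bd ` (X - {r}))"
  using assms fv.span_base[of _ "bd ` (X - {r})"] by (auto simp: cl_def)
 hence "fv.span (bd ` X) \<subseteq> fv.span (bd ` (X - {r}))" by (rule fv.span_minimal) (rule fv.subspace_span)
 thus ?thesis by (auto simp: cl_def)
qed

lemma incidence_facs:
 assumes "t \<in> facs {r}" "finite r"
 shows "bd r t \<noteq> 0"
proof -
 obtain a where a: "a \<in> r" "t = r - {a}" using assms(1) by (auto simp: facs_def)
 show ?thesis using incidence_facet_sq[OF assms(2) a(1)] a(2) by auto
qed

lemma incidence_not_facs: "t \<notin> facs {r} ==> bd r t = 0"
 unfolding incidence_def by (intro sum.neutral) (auto simp: facs_def)

text \<open>Take a minimal set through \<open>s\<close> with a relation; all coefficients are nonzero.  A facet on a single face would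
  have a nonzero coefficient in the relation.  If \<open>A\<close> shares no facets with the rest, the relation splits, which contradicts
  minimality; so does containing the boundary of a simplex properly.\<close>
lemma circuit_exists:
 assumes Y: "Y \<subseteq> all_faces n d" and s: "s \<in> all_faces n d" "s \<notin> Y" "s \<in> cl Y"
 obtains K where "core d n s K" "K \<subseteq> insert s Y" "\<forall>q\<in>K. q \<in> cl (K - {q})"
  "\<And>B. finite B ==> facs {B} \<subseteq> K ==> B \<noteq> {} ==> K = facs {B}"
proof -
 let ?P = "\<lambda>X. X \<subseteq> Y \<and> s \<in> cl X"
 have finY: "finite Y" by (rule finite_subset_faces[OF Y])
 obtain X where X: "?P X" "\<And>X'. ?P X' ==> card X \<le> card X'"
  using arg_min_natI[of ?P Y card] arg_min_nat_le[of ?P _ card] s(3) by simp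
 have finX: "finite X" by (rule finite_subset[OF conjunct1[OF X(1)] finY])
 have min: "s \<notin> cl X'" if "X' \<subset> X" for X'
  using X(2)[of X'] X(1) psubset_card_mono[OF finX that] that by auto
 have sX: "s \<notin> X" using X(1) s(2) by auto
 obtain x where x: "bd s = (\<lambda>t. \<Sum>q\<in>X. x q * bd q t)"
  using X(1) mem_span_incidence[OF finX, of "bd s"] by (auto simp: cl_def)
 have spanI: "q0 \<in> cl S" if "finite S" "bd q0 = (\<lambda>t. \<Sum>q\<in>S. y q * bd q t)" for q0 S y
  using mem_span_incidence[OF that(1), of "bd q0"] that(2) by (auto simp: cl_def)
 have x0: "x q \<noteq> 0" if r: "q \<in> X" for q
 proof
  assume 0: "x q = 0"
  have "bd s = (\<lambda>t. \<Sum>q\<in>X - {q}. x q * bd q t)"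
   unfolding x
  proof
   fix t
   show "(\<Sum>q\<in>X. x q * bd q t) = (\<Sum>q\<in>X - {q}. x q * bd q t)"
    using sum.remove[OF finX r, of "\<lambda>q. x q * bd q t"] 0 by simp
  qed
  hence "s \<in> cl (X - {q})" using finX by (intro spanI[of _ _ x]) auto
  thus False using min[of "X - {q}"] r by auto
 qed
 define K where "K = insert s X"
 define y where "y q = (if q = s then - 1 else x q)" for q
 have finK: "finite K" using finX by (simp add: K_def)
 have KF: "K \<subseteq> all_faces n d" using X(1) Y s(1) by (auto simp: K_def)
 have finr: "finite q" if "q \<in> K" for q using that KF all_faces_D by auto
 have y0: "y q \<noteq> 0" if "q \<in> K" for q using that x0 by (auto simp: K_def y_def)
 have rel: "(\<Sum>q\<in>K. y q * bd q t) = 0" for t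
 proof -
  have "(\<Sum>q\<in>K. y q * bd q t) = - bd s t + (\<Sum>q\<in>X. y q * bd q t)"
   unfolding K_def using finX sX by (simp add: y_def)
  also have "(\<Sum>q\<in>X. y q * bd q t) = (\<Sum>q\<in>X. x q * bd q t)"
   using sX by (intro sum.cong) (auto simp: y_def)
  also have "... = bd s t" using fun_cong[OF x, of t] by simp
  finally show ?thesis by simp
 qed
 have relcl: "q0 \<in> cl (A - {q0})" if A: "finite A" "q0 \<in> A" "y q0 \<noteq> 0" and r: "\<And>t. (\<Sum>q\<in>A. y q * bd q t) = 0" for A q0
 proof (rule spanI)
  show "bd q0 = (\<lambda>t. \<Sum>q\<in>A - {q0}. (- y q / y q0) * bd q t)"
  proof
   fix t
   have e: "y q0 * bd q0 t = - (\<Sum>q\<in>A - {q0}. y q * bd q t)"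
    using r[of t] sum.remove[OF A(1,2), of "\<lambda>q. y q * bd q t"] by simp
   have "(\<Sum>q\<in>A - {q0}. (- y q / y q0) * bd q t) = - (\<Sum>q\<in>A - {q0}. y q * bd q t) / y q0"
    by (simp add: sum_negf sum_divide_distrib)
   also have "... = bd q0 t" unfolding e[symmetric] using A(3) by simp
   finally show "bd q0 t = (\<Sum>q\<in>A - {q0}. (- y q / y q0) * bd q t)" by simp
  qed
 qed (use A in auto)
 have codeg: "\<exists>q'\<in>K. q' \<noteq> q \<and> t \<in> facs {q'}" if r: "q \<in> K" "t \<in> facs {q}" for q t
 proof (rule ccontr)
  assume "\<not> ?thesis"
  hence z: "\<And>q'. q' \<in> K - {q} ==> bd q' t = 0" using incidence_not_facs by blast
  show False using z rel[of t] sum.remove[OF finK r(1), of "\<lambda>q. y q * bd q t"] y0[OF r(1)] incidence_facs[OF r(2) finr[OF r(1)]] by simp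
 qed
 have conn: "A = K" if A: "s \<in> A" "A \<subseteq> K" "facs A \<inter> facs (K - A) = {}" for A
 proof (rule ccontr)
  assume ne: "A \<noteq> K"
  have finA: "finite A" by (rule finite_subset[OF A(2) finK])
  have "(\<Sum>q\<in>A. y q * bd q t) = 0" for t
  proof (cases "t \<in> facs A")
   case True
   hence "bd q t = 0" if "q \<in> K - A" for q using A(3) that facs_memD[of t q "K - A"] incidence_not_facs by auto
   thus ?thesis using rel[of t] sum.subset_diff[OF A(2) finK, of "\<lambda>q. y q * bd q t"] by simp
  next
   case False
   hence "bd q t = 0" if "q \<in> A" for q using that facs_memD[of t q A] incidence_not_facs by blast
   thus ?thesis by simp
  qed
  hence "s \<in> cl (A - {s})" using finA A(1) y0[of s] by (intro relcl) (auto simp: K_def)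
  moreover have "A - {s} \<subset> X" using A ne sX by (auto simp: K_def)
  ultimately show False using min by blast
 qed
 show thesis
 proof (rule that[of K])
  show "core d n s K" unfolding core_def
  proof (intro conjI ballI allI impI)
   show "s \<in> K" by (simp add: K_def)
   show "A = K" if "s \<in> A \<and> A \<subseteq> K \<and> facs A \<inter> facs (K - A) = {}" for A using that conn by blast
  qed (use KF codeg in auto)
  show "K \<subseteq> insert s Y" using X(1) by (auto simp: K_def)
  show "\<forall>q\<in>K. q \<in> cl (K - {q})" using relcl[OF finK _ y0 rel] by blast
  fix B assume B: "finite B" "facs {B} \<subseteq> K" "B \<noteq> {}"
  show "K = facs {B}"
  proof (cases "s \<in> facs {B}")
   case True
   have "s \<in> cl (facs {B} - {s})" by (rule facet_in_cl[OF B(1) True])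
   moreover have "facs {B} - {s} \<subseteq> X" using B(2) by (auto simp: K_def)
   ultimately have "facs {B} - {s} = X" using min by blast
   thus ?thesis using True by (auto simp: K_def)
  next
   case False
   obtain q where r: "q \<in> facs {B}" using B(3) by (auto simp: facs_def)
   have sub: "facs {B} \<subseteq> X" using False B(2) by (auto simp: K_def)
   have "q \<in> cl (facs {B} - {q})" by (rule facet_in_cl[OF B(1) r])
   hence "s \<in> cl (X - {q})" using cl_mono[of "facs {B} - {q}" "X - {q}"] sub cl_absorb X(1) by blast
   moreover have "X - {q} \<subset> X" using sub r by auto
   ultimately show ?thesis using min by blast
  qed
 qed
qed

context
 fixes d :: nat and K :: "nat set set"
 assumes d: "d \<ge> 2" and finK: "finite K" and cardK: "\<And>r. r \<in> K ==> finite r \<and> card r = d + 1"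
  and codeg: "\<And>r t. r \<in> K ==> t \<in> facs {r} ==> \<exists>r'\<in>K. r' \<noteq> r \<and> t \<in> facs {r'}"
begin

text \<open>The facets of \<open>q0\<close> through \<open>v\<close> are covered by different further faces through \<open>v\<close>, as a face containing two of these
  facets contains \<open>q0\<close>.\<close>
lemma star_neighbours:
 assumes r: "q0 \<in> K" "v \<in> q0"
 shows "\<exists>h. (\<forall>x\<in>q0 - {v}. h x \<notin> q0 \<and> insert (h x) (q0 - {x}) \<in> {q \<in> K. v \<in> q}) \<and>
  inj_on (\<lambda>x. insert (h x) (q0 - {x})) (q0 - {v}) \<and> q0 \<notin> (\<lambda>x. insert (h x) (q0 - {x})) ` (q0 - {v})"
proof -
 have "\<exists>w. w \<notin> q0 \<and> insert w (q0 - {x}) \<in> {q \<in> K. v \<in> q}" if x: "x \<in> q0 - {v}" for x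
 proof -
  have "q0 - {x} \<in> facs {q0}" using x by (auto simp: facs_def)
  from codeg[OF r(1) this] obtain q' where r': "q' \<in> K" "q' \<noteq> q0" "q0 - {x} \<in> facs {q'}" by blast
  obtain w where w: "w \<in> q'" "q0 - {x} = q' - {w}" using r'(3) by (auto simp: facs_def)
  have e: "q' = insert w (q0 - {x})" using w by auto
  have "w \<noteq> x" using e r'(2) x by auto
  moreover have "w \<notin> q0 - {x}" using w(2) by auto
  ultimately show ?thesis using e r' r(2) x by auto
 qed
 hence "\<forall>x\<in>q0 - {v}. \<exists>w. w \<notin> q0 \<and> insert w (q0 - {x}) \<in> {q \<in> K. v \<in> q}" by simp
 from bchoice[OF this] obtain h where h: "\<forall>x\<in>q0 - {v}. h x \<notin> q0 \<and> insert (h x) (q0 - {x}) \<in> {q \<in> K. v \<in> q}" by (rule exE)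
 have nx: "x \<notin> insert (h x) (q0 - {x})" if "x \<in> q0 - {v}" for x using bspec[OF h that] that by auto
 show ?thesis
 proof (intro exI[of _ h] conjI)
  show "inj_on (\<lambda>x. insert (h x) (q0 - {x})) (q0 - {v})"
  proof (rule inj_onI, rule ccontr)
   fix x x' assume a: "x \<in> q0 - {v}" "x' \<in> q0 - {v}" "insert (h x) (q0 - {x}) = insert (h x') (q0 - {x'})" "x \<noteq> x'"
   show False using a nx[OF a(1)] by simp
  qed
  show "q0 \<notin> (\<lambda>x. insert (h x) (q0 - {x})) ` (q0 - {v})" using h by auto
 qed (rule h)
qed

lemma star_card:
 assumes r: "r0 \<in> K" "v \<in> r0"
 shows "d + 1 \<le> card {r \<in> K. v \<in> r}"
proof -
 obtain h where h0: "\<forall>x\<in>r0 - {v}. h x \<notin> r0 \<and> insert (h x) (r0 - {x}) \<in> {r \<in> K. v \<in> r}"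
  and h': "inj_on (\<lambda>x. insert (h x) (r0 - {x})) (r0 - {v})" "r0 \<notin> (\<lambda>x. insert (h x) (r0 - {x})) ` (r0 - {v})"
  using star_neighbours[OF r] by auto
 note h = bspec[OF h0] h'
 have "d + 1 = card (insert r0 ((\<lambda>x. insert (h x) (r0 - {x})) ` (r0 - {v})))"
  using h(2,3) cardK[OF r(1)] r(2) by (simp add: card_image)
 also have "... \<le> card {r \<in> K. v \<in> r}" using h(1) r finK by (intro card_mono) auto
 finally show ?thesis .
qed

text \<open>If equality holds then the neighbours add the same vertex, and the star is that of a simplex boundary.\<close>
lemma star_extremal:
 assumes r: "q0 \<in> K" "v \<in> q0" and c: "card {q \<in> K. v \<in> q} = d + 1"
 obtains B where "card B = d + 2" "finite B" "v \<in> B" "{q \<in> K. v \<in> q} = (\<lambda>b. B - {b}) ` (B - {v})"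
proof -
 obtain h where h0: "\<forall>x\<in>q0 - {v}. h x \<notin> q0 \<and> insert (h x) (q0 - {x}) \<in> {q \<in> K. v \<in> q}"
  and h': "inj_on (\<lambda>x. insert (h x) (q0 - {x})) (q0 - {v})" "q0 \<notin> (\<lambda>x. insert (h x) (q0 - {x})) ` (q0 - {v})"
  using star_neighbours[OF r] by auto
 note h = bspec[OF h0] h'
 let ?g = "\<lambda>x. insert (h x) (q0 - {x})"
 have star: "{q \<in> K. v \<in> q} = insert q0 (?g ` (q0 - {v}))"
 proof (rule card_subset_eq[symmetric])
  show "finite {q \<in> K. v \<in> q}" using finK by simp
  show "insert q0 (?g ` (q0 - {v})) \<subseteq> {q \<in> K. v \<in> q}" using h(1) r by auto
  show "card (insert q0 (?g ` (q0 - {v}))) = card {q \<in> K. v \<in> q}"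
   unfolding c using h(2,3) cardK[OF r(1)] r(2) by (simp add: card_image)
 qed
 have const: "h x = h x'" if x: "x \<in> q0 - {v}" "x' \<in> q0 - {v}" "x \<noteq> x'" for x x'
 proof -
  have gK: "?g x \<in> K" using h(1)[OF x(1)] by auto
  have "?g x - {x'} \<in> facs {?g x}" using x by (auto simp: facs_def)
  from codeg[OF gK this] obtain q' where r': "q' \<in> K" "q' \<noteq> ?g x" "?g x - {x'} \<in> facs {q'}" by blast
  have sub: "?g x - {x'} \<subseteq> q'" using r'(3) by (auto simp: facs_def)
  have "q' \<in> insert q0 (?g ` (q0 - {v}))" using x sub r'(1) star by auto
  moreover have hr: "h x \<in> q'" using sub h(1) x x by auto
  ultimately obtain z where z: "z \<in> q0 - {v}" "q' = ?g z" using h(1) x by auto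
  have "z \<noteq> x" using z r'(2) by auto
  have "z = x'"
  proof (rule ccontr)
   assume "z \<noteq> x'"
   thus False using z \<open>z \<noteq> x\<close> sub h(1)[OF z(1)] by auto
  qed
  thus ?thesis using hr z(2) h(1) x by auto
 qed
 have "card (q0 - {v}) > 0" using cardK[OF r(1)] r(2) d by simp
 then obtain x0 where x0: "x0 \<in> q0 - {v}" unfolding card_gt_0_iff by blast
 define w where "w = h x0"
 have hw: "h x = w" if "x \<in> q0 - {v}" for x using const[OF that x0] unfolding w_def by auto
 have w: "w \<notin> q0" using h(1)[OF x0] by (simp add: w_def)
 define B where "B = insert w q0"
 have gB: "?g x = B - {x}" if "x \<in> q0 - {v}" for x using hw[OF that] w that by (auto simp: B_def)
 have rB: "q0 = B - {w}" using w by (auto simp: B_def)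
 have Bv: "B - {v} = insert w (q0 - {v})" using w r(2) by (auto simp: B_def)
 show thesis
 proof (rule that[of B])
  show "card B = d + 2" "finite B" "v \<in> B" using cardK[OF r(1)] w r(2) by (auto simp: B_def)
  show "{q \<in> K. v \<in> q} = (\<lambda>b. B - {b}) ` (B - {v})"
   unfolding star Bv image_insert rB[symmetric] using gB by auto
 qed
qed

text \<open>Each vertex is on at least \<open>d + 1\<close> faces, and each face has \<open>d + 1\<close> vertices, so there are at most as many vertices as
  faces.  With equality all stars are extremal, hence stars in boundaries of simplices, and such a boundary is contained in \<open>K\<close>.\<close>
lemma few_vertices:
 assumes K: "K \<noteq> {}" and free: "\<And>B. card B = d + 2 ==> \<not> facs {B} \<subseteq> K"
 shows "card (\<Union>K) + 1 \<le> card K"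
proof -
 have finU: "finite (\<Union>K)" using finK cardK by auto
 have "(\<Sum>v\<in>\<Union>K. card {q \<in> K. v \<in> q}) = (\<Sum>v\<in>\<Union>K. \<Sum>q\<in>K. of_bool (v \<in> q))"
  using finK by (simp add: Int_def)
 also have "... = (\<Sum>q\<in>K. \<Sum>v\<in>\<Union>K. of_bool (v \<in> q))" by (rule sum.swap)
 also have "... = (\<Sum>q\<in>K. d + 1)"
 proof (rule sum.cong[OF refl])
  fix q assume r: "q \<in> K"
  have "(\<Sum>v\<in>\<Union>K. of_bool (v \<in> q)) = card {v \<in> \<Union>K. v \<in> q}" using finU by (simp add: Int_def)
  also have "{v \<in> \<Union>K. v \<in> q} = q" using r by auto
  finally show "(\<Sum>v\<in>\<Union>K. of_bool (v \<in> q)) = d + 1" using cardK[OF r] by simp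
 qed
 finally have total: "(\<Sum>v\<in>\<Union>K. card {q \<in> K. v \<in> q}) = card K * (d + 1)" by simp
 have ge: "d + 1 \<le> card {q \<in> K. v \<in> q}" if "v \<in> \<Union>K" for v using that star_card by auto
 have "\<exists>v\<in>\<Union>K. card {q \<in> K. v \<in> q} \<noteq> d + 1"
 proof (rule ccontr)
  assume "\<not> ?thesis"
  hence all: "\<And>v. v \<in> \<Union>K ==> card {q \<in> K. v \<in> q} = d + 1" by blast
  \<comment> \<open>The stars of two vertices of a face belong to simplices with the same vertices, as these have two common faces.\<close>
  obtain q0 where r0: "q0 \<in> K" using K by auto
  have "q0 \<noteq> {}" using cardK[OF r0] by auto
  then obtain v where v: "v \<in> q0" by blast
  have vU: "v \<in> \<Union>K" using r0 v by auto
  obtain B where B: "card B = d + 2" "finite B" "v \<in> B" "{q \<in> K. v \<in> q} = (\<lambda>b. B - {b}) ` (B - {v})"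
   by (rule star_extremal[OF r0 v all[OF vU]])
  have "card (B - {v}) > 0" using B by simp
  then obtain u where u: "u \<in> B" "u \<noteq> v" unfolding card_gt_0_iff by auto
  have c2: "card (B - {v, u}) = d" using B u by simp
  hence "card (B - {v, u}) > 0" using d by simp
  then obtain b1 where b1: "b1 \<in> B - {v, u}" unfolding card_gt_0_iff by blast
  have "card (B - {v, u} - {b1}) > 0" using c2 b1 d by simp
  then obtain b2 where b2: "b2 \<in> B - {v, u}" "b2 \<noteq> b1" unfolding card_gt_0_iff by blast
  have inK: "B - {b} \<in> K" if "b \<in> B - {v}" for b using B(4) that by auto
  have uin: "u \<in> B - {b1}" using u b1 by auto
  have uU: "u \<in> \<Union>K" using inK[of b1] b1 uin by blast
  obtain B' where B': "card B' = d + 2" "finite B'" "u \<in> B'" "{q \<in> K. u \<in> q} = (\<lambda>b. B' - {b}) ` (B' - {u})"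
   by (rule star_extremal[OF inK[of b1] uin all[OF uU]]) (use b1 in auto)
  have sub: "B - {b} \<subseteq> B'" if "b \<in> B - {v, u}" for b
  proof -
   have "B - {b} \<in> {q \<in> K. u \<in> q}" using inK[of b] that u by auto
   thus ?thesis unfolding B'(4) by auto
  qed
  have BB: "B = B'" using sub[OF b1] sub[OF b2(1)] b2(2) B B' by (intro card_subset_eq) auto
  have "B - {v} \<in> {q \<in> K. u \<in> q}" unfolding B'(4) BB[symmetric] using B(3) u by auto
  thus False using inK free B(1) unfolding facs_single by auto
 qed
 then obtain v where v: "v \<in> \<Union>K" "card {q \<in> K. v \<in> q} \<noteq> d + 1" by blast
 have "(\<Sum>v\<in>\<Union>K. d + 1) < (\<Sum>v\<in>\<Union>K. card {q \<in> K. v \<in> q})"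
 proof (rule sum_strict_mono_ex1[OF finU])
  have "d + 1 < card {q \<in> K. v \<in> q}" using ge[OF v(1)] v(2) by simp
  thus "\<exists>v\<in>\<Union>K. d + 1 < card {q \<in> K. v \<in> q}" using v(1) by (rule bexI)
 qed (use ge in blast)
 hence "card (\<Union>K) * (d + 1) < card K * (d + 1)" unfolding total by simp
 thus ?thesis unfolding mult_less_cancel2 by simp
qed

end

section \<open>Circuits of bounded size\<close>

definition sfree :: "nat => nat set set => bool" where
 "sfree d K \<longleftrightarrow> (\<forall>B. card B = d + 2 --> \<not> facs {B} \<subseteq> K)"

definition sfree_cores :: "nat => nat => nat => (nat set \<times> nat set set) set" where
 "sfree_cores d n m = {(s, K) \<in> cores d n m. sfree d K}"

text \<open>At most \<open>m - 1\<close> vertices leave no power of \<open>n\<close> after multiplication by the density.\<close>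
lemma card_sfree_cores:
 assumes d: "d \<ge> 2"
 shows "card (sfree_cores d n m) \<le> (n + 1) ^ (m - 1) * (2 ^ (m - 1) * 2 ^ (2 ^ (m - 1)))"
proof -
 let ?U = "{U. U \<subseteq> {..<n} \<and> card U \<le> m - 1}"
 have sub: "sfree_cores d n m \<subseteq> (\<Union>U\<in>?U. Pow U \<times> Pow (Pow U))"
 proof
  fix x assume "x \<in> sfree_cores d n m"
  then obtain g K where x: "x = (g, K)" "core d n g K" "card K = m" "sfree d K"
   by (auto simp: sfree_cores_def cores_def)
  note KF = coreD(2)[OF x(2)] and s = coreD(1)[OF x(2)]
  have "card (\<Union>K) + 1 \<le> card K"
  proof (rule few_vertices[OF d])
   show "finite K" by (rule finite_subset_faces[OF KF])
   show "\<And>r. r \<in> K ==> finite r \<and> card r = d + 1" using KF all_faces_D by auto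
   show "\<And>r t. r \<in> K ==> t \<in> facs {r} ==> \<exists>r'\<in>K. r' \<noteq> r \<and> t \<in> facs {r'}" using x(2) unfolding core_def by blast
   show "K \<noteq> {}" using s by auto
   show "\<And>B. card B = d + 2 ==> \<not> facs {B} \<subseteq> K" using x(4) unfolding sfree_def by blast
  qed
  hence "card (\<Union>K) \<le> m - 1" using x(3) by simp
  moreover have "\<Union>K \<subseteq> {..<n}" using KF all_faces_D by blast
  moreover have "x \<in> Pow (\<Union>K) \<times> Pow (Pow (\<Union>K))" using s x(1) by auto
  ultimately show "x \<in> (\<Union>U\<in>?U. Pow U \<times> Pow (Pow U))" by blast
 qed
 have fU: "finite U" if "U \<in> ?U" for U by (rule finite_subset[of _ "{..<n}"]) (use that in simp_all)
 have finU: "finite ?U" by simp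
 have "card (sfree_cores d n m) \<le> card (\<Union>U\<in>?U. Pow U \<times> Pow (Pow U))"
  by (rule card_mono[OF finite_UN_I[OF finU] sub]) (intro finite_cartesian_product finite_Pow_iff[THEN iffD2] fU)
 also have "... \<le> (\<Sum>U\<in>?U. card (Pow U \<times> Pow (Pow U)))" by (rule card_UN_le[OF finU])
 also have "... \<le> (\<Sum>U\<in>?U. 2 ^ (m - 1) * 2 ^ (2 ^ (m - 1)))"
 proof (rule sum_mono)
  fix U assume U: "U \<in> ?U"
  have "card (Pow U \<times> Pow (Pow U)) = 2 ^ card U * 2 ^ (2 ^ card U)"
   using fU[OF U] by (simp add: card_Pow)
  also have "... \<le> 2 ^ (m - 1) * 2 ^ (2 ^ (m - 1))"
   using U by (intro mult_mono power_increasing) auto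
  finally show "card (Pow U \<times> Pow (Pow U)) \<le> 2 ^ (m - 1) * 2 ^ (2 ^ (m - 1))" .
 qed
 also have "... = card ?U * (2 ^ (m - 1) * 2 ^ (2 ^ (m - 1)))" by simp
 also have "card ?U \<le> (n + 1) ^ (m - 1)" using card_small_subsets[of "{..<n}" "m - 1"] by simp
 finally show ?thesis by simp
qed

lemma sfree_core_weight:
 assumes d: "d \<ge> 2" and c: "c > 0" and n: "n \<ge> 1"
 shows "real (card (sfree_cores d n m)) * (c / real n) ^ (m - 1) \<le> (2 * c) ^ (m - 1) * (2 ^ (m - 1) * 2 ^ (2 ^ (m - 1)))"
proof -
 let ?A = "(2 ^ (m - 1) * 2 ^ (2 ^ (m - 1)))"
 have "real (card (sfree_cores d n m)) \<le> real ((n + 1) ^ (m - 1) * ?A)"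
  using card_sfree_cores[OF d, of n m] by (simp only:)
 also have "... = (real n + 1) ^ (m - 1) * ?A" by (simp add: add.commute)
 also have "... \<le> (2 * real n) ^ (m - 1) * ?A"
  using n by (intro mult_right_mono power_mono) auto
 finally have "real (card (sfree_cores d n m)) * (c / real n) ^ (m - 1) \<le> (2 * real n) ^ (m - 1) * ?A * (c / real n) ^ (m - 1)"
  using c by (intro mult_right_mono) auto
 also have "... = ((2 * real n) * (c / real n)) ^ (m - 1) * ?A"
  unfolding power_mult_distrib[of "2 * real n" "c / real n"] by simp
 also have "(2 * real n) * (c / real n) = 2 * c" using n by simp
 finally show ?thesis .
qed

text \<open>Bounded sizes are covered by \<open>sfree_core_weight\<close>, the others by \<open>core_weight_sum\<close>.\<close>
lemma sfree_closing_bounded: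
 assumes d: "d \<ge> 2" and c: "c > 0"
 shows "\<exists>e>0. \<exists>B. eventually (\<lambda>n. EY d n c (\<lambda>Y. real (card {s \<in> all_faces n d.
  \<exists>K. core d n s K \<and> sfree d K \<and> real (card K) \<le> e * real (n choose d) \<and> K \<subseteq> insert s Y})) \<le> B) sequentially"
proof -
 obtain e m0 where e: "e > 0" "m0 \<ge> 1" and lim: "(\<lambda>n. \<Sum>m | m0 \<le> m \<and> real m \<le> e * real (n choose d). core_weight d c n m) \<longlonglongrightarrow> 0"
  using core_weight_sum[OF d c] by blast
 define b where "b m = (2 * c) ^ (m - 1) * (2 ^ (m - 1) * 2 ^ (2 ^ (m - 1)))" for m :: nat
 have "eventually (\<lambda>n. (\<Sum>m | m0 \<le> m \<and> real m \<le> e * real (n choose d). core_weight d c n m) \<le> 1) sequentially"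
  by (rule eventually_le_limit[OF lim]) simp
 hence "eventually (\<lambda>n. EY d n c (\<lambda>Y. real (card {s \<in> all_faces n d.
  \<exists>K. core d n s K \<and> sfree d K \<and> real (card K) \<le> e * real (n choose d) \<and> K \<subseteq> insert s Y})) \<le> (\<Sum>m<m0. b m) + 1) sequentially"
  using eventually_ge_at_top[of "nat \<lceil>c\<rceil> + 1"]
 proof eventually_elim
  case (elim n)
  let ?F = "all_faces n d" and ?p = "c / real n"
  have n: "n \<ge> 1" "real n \<ge> c" using elim(2) by linarith+
  let ?M = "{m. real m \<le> e * real (n choose d)}"
  have finM: "finite ?M" by (rule finite_subset[of _ "{..nat \<lfloor>e * real (n choose d)\<rfloor>}"]) (auto simp: le_nat_floor)
  let ?P = "SIGMA m:?M. sfree_cores d n m"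
  have finS: "finite (sfree_cores d n m)" for m by (rule finite_subset[OF _ finite_cores[of d n m]]) (auto simp: sfree_cores_def)
  have finP: "finite ?P" using finM finS by auto
  have "EE ?F ?p (\<lambda>Y. real (card {s \<in> ?F. \<exists>K. core d n s K \<and> sfree d K \<and> real (card K) \<le> e * real (n choose d) \<and> K \<subseteq> insert s Y}))
   \<le> EE ?F ?p (\<lambda>Y. \<Sum>x\<in>?P. of_bool (snd (snd x) - {fst (snd x)} \<subseteq> Y))"
  proof (rule EE_mono)
   let ?B = "real (n choose d)"
   let ?A = "(\<lambda>x. fst (snd x))"
   fix Y assume Y: "Y \<subseteq> ?F"
   let ?G = "{x \<in> ?P. snd (snd x) - {fst (snd x)} \<subseteq> Y}"
   have "{s \<in> ?F. \<exists>K. core d n s K \<and> sfree d K \<and> real (card K) \<le> e * ?B \<and> K \<subseteq> insert s Y} \<subseteq> ?A ` ?G"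
   proof clarify
    fix s K assume K: "core d n s K" "sfree d K" "real (card K) \<le> e * ?B" "K \<subseteq> insert s Y"
    have "(card K, s, K) \<in> ?G" using K by (auto simp: sfree_cores_def cores_def)
    thus "s \<in> ?A ` ?G" by (rule rev_image_eqI) simp
   qed
   from card_mono[OF _ this] have "card {s \<in> ?F. \<exists>K. core d n s K \<and> sfree d K \<and> real (card K) \<le> e * ?B \<and> K \<subseteq> insert s Y} \<le> card (?A ` ?G)"
    using finP by simp
   also have "... \<le> card ?G" using finP by (intro card_image_le) simp
   finally show "real (card {s \<in> ?F. \<exists>K. core d n s K \<and> sfree d K \<and> real (card K) \<le> e * ?B \<and> K \<subseteq> insert s Y}) \<le> (\<Sum>x\<in>?P. of_bool (snd (snd x) - {fst (snd x)} \<subseteq> Y))"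
    unfolding card_filter_sum[OF finP, symmetric] by simp
  qed simp
  also have "... = (\<Sum>x\<in>?P. PR ?F ?p (\<lambda>Y. snd (snd x) - {fst (snd x)} \<subseteq> Y))"
   by (simp only: EE_sum[OF finite_all_faces] EE_indicator)
  also have "... = (\<Sum>x\<in>?P. ?p ^ (fst x - 1))"
  proof (rule sum.cong[OF refl])
   fix x assume "x \<in> ?P"
   then obtain m s K where x: "x = (m, s, K)" "core d n s K" "card K = m" by (auto simp: sfree_cores_def cores_def)
   have "PR ?F ?p (\<lambda>Y. K - {s} \<subseteq> Y) = ?p ^ card (K - {s})"
    using coreD[OF x(2)] c n by (intro PR_subset) auto
   also have "card (K - {s}) = m - 1" using coreD[OF x(2)] x(3) by simp
   finally show "PR ?F ?p (\<lambda>Y. snd (snd x) - {fst (snd x)} \<subseteq> Y) = ?p ^ (fst x - 1)" by (simp add: x(1))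
  qed
  also have "... = (\<Sum>m\<in>?M. \<Sum>y\<in>sfree_cores d n m. ?p ^ (m - 1))"
   using finM finS by (subst sum.Sigma) (auto simp: case_prod_unfold)
  also have "... = (\<Sum>m\<in>?M. real (card (sfree_cores d n m)) * ?p ^ (m - 1))" by simp
  also have "... \<le> (\<Sum>m\<in>?M. if m < m0 then b m else core_weight d c n m)"
  proof (rule sum_mono)
   fix m assume "m \<in> ?M"
   show "real (card (sfree_cores d n m)) * ?p ^ (m - 1) \<le> (if m < m0 then b m else core_weight d c n m)"
   proof (cases "m < m0")
    case True
    thus ?thesis using sfree_core_weight[OF d c n(1), of m] by (simp add: b_def)
   next
    case False
    have "card (sfree_cores d n m) \<le> card (cores d n m)"
     using finite_cores by (intro card_mono) (auto simp: sfree_cores_def)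
    thus ?thesis using False c n unfolding core_weight_def by auto
   qed
  qed
  also have "... = (\<Sum>m\<in>?M \<inter> {m. m < m0}. b m) + (\<Sum>m\<in>?M \<inter> - {m. m < m0}. core_weight d c n m)"
   using finM by (rule sum.If_cases)
  also have "... \<le> (\<Sum>m<m0. b m) + 1"
  proof (rule add_mono)
   show "(\<Sum>m\<in>?M \<inter> {m. m < m0}. b m) \<le> (\<Sum>m<m0. b m)"
    using c by (intro sum_mono2) (auto simp: b_def)
   have "?M \<inter> - {m. m < m0} = {m. m0 \<le> m \<and> real m \<le> e * real (n choose d)}" by auto
   thus "(\<Sum>m\<in>?M \<inter> - {m. m < m0}. core_weight d c n m) \<le> 1" using elim(1) by simp
  qed
  finally show ?case .
 qed
 thus ?thesis using e(1) by blast
qed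

section \<open>Circuits of positive density\<close>

definition large_cycle :: "nat => nat => real => nat set set => bool" where
 "large_cycle d n s Y \<longleftrightarrow> (\<exists>g\<in>all_faces n d. \<exists>K\<subseteq>insert g Y. (\<forall>r\<in>K. r \<in> cl (K - {r})) \<and> real (card K) > s)"

lemma cyc_insert_le:
 assumes "finite Y"
 shows "cyc (insert s Y) \<le> cyc Y + 1"
 using cyc_insert[OF assms, of s] by (cases "s \<in> Y") (auto simp: insert_absorb)

text \<open>Let \<open>B\<close> meet all cycles through faces that are thinned out.  What remains cyclic without \<open>B\<close> survives the thinning and
  contains the large cycle, but it is determined by \<open>B\<close> and the closing face.\<close>
lemma large_cycle_survives:
 assumes Y: "Y \<subseteq> all_faces n d" and lc: "large_cycle d n s (Y \<inter> Z)"
 shows "\<exists>g\<in>all_faces n d. \<exists>B. B \<subseteq> Y \<and> card B \<le> cyc Y + 1 \<and>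
  real (card (cyclic_part (insert g Y - B) - {g})) > s - 1 \<and> cyclic_part (insert g Y - B) - {g} \<subseteq> Y \<inter> Z"
proof -
 obtain g K where g: "g \<in> all_faces n d" and K: "K \<subseteq> insert g (Y \<inter> Z)" "\<forall>q\<in>K. q \<in> cl (K - {q})" "real (card K) > s"
  using lc unfolding large_cycle_def by blast
 define T where "T = insert g Y"
 define R where "R = Y - Z - {g}"
 have finY: "finite Y" by (rule finite_subset_faces[OF Y])
 hence finT: "finite T" by (simp add: T_def)
 obtain B where B: "B \<subseteq> R" "B \<subseteq> T" "card B \<le> cyc T" "cyclic_part (T - B) \<inter> R = {}"
  using cyclic_part_hitting[OF finT, of R] by blast
 have BY: "B \<subseteq> Y" using B(1) by (auto simp: R_def)
 have cB: "card B \<le> cyc Y + 1" using B(3) cyc_insert_le[OF finY, of g] by (simp add: T_def)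
 let ?U = "cyclic_part (T - B)"
 have U1: "?U - {g} \<subseteq> Y \<inter> Z"
  using B(4) by (fastforce simp: cyclic_part_def T_def R_def)
 have "K \<subseteq> T - B" using K(1) B(1) by (auto simp: T_def R_def)
 hence "cyclic_part K \<subseteq> ?U" by (rule cyclic_part_mono)
 moreover have "cyclic_part K = K" using K(2) by (auto simp: cyclic_part_def)
 ultimately have KU: "K \<subseteq> ?U" by simp
 have finU: "finite ?U" using finT by (auto simp: cyclic_part_def)
 have "card K \<le> card ?U" by (rule card_mono[OF finU KU])
 also have "... \<le> card (?U - {g}) + 1"
 proof -
  have "?U \<subseteq> insert g (?U - {g})" by auto
  from card_mono[OF _ this] have "card ?U \<le> card (insert g (?U - {g}))" using finU by simp
  also have "... = card (?U - {g}) + 1" using finU by (subst card_insert_disjoint) auto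
  finally show ?thesis .
 qed
 finally have "real (card (?U - {g})) > s - 1" using K(3) by simp
 thus ?thesis using g BY cB U1 unfolding T_def by blast
qed

lemma card_subsets_exp:
 assumes "finite M" "0 < x" "x \<le> 1"
 shows "real (card {B. B \<subseteq> M \<and> card B \<le> a}) \<le> exp (x * real (card M) + real a * ln (1 / x))"
proof -
 let ?S = "{B. B \<subseteq> M \<and> card B \<le> a}"
 have "real (card ?S) * x ^ a = (\<Sum>B\<in>?S. x ^ a)" by simp
 also have "... \<le> (\<Sum>B\<in>?S. x ^ card B)" using assms by (intro sum_mono power_decreasing) auto
 also have "... \<le> (\<Sum>B\<in>Pow M. x ^ card B)" using assms by (intro sum_mono2) auto
 also have "... = (1 + x) ^ card M"
 proof -
  have "(\<Sum>B\<in>Pow M. x ^ card B) = (\<Prod>i\<in>M. x + 1)"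
   unfolding prod_add[OF assms(1)] by simp
  thus ?thesis by (simp add: add.commute)
 qed
 also have "... \<le> exp x ^ card M" using assms by (intro power_mono) auto
 also have "... = exp (x * real (card M))" by (rule exp_of_nat2_mult[symmetric])
 finally have "real (card ?S) \<le> exp (x * real (card M)) / x ^ a" using assms by (simp add: pos_le_divide_eq)
 also have "x ^ a = exp (- (real a * ln (1 / x)))" using assms by (simp add: ln_div exp_of_nat_mult)
 also have "exp (x * real (card M)) / exp (- (real a * ln (1 / x))) = exp (x * real (card M) + real a * ln (1 / x))"
  by (simp add: exp_add exp_minus divide_simps)
 finally show ?thesis .
qed

text \<open>A union bound over the closing face and \<open>B\<close>; each of the sets determined by them survives with probability at most
  \<open>q ^ (s - 1)\<close>.\<close>
lemma thinned_large_cycle: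
 assumes Y: "Y \<subseteq> all_faces n d" and q: "0 < q" "q < 1" and x: "0 < x" "x \<le> 1" and s: "s > 1"
 shows "PR (all_faces n d) q (\<lambda>Z. large_cycle d n s (Y \<inter> Z)) \<le>
  real n ^ (d + 1) * exp (x * real (card Y) + (real (cyc Y) + 1) * ln (1 / x) + (s - 1) * ln q)"
proof -
 let ?A = "exp ((s - 1) * ln q)"
 let ?F = "all_faces n d"
 let ?U = "\<lambda>g B. cyclic_part (insert g Y - B) - {g}"
 let ?S = "{B. B \<subseteq> Y \<and> card B \<le> cyc Y + 1}"
 let ?J = "{x \<in> ?F \<times> ?S. real (card (?U (fst x) (snd x))) > s - 1 \<and> ?U (fst x) (snd x) \<subseteq> ?F}"
 have finY: "finite Y" by (rule finite_subset_faces[OF Y])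
 have finJ: "finite ?J" using finY by simp
 have "PR ?F q (\<lambda>Z. large_cycle d n s (Y \<inter> Z)) \<le> PR ?F q (\<lambda>Z. Z \<in> (\<Union>x\<in>?J. {Z. ?U (fst x) (snd x) \<subseteq> Z}))"
 proof (rule PR_mono)
  fix Z assume "large_cycle d n s (Y \<inter> Z)"
  from large_cycle_survives[OF Y this] obtain g B where b: "g \<in> ?F" "B \<subseteq> Y" "card B \<le> cyc Y + 1"
   "real (card (?U g B)) > s - 1" "?U g B \<subseteq> Y \<inter> Z" by blast
  have "(g, B) \<in> ?J" using b Y by auto
  moreover have "Z \<in> {Z. ?U g B \<subseteq> Z}" using b(5) by auto
  ultimately show "Z \<in> (\<Union>x\<in>?J. {Z. ?U (fst x) (snd x) \<subseteq> Z})" by auto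
 qed
 also have "... \<le> (\<Sum>x\<in>?J. PR ?F q (\<lambda>Z. ?U (fst x) (snd x) \<subseteq> Z))"
  unfolding Collect_mem_eq by (intro measure_pmf.finite_measure_subadditive_finite finJ) auto
 also have "... \<le> (\<Sum>x\<in>?J. ?A)"
 proof (rule sum_mono)
  fix x assume x: "x \<in> ?J"
  have "PR ?F q (\<lambda>Z. ?U (fst x) (snd x) \<subseteq> Z) = q ^ card (?U (fst x) (snd x))"
   using x q by (intro PR_subset) auto
  also have "... = exp (real (card (?U (fst x) (snd x))) * ln q)" using q by (simp add: exp_of_nat_mult)
  also have "... \<le> ?A" using x q by simp
  finally show "PR ?F q (\<lambda>Z. ?U (fst x) (snd x) \<subseteq> Z) \<le> ?A" .
 qed
 also have "... = real (card ?J) * ?A" by simp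
 also have "... \<le> (real n ^ (d + 1) * exp (x * real (card Y) + real (cyc Y + 1) * ln (1 / x))) * ?A"
 proof (rule mult_right_mono)
  let ?A = "exp (x * real (card Y) + real (cyc Y + 1) * ln (1 / x))"
  have "card ?J \<le> card (?F \<times> ?S)" using finY by (intro card_mono) auto
  hence "real (card ?J) \<le> real (card ?F) * real (card ?S)" by (simp add: card_cartesian_product flip: of_nat_mult)
  also have "... \<le> real n ^ (d + 1) * ?A"
  proof (rule mult_mono)
   have "real (n choose (d + 1)) \<le> real (n ^ (d + 1))" using choose_le_power by (simp only: of_nat_le_iff)
   thus "real (card ?F) \<le> real n ^ (d + 1)" by (simp add: card_all_faces)
   show "real (card ?S) \<le> ?A" by (rule card_subsets_exp[OF finY x])
  qed auto
  finally show "real (card ?J) \<le> real n ^ (d + 1) * ?A" .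
 qed simp
 also have "... = real n ^ (d + 1) * exp (x * real (card Y) + (real (cyc Y) + 1) * ln (1 / x) + (s - 1) * ln q)"
  by (simp add: exp_add)
 finally show ?thesis .
qed

text \<open>Realise density \<open>c\<close> by thinning density \<open>c'\<close> with \<open>c < c' < c_star d\<close>.  The nullity at \<open>c'\<close> is at most a small multiple of
  \<open>n choose d\<close>, outside an event of small probability, so that the union bound is over few sets, while the
  survival probability is exponentially small.\<close>
lemma no_large_cycle:
 assumes d: "d \<ge> 2" and c: "0 < c" "c < c_star d" and e: "e > 0"
 shows "(\<lambda>n. PY d n c (large_cycle d n (e * real (n choose d)))) \<longlonglongrightarrow> 0"
proof (rule order_tendstoI)
 fix a :: real assume a: "a < 0"
 show "eventually (\<lambda>n. a < PY d n c (large_cycle d n (e * real (n choose d)))) sequentially"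
  using a by (intro always_eventually allI) (rule less_le_trans[OF _ measure_nonneg])
next
 fix f :: real assume f: "f > 0"
 \<comment> \<open>Any density between \<open>c\<close> and the threshold will do; \<open>q\<close> is the probability of surviving.\<close>
 define c' where "c' = (c + c_star d) / 2"
 define q where "q = c / c'"
 have c': "0 < c'" "c < c'" "c' < c_star d" using c by (auto simp: c'_def)
 have q: "0 < q" "q < 1" using c c' by (auto simp: q_def)
 define l where "l = - ln q"
 have l: "l > 0" using q by (simp add: l_def)
 \<comment> \<open>Up to probability \<open>f\<close>, the denser complex has at most \<open>k\<close> faces and nullity at most \<open>h\<close>, relative to \<open>n choose d\<close>.\<close>
 define k where "k = 4 * c' / f"
 have k: "k > 0" using c' f by (simp add: k_def)
 define x where "x = min 1 (l * e / (4 * k))"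
 have x: "0 < x" "x \<le> 1" "x * k \<le> l * e / 4" using l e k by (auto simp: x_def min_def)
 define w where "w = ln (1 / x)"
 have w: "w \<ge> 0" using x by (simp add: w_def)
 define h where "h = l * e / (4 * (1 + w))"
 have h: "h > 0" "h * w \<le> l * e / 4"
 proof -
  show "h > 0" using l e w by (simp add: h_def)
  have "h * w \<le> h * (1 + w)" using \<open>h > 0\<close> by simp
  also have "... = l * e / 4"
  proof -
   have "a / (4 * v) * v = a / 4" if "v > 0" for a v :: real using that by simp
   from this[of "1 + w" "l * e"] w show ?thesis unfolding h_def by simp
  qed
  finally show "h * w \<le> l * e / 4" .
 qed
 define g where "g = l * e / (2 * real d)"
 have g: "g > 0" using l e d by (simp add: g_def)
 define G where "G n = real n ^ (d + 1) * (exp (w + l) * exp (- (g * real n)))" for n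
 have e1: "eventually (\<lambda>n. cycd d c' n \<le> h * (f / 4)) sequentially"
  using h f by (intro cycd_below[OF d c'(1,3)]) simp
 have e2: "eventually (\<lambda>n. G n \<le> f / 4) sequentially" using g f unfolding G_def by real_asymp
 have "eventually (\<lambda>n. g * real n > l / 2 + 1) sequentially" using g by real_asymp
 hence e3: "eventually (\<lambda>n. e * real (n choose d) > 1) sequentially" using eventually_ge_at_top[of d]
 proof eventually_elim
  case (elim n)
  have "(real n / real d) ^ 1 \<le> (real n / real d) ^ d" using elim d by (intro power_increasing) auto
  also have "... \<le> real (n choose d)" using binomial_ge_n_over_k_pow_k[of d n] elim by simp
  finally have N: "real n / real d \<le> real (n choose d)" by simp
  have "l / 2 < g * real n" using elim(1) by linarith
  also have "... = l * e / 2 * (real n / real d)" by (simp add: g_def)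
  also have "... \<le> l * e / 2 * real (n choose d)" using N l e by (intro mult_left_mono) auto
  finally have "l / 2 * 1 < l / 2 * (e * real (n choose d))" by simp
  thus ?case using l by simp
 qed
 show "eventually (\<lambda>n. PY d n c (large_cycle d n (e * real (n choose d))) < f) sequentially"
  using e1 e2 e3 eventually_ge_at_top[of "nat \<lceil>c'\<rceil> + d + 1"]
 proof eventually_elim
  case (elim n)
  let ?F = "all_faces n d" and ?N = "real (n choose d)"
  let ?s = "e * ?N"
  have n: "n > d" "real n \<ge> c'" using elim(4) by linarith+
  have p: "0 \<le> c' / real n" "c' / real n \<le> 1" using c' n by auto
  have N: "real n / real d \<le> ?N"
  proof -
   have "(real n / real d) ^ 1 \<le> (real n / real d) ^ d" using n d by (intro power_increasing) auto
   also have "... \<le> ?N" using binomial_ge_n_over_k_pow_k[of d n] n by simp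
   finally show ?thesis by simp
  qed
  have cq: "c' / real n * q = c / real n" using c' by (simp add: q_def)
  have "PR ?F (c / real n) (large_cycle d n ?s) = EE ?F (c' / real n) (\<lambda>Y. EE ?F q (\<lambda>Z. of_bool (large_cycle d n ?s (Y \<inter> Z))))"
   using EE_thin[OF finite_all_faces p, of q n d "\<lambda>Y. of_bool (large_cycle d n ?s Y)"] q unfolding cq EE_indicator[symmetric] by simp
  also have "... \<le> EE ?F (c' / real n) (\<lambda>Y. of_bool (real (cyc Y) \<ge> h * ?N) + of_bool (real (card Y) \<ge> k * ?N) + f / 4)"
  proof (rule EE_mono)
   fix Y assume Y: "Y \<subseteq> ?F"
   show "EE ?F q (\<lambda>Z. of_bool (large_cycle d n ?s (Y \<inter> Z))) \<le> of_bool (real (cyc Y) \<ge> h * ?N) + of_bool (real (card Y) \<ge> k * ?N) + f / 4"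
   proof (cases "real (cyc Y) \<ge> h * ?N \<or> real (card Y) \<ge> k * ?N")
    case True
    have "EE ?F q (\<lambda>Z. of_bool (large_cycle d n ?s (Y \<inter> Z))) \<le> EE ?F q (\<lambda>Z. 1)" by (intro EE_mono) auto
    also have "... = 1" by simp
    also have "1 \<le> of_bool (real (cyc Y) \<ge> h * ?N) + of_bool (real (card Y) \<ge> k * ?N) + f / 4" using True f by auto
    finally show ?thesis .
   next
    case False
    hence b: "real (cyc Y) \<le> h * ?N" "real (card Y) \<le> k * ?N" by auto
    have "EE ?F q (\<lambda>Z. of_bool (large_cycle d n ?s (Y \<inter> Z))) \<le> real n ^ (d + 1) * exp (x * real (card Y) + (real (cyc Y) + 1) * ln (1 / x) + (?s - 1) * ln q)"
     unfolding EE_indicator by (rule thinned_large_cycle[OF Y q x(1,2) elim(3)])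
    also have "... \<le> G n"
     unfolding G_def exp_add[symmetric]
    proof (intro mult_left_mono iffD2[OF exp_le_cancel_iff])
     have "x * real (card Y) \<le> x * (k * ?N)" using b x by simp
     also have "... \<le> l * e / 4 * ?N" using x n by simp
     finally have 1: "x * real (card Y) \<le> l * e / 4 * ?N" .
     have "(real (cyc Y) + 1) * w \<le> (h * ?N + 1) * w" using b w by (intro mult_right_mono) auto
     also have "... \<le> l * e / 4 * ?N + w" using h n by (simp add: algebra_simps)
     finally have 2: "(real (cyc Y) + 1) * w \<le> l * e / 4 * ?N + w" .
     have 3: "(?s - 1) * ln q = - (l * e * ?N) + l" by (simp add: l_def algebra_simps)
     have "g * real n = l * e / 2 * (real n / real d)" by (simp add: g_def)
     also have "... \<le> l * e / 2 * ?N" using N l e by (intro mult_left_mono) auto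
     finally have 4: "g * real n \<le> l * e / 2 * ?N" .
     show "x * real (card Y) + (real (cyc Y) + 1) * ln (1 / x) + (?s - 1) * ln q \<le> w + l + - (g * real n)"
      unfolding 3 w_def[symmetric] using 1 2 4 by simp
    qed simp
    also have "... \<le> f / 4" by (rule elim(2))
    finally show ?thesis by simp
   qed
  qed simp
  also have "... = PR ?F (c' / real n) (\<lambda>Y. real (cyc Y) \<ge> h * ?N) + PR ?F (c' / real n) (\<lambda>Y. real (card Y) \<ge> k * ?N) + f / 4"
   by (simp add: EE_indicator)
  also have "PR ?F (c' / real n) (\<lambda>Y. real (cyc Y) \<ge> h * ?N) \<le> EE ?F (c' / real n) (\<lambda>Y. real (cyc Y)) / (h * ?N)"
   using h n by (intro PR_markov) auto
  also have "EE ?F (c' / real n) (\<lambda>Y. real (cyc Y)) / (h * ?N) = cycd d c' n / h" by (simp add: cycd_def)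
  also have "... \<le> f / 4" using elim(1) h by (simp add: pos_divide_le_eq mult.commute)
  also have "PR ?F (c' / real n) (\<lambda>Y. real (card Y) \<ge> k * ?N) \<le> EE ?F (c' / real n) (\<lambda>Y. real (card Y)) / (k * ?N)"
   using k n by (intro PR_markov) auto
  also have "EE ?F (c' / real n) (\<lambda>Y. real (card Y)) / (k * ?N) = c' * ratio d n / k"
   using p n n unfolding EE_card[OF finite_all_faces p] card_all_faces binomial_ratio[OF n(1)] by simp
  also have "... \<le> c' * 1 / k"
  proof (intro divide_right_mono mult_left_mono)
   show "ratio d n \<le> 1" using ratio_bounds(2)[of d n] by (rule order_trans) simp
  qed (use c' k in auto)
  also have "... = f / 4" using c' f by (simp add: k_def)
  finally show ?case using f by simp
 qed
qed

section \<open>Simplices with a missing face\<close>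

text \<open>Pairs of a simplex with \<open>d + 2\<close> vertices and a vertex; the facet opposite to the vertex is the missing one.\<close>
definition horns :: "nat => nat => (nat set \<times> nat) set" where
 "horns d n = (SIGMA B:all_faces n (d + 1). B)"

definition horn :: "nat set \<times> nat => nat set set" where
 "horn h = facs {fst h} - {fst h - {snd h}}"

lemma hornsD:
 assumes "h \<in> horns d n"
 shows "fst h \<subseteq> {..<n}" "card (fst h) = d + 2" "finite (fst h)" "snd h \<in> fst h"
proof -
 have B: "fst h \<in> all_faces n (d + 1)" and b: "snd h \<in> fst h" using assms by (auto simp: horns_def)
 from all_faces_D[OF B] show "fst h \<subseteq> {..<n}" "card (fst h) = d + 2" "finite (fst h)" by auto
 show "snd h \<in> fst h" by (rule b)
qed

lemma finite_horns: "finite (horns d n)"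
 unfolding horns_def by (rule finite_SigmaI[OF finite_all_faces]) (simp add: all_faces_D)

lemma card_horns: "card (horns d n) = (d + 2) * (n choose (d + 2))"
proof -
 have "card (horns d n) = (\<Sum>B\<in>all_faces n (d + 1). card B)"
  unfolding horns_def by (rule card_SigmaI[OF finite_all_faces]) (simp add: all_faces_D)
 also have "... = (\<Sum>B\<in>all_faces n (d + 1). d + 2)" by (rule sum.cong[OF refl]) (simp add: all_faces_D)
 finally show ?thesis by (simp add: card_all_faces)
qed

lemma facs_all_faces: "B \<subseteq> {..<n} ==> card B = d + 2 ==> facs {B} \<subseteq> all_faces n d"
 unfolding facs_single all_faces_def by auto

lemma horn_props:
 assumes h: "h \<in> horns d n"
 shows "horn h \<subseteq> all_faces n d" "card (horn h) = d + 1" "finite (horn h)" "fst h - {snd h} \<in> all_faces n d"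
  "facs {fst h} = insert (fst h - {snd h}) (horn h)" "fst h - {snd h} \<notin> horn h"
proof -
 note D = hornsD[OF h]
 show 1: "horn h \<subseteq> all_faces n d" using facs_all_faces[OF D(1,2)] by (auto simp: horn_def)
 have m: "fst h - {snd h} \<in> facs {fst h}" using D(4) by (auto simp: facs_def)
 show "card (horn h) = d + 1" unfolding horn_def using m D card_facs_single[OF D(3)] by simp
 show "finite (horn h)" using 1 finite_subset_faces by blast
 show "fst h - {snd h} \<in> all_faces n d" using m facs_all_faces[OF D(1,2)] by auto
 show "facs {fst h} = insert (fst h - {snd h}) (horn h)" using m by (auto simp: horn_def)
 show "fst h - {snd h} \<notin> horn h" by (simp add: horn_def)
qed

text \<open>The expected number of pairs all of whose other facets are present.\<close>
definition mu :: "nat => real => nat => real" where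
 "mu d c n = real (card (horns d n)) * (c / real n) ^ (d + 1)"

lemma mu_bounds:
 assumes c: "c > 0" and n: "n \<ge> d + 2"
 shows "mu d c n \<le> real (d + 2) * c ^ (d + 1) * real n" "mu d c n \<ge> (c / real (d + 2)) ^ (d + 1) * real n"
proof -
 let ?A = "(real n / real (d + 2))"
 have e: "real n ^ (d + 2) * (c / real n) ^ (d + 1) = c ^ (d + 1) * real n"
 proof -
  have "real n ^ (d + 2) = real n ^ (d + 1) * real n" by simp
  moreover have "real n ^ (d + 1) * (c / real n) ^ (d + 1) = c ^ (d + 1)"
   unfolding power_mult_distrib[symmetric] using n by simp
  ultimately show ?thesis by auto
 qed
 have "mu d c n \<le> real (d + 2) * real n ^ (d + 2) * (c / real n) ^ (d + 1)" using choose_le_power c unfolding mu_def card_horns of_nat_mult by (intro mult_right_mono mult_left_mono) (auto simp del: power_Suc)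
 also have "... = real (d + 2) * c ^ (d + 1) * real n" unfolding mult.assoc e ..
 finally show "mu d c n \<le> real (d + 2) * c ^ (d + 1) * real n" .
 have "real (d + 2) * ?A ^ (d + 2) * (c / real n) ^ (d + 1) \<le> mu d c n" using binomial_ge_n_over_k_pow_k[of "d + 2" n] n c unfolding mu_def card_horns of_nat_mult by (intro mult_right_mono mult_left_mono) auto
 moreover have "real (d + 2) * ?A ^ (d + 2) * (c / real n) ^ (d + 1) = (c / real (d + 2)) ^ (d + 1) * real n"
 proof -
  have "real (d + 2) * ?A ^ (d + 2) = real n * ?A ^ (d + 1)" by simp
  moreover have "?A ^ (d + 1) * (c / real n) ^ (d + 1) = (c / real (d + 2)) ^ (d + 1)"
   unfolding power_mult_distrib[symmetric] using n by simp
  ultimately show ?thesis by auto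
 qed
 ultimately show "mu d c n \<ge> (c / real (d + 2)) ^ (d + 1) * real n" by simp
qed

lemma horns_share:
 assumes h: "h \<in> horns d n" "h' \<in> horns d n" and ne: "fst h \<noteq> fst h'" and r: "r \<in> facs {fst h}" "r \<in> facs {fst h'}"
 shows "fst h \<inter> fst h' = r" "\<exists>v<n. fst h' = insert v r"
proof -
 note D = hornsD[OF h(1)] and D' = hornsD[OF h(2)]
 obtain b where b: "b \<in> fst h" "r = fst h - {b}" using r(1) by (auto simp: facs_def)
 have c: "card r = d + 1" "r \<subseteq> fst h" "r \<subseteq> fst h'" using b D r(2) by (auto simp: facs_def)
 have "card (fst h \<inter> fst h') < d + 2"
 proof (rule ccontr)
  assume a: "\<not> ?thesis"
  have "fst h \<inter> fst h' = fst h" by (rule card_seteq[OF D(3)]) (use a D(2) in simp_all)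
  moreover have "fst h \<inter> fst h' = fst h'" by (rule card_seteq[OF D'(3)]) (use a D'(2) in simp_all)
  ultimately show False using ne by simp
 qed
 hence ci: "card (fst h \<inter> fst h') \<le> card r" using c(1) by simp
 have "r = fst h \<inter> fst h'" by (rule card_seteq[OF _ _ ci]) (use c D(3) in simp_all)
 thus "fst h \<inter> fst h' = r" by simp
 obtain v where v: "v \<in> fst h'" "r = fst h' - {v}" using r(2) by (auto simp: facs_def)
 thus "\<exists>v<n. fst h' = insert v r" using D'(1) by auto
qed

lemma card_horns_through:
 assumes h: "h \<in> horns d n"
 shows "card {h' \<in> horns d n. fst h' \<noteq> fst h \<and> horn h \<inter> horn h' \<noteq> {}} \<le> (d + 2) * (n * (d + 2))"
proof -
 let ?A = "facs {fst h} \<times> {..<n}"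
 note D = hornsD[OF h]
 let ?S = "SIGMA B:(\<lambda>(q, v). insert v q) ` ?A. if card B = d + 2 then B else {}"
 have finf: "finite (facs {fst h})" using D by (simp add: facs_single)
 have finB: "finite (if card B = d + 2 then B else {})" for B :: "nat set"
  by (auto intro: card_ge_0_finite)
 have "{h' \<in> horns d n. fst h' \<noteq> fst h \<and> horn h \<inter> horn h' \<noteq> {}} \<subseteq> ?S"
 proof
  fix h' assume "h' \<in> {h' \<in> horns d n. fst h' \<noteq> fst h \<and> horn h \<inter> horn h' \<noteq> {}}"
  then obtain q where r: "h' \<in> horns d n" "fst h' \<noteq> fst h" "q \<in> horn h" "q \<in> horn h'" by auto
  hence rf: "q \<in> facs {fst h}" "q \<in> facs {fst h'}" by (auto simp: horn_def)
  obtain v where v: "v < n" "fst h' = insert v q" using horns_share(2)[OF h r(1) _ rf] r(2) by metis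
  have "fst h' \<in> (\<lambda>(q, v). insert v q) ` ?A"
   using v rf(1) by auto
  moreover have "snd h' \<in> (if card (fst h') = d + 2 then fst h' else {})" using hornsD[OF r(1)] by simp
  ultimately have "(fst h', snd h') \<in> ?S" by blast
  thus "h' \<in> ?S" by simp
 qed
 hence "card {h' \<in> horns d n. fst h' \<noteq> fst h \<and> horn h \<inter> horn h' \<noteq> {}} \<le> card ?S"
  using finf finB by (intro card_mono finite_SigmaI) auto
 also have "... = (\<Sum>B\<in>(\<lambda>(q, v). insert v q) ` ?A. card (if card B = d + 2 then B else {}))"
  using finf finB by simp
 also have "... \<le> (\<Sum>B\<in>(\<lambda>(q, v). insert v q) ` ?A. d + 2)" by (intro sum_mono) auto
 also have "... = card ((\<lambda>(q, v). insert v q) ` ?A) * (d + 2)" by simp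
 also have "... \<le> card ?A * (d + 2)" using finf by (intro mult_right_mono card_image_le) auto
 also have "... = (d + 2) * (n * (d + 2))" using D by (simp add: card_cartesian_product card_facs_single)
 finally show ?thesis .
qed

text \<open>Different simplices share at most one facet.\<close>
lemma card_horn_Un:
 assumes h: "h \<in> horns d n" "h' \<in> horns d n"
 shows "fst h \<noteq> fst h' ==> card (horn h \<union> horn h') \<ge> 2 * d + 1" "horn h \<inter> horn h' = {} ==> card (horn h \<union> horn h') = 2 * d + 2"
  "card (horn h \<union> horn h') \<ge> d + 1"
proof -
 let ?A = "card (horn h \<union> horn h')"
 note P = horn_props[OF h(1)] and P' = horn_props[OF h(2)]
 show "horn h \<inter> horn h' = {} ==> ?A = 2 * d + 2" using card_Un_Int[OF P(3) P'(3)] P(2) P'(2) by simp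
 have "card (horn h) \<le> ?A" using P P' by (intro card_mono) auto
 thus "?A \<ge> d + 1" using P(2) by simp
 assume ne: "fst h \<noteq> fst h'"
 have "horn h \<inter> horn h' \<subseteq> {fst h \<inter> fst h'}"
  using horns_share(1)[OF h ne] by (auto simp: horn_def)
 from card_mono[OF _ this] have "card (horn h \<inter> horn h') \<le> 1" by simp
 thus "?A \<ge> 2 * d + 1" using card_Un_Int[OF P(3) P'(3)] P(2) P'(2) by simp
qed

definition full_horns :: "nat => nat => nat set set => (nat set \<times> nat) set" where
 "full_horns d n Y = {h \<in> horns d n. horn h \<subseteq> Y}"

text \<open>Only pairs that share a face are correlated, and each simplex has at most \<open>(d + 2)\<^sup>2 * n\<close> such partners.\<close>
lemma horns_concentrated:
 assumes d: "d \<ge> 2" and c: "c > 0" and n: "n \<ge> d + 2" "real n \<ge> c"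
 shows "PY d n c (\<lambda>Y. \<bar>real (card (full_horns d n Y)) - mu d c n\<bar> \<ge> mu d c n / 2)
  \<le> 4 * ((real d + 2)\<^sup>2 * c ^ d + (real d + 2)) / mu d c n"
proof -
 let ?A = "((real d + 2)\<^sup>2 * c ^ d + (real d + 2))"
 let ?F = "all_faces n d" and ?p = "c / real n" and ?H = "horns d n" and ?l = "mu d c n"
 let ?X = "\<lambda>Y. real (card (full_horns d n Y))"
 have n0: "real n > 0" using n by simp
 have p: "0 \<le> ?p" "?p \<le> 1" using c n n0 by auto
 have pk: "0 \<le> ?p ^ k" for k by (rule zero_le_power[OF p(1)])
 have l0: "?l > 0" using mu_bounds(2)[OF c n(1)] by (rule less_le_trans[rotated]) (use c n0 in \<open>intro mult_pos_pos zero_less_power divide_pos_pos, auto\<close>)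
 have X: "?X Y = (\<Sum>h\<in>?H. of_bool (horn h \<subseteq> Y))" for Y
  unfolding full_horns_def by (rule card_filter_sum[OF finite_horns])
 have pr: "PR ?F ?p (\<lambda>Y. horn h \<subseteq> Y) = ?p ^ (d + 1)" if "h \<in> ?H" for h
  using PR_subset[OF finite_all_faces p horn_props(1)[OF that]] horn_props(2)[OF that] by simp
 have EX: "EE ?F ?p ?X = ?l"
 proof -
  have "EE ?F ?p ?X = (\<Sum>h\<in>?H. PR ?F ?p (\<lambda>Y. horn h \<subseteq> Y))" unfolding X by (simp only: EE_sum[OF finite_all_faces] EE_indicator)
  also have "... = (\<Sum>h\<in>?H. ?p ^ (d + 1))" by (intro sum.cong refl pr)
  finally show ?thesis by (simp add: mu_def)
 qed
 let ?J = "\<lambda>h. {h' \<in> ?H. fst h' \<noteq> fst h \<and> horn h \<inter> horn h' \<noteq> {}}"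
 have row: "(\<Sum>h'\<in>?H. ?p ^ card (horn h \<union> horn h')) \<le> ?l * ?p ^ (d + 1) + ?A * ?p ^ (d + 1)"
  if h: "h \<in> ?H" for h
 proof -
  have "(\<Sum>h'\<in>?H. ?p ^ card (horn h \<union> horn h')) \<le> (\<Sum>h'\<in>?H. ?p ^ (2 * d + 2) + of_bool (h' \<in> ?J h) * ?p ^ (2 * d + 1) + of_bool (fst h' = fst h) * ?p ^ (d + 1))"
  proof (rule sum_mono)
   fix h' assume h': "h' \<in> ?H"
   have pos: "0 \<le> ?p ^ k" for k using p by simp
    consider "fst h' = fst h" | "h' \<in> ?J h" "fst h' \<noteq> fst h" | "horn h \<inter> horn h' = {}" "fst h' \<noteq> fst h" using h' by blast
   thus "?p ^ card (horn h \<union> horn h') \<le> ?p ^ (2 * d + 2) + of_bool (h' \<in> ?J h) * ?p ^ (2 * d + 1) + of_bool (fst h' = fst h) * ?p ^ (d + 1)"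
   proof cases
    case 1
    have "?p ^ card (horn h \<union> horn h') \<le> ?p ^ (d + 1)" by (rule power_decreasing[OF card_horn_Un(3)[OF h h'] p])
    thus ?thesis using 1 pos[of "2 * d + 2"] by simp
   next
    case 2
    have "?p ^ card (horn h \<union> horn h') \<le> ?p ^ (2 * d + 1)" by (rule power_decreasing[OF card_horn_Un(1)[OF h h'] p]) (use 2 in auto)
    thus ?thesis using 2 pos[of "2 * d + 2"] by simp
   next
    case 3
    have "?p ^ card (horn h \<union> horn h') = ?p ^ (2 * d + 2)" using card_horn_Un(2)[OF h h' 3(1)] by simp
    thus ?thesis using 3 by simp
   qed
  qed
  also have "... = real (card ?H) * ?p ^ (2 * d + 2) + real (card {h' \<in> ?H. h' \<in> ?J h}) * ?p ^ (2 * d + 1) + real (card {h' \<in> ?H. fst h' = fst h}) * ?p ^ (d + 1)"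
   unfolding card_filter_sum[OF finite_horns] by (simp only: sum.distrib sum_distrib_right[symmetric] sum_constant)
  also have "... \<le> real (card ?H) * ?p ^ (2 * d + 2) + ((real d + 2)\<^sup>2 * real n) * ?p ^ (2 * d + 1) + (real d + 2) * ?p ^ (d + 1)"
  proof (intro add_mono mult_right_mono order_refl)
   have "{h' \<in> ?H. h' \<in> ?J h} = ?J h" by auto
   hence "real (card {h' \<in> ?H. h' \<in> ?J h}) \<le> real ((d + 2) * (n * (d + 2)))" using card_horns_through[OF h] by (simp only: of_nat_le_iff)
   also have "... = (real d + 2)\<^sup>2 * real n" by (simp add: power2_eq_square algebra_simps)
   finally show "real (card {h' \<in> ?H. h' \<in> ?J h}) \<le> (real d + 2)\<^sup>2 * real n" .
   have "{h' \<in> ?H. fst h' = fst h} \<subseteq> Pair (fst h) ` fst h" using hornsD(4) by force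
   from card_mono[OF _ this] have "card {h' \<in> ?H. fst h' = fst h} \<le> card (Pair (fst h) ` fst h)" using hornsD(3)[OF h] by simp
   also have "... \<le> card (fst h)" using hornsD(3)[OF h] by (rule card_image_le)
   finally show "real (card {h' \<in> ?H. fst h' = fst h}) \<le> real d + 2" using hornsD(2)[OF h] by simp
  qed (rule zero_le_power[OF p(1)])+
  also have "real (card ?H) * ?p ^ (2 * d + 2) = ?l * ?p ^ (d + 1)"
  proof -
   have "2 * d + 2 = (d + 1) + (d + 1)" by simp
   thus ?thesis unfolding mu_def by (simp only: power_add mult.assoc)
  qed
  also have "((real d + 2)\<^sup>2 * real n) * ?p ^ (2 * d + 1) \<le> ((real d + 2)\<^sup>2 * c ^ d) * ?p ^ (d + 1)"
  proof -
   have "2 * d + 1 = d + (d + 1)" by simp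
   hence e: "real n * ?p ^ (2 * d + 1) = (real n * ?p ^ d) * ?p ^ (d + 1)" by (simp only: power_add mult.assoc)
   have "real n * ?p ^ d = c ^ d * (real n / real n ^ d)" by (simp add: power_divide)
   also have "... \<le> c ^ d * 1"
   proof (rule mult_left_mono)
    have "real n ^ 1 \<le> real n ^ d" using n d by (intro power_increasing) auto
    thus "real n / real n ^ d \<le> 1" using n0 by (simp add: divide_le_eq)
   qed (use c in simp)
   finally have "real n * ?p ^ d \<le> c ^ d" by simp
   hence "(real n * ?p ^ d) * ?p ^ (d + 1) \<le> c ^ d * ?p ^ (d + 1)" by (rule mult_right_mono[OF _ pk])
   hence "real n * ?p ^ (2 * d + 1) \<le> c ^ d * ?p ^ (d + 1)" unfolding e .
   from mult_left_mono[OF this, of "(real d + 2)\<^sup>2"] show ?thesis unfolding mult.assoc by simp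
  qed
  finally show ?thesis by (simp only: distrib_right add.assoc)
 qed
 have EX2: "EE ?F ?p (\<lambda>Y. (?X Y)\<^sup>2) \<le> ?l\<^sup>2 + ?A * ?l"
 proof -
  have sq: "(?X Y)\<^sup>2 = (\<Sum>h\<in>?H. \<Sum>h'\<in>?H. of_bool (horn h \<union> horn h' \<subseteq> Y))" for Y
   unfolding X power2_eq_square sum_product Un_subset_iff by (simp only: of_bool_conj)
  have "EE ?F ?p (\<lambda>Y. (?X Y)\<^sup>2) = (\<Sum>h\<in>?H. \<Sum>h'\<in>?H. PR ?F ?p (\<lambda>Y. horn h \<union> horn h' \<subseteq> Y))"
   unfolding sq by (simp only: EE_sum[OF finite_all_faces] EE_indicator)
  also have "... = (\<Sum>h\<in>?H. \<Sum>h'\<in>?H. ?p ^ card (horn h \<union> horn h'))"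
  proof (intro sum.cong refl)
   fix h h' assume "h \<in> ?H" "h' \<in> ?H"
   thus "PR ?F ?p (\<lambda>Y. horn h \<union> horn h' \<subseteq> Y) = ?p ^ card (horn h \<union> horn h')"
    using horn_props(1) by (intro PR_subset[OF finite_all_faces p]) blast
  qed
  also have "... \<le> (\<Sum>h\<in>?H. ?l * ?p ^ (d + 1) + ?A * ?p ^ (d + 1))"
   by (intro sum_mono row)
  also have "... = ?l * (real (card ?H) * ?p ^ (d + 1)) + ?A * (real (card ?H) * ?p ^ (d + 1))"
   unfolding sum_constant by (simp only: distrib_left mult_ac)
  also have "... = ?l\<^sup>2 + ?A * ?l" unfolding mu_def[symmetric] by (simp only: power2_eq_square)
  finally show ?thesis .
 qed
 have "PR ?F ?p (\<lambda>Y. \<bar>?X Y - ?l\<bar> \<ge> ?l / 2) \<le> PR ?F ?p (\<lambda>Y. (?X Y - ?l)\<^sup>2 \<ge> (?l / 2)\<^sup>2)"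
 proof (rule PR_mono)
  fix Y assume "\<bar>?X Y - ?l\<bar> \<ge> ?l / 2"
  from power_mono[OF this, of 2] l0 show "(?X Y - ?l)\<^sup>2 \<ge> (?l / 2)\<^sup>2" by simp
 qed
 also have "... \<le> EE ?F ?p (\<lambda>Y. (?X Y - ?l)\<^sup>2) / (?l / 2)\<^sup>2" using l0 by (intro PR_markov) auto
 also have "EE ?F ?p (\<lambda>Y. (?X Y - ?l)\<^sup>2) = EE ?F ?p (\<lambda>Y. (?X Y)\<^sup>2 - 2 * ?l * ?X Y + ?l\<^sup>2)"
  by (intro EE_cong) (simp only: power2_diff, simp)
 also have "... = EE ?F ?p (\<lambda>Y. (?X Y)\<^sup>2) - 2 * ?l * EE ?F ?p ?X + ?l\<^sup>2" by simp
 also have "... \<le> ?A * ?l" unfolding EX using EX2 by (simp add: power2_eq_square)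
 also have "?A * ?l / (?l / 2)\<^sup>2 = 4 * ?A / ?l"
 proof -
  have "K * m / (m / 2)\<^sup>2 = 4 * K / m" if "m > 0" for K m :: real by (simp add: power2_eq_square)
  from this[OF l0] show ?thesis .
 qed
 finally show ?thesis by (simp add: divide_right_mono)
qed

definition closed_horns :: "nat => nat => nat set set => (nat set \<times> nat) set" where
 "closed_horns d n Y = {h \<in> horns d n. facs {fst h} \<subseteq> Y}"

definition horn_pairs :: "nat => nat => ((nat set \<times> nat) \<times> (nat set \<times> nat)) set" where
 "horn_pairs d n = {(h, h'). h \<in> horns d n \<and> h' \<in> horns d n \<and> h \<noteq> h' \<and> fst h - {snd h} = fst h' - {snd h'}}"

lemma expected_closed_horns:
 assumes c: "c > 0" and n: "n \<ge> d + 2" "real n \<ge> c"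
 shows "EY d n c (\<lambda>Y. real (card (closed_horns d n Y))) \<le> real (d + 2) * c ^ (d + 2)"
proof -
 let ?F = "all_faces n d" and ?p = "c / real n" and ?H = "horns d n"
 have p: "0 \<le> ?p" "?p \<le> 1" using c n n by auto
 have pr: "PR ?F ?p (\<lambda>Y. facs {fst h} \<subseteq> Y) = ?p ^ (d + 1) * ?p" if "h \<in> ?H" for h
  using card_facs_single hornsD[OF that] PR_subset[OF finite_all_faces p facs_all_faces[OF hornsD(1,2)[OF that]]] by auto
 have "EE ?F ?p (\<lambda>Y. real (card (closed_horns d n Y))) = (\<Sum>h\<in>?H. PR ?F ?p (\<lambda>Y. facs {fst h} \<subseteq> Y))"
  unfolding closed_horns_def card_filter_sum[OF finite_horns] by (simp only: EE_sum[OF finite_all_faces] EE_indicator)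
 also have "... = (\<Sum>h\<in>?H. ?p ^ (d + 1) * ?p)" by (intro sum.cong refl pr)
 also have "... = mu d c n * ?p" by (simp add: mu_def)
 also have "... \<le> real (d + 2) * c ^ (d + 1) * real n * ?p" using p by (intro mult_right_mono mu_bounds(1)[OF c n(1)])
 also have "... = real (d + 2) * c ^ (d + 2)" using n by simp
 finally show ?thesis .
qed

lemma horn_pairs_props:
 assumes "(h, h') \<in> horn_pairs d n"
 shows "horn h \<inter> horn h' = {}" "\<exists>v<n. h' = (insert v (fst h - {snd h}), v)"
proof -
 have h: "h \<in> horns d n" "h' \<in> horns d n" "h \<noteq> h'" "fst h - {snd h} = fst h' - {snd h'}" using assms by (auto simp: horn_pairs_def)
 note D = hornsD[OF h(1)] and D' = hornsD[OF h(2)]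
 have ne: "fst h \<noteq> fst h'"
  using h(4) D(4) h(3) by (auto simp: prod_eq_iff)
 show "horn h \<inter> horn h' = {}"
 proof (rule ccontr)
  assume "\<not> ?thesis"
  then obtain q where r: "q \<in> horn h" "q \<in> horn h'" by auto
  hence f: "q \<in> facs {fst h}" "q \<in> facs {fst h'}" by (auto simp: horn_def)
  have "fst h - {snd h} \<in> facs {fst h}" "fst h - {snd h} \<in> facs {fst h'}" using D(4) D'(4) h(4) by (auto simp: facs_def)
  hence "fst h \<inter> fst h' = fst h - {snd h}" by (rule horns_share(1)[OF h(1,2) ne])
  thus False using horns_share(1)[OF h(1,2) ne f] r by (simp add: horn_def)
 qed
 have "h' = (insert (snd h') (fst h - {snd h}), snd h')" unfolding h(4) using D'(4) by (simp add: insert_absorb)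
 moreover have "snd h' < n" using D' by auto
 ultimately show "\<exists>v<n. h' = (insert v (fst h - {snd h}), v)" by blast
qed

lemma expected_horn_pairs:
 assumes d: "d \<ge> 2" and c: "c > 0" and n: "n \<ge> d + 2" "real n \<ge> c"
 shows "EY d n c (\<lambda>Y. real (card {x \<in> horn_pairs d n. horn (fst x) \<union> horn (snd x) \<subseteq> Y})) \<le> real (d + 2) * c ^ (2 * (d + 1))"
proof -
 let ?F = "all_faces n d" and ?p = "c / real n" and ?H = "horns d n" and ?Q = "horn_pairs d n"
 have p: "0 \<le> ?p" "?p \<le> 1" using c n n by auto
 have pk: "0 \<le> ?p ^ k" for k by (rule zero_le_power[OF p(1)])
 let ?S = "(\<lambda>(h, v). (h, (insert v (fst h - {snd h}), v))) ` (?H \<times> {..<n})"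
 have sub: "?Q \<subseteq> ?S"
 proof
  fix x assume x: "x \<in> ?Q"
  obtain h h' where e: "x = (h, h')" by (cases x)
  have hH: "h \<in> ?H" using x e by (simp add: horn_pairs_def)
  obtain v where "v < n" "h' = (insert v (fst h - {snd h}), v)" using horn_pairs_props(2) x e by blast
  thus "x \<in> ?S" using hH e by auto
 qed
 have finS: "finite ?S" using finite_horns by simp
 have finQ: "finite ?Q" by (rule finite_subset[OF sub finS])
 have "card ?Q \<le> card ?S" by (rule card_mono[OF finS sub])
 also have "... \<le> card (?H \<times> {..<n})" using finite_horns by (intro card_image_le) auto
 finally have cQ: "real (card ?Q) \<le> real (card ?H) * real n" by (simp add: card_cartesian_product flip: of_nat_mult)
 have pr: "PR ?F ?p (\<lambda>Y. horn (fst x) \<union> horn (snd x) \<subseteq> Y) = ?p ^ (d + 1) * ?p ^ (d + 1)" if x: "x \<in> ?Q" for x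
 proof -
  obtain h h' where e: "x = (h, h')" by (cases x)
  have hQ: "(h, h') \<in> ?Q" using x e by simp
  have h: "h \<in> ?H" "h' \<in> ?H" "horn h \<inter> horn h' = {}" using hQ horn_pairs_props(1)[OF hQ] by (simp_all add: horn_pairs_def)
  have "PR ?F ?p (\<lambda>Y. horn h \<union> horn h' \<subseteq> Y) = ?p ^ card (horn h \<union> horn h')"
   using horn_props(1)[OF h(1)] horn_props(1)[OF h(2)] by (intro PR_subset[OF finite_all_faces p]) blast
  also have "card (horn h \<union> horn h') = (d + 1) + (d + 1)" using card_horn_Un(2)[OF h] by simp
  finally show ?thesis unfolding e by (simp only: fst_conv snd_conv power_add)
 qed
 have "EE ?F ?p (\<lambda>Y. real (card {x \<in> ?Q. horn (fst x) \<union> horn (snd x) \<subseteq> Y})) = (\<Sum>x\<in>?Q. PR ?F ?p (\<lambda>Y. horn (fst x) \<union> horn (snd x) \<subseteq> Y))"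
  unfolding card_filter_sum[OF finQ] by (simp only: EE_sum[OF finite_all_faces] EE_indicator)
 also have "... = (\<Sum>x\<in>?Q. ?p ^ (d + 1) * ?p ^ (d + 1))" by (rule sum.cong[OF refl pr])
 also have "... = real (card ?Q) * (?p ^ (d + 1) * ?p ^ (d + 1))" by simp
 also have "... \<le> real (card ?H) * real n * (?p ^ (d + 1) * ?p ^ (d + 1))" by (intro mult_right_mono cQ mult_nonneg_nonneg pk)
 also have "... = mu d c n * (real n * ?p ^ (d + 1))" by (simp add: mu_def)
 also have "... \<le> (real (d + 2) * c ^ (d + 1) * real n) * (real n * ?p ^ (d + 1))"
  by (intro mult_right_mono mu_bounds(1)[OF c n(1)] mult_nonneg_nonneg pk) simp
 also have "... = real (d + 2) * c ^ (d + 1) * ((real n)\<^sup>2 * ?p ^ (d + 1))" by (simp add: power2_eq_square)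
 also have "... \<le> real (d + 2) * c ^ (d + 1) * c ^ (d + 1)"
 proof (rule mult_left_mono)
  have "(real n)\<^sup>2 \<le> real n ^ (d + 1)" using n d by (intro power_increasing) auto
  hence "(real n)\<^sup>2 * ?p ^ (d + 1) \<le> real n ^ (d + 1) * ?p ^ (d + 1)" by (rule mult_right_mono[OF _ pk])
  also have "... = c ^ (d + 1)" unfolding power_mult_distrib[symmetric] using n by simp
  finally show "(real n)\<^sup>2 * ?p ^ (d + 1) \<le> c ^ (d + 1)" .
 qed (use c in auto)
 also have "... = real (d + 2) * c ^ (2 * (d + 1))" by (simp only: mult_2 power_add)
 finally show ?thesis .
qed

text \<open>An element that collides with none is counted in the image.\<close>
lemma card_le_image_collisions:
 assumes A: "finite A"
 shows "card A \<le> card (f ` A) + card {(x, y). x \<in> A \<and> y \<in> A \<and> x \<noteq> y \<and> f x = f y}"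
proof -
 define r where "r x = inv_into A f (f x)" for x
 have r: "r x \<in> A" "f (r x) = f x" if "x \<in> A" for x
  unfolding r_def using that by (auto intro: inv_into_into f_inv_into_f)
 let ?E = "{x \<in> A. r x = x}" and ?N = "{x \<in> A. r x \<noteq> x}"
 let ?C = "{(x, y). x \<in> A \<and> y \<in> A \<and> x \<noteq> y \<and> f x = f y}"
 have finC: "finite ?C" by (rule finite_subset[of _ "A \<times> A"]) (use A in auto)
 have 1: "card ?E \<le> card (f ` A)"
 proof (rule card_inj_on_le[of f])
  show "inj_on f ?E" by (rule inj_onI) (auto simp: r_def)
 qed (use A in auto)
 have 2: "card ?N \<le> card ?C"
 proof (rule card_inj_on_le[OF _ _ finC])
  show "inj_on (\<lambda>x. (x, r x)) ?N" by (rule inj_onI) auto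
  show "(\<lambda>x. (x, r x)) ` ?N \<subseteq> ?C" using r by auto
 qed
 have "A = ?E \<union> ?N" by auto
 hence "card A \<le> card ?E + card ?N" by (metis card_Un_le)
 thus ?thesis using 1 2 by simp
qed

text \<open>A full horn contributes its missing face, unless this is present or is counted for another horn as well.\<close>
lemma shadow_ge_horns:
 assumes Y: "Y \<subseteq> all_faces n d"
 shows "card (full_horns d n Y) \<le> card {s \<in> all_faces n d. s \<notin> Y \<and> s \<in> cl Y} + card (closed_horns d n Y)
  + card {x \<in> horn_pairs d n. horn (fst x) \<union> horn (snd x) \<subseteq> Y}"
proof -
 let ?f = "\<lambda>h. fst h - {snd h} :: nat set"
 let ?S = "{s \<in> all_faces n d. s \<notin> Y \<and> s \<in> cl Y}"
 let ?A = "{h \<in> full_horns d n Y. ?f h \<notin> Y}"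
 let ?Q = "{x \<in> horn_pairs d n. horn (fst x) \<union> horn (snd x) \<subseteq> Y}"
 have finf: "finite (full_horns d n Y)" using finite_horns by (simp add: full_horns_def)
 have finQ: "finite ?Q" by (rule finite_subset[of _ "horns d n \<times> horns d n"]) (auto simp: horn_pairs_def finite_horns)
 have im: "?f ` ?A \<subseteq> ?S"
 proof (rule image_subsetI)
  fix h assume "h \<in> ?A"
  hence h: "h \<in> horns d n" "horn h \<subseteq> Y" "?f h \<notin> Y" by (auto simp: full_horns_def)
  have "?f h \<in> facs {fst h}" using hornsD(4)[OF h(1)] by (auto simp: facs_def)
  from facet_in_cl[OF hornsD(3)[OF h(1)] this] have "?f h \<in> cl (horn h)" by (simp add: horn_def)
  thus "?f h \<in> ?S" using cl_mono[OF h(2)] horn_props(4)[OF h(1)] h(3) by auto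
 qed
 have "full_horns d n Y \<subseteq> ?A \<union> closed_horns d n Y"
 proof
  fix h assume h: "h \<in> full_horns d n Y"
  hence hH: "h \<in> horns d n" "horn h \<subseteq> Y" by (auto simp: full_horns_def)
  show "h \<in> ?A \<union> closed_horns d n Y" using h hH horn_props(5)[OF hH(1)] by (cases "?f h \<in> Y") (auto simp: closed_horns_def)
 qed
 hence "card (full_horns d n Y) \<le> card (?A \<union> closed_horns d n Y)"
  using finf finite_horns by (intro card_mono) (auto simp: closed_horns_def)
 also have "... \<le> card ?A + card (closed_horns d n Y)" by (rule card_Un_le)
 also have "card ?A \<le> card (?f ` ?A) + card {(x, y). x \<in> ?A \<and> y \<in> ?A \<and> x \<noteq> y \<and> ?f x = ?f y}"
  using finf by (intro card_le_image_collisions) simp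
 also have "card (?f ` ?A) \<le> card ?S" by (rule card_mono[OF _ im]) simp
 also have "card {(x, y). x \<in> ?A \<and> y \<in> ?A \<and> x \<noteq> y \<and> ?f x = ?f y} \<le> card ?Q"
  by (rule card_mono[OF finQ]) (auto simp: horn_pairs_def full_horns_def)
 finally show ?thesis by simp
qed

text \<open>A face of the shadow lies on a circuit, which is the boundary of a simplex, or simplex-free and small, or large.\<close>
lemma shadow_le_horns:
 assumes d: "d \<ge> 2" and Y: "Y \<subseteq> all_faces n d" and nl: "\<not> large_cycle d n s Y"
 shows "card {g \<in> all_faces n d. g \<notin> Y \<and> g \<in> cl Y} \<le> card (full_horns d n Y)
  + card {g \<in> all_faces n d. \<exists>K. core d n g K \<and> sfree d K \<and> real (card K) \<le> s \<and> K \<subseteq> insert g Y}"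
proof -
 let ?f = "\<lambda>h. fst h - {snd h} :: nat set"
 let ?S = "{g \<in> all_faces n d. g \<notin> Y \<and> g \<in> cl Y}"
 let ?T = "{g \<in> all_faces n d. \<exists>K. core d n g K \<and> sfree d K \<and> real (card K) \<le> s \<and> K \<subseteq> insert g Y}"
 have finf: "finite (full_horns d n Y)" using finite_horns by (simp add: full_horns_def)
 have "?S \<subseteq> ?f ` full_horns d n Y \<union> ?T"
 proof
  fix g assume "g \<in> ?S"
  hence s: "g \<in> all_faces n d" "g \<notin> Y" "g \<in> cl Y" by auto
  obtain K where K: "core d n g K" "K \<subseteq> insert g Y" "\<forall>r\<in>K. r \<in> cl (K - {r})"
   "\<And>B. finite B ==> facs {B} \<subseteq> K ==> B \<noteq> {} ==> K = facs {B}"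
   by (rule circuit_exists[OF Y s]) blast
  have small: "real (card K) \<le> s" using nl s(1) K(2,3) unfolding large_cycle_def by fastforce
  show "g \<in> ?f ` full_horns d n Y \<union> ?T"
  proof (cases "sfree d K")
   case True
   thus ?thesis using s(1) K(1,2) small by blast
  next
   case False
   then obtain B where B: "card B = d + 2" "facs {B} \<subseteq> K" unfolding sfree_def by blast
   have finB: "finite B" using B(1) by (intro card_ge_0_finite) simp
   have "B \<noteq> {}" using B(1) by auto
   hence KB: "K = facs {B}" by (rule K(4)[OF finB B(2)])
   have Bn: "B \<subseteq> {..<n}"
   proof
    fix x assume x: "x \<in> B"
    have "card (B - {x}) > 0" using B(1) x by simp
    then obtain y where y: "y \<in> B - {x}" unfolding card_gt_0_iff by blast
    hence "B - {y} \<in> K" unfolding KB by (auto simp: facs_def)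
    thus "x \<in> {..<n}" using coreD(2)[OF K(1)] all_faces_D x y by blast
   qed
   obtain b where b: "b \<in> B" "g = B - {b}" using coreD(1)[OF K(1)] KB by (auto simp: facs_def)
   have "(B, b) \<in> horns d n" unfolding horns_def using b(1) B(1) Bn by (auto simp: all_faces_def)
   moreover have "horn (B, b) \<subseteq> Y" unfolding horn_def using K(2) KB b(2) by auto
   ultimately have "(B, b) \<in> full_horns d n Y" by (simp add: full_horns_def)
   thus ?thesis using b(2) by (intro UnI1 image_eqI[of _ _ "(B, b)"]) auto
  qed
 qed
 hence "card ?S \<le> card (?f ` full_horns d n Y \<union> ?T)" using finf by (intro card_mono) auto
 also have "... \<le> card (?f ` full_horns d n Y) + card ?T" by (rule card_Un_le)
 also have "card (?f ` full_horns d n Y) \<le> card (full_horns d n Y)" by (rule card_image_le[OF finf])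
 finally show ?thesis by simp
qed

text \<open>All corrections to the number of horns are bounded in expectation, and the number itself is of order \<open>n\<close>.\<close>
lemma shadow_below:
 assumes d: "d \<ge> 2" and c: "0 < c" "c < c_star d"
 shows "\<exists>a A. 0 < a \<and> a < A \<and> aas (\<lambda>n. random_complex d n (c / real n))
  (\<lambda>n Y. a * real n \<le> real (card (shadow n d Y)) \<and> real (card (shadow n d Y)) \<le> A * real n)"
proof -
 obtain e B where e: "e > 0" and B: "eventually (\<lambda>n. EY d n c (\<lambda>Y. real (card {s \<in> all_faces n d.
  \<exists>K. core d n s K \<and> sfree d K \<and> real (card K) \<le> e * real (n choose d) \<and> K \<subseteq> insert s Y})) \<le> B) sequentially"
  using sfree_closing_bounded[OF d c(1)] by blast
 \<comment> \<open>\<open>a0\<close> and \<open>A0\<close> bound \<open>mu d c n / n\<close>; the other constants bound the error terms.\<close>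
 define a0 where "a0 = (c / real (d + 2)) ^ (d + 1)"
 define A0 where "A0 = real (d + 2) * c ^ (d + 1)"
 define V where "V = 4 * ((real d + 2)\<^sup>2 * c ^ d + (real d + 2))"
 define B1 where "B1 = real (d + 2) * c ^ (d + 2)"
 define B2 where "B2 = real (d + 2) * c ^ (2 * (d + 1))"
 have a0: "a0 > 0" unfolding a0_def using c by simp
 have A0: "A0 > 0" unfolding A0_def using c by simp
 have V0: "V \<ge> 0" using c by (simp add: V_def)
 define a where "a = a0 / 4"
 define A where "A = 2 * A0 + a0 + 1"
 let ?S = "\<lambda>n Y. real (card {s \<in> all_faces n d. s \<notin> Y \<and> s \<in> cl Y})"
 define g where "g n = PY d n c (large_cycle d n (e * real (n choose d))) + (V / a0 + \<bar>B\<bar> + B1 / (a0 / 8) + B2 / (a0 / 8)) / real n" for n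
 have "g \<longlonglongrightarrow> 0 + 0" unfolding g_def by (intro tendsto_add no_large_cycle[OF d c e] lim_const_over_n)
 hence glim: "g \<longlonglongrightarrow> 0" by simp
 have "aas (\<lambda>n. random_complex d n (c / real n))
  (\<lambda>n Y. a * real n \<le> real (card (shadow n d Y)) \<and> real (card (shadow n d Y)) \<le> A * real n)"
 proof (rule aas_shadowI, rule tendsto_sandwich[OF _ _ tendsto_const glim])
  show "eventually (\<lambda>n. 0 \<le> PY d n c (\<lambda>Y. \<not> (a * real n \<le> ?S n Y \<and> ?S n Y \<le> A * real n))) sequentially" by simp
  show "eventually (\<lambda>n. PY d n c (\<lambda>Y. \<not> (a * real n \<le> ?S n Y \<and> ?S n Y \<le> A * real n)) \<le> g n) sequentially"
   using B eventually_ge_at_top[of "nat \<lceil>c\<rceil> + d + 2"]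
  proof eventually_elim
   case (elim n)
   let ?F = "all_faces n d" and ?p = "c / real n" and ?m = "mu d c n"
   let ?X = "\<lambda>Y. real (card (full_horns d n Y))"
   let ?W = "\<lambda>Y. real (card {s \<in> ?F. \<exists>K. core d n s K \<and> sfree d K \<and> real (card K) \<le> e * real (n choose d) \<and> K \<subseteq> insert s Y})"
   let ?C1 = "\<lambda>Y. real (card (closed_horns d n Y))"
   let ?C2 = "\<lambda>Y. real (card {x \<in> horn_pairs d n. horn (fst x) \<union> horn (snd x) \<subseteq> Y})"
   let ?L = "large_cycle d n (e * real (n choose d))"
   have n: "n \<ge> d + 2" "real n \<ge> c" using elim(2) by linarith+
   have n0: "real n > 0" using n(1) by simp
   have m: "?m \<le> A0 * real n" "?m \<ge> a0 * real n" using mu_bounds[OF c(1) n(1)] by (simp_all only: A0_def a0_def)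
   have m0: "?m > 0" by (rule less_le_trans[OF mult_pos_pos[OF a0 n0] m(2)])
   have "PR ?F ?p (\<lambda>Y. \<not> (a * real n \<le> ?S n Y \<and> ?S n Y \<le> A * real n))
    \<le> PR ?F ?p (\<lambda>Y. ?L Y \<or> \<bar>?X Y - ?m\<bar> \<ge> ?m / 2 \<or> ?W Y \<ge> real n \<or> ?C1 Y \<ge> a0 / 8 * real n \<or> ?C2 Y \<ge> a0 / 8 * real n)"
   proof (rule PR_mono, rule ccontr)
    fix Y assume Y: "Y \<subseteq> ?F" and bad: "\<not> (a * real n \<le> ?S n Y \<and> ?S n Y \<le> A * real n)"
     and "\<not> (?L Y \<or> \<bar>?X Y - ?m\<bar> \<ge> ?m / 2 \<or> ?W Y \<ge> real n \<or> ?C1 Y \<ge> a0 / 8 * real n \<or> ?C2 Y \<ge> a0 / 8 * real n)"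
    hence ok: "\<not> ?L Y" "\<bar>?X Y - ?m\<bar> < ?m / 2" "?W Y < real n" "?C1 Y < a0 / 8 * real n" "?C2 Y < a0 / 8 * real n"
     by auto
    have "?S n Y \<ge> a0 * real n / 4" "?S n Y \<le> 2 * (A0 * real n) + real n" using ok(2) shadow_ge_horns[OF Y] shadow_le_horns[OF d Y ok(1)] ok(3,4,5) m m0 by linarith+
    moreover have "0 \<le> a0 * real n" using a0 by simp
    moreover have "A * real n = 2 * (A0 * real n) + a0 * real n + real n" by (simp add: A_def algebra_simps)
    moreover have "a * real n = a0 * real n / 4" by (simp add: a_def)
    ultimately show False using bad by linarith
   qed
   also have "... \<le> PR ?F ?p ?L + (PR ?F ?p (\<lambda>Y. \<bar>?X Y - ?m\<bar> \<ge> ?m / 2) + (PR ?F ?p (\<lambda>Y. ?W Y \<ge> real n) + (PR ?F ?p (\<lambda>Y. ?C1 Y \<ge> a0 / 8 * real n) + PR ?F ?p (\<lambda>Y. ?C2 Y \<ge> a0 / 8 * real n))))"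
    unfolding Collect_disj_eq
    by (intro order_trans[OF measure_Un_le] add_left_mono order_refl) auto
   also have "... \<le> PR ?F ?p ?L + (V / ?m + (B / real n + (B1 / (a0 / 8 * real n) + B2 / (a0 / 8 * real n))))"
   proof (intro add_mono order_refl)
    let ?C = "PR ?F ?p (\<lambda>Y. ?C1 Y \<ge> a0 / 8 * real n)"
    let ?B = "PR ?F ?p (\<lambda>Y. ?C2 Y \<ge> a0 / 8 * real n)"
    let ?A = "a0 / 8 * real n"
    show "PR ?F ?p (\<lambda>Y. \<bar>?X Y - ?m\<bar> \<ge> ?m / 2) \<le> V / ?m" unfolding V_def by (rule horns_concentrated[OF d c(1) n])
    have "PR ?F ?p (\<lambda>Y. ?W Y \<ge> real n) \<le> EE ?F ?p ?W / real n" using n0 by (intro PR_markov) auto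
    also have "... \<le> B / real n" using elim(1) n0 by (intro divide_right_mono) auto
    finally show "PR ?F ?p (\<lambda>Y. ?W Y \<ge> real n) \<le> B / real n" .
    have "?C \<le> EE ?F ?p ?C1 / ?A" using a0 n0 by (intro PR_markov) auto
    also have "... \<le> B1 / ?A" unfolding B1_def using expected_closed_horns[OF c(1) n] a0 n0 by (intro divide_right_mono) auto
    finally show "?C \<le> B1 / ?A" .
    have "?B \<le> EE ?F ?p ?C2 / ?A" using a0 n0 by (intro PR_markov) auto
    also have "... \<le> B2 / ?A" unfolding B2_def using expected_horn_pairs[OF d c(1) n] a0 n0 by (intro divide_right_mono) auto
    finally show "?B \<le> B2 / ?A" .
   qed
   also have "... \<le> g n"
   proof -
    have "V / ?m \<le> V / (a0 * real n)" using V0 m(2) a0 n0 by (intro divide_left_mono mult_pos_pos m0) auto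
    moreover have "B / real n \<le> \<bar>B\<bar> / real n" by (intro divide_right_mono) auto
    ultimately show ?thesis unfolding g_def by (simp add: add_divide_distrib)
   qed
   finally show ?case .
  qed
 qed
 thus ?thesis using a0 A0 by (intro exI[of _ a] exI[of _ A]) (simp add: a_def A_def)
qed

section \<open>The shadow\<close>

theorem theorem1p4:
  fixes d :: nat and c :: real
  assumes "d \<ge> 2" and "c > 0"
  shows "(c < c_star d \<longrightarrow>
            (\<exists>a A. 0 < a \<and> a < A \<and>
               aas (\<lambda>n. random_complex d n (c / real n))
                 (\<lambda>n Y. a * real n \<le> real (card (shadow n d Y)) \<and>
                        real (card (shadow n d Y)) \<le> A * real n)))
       \<and> (c > c_star d \<longrightarrow>
            (\<forall>\<epsilon>>0. aas (\<lambda>n. random_complex d n (c / real n))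
               (\<lambda>n Y. \<bar>real (card (shadow n d Y)) / real (n choose (d + 1))
                        - (1 - t_root d c) ^ (d + 1)\<bar> \<le> \<epsilon>)))"
  using shadow_below[OF assms] shadow_above[OF assms(1)] by blast

end
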